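(* If $p\in\{2,3,5,7,11\}$, then there exists an elliptic curve $E$ over $\mathbb{F}_p(t)$ with $j(E)\notin\mathbb{F}_p$ such that the rank of $E(\overline{\mathbb{F}}_p(t^{1/d}))$ is zero for all positive integers $d$ prime to $p$.
   Context: $\overline{\mathbb{F}}_p$ is an algebraic closure of $\mathbb{F}_p$, and $\overline{\mathbb{F}}_p(t^{1/d})$ is the field obtained from $\overline{\mathbb{F}}_p(t)$ by adjoining a $d$-th root of $t$; $j(E)$ is the $j$-invariant of $E$. *)

theory Defs
  imports "HOL-Algebra.Algebraic_Closure_Type" "HOL-Computational_Algebra.Fraction_Field"
    "HOL-Library.Extended_Nat"
begin

text \<open>Generalised Weierstrass equations
  y^2 + a1 x y + a3 y = x^3 + a2 x^2 + a4 x + a6 over a field.\<close>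

datatype 'a weier = W (wa1: 'a) (wa2: 'a) (wa3: 'a) (wa4: 'a) (wa6: 'a)

definition map_weier :: "('a \<Rightarrow> 'b) \<Rightarrow> 'a weier \<Rightarrow> 'b weier" where
  "map_weier f E = W (f (wa1 E)) (f (wa2 E)) (f (wa3 E)) (f (wa4 E)) (f (wa6 E))"

definition wb2 :: "'a::field weier \<Rightarrow> 'a" where
  "wb2 E = wa1 E ^ 2 + 4 * wa2 E"
definition wb4 :: "'a::field weier \<Rightarrow> 'a" where
  "wb4 E = 2 * wa4 E + wa1 E * wa3 E"
definition wb6 :: "'a::field weier \<Rightarrow> 'a" where
  "wb6 E = wa3 E ^ 2 + 4 * wa6 E"
definition wb8 :: "'a::field weier \<Rightarrow> 'a" where
  "wb8 E = wa1 E ^ 2 * wa6 E + 4 * wa2 E * wa6 E - wa1 E * wa3 E * wa4 E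
           + wa2 E * wa3 E ^ 2 - wa4 E ^ 2"
definition wc4 :: "'a::field weier \<Rightarrow> 'a" where
  "wc4 E = wb2 E ^ 2 - 24 * wb4 E"
definition discr :: "'a::field weier \<Rightarrow> 'a" where
  "discr E = - (wb2 E ^ 2 * wb8 E) - 8 * wb4 E ^ 3 - 27 * wb6 E ^ 2
             + 9 * wb2 E * wb4 E * wb6 E"

definition elliptic :: "'a::field weier \<Rightarrow> bool" where
  "elliptic E \<longleftrightarrow> discr E \<noteq> 0"

definition j_inv :: "'a::field weier \<Rightarrow> 'a" where
  "j_inv E = wc4 E ^ 3 / discr E"

text \<open>Points (affine points plus the point at infinity) and the group law
  (Silverman, III.2.3).\<close>
datatype 'a ecpt = Inf | Pt 'a 'a

fun on_curve :: "'a::field weier \<Rightarrow> 'a ecpt \<Rightarrow> bool" where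
  "on_curve E Inf = True"
| "on_curve E (Pt x y) \<longleftrightarrow>
     y ^ 2 + wa1 E * x * y + wa3 E * y = x ^ 3 + wa2 E * x ^ 2 + wa4 E * x + wa6 E"

fun ec_neg :: "'a::field weier \<Rightarrow> 'a ecpt \<Rightarrow> 'a ecpt" where
  "ec_neg E Inf = Inf"
| "ec_neg E (Pt x y) = Pt x (- y - wa1 E * x - wa3 E)"

fun ec_add :: "'a::field weier \<Rightarrow> 'a ecpt \<Rightarrow> 'a ecpt \<Rightarrow> 'a ecpt" where
  "ec_add E Inf Q = Q"
| "ec_add E P Inf = P"
| "ec_add E (Pt x1 y1) (Pt x2 y2) =
    (if x1 = x2 \<and> y1 + y2 + wa1 E * x2 + wa3 E = 0 then Inf
     else
       let lam = (if x1 \<noteq> x2 then (y2 - y1) / (x2 - x1)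
                  else (3 * x1 ^ 2 + 2 * wa2 E * x1 + wa4 E - wa1 E * y1)
                       / (2 * y1 + wa1 E * x1 + wa3 E));
           nu = (if x1 \<noteq> x2 then (y1 * x2 - y2 * x1) / (x2 - x1)
                 else (- (x1 ^ 3) + wa4 E * x1 + 2 * wa6 E - wa3 E * y1)
                      / (2 * y1 + wa1 E * x1 + wa3 E));
           x3 = lam ^ 2 + wa1 E * lam - wa2 E - x1 - x2;
           y3 = - (lam + wa1 E) * x3 - nu - wa3 E
       in Pt x3 y3)"

definition ec_zmul :: "'a::field weier \<Rightarrow> int \<Rightarrow> 'a ecpt \<Rightarrow> 'a ecpt" where
  "ec_zmul E n P =
     (if n \<ge> 0 then (ec_add E P ^^ nat n) Inf
      else ec_neg E ((ec_add E P ^^ nat (- n)) Inf))"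

definition ec_sum_list :: "'a::field weier \<Rightarrow> 'a ecpt list \<Rightarrow> 'a ecpt" where
  "ec_sum_list E xs = foldr (ec_add E) xs Inf"

definition z_independent :: "'a::field weier \<Rightarrow> 'a ecpt set \<Rightarrow> bool" where
  "z_independent E S \<longleftrightarrow> finite S \<and> (\<forall>P\<in>S. on_curve E P) \<and>
     (\<forall>(c :: 'a ecpt \<Rightarrow> int) xs. distinct xs \<longrightarrow> set xs = S \<longrightarrow>
        ec_sum_list E (map (\<lambda>P. ec_zmul E (c P) P) xs) = Inf \<longrightarrow> (\<forall>P\<in>S. c P = 0))"

definition mw_rank :: "'a::field weier \<Rightarrow> enat" where
  "mw_rank E = Sup {enat (card S) | S. z_independent E S}"

text \<open>F_p(t) is 'k poly fract with CARD('k) = p; F_p-bar(t^(1/d)) is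
  ('k alg_closure) poly fract with variable u, u^d = t.  The embedding sends
  t to u^d and F_p into its algebraic closure.\<close>
definition poly_emb :: "nat \<Rightarrow> 'k::field poly \<Rightarrow> 'k alg_closure poly" where
  "poly_emb d a = pcompose (map_poly to_ac a) (monom 1 d)"

definition fract_emb :: "nat \<Rightarrow> 'k::field poly fract \<Rightarrow> 'k alg_closure poly fract" where
  "fract_emb d x =
     (let ab = (SOME ab. snd ab \<noteq> 0 \<and> x = Fract (fst ab) (snd ab))
      in Fract (poly_emb d (fst ab)) (poly_emb d (snd ab)))"

definition base_change :: "nat \<Rightarrow> 'k::field poly fract weier \<Rightarrow> 'k alg_closure poly fract weier" where
  "base_change d E = map_weier (fract_emb d) E"

definition const_fract :: "'k::field \<Rightarrow> 'k poly fract" where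
  "const_fract c = Fract [:c:] 1"

end

theory Submission
  imports Defs
begin

text \<open>
  For each $p$ we take an explicit curve $E$ with at most two finite additive fibres (over $t = 1$, and for $p = 7$ also
  $t = 3$) and nodal fibres over $t = 0, \infty$, and show by infinite descent that over
  $K = \overline{\mathbb{F}}_p(u)$, $u^d = t$, it has no points besides a few torsion points.

  Let $D$ be a suitable constant multiple of $u\,d/du$.  For a point $(x, y)$ a third coordinate $w$ is defined by a
  Gauss-Manin type system for $Dx$, $Dy$; the defect $M$ of its remaining equation for $Dw$ satisfies
  $A M = D(w^p - A w - y M_p(x))$, where $A$ is the Hasse invariant and $f^{(p-1)/2} = x^p M_p + A x^{p-1} + \dots$.
  Locally $M$ has at most simple poles, at the additive fibres, so that after clearing denominators $A M$ is a polynomial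
  which is exact; comparing coefficients, and using that the digits of the Hasse invariant do not vanish, gives $M = 0$.
  Then $w^p - A w - y M_p(x)$ is a $p$-th power without poles that vanishes at $u = 0$, hence zero: the point lifts
  to the Frobenius twist $E^{(p)}$ along the Verschiebung.  The coordinates of the lift are killed by $D$, hence are
  $p$-th powers, and their roots form a point of $E$ over $K$ whose $x$-coordinate has fewer poles.\<close>

section \<open>Discrete valuation rings with a derivation\<close>

text \<open>Uniformity in \<open>d\<close> is the main constraint. The operator
  \<open>u d/du\<close> is scaled by \<open>kap / d\<close>, so that \<open>D t = kap * t\<close>
  and on functions of \<open>t\<close> the differential system is the same for all \<open>d\<close>.
  What remains of \<open>d\<close> is that exact polynomials have no terms \<open>u^n\<close> with
  \<open>p\<close> dividing \<open>n\<close>; as \<open>p\<close> does not divide \<open>d\<close>,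
  every exponent is brought to such an \<open>n\<close> by adding a multiple of \<open>d\<close>
  below \<open>p * d\<close>. Pole bounds alone leave the possibility that
  \<open>w^p - A w - y M_p(x)\<close> is a non-zero constant. It is excluded over
  \<open>u = 0\<close>: there the derivation is logarithmic, the fibre is a nodal cubic, and the
  Artin-Schreier equation can be checked on its parametrisation by slopes. Verschiebung after
  Frobenius is multiplication by \<open>p\<close>, so a descent step passes to a \<open>p\<close>-th
  part of the point. The degree of \<open>x\<close> as a rational function serves as height, and
  points with constant \<open>x\<close> end the descent. Characteristic 2 needs its own equations,
  since the square cannot be completed there.\<close>

locale place =
  fixes R :: "'f::field set" and pi :: 'f
  assumes R_1: "1 \<in> R"
    and R_add: "x \<in> R \<Longrightarrow> y \<in> R \<Longrightarrow> x + y \<in> R"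
    and R_mult: "x \<in> R \<Longrightarrow> y \<in> R \<Longrightarrow> x * y \<in> R"
    and R_uminus: "x \<in> R \<Longrightarrow> - x \<in> R"
    and pi_R: "pi \<in> R" and pi_nz: "pi \<noteq> 0" and pi_nonunit: "inverse pi \<notin> R"
    and decomp: "x \<noteq> 0 \<Longrightarrow> \<exists>n::int. \<exists>e. e \<in> R \<and> inverse e \<in> R \<and> x = pi powi n * e"
begin

text \<open>A lower bound for the order, satisfied by 0 for every \<open>n\<close>;
  \<open>val\<close> below is the exact order and never holds for 0. Working with relations avoids a
  convention for the order of 0.\<close>

definition vge :: "'f \<Rightarrow> int \<Rightarrow> bool" where
  "vge x n \<longleftrightarrow> (\<exists>e\<in>R. x = pi powi n * e)"

definition val :: "'f \<Rightarrow> int \<Rightarrow> bool" where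
  "val x n \<longleftrightarrow> (\<exists>e. e \<in> R \<and> inverse e \<in> R \<and> e \<noteq> 0 \<and> x = pi powi n * e)"

lemma R_0: "0 \<in> R"
  using R_add[OF R_1 R_uminus[OF R_1]] by simp

lemma pi_pow_R: "pi ^ k \<in> R"
  by (induction k) (auto intro: R_1 R_mult pi_R)

lemma vge_0_iff: "vge x 0 \<longleftrightarrow> x \<in> R"
  by (auto simp: vge_def)

lemma vge_zero [simp, intro]: "vge 0 n"
  unfolding vge_def using R_0 by (intro bexI[of _ 0]) auto

lemma vge_mono: "vge x m \<Longrightarrow> n \<le> m \<Longrightarrow> vge x n"
proof -
  assume "vge x m" and le: "n \<le> m"
  then obtain e where e: "e \<in> R" "x = pi powi m * e" by (auto simp: vge_def)
  define k where "k = nat (m - n)"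
  have "m = n + int k" using le by (simp add: k_def)
  hence "x = pi powi n * (pi ^ k * e)"
    using e pi_nz by (simp add: power_int_add)
  moreover have "pi ^ k * e \<in> R" using e pi_pow_R R_mult by blast
  ultimately show "vge x n" unfolding vge_def by blast
qed

lemma vge_add: "vge x n \<Longrightarrow> vge y n \<Longrightarrow> vge (x + y) n"
  unfolding vge_def by (metis R_add distrib_left)

lemma vge_uminus: "vge x n \<Longrightarrow> vge (- x) n"
  unfolding vge_def by (metis R_uminus mult_minus_right)

lemma vge_diff: "vge x n \<Longrightarrow> vge y n \<Longrightarrow> vge (x - y) n"
  using vge_add[of x n "- y"] vge_uminus by simp

lemma vge_mult: "vge x m \<Longrightarrow> vge y n \<Longrightarrow> vge (x * y) (m + n)"
proof -
  assume "vge x m" "vge y n"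
  then obtain e f where "e \<in> R" "x = pi powi m * e" "f \<in> R" "y = pi powi n * f"
    by (auto simp: vge_def)
  hence "x * y = pi powi (m + n) * (e * f)" "e * f \<in> R"
    using pi_nz by (auto simp: power_int_add intro: R_mult)
  thus ?thesis unfolding vge_def by blast
qed

lemma vge_mult': "vge x m \<Longrightarrow> vge y n \<Longrightarrow> k \<le> m + n \<Longrightarrow> vge (x * y) k"
  using vge_mult vge_mono by blast

lemma vge_1: "vge 1 0" by (simp add: vge_0_iff R_1)

lemma vge_power: "vge x m \<Longrightarrow> vge (x ^ k) (int k * m)"
proof (induction k)
  case 0 then show ?case by (simp add: vge_1)
next
  case (Suc k)
  have "vge (x * x ^ k) (m + int k * m)" using Suc by (intro vge_mult) auto
  thus ?case by (simp add: algebra_simps)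
qed

lemma vge_of_nat: "vge (of_nat k) 0"
  by (induction k) (auto intro: vge_add vge_1)

lemma vge_of_int: "vge (of_int k) 0"
  by (cases k rule: int_cases2) (auto intro: vge_of_nat vge_uminus)

lemma vge_numeral: "vge (numeral k) 0"
  using vge_of_nat[of "numeral k"] by simp

lemma val_imp_vge: "val x n \<Longrightarrow> vge x n"
  by (auto simp: val_def vge_def)

lemma val_nz: "val x n \<Longrightarrow> x \<noteq> 0"
  using pi_nz by (auto simp: val_def)

lemma val_ex: "x \<noteq> 0 \<Longrightarrow> \<exists>n. val x n"
  using decomp[of x] by (force simp: val_def)

lemma pi_pow_inv_R: "pi powi m \<in> R \<Longrightarrow> 0 \<le> m"
proof (rule ccontr)
  assume *: "pi powi m \<in> R" "\<not> 0 \<le> m"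
  define k where "k = nat (- m - 1)"
  have k: "m = - 1 - int k" using * by (simp add: k_def)
  have "inverse pi = pi powi m * pi ^ k"
    using pi_nz by (simp add: k power_int_diff power_int_minus field_simps)
  hence "inverse pi \<in> R" using R_mult[OF *(1) pi_pow_R] by simp
  thus False using pi_nonunit by simp
qed

lemma val_vge_le: "val x n \<Longrightarrow> vge x m \<Longrightarrow> m \<le> n"
proof -
  assume "val x n" "vge x m"
  then obtain e f where e: "e \<in> R" "inverse e \<in> R" "e \<noteq> 0" "x = pi powi n * e" "f \<in> R" "x = pi powi m * f"
    by (auto simp: val_def vge_def)
  have "pi powi (n - m) = f * inverse e"
    using e pi_nz by (simp add: power_int_diff field_simps)
  hence "pi powi (n - m) \<in> R" using R_mult e by simp
  thus "m \<le> n" using pi_pow_inv_R by fastforce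
qed

lemma val_unique: "val x n \<Longrightarrow> val x m \<Longrightarrow> m = n"
  by (meson antisym val_imp_vge val_vge_le)

lemma val_mult: "val x m \<Longrightarrow> val y n \<Longrightarrow> val (x * y) (m + n)"
proof -
  assume "val x m" "val y n"
  then obtain e f where e: "e \<in> R" "inverse e \<in> R" "e \<noteq> 0" "x = pi powi m * e"
    "f \<in> R" "inverse f \<in> R" "f \<noteq> 0" "y = pi powi n * f" by (auto simp: val_def)
  have "x * y = pi powi (m + n) * (e * f)"
    using pi_nz e by (auto simp: power_int_add)
  moreover have "e * f \<in> R" "inverse (e * f) \<in> R" "e * f \<noteq> 0"
    using e R_mult by auto
  ultimately show ?thesis unfolding val_def by blast
qed

lemma val_inverse: "val x n \<Longrightarrow> val (inverse x) (- n)"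
proof -
  assume "val x n"
  then obtain e where e: "e \<in> R" "inverse e \<in> R" "e \<noteq> 0" "x = pi powi n * e" by (auto simp: val_def)
  have "inverse x = pi powi (- n) * inverse e" using e by (simp add: power_int_minus)
  moreover have "inverse e \<noteq> 0" "inverse (inverse e) \<in> R" using e by auto
  ultimately show ?thesis unfolding val_def using e by blast
qed

lemma val_divide: "val x m \<Longrightarrow> val y n \<Longrightarrow> val (x / y) (m - n)"
  using val_mult[OF _ val_inverse, of x m y n] by (simp add: field_simps)

lemma vge_divide: "vge x m \<Longrightarrow> val y n \<Longrightarrow> vge (x / y) (m - n)"
  using vge_mult[OF _ val_imp_vge[OF val_inverse], of x m y n] by (simp add: field_simps)

lemma vge_divide': "vge x m \<Longrightarrow> val y n \<Longrightarrow> k \<le> m - n \<Longrightarrow> vge (x / y) k"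
  using vge_divide vge_mono by blast

lemma val_1: "val 1 0"
  unfolding val_def using R_1 by (intro exI[of _ 1]) auto

lemma val_power: "val x m \<Longrightarrow> val (x ^ k) (int k * m)"
proof (induction k)
  case 0 then show ?case by (simp add: val_1)
next
  case (Suc k)
  have "val (x * x ^ k) (m + int k * m)" using Suc by (intro val_mult) auto
  thus ?case by (simp add: algebra_simps)
qed

lemma val_pi: "val pi 1"
  unfolding val_def using R_1 by (intro exI[of _ 1]) auto

lemma val_add: "val x n \<Longrightarrow> vge y (n + 1) \<Longrightarrow> val (x + y) n"
proof -
  assume x: "val x n" and y: "vge y (n + 1)"
  have nz: "x + y \<noteq> 0"
  proof
    assume "x + y = 0"
    hence "x = - y" by (simp add: eq_neg_iff_add_eq_0)
    hence "vge x (n + 1)" using y vge_uminus by simp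
    thus False using val_vge_le[OF x] by fastforce
  qed
  then obtain m where m: "val (x + y) m" using val_ex by blast
  have "vge (x + y) n" using vge_add[OF val_imp_vge[OF x] vge_mono[OF y]] by simp
  hence 1: "n \<le> m" using val_vge_le[OF m] by simp
  have "m \<le> n"
  proof (rule ccontr)
    assume "\<not> m \<le> n"
    hence "vge (x + y) (n + 1)" using vge_mono[OF val_imp_vge[OF m]] by simp
    hence "vge (x + y - y) (n + 1)" using y vge_diff by blast
    hence "vge x (n + 1)" by simp
    thus False using val_vge_le[OF x] by fastforce
  qed
  thus ?thesis using 1 m by simp
qed

lemma not_vge_val: "\<not> vge x m \<Longrightarrow> \<exists>n<m. val x n"
  using val_ex[of x] val_imp_vge vge_mono by (metis linorder_not_less vge_zero)

lemma unit_or_vge: "vge x n \<Longrightarrow> val x n \<or> vge x (n + 1)"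
  using not_vge_val[of x "n + 1"] val_vge_le[of x _ n] by force

text \<open>The order of a \<open>k\<close>-th power is a multiple of \<open>k\<close>, so a pole of
  order below \<open>k\<close> is no pole. This is what makes a \<open>p\<close>-th root regular
  although only a pole bound \<open>p - 1\<close> is known for the power.\<close>

lemma vge_powerD: "vge (x ^ k) m \<Longrightarrow> - int k < m \<Longrightarrow> k > 0 \<Longrightarrow> vge x 0"
proof (rule ccontr)
  assume *: "vge (x ^ k) m" "- int k < m" "k > 0" "\<not> vge x 0"
  then obtain n where n: "n < 0" "val x n" using not_vge_val by blast
  have "m \<le> int k * n" using val_vge_le[OF val_power[OF n(2)] *(1)] .
  also have "\<dots> \<le> int k * (- 1)" using n *(3) by (intro mult_left_mono) auto
  finally show False using *(2) by simp
qed

lemma vge_power_pos: "vge (x ^ k) 1 \<Longrightarrow> k > 0 \<Longrightarrow> vge x 1"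
proof (rule ccontr)
  assume *: "vge (x ^ k) 1" "k > 0" "\<not> vge x 1"
  then obtain n where n: "n < 1" "val x n" using not_vge_val by blast
  have "1 \<le> int k * n" using val_vge_le[OF val_power[OF n(2)] *(1)] .
  moreover have "int k * n \<le> 0" using n by (intro mult_nonneg_nonpos) auto
  ultimately show False by simp
qed

end

section \<open>Derivations and their effect on orders\<close>

locale derivation =
  fixes D :: "'f::field \<Rightarrow> 'f"
  assumes D_add: "D (x + y) = D x + D y"
    and D_mult: "D (x * y) = D x * y + x * D y"
begin

lemma D_0 [simp]: "D 0 = 0"
  using D_add[of 0 0] by (metis add_cancel_right_right add_0)

lemma D_1 [simp]: "D 1 = 0"
  using D_mult[of 1 1] by (metis add_cancel_right_right mult.right_neutral mult_1)

lemma D_uminus: "D (- x) = - D x"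
  using D_add[of x "- x"] by (simp add: eq_neg_iff_add_eq_0 add.commute)

lemma D_diff: "D (x - y) = D x - D y"
  using D_add[of x "- y"] D_uminus by simp

lemma D_of_nat [simp]: "D (of_nat n) = 0"
  by (induction n) (auto simp: D_add)

lemma D_numeral [simp]: "D (numeral n) = 0"
  using D_of_nat[of "numeral n"] by simp

lemma D_power: "D (x ^ n) = of_nat n * x ^ (n - 1) * D x"
proof (induction n)
  case (Suc n)
  show ?case
  proof (cases n)
    case 0 then show ?thesis by simp
  next
    case (Suc m)
    have "D (x ^ Suc n) = D x * x ^ n + x * D (x ^ n)" by (simp add: D_mult)
    also have "\<dots> = of_nat (Suc n) * x ^ n * D x"
      unfolding Suc.IH by (simp add: Suc algebra_simps)
    finally show ?thesis by simp
  qed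
qed simp

lemma D_inverse: "x \<noteq> 0 \<Longrightarrow> D (inverse x) = - D x / x ^ 2"
proof -
  assume x: "x \<noteq> 0"
  have "D x * inverse x + x * D (inverse x) = 0"
    using D_mult[of x "inverse x"] x by simp
  thus ?thesis using x by (simp add: field_simps power2_eq_square eq_neg_iff_add_eq_0)
qed

lemma D_divide: "y \<noteq> 0 \<Longrightarrow> D (x / y) = (D x * y - x * D y) / y ^ 2"
  by (simp add: divide_inverse D_mult D_inverse) (simp add: field_simps power2_eq_square)

lemma D_powi: "x \<noteq> 0 \<Longrightarrow> D (x powi n) = of_int n * x powi (n - 1) * D x"
proof (cases n rule: int_cases2)
  case (nonneg k)
  assume x: "x \<noteq> 0"
  show ?thesis
  proof (cases k)
    case 0 thus ?thesis using nonneg by simp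
  next
    case (Suc m)
    have "n - 1 = int m" using Suc nonneg by simp
    hence "x powi (n - 1) = x ^ m" by simp
    moreover have "x powi n = x ^ Suc m" using nonneg Suc by (metis power_int_of_nat)
    moreover have "of_int n = (of_nat (Suc m) :: 'f)" using nonneg Suc by simp
    ultimately show ?thesis using D_power[of x "Suc m"] by simp
  qed
next
  case (nonpos k)
  assume x: "x \<noteq> 0"
  have n: "n - 1 = - int (k + 1)" using nonpos by simp
  show ?thesis
  proof (cases k)
    case 0 thus ?thesis using nonpos by simp
  next
    case (Suc m)
    have Dk: "D (x ^ k) = of_nat k * x ^ m * D x" using D_power[of x k] Suc by simp
    have "D (x powi n) = D (inverse (x ^ k))" using nonpos by (simp add: power_int_minus)
    also have "\<dots> = - (of_nat k * x ^ m * D x) / (x ^ k) ^ 2"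
      using x D_inverse[of "x ^ k"] by (simp add: Dk)
    also have "\<dots> = - of_nat k * inverse (x ^ (k + 1)) * D x"
      using x Suc by (simp add: field_simps power2_eq_square)
    moreover have "inverse (x ^ (k + 1)) = x powi (n - 1)"
      unfolding n by (metis power_int_minus power_int_of_nat)
    ultimately show ?thesis using nonpos by simp
  qed
qed

end

locale dplace = place R pi + derivation D
  for R :: "'f::field set" and pi :: 'f and D :: "'f \<Rightarrow> 'f" +
  assumes D_R: "x \<in> R \<Longrightarrow> D x \<in> R"
begin

lemma vge_D0: "vge x 0 \<Longrightarrow> vge (D x) 0"
  by (simp add: vge_0_iff D_R)

lemma vge_D: "vge x n \<Longrightarrow> vge (D x) (n - 1)"
proof -
  assume "vge x n"
  then obtain e where e: "e \<in> R" "x = pi powi n * e" by (auto simp: vge_def)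
  have "D x = of_int n * pi powi (n - 1) * D pi * e + pi powi n * D e"
    using e pi_nz by (simp add: D_mult D_powi)
  moreover have "vge (of_int n * pi powi (n - 1) * D pi * e) (n - 1)"
  proof -
    have "vge (of_int n * D pi * e) 0"
      using vge_mult[OF vge_mult[OF vge_of_int vge_D0[of pi]], of e 0 n] e pi_R by (simp add: vge_0_iff)
    moreover have "vge (pi powi (n - 1)) (n - 1)" unfolding vge_def using R_1 by force
    ultimately show ?thesis using vge_mult by (fastforce simp: ac_simps)
  qed
  moreover have "vge (pi powi n * D e) (n - 1)"
  proof (rule vge_mono[of _ n])
    show "vge (pi powi n * D e) n" unfolding vge_def using D_R e by blast
  qed auto
  ultimately show ?thesis using vge_add by simp
qed

end

text \<open>Places at which the derivation is logarithmic; for \<open>u d/du\<close> these are 0 and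
  infinity. Here \<open>D\<close> kills the residue field, loses no order, and multiplies the
  leading coefficient of an element of order \<open>n\<close> by \<open>n * k0\<close>, which is
  \<open>val_D\<close>.\<close>

locale lplace = dplace R pi D
  for R :: "'f::field set" and pi :: 'f and D :: "'f \<Rightarrow> 'f" +
  fixes k0 :: 'f
  assumes D_R1: "x \<in> R \<Longrightarrow> vge (D x) 1" and D_pi: "D pi = k0 * pi" and k0_R: "k0 \<in> R"
begin

lemma val_D: "vge x n \<Longrightarrow> vge (D x - of_int n * k0 * x) (n + 1)"
proof -
  assume "vge x n"
  then obtain e where e: "e \<in> R" "x = pi powi n * e" by (auto simp: vge_def)
  have "pi powi (n - 1) * pi = pi powi n"
    using pi_nz by (simp add: power_int_diff)
  hence "D x = of_int n * k0 * x + pi powi n * D e"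
    using e pi_nz by (simp add: D_mult D_powi D_pi mult_ac)
  moreover have "vge (pi powi n * D e) (n + 1)"
  proof (rule vge_mult)
    show "vge (pi powi n) n" unfolding vge_def using R_1 by force
    show "vge (D e) 1" using D_R1 e by blast
  qed
  ultimately show ?thesis by simp
qed

lemma vge_Dl: "vge x n \<Longrightarrow> vge (D x) n"
proof -
  assume x: "vge x n"
  have "vge (of_int n * k0 * x) n"
    using vge_mult[OF vge_mult[OF vge_of_int, of k0 0] x] k0_R by (simp add: vge_0_iff)
  from vge_add[OF vge_mono[OF val_D[OF x]] this] show ?thesis by simp
qed

end

section \<open>The differential system of a lifted point\<close>

text \<open>For \<open>a2 = 0\<close> this is Ramanujan's system in weights 4 and 6, with
  \<open>nu\<close> in the role of the quasi-modular form of weight 2. Over the complex numbers take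
  \<open>x = wp(z)\<close>, \<open>y = wp'(z)/2\<close> with \<open>z = a tau + b\<close> for
  constants \<open>a\<close>, \<open>b\<close>: with \<open>D = -2 pi i d/dtau\<close>,
  \<open>nu\<close> is the quasi-period \<open>eta_1\<close> and the third coordinate
  \<open>w\<close> is minus Hecke's form \<open>zeta(z) - a eta_2 - b eta_1\<close>, for which
  \<open>D w = x w - y + nu w\<close>. Writing \<open>rel\<close> without a division by 3 keeps
  characteristic 3 within the system.\<close>

locale ode = derivation D for D :: "'f::field \<Rightarrow> 'f" +
  fixes a2 a4 a6 nu g0 :: 'f
  assumes two_nz: "(2::'f) \<noteq> 0"
    and Da2: "D a2 = 0"
    and Da4: "D a4 = - 6 * a6 + (4 * nu - 2 * a2) * a4 - 2 * a2 * g0"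
    and Da6: "D a6 = (6 * nu - 4 * a2) * a6 - a4 * g0"
    and rel: "4 * a4 = 2 * nu * a2 - 3 * g0"
begin

definition on :: "'f \<Rightarrow> 'f \<Rightarrow> bool" where
  "on x y \<longleftrightarrow> y ^ 2 = x ^ 3 + a2 * x ^ 2 + a4 * x + a6"

definition F :: "'f \<Rightarrow> 'f" where "F x = 3 * x ^ 2 + 2 * a2 * x + a4"

definition G :: "'f \<Rightarrow> 'f" where
  "G x = D x + 2 * x ^ 2 - (2 * nu - 2 * a2) * x - g0"

text \<open>The coordinate \<open>w\<close>, solved from \<open>G x = 2 * y * w\<close>. At
  \<open>y = 0\<close> the value 0 is the right one: the equation for \<open>D y\<close> then reads
  \<open>0 = F x * w\<close>, and \<open>F x\<close> is non-zero.\<close>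

definition wP :: "'f \<Rightarrow> 'f \<Rightarrow> 'f" where
  "wP x y = (if y = 0 then 0 else G x / (2 * y))"

definition MP :: "'f \<Rightarrow> 'f \<Rightarrow> 'f" where
  "MP x y = x * wP x y - y + nu * wP x y - D (wP x y)"

text \<open>Near the origin of the curve \<open>w\<close> behaves like \<open>y / x\<close>; the
  remainder \<open>rho\<close> turns out to be regular at the poles of \<open>x\<close>.\<close>

definition rho :: "'f \<Rightarrow> 'f \<Rightarrow> 'f" where "rho x y = wP x y - y / x"

text \<open>Differentiating the equation of the curve gives \<open>2 y D y\<close>; the added terms
  are multiples of \<open>y^2\<close>, which is replaced by the cubic. Everything then collects into
  \<open>F x * G x\<close> except a term in \<open>x^2\<close>, and its coefficient is exactly what
  \<open>rel\<close> makes vanish.\<close>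

lemma D_curve:
  assumes "on x y"
  shows "2 * y * (D y + 3 * x * y - (3 * nu - 2 * a2) * y) = F x * G x"
proof -
  have "D (y ^ 2) = D (x ^ 3 + a2 * x ^ 2 + a4 * x + a6)" using assms by (simp add: on_def)
  hence "2 * y * D y = F x * D x + D a4 * x + D a6"
    by (simp add: D_power D_add D_mult Da2 F_def algebra_simps)
  hence "2 * y * (D y + 3 * x * y - (3 * nu - 2 * a2) * y)
     = F x * D x + D a4 * x + D a6 + (6 * x - 2 * (3 * nu - 2 * a2)) * y ^ 2"
    by (simp add: algebra_simps power2_eq_square)
  also have "y ^ 2 = x ^ 3 + a2 * x ^ 2 + a4 * x + a6" using assms by (simp add: on_def)
  also have "F x * D x + D a4 * x + D a6
       + (6 * x - 2 * (3 * nu - 2 * a2)) * (x ^ 3 + a2 * x ^ 2 + a4 * x + a6)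
     = F x * G x - (2 * nu * a2 - 3 * g0 - 4 * a4) * x ^ 2"
    unfolding Da4 Da6 F_def G_def by (simp add: algebra_simps power2_eq_square power3_eq_cube)
  finally show ?thesis using rel by simp
qed

lemma Dx_eq:
  assumes "on x y" and "y = 0 \<Longrightarrow> F x \<noteq> 0"
  shows "G x = 2 * y * wP x y"
  using D_curve[OF assms(1)] assms(2) two_nz by (auto simp: wP_def)

lemma Dy_eq:
  assumes "on x y" and "y = 0 \<Longrightarrow> F x \<noteq> 0"
  shows "D y + 3 * x * y - (3 * nu - 2 * a2) * y = F x * wP x y"
proof (cases "y = 0")
  case True thus ?thesis by (simp add: wP_def)
next
  case False
  have "2 * y * (D y + 3 * x * y - (3 * nu - 2 * a2) * y) = 2 * y * (F x * wP x y)"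
    using D_curve[OF assms(1)] Dx_eq[OF assms] by simp
  thus ?thesis using False two_nz by simp
qed

text \<open>The factor \<open>2 * (a2 + 3 * x)\<close> is the derivative of \<open>F\<close> in
  \<open>x\<close>, a unit at a node. There \<open>y\<close> and \<open>F x\<close> both vanish, and
  this formula controls \<open>G x\<close>, hence \<open>w\<close>, by the order of
  \<open>F x\<close>.\<close>

lemma G_F:
  assumes "on x y"
  shows "2 * (a2 + 3 * x) * G x = D (F x) + 6 * y ^ 2 + (2 * a2 - 4 * nu + 2 * x) * F x"
proof -
  have DF: "D (F x) = 6 * x * D x + 2 * a2 * D x + D a4"
    by (simp add: F_def D_power D_add D_mult Da2 algebra_simps)
  have y2: "y ^ 2 = x ^ 3 + a2 * x ^ 2 + a4 * x + a6" using assms by (simp add: on_def)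
  have "2 * (a2 + 3 * x) * G x = D (F x) + 6 * y ^ 2 + (2 * a2 - 4 * nu + 2 * x) * F x
     + 2 * x * (2 * nu * a2 - 3 * g0 - 4 * a4)"
    unfolding y2 DF unfolding Da4 F_def G_def
    by (simp add: algebra_simps power2_eq_square power3_eq_cube)
  thus ?thesis using rel by simp
qed

text \<open>In \<open>x * G x - 2 * y^2\<close> the terms \<open>2 x^3\<close> and
  \<open>2 a2 x^2\<close> cancel; this is the gain in order that subtracting \<open>y / x\<close>
  from \<open>w\<close> brings.\<close>

lemma rho_eq:
  assumes "on x y" "x \<noteq> 0" "y \<noteq> 0"
  shows "rho x y = (D x - 2 * nu * x - 2 * a4 - 2 * a6 / x - g0) / (2 * y)"
proof -
  have y2: "y ^ 2 = x ^ 3 + a2 * x ^ 2 + a4 * x + a6" using assms by (simp add: on_def)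
  have "rho x y = (G x * x - 2 * y ^ 2) / (2 * y * x)"
    using assms two_nz by (simp add: rho_def wP_def field_simps power2_eq_square)
  also have "G x * x - 2 * y ^ 2 = x * (D x - 2 * nu * x - 2 * a4 - 2 * a6 / x - g0)"
    using assms unfolding y2 G_def by (simp add: field_simps power2_eq_square power3_eq_cube)
  finally show ?thesis using assms two_nz by simp
qed

text \<open>The summands that define \<open>MP\<close> have large poles where \<open>x\<close> has
  one. After substituting \<open>w = y / x + rho\<close> these cancel by the equation of the curve,
  and each term that is left can be bounded separately.\<close>

lemma M_rho:
  assumes "on x y" "x \<noteq> 0" "y \<noteq> 0"
  shows "MP x y = nu * rho x y + rho x y * (a4 / x + 2 * a6 / x ^ 2) + (a4 + g0) * y / x ^ 2
    + 2 * a6 * y / x ^ 3 - D (rho x y)"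
proof -
  define w r where "w = wP x y" and "r = rho x y"
  have w: "w = y / x + r" by (simp add: w_def r_def rho_def)
  have y2: "y ^ 2 = x ^ 3 + a2 * x ^ 2 + a4 * x + a6" using assms by (simp add: on_def)
  have Dx: "D x = 2 * y * w - 2 * x ^ 2 + (2 * nu - 2 * a2) * x + g0"
    using Dx_eq[OF assms(1)] assms(3) by (simp add: w_def G_def algebra_simps)
  have Dy: "D y = F x * w - 3 * x * y + (3 * nu - 2 * a2) * y"
    using Dy_eq[OF assms(1)] assms(3) by (simp add: w_def algebra_simps)
  have Dyx: "D (y / x) = (D y * x - y * D x) / x ^ 2" using D_divide assms by simp
  have e1: "x ^ 3 * (x * w - y + nu * w - (D y * x - y * D x) / x ^ 2)
     = x ^ 3 * (nu * r + r * (a4 / x + 2 * a6 / x ^ 2) + (a4 + g0) * y / x ^ 2 + 2 * a6 * y / x ^ 3)"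
  proof -
    have l: "x ^ 3 * (x * w - y + nu * w - (D y * x - y * D x) / x ^ 2)
       = x ^ 3 * (x * w - y + nu * w) - x * (D y * x - y * D x)"
      using assms by (simp add: field_simps power2_eq_square power3_eq_cube)
    have r': "x ^ 3 * (nu * r + r * (a4 / x + 2 * a6 / x ^ 2) + (a4 + g0) * y / x ^ 2 + 2 * a6 * y / x ^ 3)
       = x ^ 3 * nu * r + r * (a4 * x ^ 2 + 2 * a6 * x) + (a4 + g0) * y * x + 2 * a6 * y"
      using assms by (simp add: field_simps power2_eq_square power3_eq_cube)
    have xw: "x * w = y + x * r" using w assms by (simp add: field_simps)
    have "x ^ 3 * (x * w - y + nu * w) - x * (D y * x - y * D x)
       = (nu * x ^ 2 + a4 * x + 2 * a6) * (x * w) + y * (g0 * x - nu * x ^ 2)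
         + 2 * (x * w) * (y ^ 2 - (x ^ 3 + a2 * x ^ 2 + a4 * x + a6))"
      unfolding Dx Dy F_def by (simp add: algebra_simps power2_eq_square power3_eq_cube)
    also have "\<dots> = (nu * x ^ 2 + a4 * x + 2 * a6) * (y + x * r) + y * (g0 * x - nu * x ^ 2)"
      using y2 xw by simp
    finally show ?thesis unfolding l r' by (simp add: algebra_simps power2_eq_square power3_eq_cube)
  qed
  have "MP x y = x * w - y + nu * w - (D (y / x) + D r)"
    unfolding MP_def w_def[symmetric] using w D_add by metis
  also have "\<dots> = (x * w - y + nu * w - (D y * x - y * D x) / x ^ 2) - D r"
    by (simp add: Dyx)
  finally show ?thesis using e1 assms unfolding r_def[symmetric] by simp
qed

end

locale ode_place = ode D a2 a4 a6 nu g0 + dplace R pi D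
  for R :: "'f::field set" and pi :: 'f and D :: "'f \<Rightarrow> 'f" and a2 a4 a6 nu g0 +
  assumes two_unit: "val 2 0"
begin

lemma pole_val:
  assumes "on x y" and "vge a2 0" "vge a4 (-1)" "vge a6 (-2)" and nx: "\<not> vge x 0"
  obtains n where "n \<ge> 1" "val x (- 2 * n)" "val y (- 3 * n)"
proof -
  obtain m where m: "m < 0" "val x m" using not_vge_val[OF nx] by blast
  have x3: "val (x ^ 3) (3 * m)" using val_power[OF m(2), of 3] by simp
  have "vge (a2 * x ^ 2) (3 * m + 1)"
    by (rule vge_mult'[OF assms(2) val_imp_vge[OF val_power[OF m(2), of 2]]]) (use m in simp)
  moreover have "vge (a4 * x) (3 * m + 1)"
    by (rule vge_mult'[OF assms(3) val_imp_vge[OF m(2)]]) (use m in simp)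
  moreover have "vge a6 (3 * m + 1)" by (rule vge_mono[OF assms(4)]) (use m in simp)
  ultimately have "vge (a2 * x ^ 2 + a4 * x + a6) (3 * m + 1)" by (intro vge_add)
  from val_add[OF x3 this] have y2: "val (y ^ 2) (3 * m)"
    using assms(1) by (simp add: on_def add.assoc)
  hence "y \<noteq> 0" using val_nz by fastforce
  then obtain k where k: "val y k" using val_ex by blast
  have "2 * k = 3 * m" using val_unique[OF y2 val_power[OF k, of 2]] by simp
  hence "even m" by presburger
  then obtain n where n: "m = 2 * n" by blast
  show ?thesis
    by (rule that[of "- n"]) (use m n k \<open>2 * k = 3 * m\<close> in auto)
qed

lemma y_regular:
  assumes "on x y" "vge x 0" "vge (x ^ 3 + a2 * x ^ 2 + a4 * x + a6) m" "m \<ge> -1"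
  shows "vge y 0"
proof (rule vge_powerD[of y 2])
  show "vge (y ^ 2) m" using assms by (simp add: on_def)
qed (use assms in auto)

lemma vge_coeff_mult: "vge x n \<Longrightarrow> vge (numeral k * x) n"
  using vge_mult[OF vge_numeral, of x n k] by simp

lemma val_2y: "val y n \<Longrightarrow> val (2 * y) n"
  using val_mult[OF two_unit, of y n] by simp

text \<open>The parameter \<open>e\<close> is the pole order of the coefficients: 1 over an additive
  fibre, 0 elsewhere. The derivation costs at most one order, so the numerator in
  \<open>rho_eq\<close> has order at least \<open>- 2 * n - 1\<close>, and division by
  \<open>2 * y\<close> leaves \<open>n - 1\<close>, which is not negative.\<close>

lemma pole_rho:
  assumes "on x y" and n: "n \<ge> 1" "val x (- 2 * n)" "val y (- 3 * n)"
    and e: "e \<le> 1" "vge a4 (-e)" "vge a6 (-e)" "vge nu (-e)" "vge g0 (-e)"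
  shows "vge (rho x y) 0" and "vge (MP x y) (min 0 (- e))"
proof -
  have nz: "x \<noteq> 0" "y \<noteq> 0" using val_nz n by blast+
  note vx = val_imp_vge[OF n(2)] and vy = val_imp_vge[OF n(3)]
  have x2: "val (x ^ 2) (- 4 * n)" using val_power[OF n(2), of 2] by simp
  have x3: "val (x ^ 3) (- 6 * n)" using val_power[OF n(2), of 3] by simp
  have "vge (D x - 2 * nu * x - 2 * a4 - 2 * a6 / x - g0) (- 2 * n - 1)"
  proof (intro vge_diff)
    show "vge (D x) (- 2 * n - 1)" using vge_D[OF vx] .
    have "vge (nu * x) (- 2 * n - 1)" by (rule vge_mult'[OF e(4) vx]) (use e in simp)
    from vge_coeff_mult[OF this] show "vge (2 * nu * x) (- 2 * n - 1)" by (simp add: mult.assoc)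
    show "vge (2 * a4) (- 2 * n - 1)" by (rule vge_coeff_mult[OF vge_mono[OF e(2)]]) (use e n in simp)
    have "vge (2 * a6 / x) (-e - (- 2 * n))" by (intro vge_divide vge_coeff_mult e n)
    thus "vge (2 * a6 / x) (- 2 * n - 1)" by (rule vge_mono) (use e n in simp)
    show "vge g0 (- 2 * n - 1)" by (rule vge_mono[OF e(5)]) (use e n in simp)
  qed
  from vge_divide[OF this val_2y[OF n(3)]]
  show r: "vge (rho x y) 0" unfolding rho_eq[OF assms(1) nz]
    by (rule vge_mono) (use n in simp)
  have e0: "- e \<le> 0 \<or> - e \<ge> 0" by auto
  show "vge (MP x y) (min 0 (- e))"
    unfolding M_rho[OF assms(1) nz]
  proof (intro vge_diff vge_add)
    show "vge (nu * rho x y) (min 0 (- e))" by (rule vge_mult'[OF e(4) r]) simp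
    have "vge (a4 / x + 2 * a6 / x ^ 2) 0"
      by (intro vge_add vge_divide'[OF e(2) n(2)] vge_divide'[OF vge_coeff_mult[OF e(3)] x2])
         (use e n in auto)
    from vge_mult'[OF r this]
    show "vge (rho x y * (a4 / x + 2 * a6 / x ^ 2)) (min 0 (- e))" by simp
    have "vge ((a4 + g0) * y) (- e - 3 * n)" using vge_mult[OF vge_add[OF e(2) e(5)] vy] by simp
    thus "vge ((a4 + g0) * y / x ^ 2) (min 0 (- e))" by (rule vge_divide'[OF _ x2]) (use e n in auto)
    have "vge (2 * a6 * y) (- e - 3 * n)" using vge_mult[OF vge_coeff_mult[OF e(3)] vy] by simp
    thus "vge (2 * a6 * y / x ^ 3) (min 0 (- e))" by (rule vge_divide'[OF _ x3]) (use e n in auto)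
    show "vge (D (rho x y)) (min 0 (- e))" by (rule vge_mono[OF vge_D0[OF r]]) simp
  qed
qed

lemma regular_M:
  assumes "vge x 0" "vge y 0" "vge (wP x y) 0" "vge nu (-e)" "e \<ge> 0"
  shows "vge (MP x y) (- e)"
  unfolding MP_def
proof (intro vge_diff vge_add)
  show "vge (x * wP x y) (- e)" by (rule vge_mult'[OF assms(1,3)]) (use assms in simp)
  show "vge y (- e)" by (rule vge_mono[OF assms(2)]) (use assms in simp)
  show "vge (nu * wP x y) (- e)" by (rule vge_mult'[OF assms(4,3)]) simp
  show "vge (D (wP x y)) (- e)" by (rule vge_mono[OF vge_D0[OF assms(3)]]) (use assms in simp)
qed

lemma vge_G:
  assumes "vge x 0" "vge a2 0" "vge nu 0" "vge g0 0"
  shows "vge (G x) 0"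
  unfolding G_def
proof (intro vge_diff vge_add)
  show "vge (D x) 0" using vge_D0[OF assms(1)] .
  show "vge (2 * x\<^sup>2) 0" using vge_coeff_mult[OF vge_power[OF assms(1), of 2]] by simp
  have "vge (2 * nu - 2 * a2) 0" by (intro vge_diff vge_coeff_mult assms)
  thus "vge ((2 * nu - 2 * a2) * x) 0" by (rule vge_mult'[OF _ assms(1)]) simp
qed (rule assms)

lemma vge_F:
  assumes "vge x 0" "vge a2 0" "vge a4 0" shows "vge (F x) 0"
  unfolding F_def
proof (intro vge_add)
  show "vge (3 * x\<^sup>2) 0" using vge_coeff_mult[OF vge_power[OF assms(1), of 2]] by simp
  show "vge (2 * a2 * x) 0" by (rule vge_mult'[OF vge_coeff_mult[OF assms(2)] assms(1)]) simp
qed (rule assms)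

lemma vge_cubic:
  assumes "vge x 0" "vge a2 0" "vge a4 m" "vge a6 m" "m \<le> 0"
  shows "vge (x ^ 3 + a2 * x ^ 2 + a4 * x + a6) m"
proof (intro vge_add)
  show "vge (x ^ 3) m" by (rule vge_mono[OF vge_power[OF assms(1)]]) (use assms in simp)
  show "vge (a2 * x\<^sup>2) m" by (rule vge_mult'[OF assms(2) vge_power[OF assms(1)]]) (use assms in simp)
  show "vge (a4 * x) m" by (rule vge_mult'[OF assms(3,1)]) (use assms in simp)
qed (rule assms)

lemma vge_numer:
  assumes "vge x 0" "vge y m" "vge (D y) k" "vge a2 0" "vge nu (-e)" "e \<ge> 0" "k \<le> m - e"
  shows "vge (D y + 3 * x * y - (3 * nu - 2 * a2) * y) k"
proof (intro vge_diff vge_add)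
  show "vge (D y) k" by fact
  show "vge (3 * x * y) k" by (rule vge_mult'[OF vge_coeff_mult[OF assms(1)] assms(2)]) (use assms in simp)
  have "vge (3 * nu - 2 * a2) (-e)"
    by (intro vge_diff vge_coeff_mult assms vge_mono[OF assms(4)]) (use assms in simp)
  thus "vge ((3 * nu - 2 * a2) * y) k" by (rule vge_mult'[OF _ assms(2)]) (use assms in simp)
qed

text \<open>On a smooth fibre \<open>y\<close> and \<open>F x\<close> do not both vanish, so
  \<open>w\<close> is obtained from the equation for \<open>D x\<close> by dividing by
  \<open>2 * y\<close>, or from that for \<open>D y\<close> by dividing by
  \<open>F x\<close>.\<close>

lemma regular_nonsingular:
  assumes on: "on x y" and x: "vge x 0"
    and c: "vge a2 0" "vge a4 0" "vge a6 0" "vge nu 0" "vge g0 0"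
    and ns: "val y 0 \<or> val (F x) 0"
  shows "vge y 0" "vge (wP x y) 0" "vge (MP x y) 0"
proof -
  show y: "vge y 0" by (rule y_regular[OF on x vge_cubic[of x 0]]) (use x c in auto)
  have nz: "y = 0 \<Longrightarrow> F x \<noteq> 0" using ns val_nz by auto
  show w: "vge (wP x y) 0" using ns
  proof
    assume "val y 0"
    hence "wP x y = G x / (2 * y)" using val_nz by (auto simp: wP_def)
    thus ?thesis using vge_divide[OF vge_G[OF x] val_2y[OF \<open>val y 0\<close>]] c by simp
  next
    assume F: "val (F x) 0"
    have "wP x y = (D y + 3 * x * y - (3 * nu - 2 * a2) * y) / F x"
      using Dy_eq[OF on nz] val_nz[OF F] by (simp add: field_simps)
    moreover have "vge (D y + 3 * x * y - (3 * nu - 2 * a2) * y) 0"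
      by (rule vge_numer[OF x y vge_D0[OF y], of 0]) (use c in auto)
    ultimately show ?thesis using vge_divide[OF _ F] by simp
  qed
  show "vge (MP x y) 0" using regular_M[OF x y w, of 0] c by simp
qed

text \<open>If only \<open>a6\<close> had a pole, \<open>y^2\<close> would have order -1, which is
  odd. So \<open>a4\<close> has a simple pole, \<open>F x\<close> has order exactly -1, and dividing
  the equation for \<open>D y\<close> by it absorbs the pole of \<open>nu\<close>.\<close>

lemma regular_additive:
  assumes on: "on x y" and x: "vge x 0" and nz: "y = 0 \<Longrightarrow> F x \<noteq> 0"
    and c: "vge a2 0" "vge a6 (-1)" "vge nu (-1)"
    and t: "val a4 (-1) \<or> (vge a4 0 \<and> val a6 (-1))"
  shows "vge y 0" "vge (wP x y) 0" "vge (MP x y) (-1)"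
proof -
  have a4: "vge a4 (-1)" using t val_imp_vge vge_mono by fastforce
  show y: "vge y 0" by (rule y_regular[OF on x vge_cubic[of x "-1"]]) (use x c a4 in auto)
  have t4: "val a4 (-1)"
  proof (rule ccontr)
    assume "\<not> ?thesis"
    hence a: "vge a4 0" "val a6 (-1)" using t by auto
    have "vge (x ^ 3 + a2 * x ^ 2 + a4 * x) 0"
      by (intro vge_add vge_mult'[OF c(1) vge_power[OF x]] vge_mult'[OF a(1) x]
          vge_mono[OF vge_power[OF x, of 3]]) auto
    hence "val (a6 + (x ^ 3 + a2 * x ^ 2 + a4 * x)) (-1)" by (intro val_add a) simp
    hence "val (y ^ 2) (-1)" using on by (simp add: on_def add.commute)
    moreover obtain k where "val y k" using val_nz[OF calculation] val_ex[of y] by fastforce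
    ultimately have "2 * k = -1" using val_unique[OF _ val_power[of y k 2], of "-1"] by simp
    thus False by presburger
  qed
  have "val (a4 + (3 * x ^ 2 + 2 * a2 * x)) (-1)"
  proof (rule val_add[OF t4])
    have "vge (3 * x\<^sup>2) 0" using vge_coeff_mult[OF vge_power[OF x, of 2]] by simp
    moreover have "vge (2 * a2 * x) 0" by (rule vge_mult'[OF vge_coeff_mult[OF c(1)] x]) simp
    ultimately show "vge (3 * x\<^sup>2 + 2 * a2 * x) (- 1 + 1)" using vge_add by simp
  qed
  hence F: "val (F x) (-1)" by (simp add: F_def add.commute)
  have "wP x y = (D y + 3 * x * y - (3 * nu - 2 * a2) * y) / F x"
    using Dy_eq[OF on nz] val_nz[OF F] by (simp add: field_simps)
  moreover have "vge (D y + 3 * x * y - (3 * nu - 2 * a2) * y) (-1)"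
    by (rule vge_numer[OF x y vge_mono[OF vge_D0[OF y]], of _ 1]) (use c in auto)
  ultimately show w: "vge (wP x y) 0" using vge_divide[OF _ F] by fastforce
  show "vge (MP x y) (-1)" using regular_M[OF x y w, of 1] c by simp
qed

end

locale ode_lplace = ode_place R pi D a2 a4 a6 nu g0 + lplace R pi D k0
  for R :: "'f::field set" and pi :: 'f and D :: "'f \<Rightarrow> 'f" and a2 a4 a6 nu g0 k0
begin

text \<open>At a node \<open>y\<close> and \<open>F x\<close> both vanish. If their orders differ,
  \<open>w\<close> vanishes. If both orders are \<open>i\<close>, the logarithmic derivation
  multiplies both leading coefficients by \<open>i * k0\<close>, and the two available formulas for
  \<open>w\<close> determine its residue in terms of \<open>F x / y\<close> and of
  \<open>y / F x\<close>.\<close>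

lemma singular_w:
  assumes on: "on x y" and x: "vge x 0" and nz: "y = 0 \<Longrightarrow> F x \<noteq> 0"
    and c: "vge a2 0" "vge nu 0" and u: "val (a2 + 3 * x) 0"
    and y1: "vge y 1"
  shows "vge (wP x y) 1 \<or>
    (\<exists>i. val y i \<and> val (F x) i \<and>
      vge (wP x y - (of_int i * k0 + (2 * a2 - 4 * nu + 2 * x)) / (4 * (a2 + 3 * x)) * (F x / y)) 1 \<and>
      vge (wP x y - (of_int i * k0 + 3 * x - (3 * nu - 2 * a2)) * (y / F x)) 1)"
    (is "_ \<or> (\<exists>i. ?P i)")
proof -
  let ?h = "3 * nu - 2 * a2" and ?q = "2 * a2 - 4 * nu + 2 * x"
  have h: "vge ?h 0" by (intro vge_diff vge_coeff_mult c)
  have q: "vge ?q 0" by (intro vge_diff vge_add vge_coeff_mult c x)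
  have u2: "val (2 * (a2 + 3 * x)) 0" using val_2y[OF u] .
  have w2: "wP x y = (D y + 3 * x * y - ?h * y) / F x" if "F x \<noteq> 0"
    using Dy_eq[OF on nz] that by (simp add: field_simps)
  have G: "G x = (D (F x) + 6 * y ^ 2 + ?q * F x) / (2 * (a2 + 3 * x))"
    using G_F[OF on] val_nz[OF u2] by (simp add: field_simps)
  have w1: "wP x y = (D (F x) + 6 * y ^ 2 + ?q * F x) / (4 * (a2 + 3 * x) * y)" if "y \<noteq> 0"
    using that unfolding wP_def G by simp
  have u4: "val (4 * (a2 + 3 * x)) 0"
    using val_mult[OF two_unit u2] by (simp add: mult.assoc[symmetric])
  \<comment> \<open>The case that \<open>F x\<close> vanishes to higher order than \<open>y\<close>,
    so that \<open>w\<close> is computed with denominator \<open>y\<close>; \<open>gen2\<close> is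
    the opposite case, with denominator \<open>F x\<close>.\<close>
  have gen1: "vge (wP x y) 1" if "val y j" "vge (F x) (j + 1)" "j \<ge> 1" for j
  proof -
    have "vge (D (F x) + 6 * y ^ 2 + ?q * F x) (j + 1)"
    proof (intro vge_add)
      show "vge (D (F x)) (j + 1)" using vge_Dl that by blast
      have "vge (y ^ 2) (2 * j)" using vge_power[OF val_imp_vge[OF that(1)], of 2] by simp
      thus "vge (6 * y ^ 2) (j + 1)" using vge_coeff_mult vge_mono that(3) by fastforce
      show "vge (?q * F x) (j + 1)" using vge_mult[OF q that(2)] by simp
    qed
    moreover have "val (4 * (a2 + 3 * x) * y) j" using val_mult[OF u4 that(1)] by simp
    ultimately show ?thesis unfolding w1[OF val_nz[OF that(1)]] by (rule vge_divide') simp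
  qed
  have gen2: "vge (wP x y) 1" if "val (F x) j" "vge y (j + 1)" for j
  proof -
    have "vge (D y + 3 * x * y - ?h * y) (j + 1)"
      by (rule vge_numer[OF x that(2) vge_Dl[OF that(2)], of 0]) (use c in auto)
    thus ?thesis unfolding w2[OF val_nz[OF that(1)]] by (rule vge_divide'[OF _ that(1)]) simp
  qed
  show ?thesis
  proof (cases "y = 0")
    case True thus ?thesis by (simp add: wP_def)
  next
    case ynz: False
    then obtain j where j: "val y j" using val_ex by blast
    have j1: "j \<ge> 1" using val_vge_le[OF j y1] .
    show ?thesis
    proof (cases "vge (F x) (j + 1)")
      case True thus ?thesis using gen1[OF j True j1] by simp
    next
      case False
      then obtain i where i: "i < j + 1" "val (F x) i" using not_vge_val by blast
      show ?thesis
      proof (cases "i = j")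
        case neq: False
        hence "vge y (i + 1)" using i vge_mono[OF val_imp_vge[OF j]] by simp
        thus ?thesis using gen2[OF i(2)] by simp
      next
        case True
        have Fi: "val (F x) j" using i True by simp
        have Fnz: "F x \<noteq> 0" using val_nz[OF Fi] .
        have r: "val (F x / y) 0" using val_divide[OF Fi j] by simp
        have "wP x y - (of_int j * k0 + ?q) / (4 * (a2 + 3 * x)) * (F x / y)
           = ((D (F x) - of_int j * k0 * F x) + 6 * y ^ 2) / (4 * (a2 + 3 * x) * y)"
        proof -
          define U where "U = 4 * (a2 + 3 * x)"
          have "U \<noteq> 0" using val_nz[OF u4] by (simp add: U_def)
          thus ?thesis unfolding w1[OF ynz] U_def[symmetric] using ynz by (simp add: field_simps)
        qed
        moreover have "vge ((D (F x) - of_int j * k0 * F x) + 6 * y ^ 2) (j + 1)"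
        proof (intro vge_add)
          show "vge (D (F x) - of_int j * k0 * F x) (j + 1)" using val_D[OF val_imp_vge[OF Fi]] .
          have "vge (y ^ 2) (2 * j)" using vge_power[OF val_imp_vge[OF j], of 2] by simp
          thus "vge (6 * y ^ 2) (j + 1)" using vge_coeff_mult vge_mono j1 by fastforce
        qed
        moreover have "val (4 * (a2 + 3 * x) * y) j" using val_mult[OF u4 j] by simp
        ultimately have 1: "vge (wP x y - (of_int j * k0 + ?q) / (4 * (a2 + 3 * x)) * (F x / y)) 1"
          using vge_divide' by simp
        have "wP x y - (of_int j * k0 + 3 * x - ?h) * (y / F x) = (D y - of_int j * k0 * y) / F x"
          unfolding w2[OF Fnz] using Fnz by (simp add: field_simps)
        moreover have "vge ((D y - of_int j * k0 * y) / F x) 1"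
          by (rule vge_divide'[OF val_D[OF val_imp_vge[OF j]] Fi]) simp
        ultimately show ?thesis using 1 j Fi by auto
      qed
    qed
  qed
qed

lemma singular_regular:
  assumes on: "on x y" and x: "vge x 0" and nz: "y = 0 \<Longrightarrow> F x \<noteq> 0"
    and c: "vge a2 0" "vge nu 0" and u: "val (a2 + 3 * x) 0"
    and y1: "vge y 1"
  shows "vge (wP x y) 0"
  using singular_w[OF assms]
proof
  assume "vge (wP x y) 1" thus ?thesis by (rule vge_mono) simp
next
  assume "\<exists>i. val y i \<and> val (F x) i \<and>
      vge (wP x y - (of_int i * k0 + (2 * a2 - 4 * nu + 2 * x)) / (4 * (a2 + 3 * x)) * (F x / y)) 1 \<and>
      vge (wP x y - (of_int i * k0 + 3 * x - (3 * nu - 2 * a2)) * (y / F x)) 1"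
  then obtain i where i: "val y i" "val (F x) i"
    "vge (wP x y - (of_int i * k0 + 3 * x - (3 * nu - 2 * a2)) * (y / F x)) 1" by blast
  have "vge (of_int i * k0) 0" using vge_mult[OF vge_of_int, of k0 0 i] k0_R by (simp add: vge_0_iff)
  hence "vge (of_int i * k0 + 3 * x - (3 * nu - 2 * a2)) 0"
    by (intro vge_diff vge_add vge_coeff_mult c x)
  hence "vge ((of_int i * k0 + 3 * x - (3 * nu - 2 * a2)) * (y / F x)) 0"
    using vge_mult val_imp_vge[OF val_divide[OF i(1,2)]] by fastforce
  from vge_add[OF vge_mono[OF i(3)] this] show ?thesis by simp
qed

text \<open>One order better than in general, because a logarithmic derivation does not lower the
  order of \<open>x\<close>.\<close>

lemma pole_rho_log:
  assumes "on x y" and n: "n \<ge> 1" "val x (- 2 * n)" "val y (- 3 * n)"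
    and e: "vge a4 0" "vge a6 0" "vge nu 0" "vge g0 0"
  shows "vge (rho x y) 1"
proof -
  have nz: "x \<noteq> 0" "y \<noteq> 0" using val_nz n by blast+
  note vx = val_imp_vge[OF n(2)]
  have "vge (D x - 2 * nu * x - 2 * a4 - 2 * a6 / x - g0) (- 2 * n)"
  proof (intro vge_diff)
    show "vge (D x) (- 2 * n)" using vge_Dl[OF vx] .
    have "vge (nu * x) (- 2 * n)" by (rule vge_mult'[OF e(3) vx]) simp
    from vge_coeff_mult[OF this] show "vge (2 * nu * x) (- 2 * n)" by (simp add: mult.assoc)
    show "vge (2 * a4) (- 2 * n)" by (rule vge_coeff_mult[OF vge_mono[OF e(1)]]) (use n in simp)
    have "vge (2 * a6 / x) (0 - (- 2 * n))" by (intro vge_divide vge_coeff_mult e n)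
    thus "vge (2 * a6 / x) (- 2 * n)" by (rule vge_mono) (use n in simp)
    show "vge g0 (- 2 * n)" by (rule vge_mono[OF e(4)]) (use n in simp)
  qed
  from vge_divide[OF this val_2y[OF n(3)]]
  show ?thesis unfolding rho_eq[OF assms(1) nz]
    by (rule vge_mono) (use n in simp)
qed

end

section \<open>The rational function field\<close>

text \<open>The operator \<open>u d/du\<close> rather than \<open>d/du\<close>: it multiplies the
  coefficient of \<open>u^n\<close> by \<open>n\<close>, and it is logarithmic both at 0 and at
  infinity.\<close>

definition tpoly :: "'a::field poly \<Rightarrow> 'a poly" where
  "tpoly a = pCons 0 (pderiv a)"

lemma tpoly_add: "tpoly (a + b) = tpoly a + tpoly b"
  by (simp add: tpoly_def pderiv_add)

lemma tpoly_mult: "tpoly (a * b) = tpoly a * b + a * tpoly b"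
  by (simp add: tpoly_def pderiv_mult algebra_simps)

lemma tpoly_1 [simp]: "tpoly 1 = 0"
  by (simp add: tpoly_def)

lemma tpoly_const [simp]: "tpoly [:c:] = 0"
  by (simp add: tpoly_def)

lemma coeff_tpoly: "coeff (tpoly a) n = of_nat n * coeff a n"
  by (cases n) (simp_all add: tpoly_def coeff_pderiv)

definition tder :: "'a::field poly fract \<Rightarrow> 'a poly fract" where
  "tder x = (let (a, b) = (SOME ab. snd ab \<noteq> 0 \<and> x = Fract (fst ab) (snd ab))
     in Fract (tpoly a * b - a * tpoly b) (b * b))"

lemma Fract_some:
  assumes "b \<noteq> (0 :: 'b::idom)"
  obtains c d where "(SOME ab. snd ab \<noteq> 0 \<and> Fract a b = Fract (fst ab) (snd ab)) = (c, d)"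
    "d \<noteq> 0" "a * d = c * b"
proof -
  let ?P = "\<lambda>ab. snd ab \<noteq> 0 \<and> Fract a b = Fract (fst ab) (snd ab)"
  obtain c d where cd: "(SOME ab. ?P ab) = (c, d)" by (cases "SOME ab. ?P ab")
  have "?P (SOME ab. ?P ab)" by (rule someI[of ?P "(a, b)"]) (use assms in simp)
  hence "d \<noteq> 0" "Fract a b = Fract c d" unfolding cd by auto
  moreover from this have "a * d = c * b" using assms eq_fract(1) by blast
  ultimately show ?thesis using that[OF cd] by blast
qed

lemma tder_Fract:
  assumes b: "b \<noteq> 0"
  shows "tder (Fract a b) = Fract (tpoly a * b - a * tpoly b) (b * b)"
proof -
  obtain c d where s: "(SOME ab. snd ab \<noteq> 0 \<and> Fract a b = Fract (fst ab) (snd ab)) = (c, d)"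
    and d: "d \<noteq> 0" and e0: "a * d = c * b" using Fract_some[OF b] by blast
  have "tpoly (a * d) = tpoly (c * b)" using e0 by simp
  hence e: "tpoly a * d - tpoly c * b = c * tpoly b - a * tpoly d"
    by (simp add: tpoly_mult algebra_simps)
  have "(tpoly a * b - a * tpoly b) * (d * d) - (tpoly c * d - c * tpoly d) * (b * b)
     = b * d * (tpoly a * d - tpoly c * b) - tpoly b * d * (a * d) + tpoly d * b * (c * b)"
    by (simp add: algebra_simps)
  also have "\<dots> = 0" unfolding e e0 by (simp add: algebra_simps e0)
  finally have "(tpoly a * b - a * tpoly b) * (d * d) = (tpoly c * d - c * tpoly d) * (b * b)" by simp
  thus ?thesis unfolding tder_def s using b d by (simp add: eq_fract)
qed

lemma tder_poly: "tder (Fract a 1) = Fract (tpoly a) 1"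
  by (simp add: tder_Fract)

lemma tder_add: "tder (x + y) = tder x + tder y"
proof (cases x, cases y)
  fix a b c d assume [simp]: "x = Fract a b" "y = Fract c d" "b \<noteq> 0" "d \<noteq> 0"
  show ?thesis
    by (simp add: tder_Fract eq_fract tpoly_add tpoly_mult algebra_simps)
qed

lemma tder_mult: "tder (x * y) = tder x * y + x * tder y"
proof (cases x, cases y)
  fix a b c d assume [simp]: "x = Fract a b" "y = Fract c d" "b \<noteq> 0" "d \<noteq> 0"
  show ?thesis
    by (simp add: tder_Fract eq_fract tpoly_add tpoly_mult algebra_simps)
qed

lemma const_fract_add: "const_fract (a + b) = const_fract a + const_fract b"
  by (simp add: const_fract_def)
lemma const_fract_mult: "const_fract (a * b) = const_fract a * const_fract b"
  by (simp add: const_fract_def mult.commute)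
lemma const_fract_0 [simp]: "const_fract 0 = 0"
  by (simp add: const_fract_def Zero_fract_def)
lemma const_fract_1 [simp]: "const_fract 1 = 1"
  by (simp add: const_fract_def One_fract_def one_pCons[symmetric])
lemma const_fract_uminus: "const_fract (- a) = - const_fract a"
  by (simp add: const_fract_def)
lemma const_fract_diff: "const_fract (a - b) = const_fract a - const_fract b"
  by (simp add: const_fract_def)
lemma const_fract_eq_0: "const_fract a = 0 \<longleftrightarrow> a = 0"
  by (simp add: const_fract_def Zero_fract_def eq_fract)
lemma const_fract_power: "const_fract (a ^ n) = const_fract a ^ n"
  by (induction n) (auto simp: const_fract_mult)
lemma const_fract_inverse: "const_fract (inverse a) = inverse (const_fract a)"
proof (cases "a = 0")
  case False
  have "const_fract (inverse a) * const_fract a = 1"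
    using False by (simp add: const_fract_mult[symmetric])
  thus ?thesis by (metis inverse_unique mult.commute)
qed simp
lemma const_fract_divide: "const_fract (a / b) = const_fract a / const_fract b"
  by (simp add: divide_inverse const_fract_mult const_fract_inverse)
lemma const_fract_of_nat [simp]: "const_fract (of_nat n) = of_nat n"
  by (induction n) (auto simp: const_fract_add)
lemma const_fract_numeral [simp]: "const_fract (numeral n) = numeral n"
  using const_fract_of_nat[of "numeral n"] by simp
lemma const_fract_of_int [simp]: "const_fract (of_int n) = of_int n"
  by (cases n rule: int_cases2) (auto simp: const_fract_uminus)

lemma tder_const [simp]: "tder (const_fract c) = 0"
  by (simp add: const_fract_def tder_poly fract_collapse)

lemma Fract_power: "Fract a b ^ n = Fract (a ^ n) (b ^ n)"
  by (induction n) (auto simp: One_fract_def)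

lemma derivation_tder: "derivation (\<lambda>x. const_fract k * tder x)"
  by standard (auto simp: tder_add tder_mult algebra_simps)

definition finR :: "'a::field \<Rightarrow> 'a poly fract set" where
  "finR \<alpha> = {Fract a b | a b. poly b \<alpha> \<noteq> 0}"
definition finpi :: "'a::field \<Rightarrow> 'a poly fract" where
  "finpi \<alpha> = Fract [:- \<alpha>, 1:] 1"
definition infR :: "'a::field poly fract set" where
  "infR = {Fract a b | a b. b \<noteq> 0 \<and> degree a \<le> degree b}"
definition infpi :: "'a::field poly fract" where
  "infpi = Fract 1 [:0, 1:]"

lemma finR_I: "poly b \<alpha> \<noteq> 0 \<Longrightarrow> Fract a b \<in> finR \<alpha>"
  by (auto simp: finR_def)
lemma infR_I: "b \<noteq> 0 \<Longrightarrow> degree a \<le> degree b \<Longrightarrow> Fract a b \<in> infR"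
  by (auto simp: infR_def)

lemma place_fin: "place (finR \<alpha>) (finpi \<alpha>)"
proof
  show "1 \<in> finR \<alpha>" unfolding One_fract_def by (rule finR_I) simp
  show "finpi \<alpha> \<in> finR \<alpha>" unfolding finpi_def by (rule finR_I) simp
  show "finpi \<alpha> \<noteq> 0" by (simp add: finpi_def Zero_fract_def eq_fract)
  show "inverse (finpi \<alpha>) \<notin> finR \<alpha>"
  proof
    assume "inverse (finpi \<alpha>) \<in> finR \<alpha>"
    then obtain a b where ab: "poly b \<alpha> \<noteq> 0" "Fract 1 [:- \<alpha>, 1:] = Fract a b"
      by (auto simp: finR_def finpi_def)
    hence "b = a * [:- \<alpha>, 1:]" by (subst (asm) eq_fract) auto
    hence "poly b \<alpha> = 0" by simp
    thus False using ab by simp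
  qed
next
  fix x y assume "x \<in> finR \<alpha>" "y \<in> finR \<alpha>"
  then obtain a b c d where *: "x = Fract a b" "y = Fract c d" "poly b \<alpha> \<noteq> 0" "poly d \<alpha> \<noteq> 0"
    by (auto simp: finR_def)
  have nz: "b \<noteq> 0" "d \<noteq> 0" using * by auto
  show "x + y \<in> finR \<alpha>" unfolding * using nz *(3,4) by (simp add: finR_I)
  show "x * y \<in> finR \<alpha>" unfolding * using *(3,4) by (simp add: finR_I)
next
  fix x assume "x \<in> finR \<alpha>"
  then obtain a b where "x = Fract a b" "poly b \<alpha> \<noteq> 0" by (auto simp: finR_def)
  thus "- x \<in> finR \<alpha>" using finR_I[of b \<alpha> "- a"] by simp
next
  fix x :: "'a poly fract" assume "x \<noteq> 0"
  then obtain a b where ab: "x = Fract a b" "a \<noteq> 0" "b \<noteq> 0"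
    by (cases x rule: Fract_cases_nonzero) auto
  obtain a' where a': "a = [:- \<alpha>, 1:] ^ order \<alpha> a * a'" "\<not> [:- \<alpha>, 1:] dvd a'"
    using order_decomp[OF ab(2)] by blast
  obtain b' where b': "b = [:- \<alpha>, 1:] ^ order \<alpha> b * b'" "\<not> [:- \<alpha>, 1:] dvd b'"
    using order_decomp[OF ab(3)] by blast
  define e where "e = Fract a' b'"
  have p: "poly a' \<alpha> \<noteq> 0" "poly b' \<alpha> \<noteq> 0" using a' b' poly_eq_0_iff_dvd by blast+
  have pnz: "finpi \<alpha> \<noteq> 0" by (simp add: finpi_def Zero_fract_def eq_fract)
  have "x = finpi \<alpha> ^ order \<alpha> a / finpi \<alpha> ^ order \<alpha> b * e"
    unfolding ab(1) e_def finpi_def Fract_power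
    by (subst (1) a'(1), subst (1) b'(1)) (simp add: divide_fract_def)
  also have "finpi \<alpha> ^ order \<alpha> a / finpi \<alpha> ^ order \<alpha> b = finpi \<alpha> powi (int (order \<alpha> a) - int (order \<alpha> b))"
    using pnz by (simp add: power_int_diff)
  finally have "x = finpi \<alpha> powi (int (order \<alpha> a) - int (order \<alpha> b)) * e" .
  moreover have "e \<in> finR \<alpha>" "inverse e \<in> finR \<alpha>" unfolding e_def using p by (auto intro: finR_I)
  ultimately show "\<exists>n e. e \<in> finR \<alpha> \<and> inverse e \<in> finR \<alpha> \<and> x = finpi \<alpha> powi n * e" by blast
qed

lemma dplace_fin: "dplace (finR \<alpha>) (finpi \<alpha>) (\<lambda>x. const_fract k * tder x)"
proof (intro dplace.intro place_fin derivation_tder dplace_axioms.intro)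
  fix x assume "x \<in> finR \<alpha>"
  then obtain a b where *: "x = Fract a b" "poly b \<alpha> \<noteq> 0" by (auto simp: finR_def)
  have "b \<noteq> 0" using * by auto
  thus "const_fract k * tder x \<in> finR \<alpha>"
    unfolding *(1) const_fract_def using *(2) by (simp add: tder_Fract finR_I)
qed

lemma lplace_0: "lplace (finR 0) (finpi 0) (\<lambda>x. const_fract k * tder x) (const_fract k)"
proof (intro lplace.intro dplace_fin lplace_axioms.intro)
  interpret place "finR (0::'a)" "finpi 0" by (rule place_fin)
  show "const_fract k \<in> finR 0" unfolding const_fract_def by (rule finR_I) simp
  show "const_fract k * tder (finpi 0) = const_fract k * finpi 0"
    by (simp add: finpi_def tder_poly tpoly_def pderiv_pCons)
  fix x :: "'a poly fract" assume "x \<in> finR 0"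
  then obtain a b where *: "x = Fract a b" "poly b 0 \<noteq> 0" by (auto simp: finR_def)
  hence b: "b \<noteq> 0" by auto
  define c where "c = pderiv a * b - a * pderiv b"
  have "tpoly a * b - a * tpoly b = [:0, 1:] * c"
    by (simp add: tpoly_def c_def algebra_simps)
  hence "const_fract k * tder x = finpi 0 * Fract ([:k:] * c) (b * b)"
    unfolding *(1) by (simp add: tder_Fract b const_fract_def finpi_def)
  moreover have "Fract ([:k:] * c) (b * b) \<in> finR 0" using * by (intro finR_I) auto
  ultimately show "place.vge (finR 0) (finpi 0) (const_fract k * tder x) 1"
    unfolding vge_def by auto
qed

lemma place_inf: "place infR (infpi :: 'a::field poly fract)"
proof
  show "(1::'a poly fract) \<in> infR" unfolding One_fract_def by (rule infR_I) auto
  show "(infpi::'a poly fract) \<in> infR" unfolding infpi_def by (rule infR_I) auto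
  show pnz: "(infpi::'a poly fract) \<noteq> 0" by (simp add: infpi_def Zero_fract_def eq_fract)
  show "inverse infpi \<notin> (infR :: 'a poly fract set)"
  proof
    assume "inverse infpi \<in> (infR :: 'a poly fract set)"
    then obtain a b :: "'a poly" where ab: "b \<noteq> 0" "degree a \<le> degree b" "Fract [:0,1:] 1 = Fract a b"
      by (auto simp: infR_def infpi_def)
    hence "[:0,1:] * b = a" by (subst (asm) eq_fract) auto
    hence "a = pCons 0 b" by simp
    hence "degree a = Suc (degree b)" using ab(1) by (simp add: degree_pCons_eq)
    thus False using ab by simp
  qed
next
  fix x y :: "'a poly fract" assume "x \<in> infR" "y \<in> infR"
  then obtain a b c d where *: "x = Fract a b" "y = Fract c d" "b \<noteq> 0" "d \<noteq> 0"
     "degree a \<le> degree b" "degree c \<le> degree d"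
    by (auto simp: infR_def)
  have dd: "degree (b * d) = degree b + degree d" using * by (simp add: degree_mult_eq)
  have "degree (a * d) \<le> degree b + degree d" "degree (c * b) \<le> degree b + degree d"
    using degree_mult_le[of a d] degree_mult_le[of c b] * by linarith+
  hence "degree (a * d + c * b) \<le> degree (b * d)" using dd by (simp add: degree_add_le)
  thus "x + y \<in> infR" unfolding * using *(3,4) by (simp add: infR_I)
  have "degree (a * c) \<le> degree (b * d)" using degree_mult_le[of a c] * dd by linarith
  thus "x * y \<in> infR" unfolding * using *(3,4) by (simp add: infR_I)
next
  fix x :: "'a poly fract" assume "x \<in> infR"
  then obtain a b where "x = Fract a b" "b \<noteq> 0" "degree a \<le> degree b" by (auto simp: infR_def)
  thus "- x \<in> infR" using infR_I[of b "- a"] by simp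
next
  fix x :: "'a poly fract" assume "x \<noteq> 0"
  then obtain a b where ab: "x = Fract a b" "a \<noteq> 0" "b \<noteq> 0"
    by (cases x rule: Fract_cases_nonzero) auto
  define m n where "m = degree b" and "n = degree a"
  define e where "e = Fract (a * [:0,1:] ^ m) (b * [:0,1:] ^ n)"
  have deg: "degree ([:0, 1::'a:] ^ k) = k" for k by (simp add: degree_power_eq)
  have dg: "degree (a * [:0,1:] ^ m) = degree (b * [:0,1:] ^ n)"
    using ab by (simp add: degree_mult_eq deg m_def n_def)
  have nz: "a * [:0,1:] ^ m \<noteq> 0" "b * [:0,1:] ^ n \<noteq> 0" using ab by auto
  have pnz: "(infpi::'a poly fract) \<noteq> 0" by (simp add: infpi_def Zero_fract_def eq_fract)
  have "x = infpi ^ m / infpi ^ n * e"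
    unfolding ab(1) e_def infpi_def Fract_power
    using ab nz by (simp add: divide_fract_def eq_fract mult_ac)
  also have "infpi ^ m / infpi ^ n = (infpi::'a poly fract) powi (int m - int n)"
    using pnz by (simp add: power_int_diff)
  finally have "x = infpi powi (int m - int n) * e" .
  moreover have "e \<in> infR" "inverse e \<in> infR" unfolding e_def using dg nz by (auto intro: infR_I)
  ultimately show "\<exists>n e. e \<in> infR \<and> inverse e \<in> infR \<and> x = infpi powi n * e" by blast
qed

lemma degree_tpoly: "degree (tpoly a) \<le> degree a"
  by (rule degree_le) (simp add: coeff_tpoly coeff_eq_0)

text \<open>Write \<open>a = q * b + r\<close> with a constant \<open>q\<close> and \<open>r\<close>
  of smaller degree than \<open>b\<close>. The constant contributes nothing to the derivative of
  \<open>a / b\<close>, so the numerator has degree below \<open>2 * degree b\<close>.\<close>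

lemma tder_infR:
  fixes x :: "'a::field poly fract"
  assumes "x \<in> infR"
  shows "tder x \<in> infR" and "place.vge infR infpi (tder x) 1"
proof -
  interpret place "infR :: 'a poly fract set" infpi by (rule place_inf)
  obtain a b where *: "x = Fract a b" "b \<noteq> 0" "degree a \<le> degree b" using assms by (auto simp: infR_def)
  define n where "n = degree b"
  define c where "c = tpoly a * b - a * tpoly b"
  have bb: "degree (b * b) = 2 * n" using * by (simp add: degree_mult_eq n_def)
  have cd: "degree c < 2 * n \<or> c = 0"
  proof (cases "n = 0")
    case True
    hence "degree a = 0" "degree b = 0" using * n_def by auto
    then obtain r s where "a = [:r:]" "b = [:s:]" by (metis degree_0_id degree_eq_zeroE)
    thus ?thesis by (simp add: c_def)
  next
    case False
    obtain q r where a: "a = smult q b + r" and r: "degree r < n"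
    proof (cases "degree a < n")
      case True thus ?thesis using that[of 0 a] by simp
    next
      case F: False
      define q where "q = coeff a n / coeff b n"
      have lb: "coeff b n \<noteq> 0" using * by (simp add: n_def)
      have "degree (a - smult q b) < n"
      proof (rule ccontr)
        assume "\<not> ?thesis"
        moreover have "degree (a - smult q b) \<le> n"
          using * by (intro degree_diff_le) (auto simp: n_def intro: order_trans[OF degree_smult_le])
        ultimately have "degree (a - smult q b) = n" by simp
        moreover have "coeff (a - smult q b) n = 0" using lb by (simp add: q_def)
        ultimately show False using False by (metis degree_0 leading_coeff_0_iff)
      qed
      thus ?thesis using that[of q "a - smult q b"] by simp
    qed
    have ts: "tpoly (smult q b) = smult q (tpoly b)" by (simp add: tpoly_def pderiv_smult)
    have c: "c = tpoly r * b - r * tpoly b"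
      unfolding c_def a by (simp add: tpoly_add ts algebra_simps)
    have "degree (tpoly r * b) \<le> degree r + n" "degree (r * tpoly b) \<le> degree r + n"
      using degree_mult_le[of "tpoly r" b] degree_mult_le[of r "tpoly b"]
        degree_tpoly[of r] degree_tpoly[of b] by (auto simp: n_def)
    hence "degree c \<le> degree r + n" unfolding c by (rule degree_diff_le)
    thus ?thesis using r by simp
  qed
  have t: "tder x = infpi * Fract ([:0,1:] * c) (b * b)"
    unfolding *(1) tder_Fract[OF *(2)] c_def[symmetric] infpi_def using * by (simp add: eq_fract)
  have "Fract ([:0,1:] * c) (b * b) \<in> infR"
  proof (rule infR_I)
    show "b * b \<noteq> 0" using * by simp
    show "degree ([:0,1:] * c) \<le> degree (b * b)"
      using cd unfolding bb by (cases "c = 0") (auto simp: degree_pCons_eq)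
  qed
  thus "vge (tder x) 1" unfolding vge_def t by auto
  thus "tder x \<in> infR" using vge_mono vge_0_iff by (metis zero_le_one)
qed

lemma const_infR: "const_fract k \<in> infR"
  unfolding const_fract_def by (rule infR_I) auto

lemma lplace_inf: "lplace infR infpi (\<lambda>x. const_fract k * tder x) (const_fract (- k))"
proof (intro lplace.intro lplace_axioms.intro dplace.intro place_inf derivation_tder dplace_axioms.intro)
  interpret place "infR :: 'a poly fract set" infpi by (rule place_inf)
  fix x :: "'a poly fract" assume x: "x \<in> infR"
  show "const_fract k * tder x \<in> infR" using R_mult const_infR tder_infR(1)[OF x] by blast
  show "vge (const_fract k * tder x) 1"
    using vge_mult[of "const_fract k" 0, OF _ tder_infR(2)[OF x]] const_infR[of k] by (simp add: vge_0_iff)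
next
  have "tder infpi = - (infpi :: 'a poly fract)"
    by (simp add: infpi_def tder_Fract eq_fract tpoly_def pderiv_pCons)
  thus "const_fract k * tder infpi = const_fract (- k) * infpi" by (simp add: const_fract_uminus)
  show "const_fract (- k) \<in> infR" by (rule const_infR)
qed

lemma fract_lowest:
  fixes x :: "'a::field poly fract"
  obtains a b where "x = Fract a b" "b \<noteq> 0" "\<And>\<alpha>. poly b \<alpha> = 0 \<Longrightarrow> poly a \<alpha> \<noteq> 0"
proof -
  let ?P = "\<lambda>b. b \<noteq> 0 \<and> (\<exists>a. x = Fract a b)"
  obtain a0 b0 where "x = Fract a0 b0" "b0 \<noteq> 0" by (cases x)
  hence "?P b0" by auto
  then obtain b where b: "?P b" and m: "\<And>c. ?P c \<Longrightarrow> degree b \<le> degree c"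
    using ex_has_least_nat[of ?P b0 degree] by blast
  then obtain a where a: "x = Fract a b" by blast
  have "poly a \<alpha> \<noteq> 0" if r: "poly b \<alpha> = 0" for \<alpha>
  proof
    assume "poly a \<alpha> = 0"
    then obtain a' where a': "a = [:-\<alpha>, 1:] * a'" using poly_eq_0_iff_dvd by blast
    obtain b' where b': "b = [:-\<alpha>, 1:] * b'" using r poly_eq_0_iff_dvd by blast
    have "b' \<noteq> 0" using b b' by auto
    moreover have "x = Fract a' b'" unfolding a a' b' using \<open>b' \<noteq> 0\<close>
      by (subst mult_fract_cancel) auto
    ultimately have "degree b \<le> degree b'" using m by blast
    moreover have "degree b = Suc (degree b')" unfolding b' using \<open>b' \<noteq> 0\<close>
      by (subst degree_mult_eq) auto
    ultimately show False by simp
  qed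
  thus ?thesis using that a b by blast
qed

lemma finR_lowest:
  assumes "b \<noteq> 0" "poly b \<alpha> = 0 \<Longrightarrow> poly a \<alpha> \<noteq> 0"
  shows "Fract a b \<in> finR \<alpha> \<longleftrightarrow> poly b \<alpha> \<noteq> 0"
proof
  assume "Fract a b \<in> finR \<alpha>"
  then obtain c d where cd: "Fract a b = Fract c d" "poly d \<alpha> \<noteq> 0" by (auto simp: finR_def)
  have "d \<noteq> 0" using cd by auto
  hence "a * d = c * b" using cd assms by (simp add: eq_fract)
  hence "poly a \<alpha> * poly d \<alpha> = poly c \<alpha> * poly b \<alpha>" by (metis poly_mult)
  thus "poly b \<alpha> \<noteq> 0" using assms cd by auto
qed (rule finR_I)

lemma regular_poly:
  fixes x :: "'a::alg_closed_field poly fract"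
  assumes "\<And>\<alpha>. x \<in> finR \<alpha>"
  obtains f where "x = Fract f 1"
proof -
  obtain a b where ab: "x = Fract a b" "b \<noteq> 0" "\<And>\<alpha>. poly b \<alpha> = 0 \<Longrightarrow> poly a \<alpha> \<noteq> 0"
    using fract_lowest by blast
  have "poly b \<alpha> \<noteq> 0" for \<alpha> using finR_lowest[OF ab(2,3)] assms ab(1) by blast
  hence "degree b = 0" using alg_closed_imp_poly_has_root[of b] by auto
  then obtain c where c: "b = [:c:]" "c \<noteq> 0" using ab(2) by (metis degree_eq_zeroE pCons_0_0)
  have "x = Fract (smult (inverse c) a) 1" using ab c by (simp add: eq_fract)
  thus ?thesis using that by blast
qed

lemma poly_infR: "Fract f 1 \<in> infR \<Longrightarrow> degree f = 0"
proof -
  assume "Fract f 1 \<in> infR"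
  then obtain a b where ab: "Fract f 1 = Fract a b" "b \<noteq> 0" "degree a \<le> degree b" by (auto simp: infR_def)
  hence "f * b = a" by (simp add: eq_fract)
  thus "degree f = 0" using ab by (cases "f = 0") (auto simp: degree_mult_eq)
qed

lemma regular_const:
  fixes x :: "'a::alg_closed_field poly fract"
  assumes "\<And>\<alpha>. x \<in> finR \<alpha>" "x \<in> infR"
  obtains c where "x = const_fract c"
proof -
  obtain f where f: "x = Fract f 1" using regular_poly assms by blast
  hence "degree f = 0" using poly_infR assms by blast
  thus ?thesis using that f by (metis const_fract_def degree_eq_zeroE)
qed

section \<open>Powers in characteristic p and the Hasse-Witt operator\<close>

lemma CHAR_poly_fract: "CHAR('a::field poly fract) = CHAR('a)"
proof (rule CHAR_eqI)
  show "of_nat CHAR('a) = (0 :: 'a poly fract)"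
    by (simp add: const_fract_of_nat[symmetric] del: const_fract_of_nat)
  show "CHAR('a) dvd n" if "of_nat n = (0 :: 'a poly fract)" for n
  proof -
    have "const_fract (of_nat n :: 'a) = 0" using that by simp
    hence "of_nat n = (0::'a)" unfolding const_fract_eq_0 .
    thus ?thesis using of_nat_eq_0_iff_char_dvd by blast
  qed
qed

lemma coeff_pth_power:
  fixes b :: "'a::field poly"
  assumes p: "prime p" "CHAR('a) = p"
  shows "coeff (b ^ p) j = (if p dvd j then coeff b (j div p) ^ p else 0)"
proof -
  have "b ^ p = (\<Sum>i\<le>degree b. monom (coeff b i) i) ^ p" by (simp add: poly_as_sum_of_monoms)
  also have "\<dots> = (\<Sum>i\<le>degree b. monom (coeff b i) i ^ p)"
    using p by (intro freshmans_dream_sum) auto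
  also have "\<dots> = (\<Sum>i\<le>degree b. monom (coeff b i ^ p) (i * p))" by (simp add: monom_power)
  finally have *: "coeff (b ^ p) j = (\<Sum>i\<le>degree b. if i * p = j then coeff b i ^ p else 0)"
    by (simp add: coeff_sum)
  have p0: "p > 0" using p prime_gt_0_nat by blast
  show ?thesis
  proof (cases "p dvd j")
    case True
    then obtain i where i: "j = i * p" by (metis dvdE mult.commute)
    have "coeff (b ^ p) j = (\<Sum>k\<le>degree b. if k = i then coeff b k ^ p else 0)"
      unfolding * unfolding i using p0 by (intro sum.cong) auto
    also have "\<dots> = coeff b i ^ p" using p0 by (simp add: sum.delta coeff_eq_0 power_0_left)
    finally show ?thesis using i p0 by simp
  next
    case False
    thus ?thesis unfolding * by (auto intro!: sum.neutral)
  qed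
qed

lemma poly_pth_root:
  fixes f :: "'a::alg_closed_field poly"
  assumes p: "prime p" "CHAR('a) = p" and f: "\<And>n. coeff f n \<noteq> 0 \<Longrightarrow> p dvd n"
  obtains g where "f = g ^ p"
proof -
  have p0: "p > 0" using p prime_gt_0_nat by blast
  define r where "r c = (SOME z :: 'a. z ^ p = c)" for c
  have r: "r c ^ p = c" for c
    unfolding r_def using nth_root_exists[OF p0, of c] by (rule someI_ex)
  define g where "g = (\<Sum>i\<le>degree f. monom (r (coeff f (i * p))) i)"
  have cg: "coeff g i = (if i \<le> degree f then r (coeff f (i * p)) else 0)" for i
    unfolding g_def by (simp add: coeff_sum)
  have "coeff f n = coeff (g ^ p) n" for n
  proof (cases "p dvd n")
    case True
    then obtain i where i: "n = i * p" by (metis dvdE mult.commute)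
    show ?thesis
    proof (cases "i \<le> degree f")
      case le: True
      thus ?thesis unfolding coeff_pth_power[OF p] i using p0 by (simp add: cg r)
    next
      case False
      have "i \<le> i * p" using p0 by simp
      hence "n > degree f" using False i by linarith
      thus ?thesis unfolding coeff_pth_power[OF p] i using p0 False
        by (simp add: cg coeff_eq_0 power_0_left)
    qed
  next
    case False
    thus ?thesis using f[of n] by (auto simp: coeff_pth_power[OF p])
  qed
  thus ?thesis using that poly_eqI by blast
qed

text \<open>Over a \<open>p\<close>-th power denominator the derivation acts on the numerator alone,
  so that questions about its kernel and its image become questions about coefficients of
  polynomials.\<close>

lemma pth_power_denominator:
  fixes x :: "'a::field poly fract"
  assumes "p > (0::nat)"
  obtains f b where "x = Fract f (b ^ p)" "b \<noteq> 0"
proof -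
  obtain a b where ab: "x = Fract a b" "b \<noteq> 0" by (cases x)
  have "x = Fract (a * b ^ (p - 1)) (b ^ p)"
    using ab assms by (cases p) (auto simp: eq_fract mult_ac)
  thus ?thesis using that ab by blast
qed

lemma tpoly_power_char:
  fixes b :: "'a::field poly"
  assumes p: "prime p" "CHAR('a) = p" shows "tpoly (b ^ p) = 0"
proof (rule poly_eqI)
  fix n
  show "coeff (tpoly (b ^ p)) n = coeff 0 n"
    using p(2) by (auto simp: coeff_tpoly coeff_pth_power[OF p] of_nat_eq_0_iff_char_dvd)
qed

lemma tder_pth_denominator:
  fixes f b :: "'a::field poly"
  assumes "prime p" "CHAR('a) = p" "b \<noteq> 0"
  shows "tder (Fract f (b ^ p)) = Fract (tpoly f) (b ^ p)"
  using assms by (simp add: tder_Fract tpoly_power_char eq_fract)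

lemma tder_eq_0:
  fixes x :: "'a::alg_closed_field poly fract"
  assumes p: "prime p" "CHAR('a) = p" and x: "tder x = 0"
  obtains y where "x = y ^ p"
proof -
  have p0: "p > 0" using p prime_gt_0_nat by blast
  obtain f b where fb: "x = Fract f (b ^ p)" "b \<noteq> 0" using pth_power_denominator[OF p0] by blast
  have "tpoly f = 0" using x fb tder_pth_denominator[OF p fb(2)]
    by (simp add: Zero_fract_def eq_fract)
  hence "of_nat n * coeff f n = 0" for n using coeff_tpoly[of f n] by simp
  hence "p dvd n" if "coeff f n \<noteq> 0" for n
    using that p(2) by (metis mult_eq_0_iff of_nat_eq_0_iff_char_dvd)
  then obtain g where "f = g ^ p" using poly_pth_root[OF p] by blast
  hence "x = Fract g b ^ p" using fb by (simp add: Fract_power)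
  thus ?thesis using that by blast
qed

text \<open>If the form \<open>H du/u\<close> is exact, its image under the Cartier operator is
  zero, even when the primitive has poles. After clearing the denominator \<open>b^p\<close>,
  suppose \<open>p * i\<close> is the lowest exponent divisible by \<open>p\<close> in
  \<open>H\<close>, and \<open>m\<close> the lowest exponent in \<open>b\<close>: the coefficient of
  \<open>b^p * H\<close> at \<open>p * (m + i)\<close> is then a single non-zero product, whereas
  exactness makes it zero.\<close>

lemma exact_coeff:
  fixes H :: "'a::field poly"
  assumes p: "prime p" "CHAR('a) = p" and H: "Fract H 1 = tder x"
  shows "coeff H (p * i) = 0"
proof (rule ccontr)
  have p0: "p > 0" using p prime_gt_0_nat by blast
  obtain f b where fb: "x = Fract f (b ^ p)" "b \<noteq> 0" using pth_power_denominator[OF p0] by blast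
  have e: "H * b ^ p = tpoly f"
    using H fb tder_pth_denominator[OF p fb(2)] by (simp add: eq_fract)
  assume "coeff H (p * i) \<noteq> 0"
  then obtain i where i: "coeff H (p * i) \<noteq> 0" and mi: "\<And>k. coeff H (p * k) \<noteq> 0 \<Longrightarrow> i \<le> k"
    using ex_has_least_nat[of "\<lambda>i. coeff H (p * i) \<noteq> 0" i "\<lambda>x. x"] by auto
  obtain m0 where "coeff b m0 \<noteq> 0" using fb(2) by (metis leading_coeff_0_iff)
  then obtain m where m: "coeff b m \<noteq> 0" and mm: "\<And>k. coeff b k \<noteq> 0 \<Longrightarrow> m \<le> k"
    using ex_has_least_nat[of "\<lambda>i. coeff b i \<noteq> 0" m0 "\<lambda>x. x"] by auto
  have "coeff (b ^ p * H) (p * (m + i)) = (\<Sum>j\<le>p * (m + i). coeff (b ^ p) j * coeff H (p * (m + i) - j))"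
    by (simp add: coeff_mult)
  also have "\<dots> = (\<Sum>j\<le>p * (m + i). if j = p * m then coeff b m ^ p * coeff H (p * i) else 0)"
  proof (rule sum.cong)
    fix j assume j: "j \<in> {..p * (m + i)}"
    show "coeff (b ^ p) j * coeff H (p * (m + i) - j) = (if j = p * m then coeff b m ^ p * coeff H (p * i) else 0)"
    proof (cases "p dvd j")
      case True
      then obtain k where k: "j = p * k" by (rule dvdE)
      have cb: "coeff (b ^ p) j = coeff b k ^ p" using p0 by (simp add: coeff_pth_power[OF p] k)
      show ?thesis
      proof (cases "k = m")
        case True
        have "p * (m + i) - j = p * i" using k True by (simp add: algebra_simps)
        thus ?thesis using True k cb by simp
      next
        case False
        have km: "k \<le> m + i" using j k p0 by simp
        have sub: "p * (m + i) - j = p * (m + i - k)" using k by (simp add: right_diff_distrib')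
        have "coeff b k = 0 \<or> coeff H (p * (m + i - k)) = 0"
        proof (rule ccontr)
          assume "\<not> ?thesis"
          hence "m \<le> k" "i \<le> m + i - k" using mm mi by auto
          thus False using False km by linarith
        qed
        hence "coeff (b ^ p) j * coeff H (p * (m + i) - j) = 0" unfolding cb sub using p0
          by (auto simp: power_0_left)
        thus ?thesis using False k p0 by simp
      qed
    next
      case False
      thus ?thesis by (auto simp: coeff_pth_power[OF p])
    qed
  qed simp
  also have "\<dots> = coeff b m ^ p * coeff H (p * i)" by (simp add: sum.delta)
  finally have "coeff (b ^ p * H) (p * (m + i)) \<noteq> 0" using m i by simp
  moreover have "coeff (b ^ p * H) (p * (m + i)) = 0"
  proof -
    have "b ^ p * H = tpoly f" using e by (simp add: mult.commute)
    moreover have "of_nat (p * (m + i)) = (0::'a)" using p(2) by (simp add: of_nat_eq_0_iff_char_dvd)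
    ultimately show ?thesis by (simp add: coeff_tpoly)
  qed
  ultimately show False by simp
qed

lemma coeff_pcompose_monom_mult:
  fixes A M :: "'a::field poly"
  assumes "degree A \<le> J"
  shows "coeff (pcompose A (monom 1 d) * M) n =
    (\<Sum>j\<le>J. if d * j \<le> n then coeff A j * coeff M (n - d * j) else 0)"
proof -
  have "A = (\<Sum>j\<le>J. monom (coeff A j) j)" using poly_as_sum_of_monoms'[OF assms] by simp
  hence "pcompose A (monom 1 d) = (\<Sum>j\<le>J. pcompose (monom (coeff A j) j) (monom 1 d))"
    by (metis pcompose_sum)
  also have "\<dots> = (\<Sum>j\<le>J. monom (coeff A j) (d * j))"
  proof (intro sum.cong refl)
    fix j
    have "pcompose (monom c j) (monom 1 d) = monom c (d * j)" for c :: 'a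
    proof (induction j)
      case 0 thus ?case by (simp add: monom_0)
    next
      case (Suc j)
      have "pcompose (monom c (Suc j)) (monom 1 d) = monom 1 d * pcompose (monom c j) (monom 1 d)"
        by (simp add: monom_Suc pcompose_pCons)
      thus ?case using Suc by (simp add: mult_monom)
    qed
    thus "pcompose (monom (coeff A j) j) (monom 1 d) = monom (coeff A j) (d * j)" .
  qed
  finally have "pcompose A (monom 1 d) * M = (\<Sum>j\<le>J. monom (coeff A j) (d * j) * M)"
    by (simp add: sum_distrib_right)
  thus ?thesis by (auto simp: coeff_sum coeff_monom_mult intro!: sum.cong)
qed

lemma coprime_digit:
  fixes d p e :: nat
  assumes "coprime d p" "p > 0"
  obtains j where "j < p" "p dvd e + d * j"
proof -
  let ?f = "\<lambda>j. (e + d * j) mod p"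
  have inj: "inj_on ?f {..<p}"
  proof (rule linorder_inj_onI)
    fix j k assume *: "j < k" "j \<in> {..<p}" "k \<in> {..<p}"
    show "?f j \<noteq> ?f k"
    proof
      assume "?f j = ?f k"
      moreover have "e + d * j \<le> e + d * k" using * by simp
      ultimately have "p dvd (e + d * k) - (e + d * j)" using mod_eq_dvd_iff_nat by metis
      moreover have "(e + d * k) - (e + d * j) = d * (k - j)" by (simp add: right_diff_distrib')
      ultimately have "p dvd k - j" using assms(1) by (metis coprime_commute coprime_dvd_mult_right_iff)
      thus False using * by (auto dest: dvd_imp_le)
    qed
  qed auto
  have "?f ` {..<p} \<subseteq> {..<p}" using assms by auto
  hence "?f ` {..<p} = {..<p}" using endo_inj_surj[OF _ _ inj] by simp
  hence "0 \<in> ?f ` {..<p}" using assms by simp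
  then obtain j where "j < p" "(e + d * j) mod p = 0" by auto
  thus ?thesis using that[of j] by (simp add: mod_eq_0_iff_dvd)
qed

text \<open>Since \<open>degree M \<le> d\<close>, the shifts of \<open>M\<close> by multiples of
  \<open>d\<close> overlap only at their ends. For each exponent \<open>e\<close> some
  \<open>j < p\<close> has \<open>e + d * j\<close> divisible by \<open>p\<close>, and the vanishing
  coefficient there is \<open>coeff A j * coeff M e\<close>.\<close>

lemma hasse_witt_1:
  fixes A M :: "'a::field poly"
  assumes p: "p > 0" "coprime d p" and A: "degree A \<le> p - 1" "\<And>j. j < p \<Longrightarrow> coeff A j \<noteq> 0"
    and M: "degree M \<le> d"
    and H: "\<And>i. coeff (pcompose A (monom 1 d) * M) (p * i) = 0"
  shows "M = 0"
proof (rule poly_eqI)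
  fix e
  show "coeff M e = coeff 0 e"
  proof (cases "e \<le> d")
    case False thus ?thesis using M by (simp add: coeff_eq_0)
  next
    case e: True
    \<comment> \<open>The end exponents 0 and \<open>d\<close> do meet in neighbouring shifts. The
      extreme digits \<open>j = 0\<close> for \<open>e = 0\<close> and \<open>j = p - 1\<close> for
      \<open>e = d\<close> avoid this, as no neighbour exists on the relevant side.\<close>
    obtain j where j: "j < p" "p dvd e + d * j" "e = 0 \<longrightarrow> j = 0" "e = d \<longrightarrow> e = 0 \<or> j = p - 1"
    proof -
      consider "e = 0" | "e = d" "e \<noteq> 0" | "e \<noteq> 0" "e \<noteq> d" by blast
      thus ?thesis
      proof cases
        case 1 thus ?thesis using that[of 0] p by simp
      next
        case 2
        have "e + d * (p - 1) = p * d" using 2 p by (cases p) auto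
        thus ?thesis using that[of "p - 1"] 2 p by simp
      next
        case 3 thus ?thesis using coprime_digit[OF p(2,1), of e] that by blast
      qed
    qed
    obtain i where i: "e + d * j = p * i" using j(2) by (rule dvdE)
    have "0 = coeff (pcompose A (monom 1 d) * M) (e + d * j)" using H[of i] i by simp
    also have "\<dots> = (\<Sum>k\<le>p - 1. if d * k \<le> e + d * j then coeff A k * coeff M (e + d * j - d * k) else 0)"
      by (rule coeff_pcompose_monom_mult[OF A(1)])
    also have "\<dots> = (\<Sum>k\<le>p - 1. if k = j then coeff A j * coeff M e else 0)"
    proof (rule sum.cong)
      fix k assume k: "k \<in> {..p - 1}"
      have "coeff M (e + d * j - d * k) = 0" if "d * k \<le> e + d * j" "k \<noteq> j"
      proof (cases "k < j")
        case True
        hence "d * k + d \<le> d * j" by (metis Suc_leI mult_Suc_right mult_le_mono2 add.commute)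
        moreover have "e \<noteq> 0" using True j(3) by auto
        ultimately show ?thesis using M by (intro coeff_eq_0) linarith
      next
        case False
        hence "j < k" using that by simp
        hence *: "d * j + d \<le> d * k" by (metis Suc_leI mult_Suc_right mult_le_mono2 add.commute)
        hence "e = d" using that e by linarith
        hence "e = 0" using j(4) \<open>j < k\<close> k by auto
        hence "j = 0" "d = 0" using j \<open>e = d\<close> by auto
        thus ?thesis using p by simp (use p(2) \<open>d = 0\<close> \<open>j < k\<close> k in auto)
      qed
      thus "(if d * k \<le> e + d * j then coeff A k * coeff M (e + d * j - d * k) else 0) =
        (if k = j then coeff A j * coeff M e else 0)" by auto
    qed simp
    also have "\<dots> = coeff A j * coeff M e" using j(1) by (simp add: sum.delta)
    finally show ?thesis using A(2)[OF j(1)] by simp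
  qed
qed

text \<open>Now two unknowns \<open>coeff M e\<close> and \<open>coeff M (e + d)\<close> belong to
  each \<open>e\<close> strictly between 0 and \<open>d\<close>. The digits \<open>j\<close> and
  \<open>j + p\<close> with \<open>p\<close> dividing \<open>e + d * j\<close> give two linear
  equations, whose determinant is the expression assumed to be non-zero.\<close>

lemma hasse_witt_2:
  fixes A M :: "'a::field poly"
  assumes p: "p > 1" "coprime d p" "d > 0" and A: "degree A \<le> 2 * p - 2"
    "coeff A 0 \<noteq> 0" "coeff A (p - 1) \<noteq> 0" "coeff A (2 * p - 2) \<noteq> 0"
    "\<And>j. 0 < j \<Longrightarrow> j < p \<Longrightarrow> coeff A j * coeff A (j + p - 1) \<noteq> coeff A (j - 1) * coeff A (j + p)"
    and M: "degree M \<le> 2 * d"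
    and H: "\<And>i. coeff (pcompose A (monom 1 d) * M) (p * i) = 0"
  shows "M = 0"
proof -
  define S where "S e = (\<Sum>j\<le>2 * p - 2. if d * j \<le> e then coeff A j * coeff M (e - d * j) else 0)" for e
  have S0: "S (p * i) = 0" for i
    using H[of i] coeff_pcompose_monom_mult[OF A(1), of d M "p * i"] by (simp add: S_def)
  have Mz: "coeff M k = 0" if "k > 2 * d" for k using that M by (simp add: coeff_eq_0)
  have Az: "coeff A k = 0" if "k > 2 * p - 2" for k using that A(1) by (simp add: coeff_eq_0)
  have Sform: "S (e + d * j) = coeff A j * coeff M e + (if j > 0 then coeff A (j - 1) * coeff M (e + d) else 0)
      + (if j > 1 \<and> e = 0 then coeff A (j - 2) * coeff M (2 * d) else 0)"
    if e: "e < d" for e j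
  proof -
    let ?g = "\<lambda>k. if k = j then coeff A j * coeff M e else if k + 1 = j then coeff A k * coeff M (e + d)
       else if k + 2 = j \<and> e = 0 then coeff A k * coeff M (2 * d) else 0"
    have "S (e + d * j) = (\<Sum>k\<le>2 * p - 2. ?g k)"
      unfolding S_def
    proof (rule sum.cong)
      fix k
      consider "k > j" | "k = j" | "k + 1 = j" | "k + 2 = j" | l where "j = k + 3 + l"
      proof -
        have "k > j \<or> k = j \<or> k + 1 = j \<or> k + 2 = j \<or> (\<exists>l. j = k + 3 + l)"
          by presburger
        thus ?thesis using that by blast
      qed
      thus "(if d * k \<le> e + d * j then coeff A k * coeff M (e + d * j - d * k) else 0) = ?g k"
      proof cases
        case 1
        hence "d * j + d \<le> d * k" by (metis Suc_leI mult_Suc_right mult_le_mono2 add.commute)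
        hence "\<not> d * k \<le> e + d * j" using e by linarith
        thus ?thesis using 1 by simp
      next
        case 3
        have "e + d * j - d * k = e + d" using 3[symmetric] by (simp add: algebra_simps)
        thus ?thesis using 3 by (auto simp: algebra_simps)
      next
        case 4
        have "e + d * j - d * k = e + 2 * d" using 4[symmetric] by (simp add: algebra_simps)
        thus ?thesis using 4 Mz[of "e + 2 * d"] by (cases "e = 0") auto
      next
        case 5
        have "e + d * j - d * k = e + 3 * d + d * l" using 5 by (simp add: algebra_simps)
        thus ?thesis using 5 Mz[of "e + 3 * d + d * l"] p(3) by simp
      qed auto
    qed simp
    also have "\<dots> = (\<Sum>k\<le>2 * p - 2. if k = j then coeff A k * coeff M e else 0)
       + (\<Sum>k\<le>2 * p - 2. if k + 1 = j then coeff A k * coeff M (e + d) else 0)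
       + (\<Sum>k\<le>2 * p - 2. if k + 2 = j \<and> e = 0 then coeff A k * coeff M (2 * d) else 0)"
      by (subst sum.distrib[symmetric])+ (rule sum.cong, auto)
    also have "(\<Sum>k\<le>2 * p - 2. if k = j then coeff A k * coeff M e else 0) = coeff A j * coeff M e"
      using Az[of j] by (simp add: sum.delta)
    also have "(\<Sum>k\<le>2 * p - 2. if k + 1 = j then coeff A k * coeff M (e + d) else 0)
       = (if j > 0 then coeff A (j - 1) * coeff M (e + d) else 0)"
    proof (cases j)
      case (Suc m)
      have "(\<Sum>k\<le>2 * p - 2. if k + 1 = j then coeff A k * coeff M (e + d) else 0)
        = (\<Sum>k\<le>2 * p - 2. if k = m then coeff A k * coeff M (e + d) else 0)" using Suc by (intro sum.cong) auto
      thus ?thesis using Suc Az[of m] by (simp add: sum.delta)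
    qed simp
    also have "(\<Sum>k\<le>2 * p - 2. if k + 2 = j \<and> e = 0 then coeff A k * coeff M (2 * d) else 0)
       = (if j > 1 \<and> e = 0 then coeff A (j - 2) * coeff M (2 * d) else 0)"
    proof (cases "j > 1 \<and> e = 0")
      case True
      then obtain m where m: "j = m + 2" by (metis Suc_leI add.commute le_Suc_ex one_add_one plus_1_eq_Suc)
      have "(\<Sum>k\<le>2 * p - 2. if k + 2 = j \<and> e = 0 then coeff A k * coeff M (2 * d) else 0)
        = (\<Sum>k\<le>2 * p - 2. if k = m then coeff A k * coeff M (2 * d) else 0)" using m True by (intro sum.cong) auto
      thus ?thesis using m True Az[of m] by (simp add: sum.delta)
    qed (auto intro!: sum.neutral)
    finally show ?thesis .
  qed
  \<comment> \<open>The three exponents 0, \<open>2 * d\<close> and \<open>d\<close> are treated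
    through the coefficients at 0, \<open>2 * d * p\<close> and \<open>d * p\<close>; in this order
    each equation contains only one coefficient not yet known to be zero.\<close>
  have M0: "coeff M 0 = 0" using S0[of 0] Sform[of 0 0] p A(2) by simp
  have M2: "coeff M (2 * d) = 0"
  proof -
    have e: "0 + d * (2 * p) = p * (2 * d)" by simp
    show ?thesis using S0[of "2 * d"] Sform[of 0 "2 * p"] p A(4) Az[of "2 * p"] Az[of "2 * p - 1"] M0
      unfolding e by simp
  qed
  have M1: "coeff M d = 0"
    using S0[of d] Sform[of 0 p] p A(3) M0 M2 by (simp add: mult.commute)
  have Me: "coeff M e = 0 \<and> coeff M (e + d) = 0" if e: "0 < e" "e < d" for e
  proof -
    obtain j where j: "j < p" "p dvd e + d * j" using coprime_digit[OF p(2), of e] p by auto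
    obtain i where i: "e + d * j = p * i" using j(2) by (rule dvdE)
    have i2: "e + d * (j + p) = p * (i + d)" using i by (simp add: algebra_simps)
    have e1: "coeff A j * coeff M e + (if j > 0 then coeff A (j - 1) * coeff M (e + d) else 0) = 0"
      using S0[of i] Sform[OF e(2), of j] e(1) unfolding i by simp
    have e2: "coeff A (j + p) * coeff M e + coeff A (j + p - 1) * coeff M (e + d) = 0"
      using S0[of "i + d"] Sform[OF e(2), of "j + p"] e(1) p(1) unfolding i2 by simp
    show ?thesis
    proof (cases "j = 0")
      case True thus ?thesis using e1 e2 A(2,3) by simp
    next
      case False
      let ?x = "coeff M e" and ?y = "coeff M (e + d)"
      let ?D = "coeff A j * coeff A (j + p - 1) - coeff A (j - 1) * coeff A (j + p)"
      have D: "?D \<noteq> 0" using A(5)[of j] False j by simp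
      have e1': "coeff A j * ?x + coeff A (j - 1) * ?y = 0" using e1 False by simp
      have "?D * ?x = coeff A (j + p - 1) * (coeff A j * ?x + coeff A (j - 1) * ?y)
         - coeff A (j - 1) * (coeff A (j + p) * ?x + coeff A (j + p - 1) * ?y)" by (simp add: algebra_simps)
      moreover have "?D * ?y = coeff A j * (coeff A (j + p) * ?x + coeff A (j + p - 1) * ?y)
         - coeff A (j + p) * (coeff A j * ?x + coeff A (j - 1) * ?y)" by (simp add: algebra_simps)
      ultimately have "?D * ?x = 0" "?D * ?y = 0" unfolding e1' e2 by simp_all
      thus ?thesis using D by (metis mult_eq_0_iff)
    qed
  qed
  show ?thesis
  proof (rule poly_eqI)
    fix k
    consider "k > 2 * d" | "k = 2 * d" | "k = d" | "k = 0" | "0 < k" "k < d" | e where "k = e + d" "0 < e" "e < d"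
    proof -
      have "k > 2 * d \<or> k = 2 * d \<or> k = d \<or> k = 0 \<or> (0 < k \<and> k < d) \<or> (\<exists>e. k = e + d \<and> 0 < e \<and> e < d)"
        by (metis add.commute add_diff_cancel_left' add_diff_inverse_nat gr0I less_diff_conv2 linorder_less_linear mult_2 nat_less_le zero_less_diff le_add2)
      thus ?thesis using that by blast
    qed
    thus "coeff M k = coeff 0 k" using Mz M0 M1 M2 Me by cases auto
  qed
qed

section \<open>Pole counts of rational functions\<close>

definition npole :: "'a::field \<Rightarrow> 'a poly fract \<Rightarrow> nat" where
  "npole \<alpha> x = (if x \<in> finR \<alpha> then 0 else nat (- (THE n. place.val (finR \<alpha>) (finpi \<alpha>) x n)))"

definition npole_inf :: "'a::field poly fract \<Rightarrow> nat" where
  "npole_inf x = (if x \<in> infR then 0 else nat (- (THE n. place.val infR infpi x n)))"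

text \<open>The number of poles with multiplicity, at finite places and at infinity: the degree of
  \<open>x\<close> as a map to the projective line, which is 0 exactly for constants. It takes the
  place of the height in the descent.\<close>

definition npoles :: "'a::field poly fract \<Rightarrow> nat" where
  "npoles x = (\<Sum>\<alpha> | x \<notin> finR \<alpha>. npole \<alpha> x) + npole_inf x"

lemma finite_poles: "finite {\<alpha>. x \<notin> finR \<alpha>}"
proof -
  obtain a b where ab: "x = Fract a b" "b \<noteq> 0" by (cases x)
  have "{\<alpha>. x \<notin> finR \<alpha>} \<subseteq> {\<alpha>. poly b \<alpha> = 0}" using finR_I[of b] ab by auto
  thus ?thesis using finite_subset poly_roots_finite[OF ab(2)] by blast
qed

lemma npole_val:
  assumes "place.val (finR \<alpha>) (finpi \<alpha>) x (- int n)" "n > 0"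
  shows "npole \<alpha> x = n" "x \<notin> finR \<alpha>"
proof -
  interpret place "finR \<alpha>" "finpi \<alpha>" by (rule place_fin)
  show nx: "x \<notin> finR \<alpha>" using val_vge_le[OF assms(1), of 0] assms(2) by (auto simp: vge_0_iff)
  have "(THE n. val x n) = - int n" using assms(1) val_unique by blast
  thus "npole \<alpha> x = n" using nx by (simp add: npole_def)
qed

lemma npole_inf_val:
  fixes x :: "'a::field poly fract"
  assumes "place.val infR infpi x (- int n)" "n > 0"
  shows "npole_inf x = n" "x \<notin> infR"
proof -
  interpret place "infR :: 'a poly fract set" infpi by (rule place_inf)
  show nx: "x \<notin> infR" using val_vge_le[OF assms(1), of 0] assms(2) by (auto simp: vge_0_iff)
  have "(THE n. val x n) = - int n" using assms(1) val_unique by blast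
  thus "npole_inf x = n" using nx by (simp add: npole_inf_def)
qed

lemma npoles_less:
  fixes x z :: "'a::field poly fract"
  assumes fin: "\<And>\<alpha>. z \<notin> finR \<alpha> \<Longrightarrow> \<exists>m n. 0 < m \<and> m < n \<and>
      place.val (finR \<alpha>) (finpi \<alpha>) z (- int m) \<and> place.val (finR \<alpha>) (finpi \<alpha>) x (- int n)"
    and inf: "z \<notin> infR \<Longrightarrow> \<exists>m n. 0 < m \<and> m < n \<and>
      place.val infR infpi z (- int m) \<and> place.val infR infpi x (- int n)"
    and pole: "(\<exists>\<alpha>. x \<notin> finR \<alpha>) \<or> x \<notin> infR"
  shows "npoles z < npoles x"
proof -
  let ?Z = "{\<alpha>. z \<notin> finR \<alpha>}" and ?X = "{\<alpha>. x \<notin> finR \<alpha>}"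
  have f: "\<alpha> \<in> ?X \<and> npole \<alpha> z < npole \<alpha> x" if "\<alpha> \<in> ?Z" for \<alpha>
    using fin[of \<alpha>] that npole_val by fastforce
  have pos: "npole \<alpha> x > 0" if nx: "x \<notin> finR \<alpha>" for \<alpha>
  proof -
    interpret place "finR \<alpha>" "finpi \<alpha>" by (rule place_fin)
    obtain n where n: "n < 0" "val x n" using nx not_vge_val[of x 0] by (auto simp: vge_0_iff)
    hence "val x (- int (nat (- n)))" "nat (- n) > 0" by auto
    thus ?thesis using npole_val by fastforce
  qed
  have posi: "npole_inf x > 0" if nx: "x \<notin> infR"
  proof -
    interpret place "infR :: 'a poly fract set" infpi by (rule place_inf)
    obtain n where n: "n < 0" "val x n" using nx not_vge_val[of x 0] by (auto simp: vge_0_iff)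
    hence "val x (- int (nat (- n)))" "nat (- n) > 0" by auto
    thus ?thesis using npole_inf_val by fastforce
  qed
  have ile: "npole_inf z \<le> npole_inf x" and ilt: "x \<notin> infR \<Longrightarrow> npole_inf z < npole_inf x"
  proof -
    have "npole_inf z \<le> npole_inf x \<and> (x \<notin> infR \<longrightarrow> npole_inf z < npole_inf x)"
    proof (cases "z \<in> infR")
      case True thus ?thesis using posi by (auto simp: npole_inf_def[of z])
    next
      case False
      then obtain m n where "0 < m" "m < n" "place.val infR infpi z (- int m)" "place.val infR infpi x (- int n)"
        using inf by blast
      thus ?thesis using npole_inf_val[of z m] npole_inf_val[of x n] by simp
    qed
    thus "npole_inf z \<le> npole_inf x" "x \<notin> infR \<Longrightarrow> npole_inf z < npole_inf x" by auto
  qed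
  have sub: "?Z \<subseteq> ?X" using f by blast
  have "(\<Sum>\<alpha>\<in>?X. npole \<alpha> z) = (\<Sum>\<alpha>\<in>?Z. npole \<alpha> z)"
    by (rule sum.mono_neutral_right[OF finite_poles sub]) (auto simp: npole_def)
  moreover have le: "(\<Sum>\<alpha>\<in>?X. npole \<alpha> z) \<le> (\<Sum>\<alpha>\<in>?X. npole \<alpha> x)"
  proof (rule sum_mono)
    fix \<alpha> show "npole \<alpha> z \<le> npole \<alpha> x"
      using f[of \<alpha>] by (cases "z \<in> finR \<alpha>") (auto simp: npole_def[of \<alpha> z])
  qed
  ultimately have le': "(\<Sum>\<alpha>\<in>?Z. npole \<alpha> z) \<le> (\<Sum>\<alpha>\<in>?X. npole \<alpha> x)" by simp
  show ?thesis
  proof (cases "x \<in> infR")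
    case False thus ?thesis unfolding npoles_def using le' ilt by simp
  next
    case True
    then obtain \<beta> where b: "\<beta> \<in> ?X" using pole by blast
    have "(\<Sum>\<alpha>\<in>?X. npole \<alpha> z) < (\<Sum>\<alpha>\<in>?X. npole \<alpha> x)"
    proof (rule sum_strict_mono_ex1[OF finite_poles])
      show "\<forall>\<alpha>\<in>?X. npole \<alpha> z \<le> npole \<alpha> x"
        using f by (metis le_eq_less_or_eq mem_Collect_eq npole_def zero_le)
      have "npole \<beta> z < npole \<beta> x"
        using f[of \<beta>] pos[of \<beta>] b by (cases "z \<in> finR \<beta>") (auto simp: npole_def[of \<beta> z])
      thus "\<exists>\<alpha>\<in>?X. npole \<alpha> z < npole \<alpha> x" using b by blast
    qed
    thus ?thesis unfolding npoles_def using ile \<open>(\<Sum>\<alpha>\<in>?X. npole \<alpha> z) = (\<Sum>\<alpha>\<in>?Z. npole \<alpha> z)\<close> by simp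
  qed
qed

section \<open>Points on the family and their lifts\<close>

abbreviation fvge :: "'a::field \<Rightarrow> 'a poly fract \<Rightarrow> int \<Rightarrow> bool" where
  "fvge \<alpha> \<equiv> place.vge (finR \<alpha>) (finpi \<alpha>)"
abbreviation fval :: "'a::field \<Rightarrow> 'a poly fract \<Rightarrow> int \<Rightarrow> bool" where
  "fval \<alpha> \<equiv> place.val (finR \<alpha>) (finpi \<alpha>)"
abbreviation ivge :: "'a::field poly fract \<Rightarrow> int \<Rightarrow> bool" where
  "ivge \<equiv> place.vge infR infpi"
abbreviation ival :: "'a::field poly fract \<Rightarrow> int \<Rightarrow> bool" where
  "ival \<equiv> place.val infR infpi"

lemma const_finR: "const_fract c \<in> finR \<alpha>"
  unfolding const_fract_def by (rule finR_I) simp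

lemma fval_const: "c \<noteq> 0 \<Longrightarrow> fval \<alpha> (const_fract c) 0"
proof -
  assume c: "c \<noteq> 0"
  interpret place "finR \<alpha>" "finpi \<alpha>" by (rule place_fin)
  show ?thesis unfolding val_def
    using c const_finR[of c] const_finR[of "inverse c"]
    by (intro exI[of _ "const_fract c"]) (simp add: const_fract_inverse[symmetric] const_fract_eq_0)
qed

lemma ival_const: "c \<noteq> 0 \<Longrightarrow> ival (const_fract c) 0"
proof -
  assume c: "c \<noteq> 0"
  interpret place "infR :: 'a poly fract set" infpi by (rule place_inf)
  show ?thesis unfolding val_def
    using c const_infR[of c] const_infR[of "inverse c"]
    by (intro exI[of _ "const_fract c"]) (simp add: const_fract_inverse[symmetric] const_fract_eq_0)
qed

lemma fvge_const_1: "fvge \<alpha> (const_fract c) 1 \<Longrightarrow> c = 0"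
  using fval_const[of c \<alpha>] place.val_vge_le[OF place_fin, of \<alpha> "const_fract c" 0 1] by auto

lemma fin_residue:
  assumes "fvge \<alpha> x 0"
  obtains c where "fvge \<alpha> (x - const_fract c) 1"
proof -
  interpret place "finR \<alpha>" "finpi \<alpha>" by (rule place_fin)
  have "x \<in> finR \<alpha>" using assms vge_0_iff by simp
  then obtain a b where x: "x = Fract a b" and b: "poly b \<alpha> \<noteq> 0"
    by (auto simp: finR_def)
  define c where "c = poly a \<alpha> / poly b \<alpha>"
  have bnz: "b \<noteq> 0" using b by auto
  have "poly (a - smult c b) \<alpha> = 0" using b by (simp add: c_def)
  then obtain e where e: "a - smult c b = [:-\<alpha>, 1:] * e" using poly_eq_0_iff_dvd by blast
  have "x - const_fract c = Fract (a - smult c b) b" unfolding x const_fract_def using bnz by simp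
  also have "\<dots> = finpi \<alpha> * Fract e b" unfolding e finpi_def by simp
  finally have "x - const_fract c = finpi \<alpha> powi 1 * Fract e b" by simp
  hence "fvge \<alpha> (x - const_fract c) 1" unfolding vge_def using finR_I[OF b] by blast
  thus ?thesis using that by blast
qed

lemma fvge_poly: "fvge \<alpha> (Fract f 1) 0"
  using place.vge_0_iff[OF place_fin] finR_I[of 1 \<alpha> f] by auto

lemma fvge_poly_root: "poly f \<alpha> = 0 \<Longrightarrow> fvge \<alpha> (Fract f 1) 1"
proof -
  interpret place "finR \<alpha>" "finpi \<alpha>" by (rule place_fin)
  assume "poly f \<alpha> = 0"
  then obtain e where e: "f = [:-\<alpha>, 1:] * e" using poly_eq_0_iff_dvd by blast
  have "Fract f 1 = finpi \<alpha> powi 1 * Fract e 1" unfolding e finpi_def by simp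
  thus ?thesis unfolding vge_def using finR_I[of 1 \<alpha> e] by auto
qed

lemma degree_le_of_inf:
  assumes "Fract f 1 = Fract s 1 * M" "M \<in> infR"
  shows "degree f \<le> degree s"
proof -
  obtain a b where M: "M = Fract a b" "b \<noteq> 0" "degree a \<le> degree b" using assms(2) by (auto simp: infR_def)
  have e: "f * b = s * a" using assms(1) M by (simp add: eq_fract)
  show ?thesis
  proof (cases "f = 0")
    case False
    hence "degree (f * b) = degree f + degree b" using M by (simp add: degree_mult_eq)
    moreover have "degree (s * a) \<le> degree s + degree a" by (rule degree_mult_le)
    ultimately show ?thesis using e M by simp
  qed simp
qed

text \<open>The zeros of \<open>s\<close> are the additive fibres; the two alternatives in
  \<open>addv\<close> are the Kodaira types III* and II*. Over \<open>u = 0\<close> the cubic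
  reduces to \<open>(x - x0)^2 (x + a2 + 2 x0)\<close>, a node because \<open>a2 + 3 x0\<close> is
  non-zero, and the residues of \<open>nu\<close> and \<open>g0\<close> are such that the right-hand
  sides of the system vanish there. At infinity only the reduction of \<open>c4\<close> is required
  to be non-zero, so that the fibre is smooth or nodal. The conditions \<open>kk^p = kk\<close>,
  \<open>x0^p = x0\<close> and \<open>a2^p = a2\<close> place these constants in the prime field,
  which decides the residue of \<open>w\<close> at the node.\<close>

locale odd_family =
  fixes p :: nat and kk a2 x0 :: "'c::alg_closed_field" and a4 a6 nu g0 :: "'c poly fract" and s :: "'c poly"
  assumes p: "prime p" "odd p" "CHAR('c) = p"
    and kk: "kk \<noteq> 0" "kk ^ p = kk"
    and ode: "ode (\<lambda>x. const_fract kk * tder x) (const_fract a2) a4 a6 nu g0"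
    and s: "s \<noteq> 0" "poly s 0 \<noteq> 0"
    and sep: "\<And>x y. ode.on (const_fract a2) a4 a6 x y \<Longrightarrow> y = 0 \<Longrightarrow> ode.F (const_fract a2) a4 x \<noteq> 0"
    and reg: "\<And>\<alpha>. poly s \<alpha> \<noteq> 0 \<Longrightarrow> fvge \<alpha> a4 0 \<and> fvge \<alpha> a6 0 \<and> fvge \<alpha> nu 0 \<and> fvge \<alpha> g0 0"
    and reg_inf: "ivge a4 0" "ivge a6 0" "ivge nu 0" "ivge g0 0"
    and nonsing: "\<And>\<alpha> x y. \<alpha> \<noteq> 0 \<Longrightarrow> poly s \<alpha> \<noteq> 0 \<Longrightarrow> ode.on (const_fract a2) a4 a6 x y \<Longrightarrow>
        fvge \<alpha> x 0 \<Longrightarrow> fval \<alpha> y 0 \<or> fval \<alpha> (ode.F (const_fract a2) a4 x) 0"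
    and addv: "\<And>\<alpha>. poly s \<alpha> = 0 \<Longrightarrow> fvge \<alpha> a4 (-1) \<and> fvge \<alpha> a6 (-1) \<and> fvge \<alpha> nu (-1) \<and> fvge \<alpha> g0 (-1) \<and>
        (fval \<alpha> a4 (-1) \<or> (fvge \<alpha> a4 0 \<and> fval \<alpha> a6 (-1)))"
    and node_inf: "ival (const_fract a2 ^ 2 - 3 * a4) 0"
    and x0: "x0 ^ p = x0" "a2 ^ p = a2" "a2 + 3 * x0 \<noteq> 0"
    and node_0: "fvge 0 (a4 - const_fract (- 3 * x0 ^ 2 - 2 * a2 * x0)) 1"
        "fvge 0 (a6 - const_fract (x0 ^ 2 * (a2 + 2 * x0))) 1"
        "fvge 0 (nu + const_fract x0) 1" "fvge 0 (g0 - const_fract (2 * x0 * (a2 + 2 * x0))) 1"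
begin

abbreviation D where "D \<equiv> \<lambda>x. const_fract kk * tder x"
abbreviation A2 where "A2 \<equiv> const_fract a2"

sublocale ode D A2 a4 a6 nu g0 by (rule ode)

lemma p0: "p > 0" "p > 2" "p \<noteq> 0"
proof -
  have "p \<ge> 2" "p \<noteq> 2" using p prime_ge_2_nat[of p] by auto
  thus "p > 0" "p > 2" "p \<noteq> 0" by auto
qed

lemma two: "(2::'c) \<noteq> 0"
proof
  assume "(2::'c) = 0"
  hence "of_nat 2 = (0::'c)" by simp
  hence "p dvd 2" using p(3) of_nat_eq_0_iff_char_dvd by blast
  thus False using p0 by (auto dest: dvd_imp_le)
qed

lemma two_place: "fval (\<alpha>::'c) 2 0" "ival (2 :: 'c poly fract) 0"
  using fval_const[OF two, of \<alpha>] ival_const[OF two] by simp_all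

lemma ode_fin: "ode_place (finR \<alpha>) (finpi \<alpha>) D A2 a4 a6 nu g0"
  by (intro ode_place.intro ode dplace_fin ode_place_axioms.intro two_place)

lemma ode_0: "ode_lplace (finR 0) (finpi 0) D A2 a4 a6 nu g0 (const_fract kk)"
  by (intro ode_lplace.intro ode_fin lplace_0)

lemma ode_inf: "ode_lplace infR infpi D A2 a4 a6 nu g0 (const_fract (- kk))"
proof (intro ode_lplace.intro ode_place.intro ode ode_place_axioms.intro two_place lplace_inf)
  show "dplace infR infpi D" using lplace_inf lplace_def by blast
qed

lemma A2_R: "fvge \<alpha> A2 0" "ivge A2 0"
  by (simp_all add: place.vge_0_iff[OF place_fin] place.vge_0_iff[OF place_inf] const_finR const_infR)

lemma frob: "(x + y :: 'c poly fract) ^ p = x ^ p + y ^ p"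
  using p CHAR_poly_fract[where 'a = 'c] by (intro freshmans_dream) auto

lemma nz: "on x y \<Longrightarrow> y = 0 \<Longrightarrow> F x \<noteq> 0"
  using sep by blast

lemma fin_pole:
  assumes "on x y" "\<not> fvge \<alpha> x 0"
  obtains n where "n \<ge> 1" "fval \<alpha> x (- 2 * n)" "fval \<alpha> y (- 3 * n)"
proof -
  interpret ode_place "finR \<alpha>" "finpi \<alpha>" D A2 a4 a6 nu g0 by (rule ode_fin)
  have "vge a4 (-1)" "vge a6 (-2)"
    using reg[of \<alpha>] addv[of \<alpha>] vge_mono[of a4 0 "-1"] vge_mono[of a6 _ "-2"] by fastforce+
  thus ?thesis using pole_val[OF assms(1) A2_R(1) _ _ assms(2)] that by blast
qed

lemma inf_pole:
  assumes "on x y" "\<not> ivge x 0"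
  obtains n where "n \<ge> 1" "ival x (- 2 * n)" "ival y (- 3 * n)"
proof -
  interpret ode_lplace infR infpi D A2 a4 a6 nu g0 "const_fract (- kk)" by (rule ode_inf)
  have "vge a4 (-1)" "vge a6 (-2)"
    using reg_inf vge_mono[of a4 0 "-1"] vge_mono[of a6 0 "-2"] by fastforce+
  thus ?thesis using pole_val[OF assms(1) A2_R(2) _ _ assms(2)] that by blast
qed

text \<open>Where \<open>y\<close> and \<open>F x\<close> both vanish, the residue of
  \<open>x\<close> is a double root of the reduced cubic. Were it the other root
  \<open>- a2 - 2 x0\<close>, the vanishing of \<open>F\<close> would force
  \<open>a2 + 3 x0 = 0\<close>; so it is \<open>x0\<close>.\<close>

lemma unit_at_node:
  assumes "fvge 0 x 0" "fvge 0 y 1" "on x y" "fvge 0 (F x) 1"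
  shows "fval 0 (A2 + 3 * x) 0" "fvge 0 (x - const_fract x0) 1"
proof -
  interpret ode_lplace "finR 0" "finpi 0" D A2 a4 a6 nu g0 "const_fract kk" by (rule ode_0)
  obtain xc where xc: "vge (x - const_fract xc) 1" using fin_residue assms(1) by blast
  have cR: "vge (const_fract c) 0" for c using const_finR by (simp add: vge_0_iff)
  let ?c = const_fract
  have dvd: "vge (z * w) 1" if "vge z 1" "vge w 0" for z w using vge_mult[OF that] by simp
  have yy: "vge (y ^ 2) 1" using vge_power[OF assms(2), of 2] vge_mono by fastforce
  define fx where "fx = (xc - x0) ^ 2 * (xc + a2 + 2 * x0)"
  define Fx where "Fx = 3 * xc ^ 2 + 2 * a2 * xc + (- 3 * x0 ^ 2 - 2 * a2 * x0)"
  have x2: "vge (x ^ 2 - ?c xc ^ 2) 1"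
  proof -
    have "x ^ 2 - ?c xc ^ 2 = (x - ?c xc) * (x + ?c xc)" by (simp add: algebra_simps power2_eq_square)
    thus ?thesis using dvd[OF xc vge_add[OF assms(1) cR]] by simp
  qed
  have x3: "vge (x ^ 3 - ?c xc ^ 3) 1"
  proof -
    have "x ^ 3 - ?c xc ^ 3 = (x - ?c xc) * (x ^ 2 + x * ?c xc + ?c xc ^ 2)"
      by (simp add: algebra_simps power2_eq_square power3_eq_cube)
    moreover have "vge (x ^ 2 + x * ?c xc + ?c xc ^ 2) 0"
      using vge_add[OF vge_add] vge_power[OF assms(1), of 2] vge_mult[OF assms(1) cR, of xc] vge_power[OF cR[of xc], of 2] by fastforce
    ultimately show ?thesis using dvd[OF xc] by simp
  qed
  have a4x: "vge (a4 * x - ?c ((- 3 * x0 ^ 2 - 2 * a2 * x0) * xc)) 1"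
  proof -
    have "a4 * x - ?c ((- 3 * x0 ^ 2 - 2 * a2 * x0) * xc)
      = (a4 - ?c (- 3 * x0 ^ 2 - 2 * a2 * x0)) * x + (x - ?c xc) * ?c (- 3 * x0 ^ 2 - 2 * a2 * x0)"
      unfolding const_fract_mult by (simp only: algebra_simps)
    thus ?thesis using vge_add[OF dvd[OF node_0(1) assms(1)] dvd[OF xc cR]] by simp
  qed
  have "vge (y ^ 2 - ?c fx) 1"
  proof -
    have "y ^ 2 - ?c fx = (x ^ 3 - ?c xc ^ 3) + A2 * (x ^ 2 - ?c xc ^ 2)
       + (a4 * x - ?c ((- 3 * x0 ^ 2 - 2 * a2 * x0) * xc)) + (a6 - ?c (x0 ^ 2 * (a2 + 2 * x0)))
       + ?c (xc ^ 3 + a2 * xc ^ 2 + (- 3 * x0 ^ 2 - 2 * a2 * x0) * xc + x0 ^ 2 * (a2 + 2 * x0) - fx)"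
      using assms(3) unfolding on_def
      by (simp only: const_fract_add const_fract_diff const_fract_mult const_fract_power) (simp add: algebra_simps)
    also have "xc ^ 3 + a2 * xc ^ 2 + (- 3 * x0 ^ 2 - 2 * a2 * x0) * xc + x0 ^ 2 * (a2 + 2 * x0) - fx = 0"
      unfolding fx_def by (simp add: algebra_simps power2_eq_square power3_eq_cube)
    finally show ?thesis
      using vge_add[OF vge_add[OF vge_add[OF x3 dvd[OF x2 A2_R(1)]] a4x] node_0(2)]
      by (simp add: mult.commute)
  qed
  hence "vge (y ^ 2 - (y ^ 2 - ?c fx)) 1" using yy vge_diff by blast
  hence fx0: "fx = 0" using fvge_const_1 by simp
  have "vge (F x - ?c Fx) 1"
  proof -
    have "F x - ?c Fx = 3 * (x ^ 2 - ?c xc ^ 2) + 2 * A2 * (x - ?c xc) + (a4 - ?c (- 3 * x0 ^ 2 - 2 * a2 * x0))"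
      unfolding F_def Fx_def
      by (simp only: const_fract_add const_fract_diff const_fract_mult const_fract_power const_fract_numeral)
         (simp add: algebra_simps)
    moreover have "vge (3 * (x ^ 2 - ?c xc ^ 2)) 1" using vge_coeff_mult[OF x2] .
    moreover have "vge (2 * A2 * (x - ?c xc)) 1"
      using dvd[OF xc vge_coeff_mult[OF A2_R(1)]] by (simp add: mult.commute)
    ultimately show ?thesis using vge_add node_0(1) by simp
  qed
  hence "vge (F x - (F x - ?c Fx)) 1" using assms(4) vge_diff by blast
  hence Fx0: "Fx = 0" using fvge_const_1 by simp
  have "xc = x0"
  proof (rule ccontr)
    assume "xc \<noteq> x0"
    hence e1: "xc + a2 + 2 * x0 = 0" using fx0 by (simp add: fx_def)
    have "Fx = (xc - x0) * (3 * xc + 3 * x0 + 2 * a2)"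
      by (simp add: Fx_def algebra_simps power2_eq_square)
    hence "3 * xc + 3 * x0 + 2 * a2 = 0" using Fx0 \<open>xc \<noteq> x0\<close> by simp
    moreover have "a2 + 3 * x0 = 3 * (xc + a2 + 2 * x0) - (3 * xc + 3 * x0 + 2 * a2)" by (simp add: algebra_simps)
    ultimately have "a2 + 3 * x0 = 0" using e1 by (simp only: mult_zero_right diff_self)
    thus False using x0(3) by simp
  qed
  thus r: "vge (x - ?c x0) 1" using xc by simp
  have "A2 + 3 * x = ?c (a2 + 3 * x0) + 3 * (x - ?c x0)"
    by (simp add: const_fract_add const_fract_mult algebra_simps)
  moreover have "val (?c (a2 + 3 * x0) + 3 * (x - ?c x0)) 0"
    by (rule val_add[OF fval_const[OF x0(3)]]) (use vge_coeff_mult[OF r] in simp)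
  ultimately show "val (A2 + 3 * x) 0" by metis
qed

text \<open>The identity \<open>(a2 + 3 x)^2 = (a2^2 - 3 a4) + 3 F(x)\<close> gives the unit from
  \<open>c4\<close> alone, without locating the node.\<close>

lemma unit_inf:
  assumes "ivge x 0" "ivge (F x) 1"
  shows "ival (A2 + 3 * x) 0"
proof -
  interpret ode_lplace infR infpi D A2 a4 a6 nu g0 "const_fract (- kk)" by (rule ode_inf)
  have u: "vge (A2 + 3 * x) 0" using vge_add[OF A2_R(2) vge_coeff_mult[OF assms(1)]] .
  have "(A2 + 3 * x) ^ 2 = (A2 ^ 2 - 3 * a4) + 3 * F x"
    by (simp add: F_def algebra_simps power2_eq_square)
  moreover have "val ((A2 ^ 2 - 3 * a4) + 3 * F x) 0"
    by (rule val_add[OF node_inf]) (use vge_coeff_mult[OF assms(2)] in simp)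
  ultimately have v: "val ((A2 + 3 * x) ^ 2) 0" by simp
  show ?thesis using unit_or_vge[OF u]
  proof
    assume "vge (A2 + 3 * x) (0 + 1)"
    hence "vge ((A2 + 3 * x) ^ 2) 2" using vge_power[of _ 1 2] by fastforce
    thus ?thesis using val_vge_le[OF v] by fastforce
  qed
qed

lemma fin_local:
  assumes on: "on x y"
  shows "(fvge \<alpha> x 0 \<and> fvge \<alpha> y 0 \<and> fvge \<alpha> (wP x y) 0) \<or>
    (\<exists>n\<ge>1. fval \<alpha> x (- 2 * n) \<and> fval \<alpha> y (- 3 * n) \<and> fvge \<alpha> (rho x y) 0)"
    and "fvge \<alpha> (MP x y) (if poly s \<alpha> = 0 then -1 else 0)"
proof -
  interpret ode_place "finR \<alpha>" "finpi \<alpha>" D A2 a4 a6 nu g0 by (rule ode_fin)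
  define e :: int where "e = (if poly s \<alpha> = 0 then 1 else 0)"
  have e: "e \<le> 1" "0 \<le> e" "vge a4 (-e)" "vge a6 (-e)" "vge nu (-e)" "vge g0 (-e)"
    using reg[of \<alpha>] addv[of \<alpha>] by (auto simp: e_def)
  have "((vge x 0 \<and> vge y 0 \<and> vge (wP x y) 0) \<or>
    (\<exists>n\<ge>1. val x (- 2 * n) \<and> val y (- 3 * n) \<and> vge (rho x y) 0)) \<and> vge (MP x y) (- e)"
  proof (cases "vge x 0")
    case False
    obtain n where n: "n \<ge> 1" "val x (- 2 * n)" "val y (- 3 * n)" using fin_pole[OF on False] by blast
    have "min 0 (- e) = - e" using e by simp
    thus ?thesis using pole_rho[OF on n e(1,3-6)] n by auto
  next
    case x: True
    show ?thesis
    proof (cases "poly s \<alpha> = 0")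
      case True
      have e1: "e = 1" using True by (simp add: e_def)
      have t: "val a4 (-1) \<or> (vge a4 0 \<and> val a6 (-1))" using addv[OF True] by blast
      show ?thesis using regular_additive[OF on x nz[OF on] A2_R(1) _ _ t] e x unfolding e1 by simp
    next
      case ns: False
      have c: "vge a4 0" "vge a6 0" "vge nu 0" "vge g0 0" using reg[OF ns] by auto
      have e0: "e = 0" using ns by (simp add: e_def)
      show ?thesis
      proof (cases "val y 0 \<or> val (F x) 0")
        case True
        show ?thesis using regular_nonsingular[OF on x A2_R(1) c True] x e0 by simp
      next
        case False
        \<comment> \<open>A point can meet the singular locus outside the additive fibres only over
          \<open>u = 0\<close>, where the derivation is logarithmic.\<close>
        hence a0: "\<alpha> = 0" using nonsing[OF _ ns on x] by blast
        have y: "vge y 0"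
          by (rule y_regular[OF on x vge_cubic[of x 0]]) (use x c A2_R in auto)
        have y1: "vge y 1" "vge (F x) 1"
          using unit_or_vge[OF y] unit_or_vge[OF vge_F[OF x A2_R(1) c(1)]] False by auto
        interpret l: ode_lplace "finR 0" "finpi 0" D A2 a4 a6 nu g0 "const_fract kk" by (rule ode_0)
        have w: "vge (wP x y) 0"
          using l.singular_regular[OF on _ nz[OF on] A2_R(1) _ unit_at_node(1)[OF _ _ on]] x c y1 unfolding a0 by blast
        show ?thesis using regular_M[OF x y w, of 0] c x y w e0 by simp
      qed
    qed
  qed
  thus "(vge x 0 \<and> vge y 0 \<and> vge (wP x y) 0) \<or>
    (\<exists>n\<ge>1. val x (- 2 * n) \<and> val y (- 3 * n) \<and> vge (rho x y) 0)"
    "vge (MP x y) (if poly s \<alpha> = 0 then -1 else 0)" by (auto simp: e_def)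
qed

lemma inf_local:
  assumes on: "on x y"
  shows "(ivge x 0 \<and> ivge y 0 \<and> ivge (wP x y) 0) \<or>
    (\<exists>n\<ge>1. ival x (- 2 * n) \<and> ival y (- 3 * n) \<and> ivge (rho x y) 0)"
    and "ivge (MP x y) 0"
proof -
  interpret ode_lplace infR infpi D A2 a4 a6 nu g0 "const_fract (- kk)" by (rule ode_inf)
  have "((vge x 0 \<and> vge y 0 \<and> vge (wP x y) 0) \<or>
    (\<exists>n\<ge>1. val x (- 2 * n) \<and> val y (- 3 * n) \<and> vge (rho x y) 0)) \<and> vge (MP x y) 0"
  proof (cases "vge x 0")
    case False
    obtain n where n: "n \<ge> 1" "val x (- 2 * n)" "val y (- 3 * n)" using inf_pole[OF on False] by blast
    thus ?thesis using pole_rho[OF on n, of 0] reg_inf by auto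
  next
    case x: True
    show ?thesis
    proof (cases "val y 0 \<or> val (F x) 0")
      case True
      show ?thesis using regular_nonsingular[OF on x A2_R(2) reg_inf True] x by simp
    next
      case False
      have y: "vge y 0"
        by (rule y_regular[OF on x vge_cubic[of x 0]]) (use x reg_inf A2_R in auto)
      have y1: "vge y 1" "vge (F x) 1"
        using unit_or_vge[OF y] unit_or_vge[OF vge_F[OF x A2_R(2) reg_inf(1)]] False by auto
      have w: "vge (wP x y) 0"
        using singular_regular[OF on x nz[OF on] A2_R(2) reg_inf(3) unit_inf[OF x y1(2)] y1(1)] .
      show ?thesis using regular_M[OF x y w, of 0] reg_inf x y w by simp
    qed
  qed
  thus "(vge x 0 \<and> vge y 0 \<and> vge (wP x y) 0) \<or>
    (\<exists>n\<ge>1. val x (- 2 * n) \<and> val y (- 3 * n) \<and> vge (rho x y) 0)" "vge (MP x y) 0" by auto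
qed

lemma M_poly:
  assumes "on x y"
  obtains Mm where "Fract s 1 * MP x y = Fract Mm 1" "degree Mm \<le> degree s"
proof -
  have "Fract s 1 * MP x y \<in> finR \<alpha>" for \<alpha>
  proof -
    interpret place "finR \<alpha>" "finpi \<alpha>" by (rule place_fin)
    have "vge (Fract s 1 * MP x y) 0"
    proof (cases "poly s \<alpha> = 0")
      case True
      thus ?thesis using vge_mult[OF fvge_poly_root[OF True] fin_local(2)[OF assms, of \<alpha>]] by simp
    next
      case False
      thus ?thesis using vge_mult[OF fvge_poly fin_local(2)[OF assms, of \<alpha>]] by simp
    qed
    thus ?thesis by (simp add: vge_0_iff)
  qed
  then obtain Mm where Mm: "Fract s 1 * MP x y = Fract Mm 1" using regular_poly by blast
  have "MP x y \<in> infR" using inf_local(2)[OF assms] place.vge_0_iff[OF place_inf] by blast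
  hence "degree Mm \<le> degree s" using degree_le_of_inf Mm by metis
  thus ?thesis using that Mm by blast
qed

end

text \<open>\<open>Mx\<close> and \<open>Lx\<close> are the outer parts of
  \<open>f^((p-1)/2)\<close>, cut at the coefficient \<open>A\<close> of \<open>x^(p-1)\<close>;
  \<open>Lx\<close> has degree at most \<open>p - 2\<close> in \<open>x\<close>, hence its bounds.
  The pole order \<open>p - 1\<close> over additive fibres stays below \<open>p\<close>, as needed
  for taking \<open>p\<close>-th roots. \<open>Ac\<close> and \<open>Mc\<close> are the reductions
  over \<open>u = 0\<close>, and \<open>node_AS\<close> is the Artin-Schreier equation on the nodal
  cubic, parametrised by the slope \<open>l\<close> through the node:
  \<open>x - x0 = l^2 - (a2 + 3 x0)\<close> and \<open>y = l (x - x0)\<close>.\<close>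

locale hasse_family = odd_family p kk a2 x0 a4 a6 nu g0 s
  for p :: nat and kk a2 x0 :: "'c::alg_closed_field" and a4 a6 nu g0 :: "'c poly fract" and s :: "'c poly" +
  fixes A :: "'c poly fract" and Mx Lx :: "'c poly fract \<Rightarrow> 'c poly fract" and Am :: "'c poly"
    and Ac :: 'c and Mc :: "'c \<Rightarrow> 'c"
  assumes artin_schreier: "\<And>x y. ode.on (const_fract a2) a4 a6 x y \<Longrightarrow>
      const_fract kk * tder A * wP x y + const_fract kk * tder (y * Mx x)
        = - A * (x * wP x y - y + nu * wP x y)"
    and frob_f: "\<And>x. (x ^ 3 + const_fract a2 * x ^ 2 + a4 * x + a6) ^ ((p - 1) div 2)
        = x ^ p * Mx x + A * x ^ (p - 1) + Lx x"
    and Am: "Fract Am 1 = Fract s 1 ^ (p - 1) * A"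
    and inj: "\<And>M. degree M \<le> degree s \<Longrightarrow> (\<And>i. coeff (Am * M) (p * i) = 0) \<Longrightarrow> M = 0"
    and A_reg: "\<And>\<alpha>. poly s \<alpha> \<noteq> 0 \<Longrightarrow> fvge \<alpha> A 0" "ivge A 0"
    and A_add: "\<And>\<alpha>. poly s \<alpha> = 0 \<Longrightarrow> fvge \<alpha> A (- int (p - 1))"
    and M_reg: "\<And>\<alpha> x. poly s \<alpha> \<noteq> 0 \<Longrightarrow> fvge \<alpha> x 0 \<Longrightarrow> fvge \<alpha> (Mx x) 0"
        "\<And>x. ivge x 0 \<Longrightarrow> ivge (Mx x) 0"
    and M_add: "\<And>\<alpha> x. poly s \<alpha> = 0 \<Longrightarrow> fvge \<alpha> x 0 \<Longrightarrow> fvge \<alpha> (Mx x) (- int (p - 1))"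
    and L_reg: "\<And>\<alpha> x m. poly s \<alpha> \<noteq> 0 \<Longrightarrow> m \<ge> 0 \<Longrightarrow> fvge \<alpha> x (- m) \<Longrightarrow> fvge \<alpha> (Lx x) (- m * int (p - 2))"
        "\<And>x m. m \<ge> 0 \<Longrightarrow> ivge x (- m) \<Longrightarrow> ivge (Lx x) (- m * int (p - 2))"
    and L_add: "\<And>\<alpha> x m. poly s \<alpha> = 0 \<Longrightarrow> m \<ge> 0 \<Longrightarrow> fvge \<alpha> x (- m) \<Longrightarrow> fvge \<alpha> (Lx x) (- m * int (p - 2) - int (p - 1))"
    and Ac: "fvge 0 (A - const_fract Ac) 1" "Ac * (4 * (a2 + 3 * x0)) ^ ((p - 1) div 2) = 1"
    and Mc: "\<And>x c. fvge 0 (x - const_fract c) 1 \<Longrightarrow> fvge 0 (Mx x - const_fract (Mc c)) 1"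
    and node_AS: "\<And>l. l ^ p = Ac * l + l * (l ^ 2 - (a2 + 3 * x0)) * Mc (l ^ 2 - (a2 + 2 * x0))"
begin

definition delta where "delta x y = wP x y ^ p - A * wP x y - y * Mx x"

lemma D_pth: "D (x ^ p) = 0"
proof -
  have "of_nat p = (0 :: 'c poly fract)"
    using p(3) CHAR_poly_fract[where 'a = 'c] of_nat_CHAR by metis
  thus ?thesis unfolding D_power by simp
qed

lemma D_delta:
  assumes "on x y" shows "D (delta x y) = A * MP x y"
proof -
  have "D (delta x y) = - (D A * wP x y + A * D (wP x y)) - D (y * Mx x)"
    unfolding delta_def by (simp only: D_diff D_pth D_mult) simp
  also have "\<dots> = A * (x * wP x y - y + nu * wP x y) - A * D (wP x y)"
    using artin_schreier[OF assms] by (simp add: algebra_simps)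
  also have "\<dots> = A * MP x y" unfolding MP_def by (simp add: algebra_simps)
  finally show ?thesis .
qed

lemma M_zero:
  assumes "on x y" shows "MP x y = 0"
proof -
  obtain Mm where Mm: "Fract s 1 * MP x y = Fract Mm 1" "degree Mm \<le> degree s"
    using M_poly[OF assms] by blast
  define S where "S = Fract s 1"
  have Sp: "S * S ^ (p - 1) = S ^ p" using p0 by (cases p) auto
  \<comment> \<open>Of the factor \<open>S^p\<close>, the part \<open>S^(p-1)\<close> clears the
    poles of \<open>A\<close> and one \<open>S\<close> those of \<open>MP\<close>. Being a
    \<open>p\<close>-th power, it can be moved under the derivation.\<close>
  have "Fract (Am * Mm) 1 = Fract Am 1 * Fract Mm 1" by simp
  also have "\<dots> = (S ^ (p - 1) * A) * (S * MP x y)" by (simp only: Am Mm(1)[symmetric] S_def)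
  also have "\<dots> = S ^ p * (A * MP x y)" unfolding Sp[symmetric] by (simp only: mult_ac)
  also have "\<dots> = D (S ^ p * delta x y)" unfolding D_mult D_pth D_delta[OF assms] by simp
  also have "\<dots> = tder (const_fract kk * (S ^ p * delta x y))" by (simp add: tder_mult)
  finally have "coeff (Am * Mm) (p * i) = 0" for i using exact_coeff[OF p(1,3)] by blast
  hence "Mm = 0" using inj Mm(2) by blast
  hence "Fract s 1 * MP x y = 0" using Mm(1) by (simp add: fract_collapse)
  moreover have "Fract s 1 \<noteq> 0" using s(1) by (simp add: Zero_fract_def eq_fract)
  ultimately show ?thesis by simp
qed

text \<open>From \<open>y^p = y * f^((p-1)/2)\<close> and the decomposition of that power,
  \<open>y * Mx x\<close> equals \<open>(y/x)^p - A (y/x) - y Lx/x^p\<close>. Subtracting it from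
  \<open>w^p - A w\<close> leaves the same additive expression in \<open>rho\<close>, which is
  regular.\<close>

lemma delta_pole:
  assumes "on x y" "x \<noteq> 0"
  shows "delta x y = rho x y ^ p - A * rho x y + y * Lx x / x ^ p"
proof -
  have w: "wP x y = y / x + rho x y" by (simp add: rho_def)
  have pp: "p = 1 + 2 * ((p - 1) div 2)" using p(2) by presburger
  have "y ^ p = y * (y ^ 2) ^ ((p - 1) div 2)"
    by (subst pp) (simp only: power_add power_mult power_one_right)
  also have "\<dots> = y * (x ^ p * Mx x + A * x ^ (p - 1) + Lx x)"
    using assms(1) frob_f[of x] by (simp add: on_def)
  finally have yp: "(y / x) ^ p = y * Mx x + A * (y / x) + y * Lx x / x ^ p"
  proof -
    assume e: "y ^ p = y * (x ^ p * Mx x + A * x ^ (p - 1) + Lx x)"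
    have xp: "x ^ p = x * x ^ (p - 1)" using p0 by (cases p) auto
    have "(y / x) ^ p = y * (x ^ p * Mx x + A * x ^ (p - 1) + Lx x) / x ^ p"
      by (simp only: power_divide e)
    also have "\<dots> = y * Mx x + y * (A * x ^ (p - 1)) / x ^ p + y * Lx x / x ^ p"
      using assms(2) by (simp add: distrib_left add_divide_distrib)
    also have "y * (A * x ^ (p - 1)) / x ^ p = A * (y / x)"
      unfolding xp using assms(2) by simp
    finally show ?thesis .
  qed
  have "wP x y ^ p = (y / x) ^ p + rho x y ^ p" unfolding w by (rule frob)
  thus ?thesis unfolding delta_def yp w by (simp add: algebra_simps)
qed

text \<open>The bound \<open>b\<close> is \<open>p - 1\<close> over additive fibres and 0 elsewhere.
  At a pole of \<open>x\<close> of order \<open>2 * n\<close> the last term of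
  \<open>delta_pole\<close> has order at least \<open>n - b\<close>, so only the poles of
  \<open>A\<close> and of the coefficients remain.\<close>

lemma delta_local:
  fixes Rr :: "'c poly fract set" and pp :: "'c poly fract"
  assumes P: "place Rr pp" and on: "on x y" and b: "b \<ge> 0"
    and A: "place.vge Rr pp A (- b)"
    and M: "place.vge Rr pp x 0 \<Longrightarrow> place.vge Rr pp (Mx x) (- b)"
    and L: "\<And>m. m \<ge> 0 \<Longrightarrow> place.vge Rr pp x (- m) \<Longrightarrow> place.vge Rr pp (Lx x) (- m * int (p - 2) - b)"
    and loc: "(place.vge Rr pp x 0 \<and> place.vge Rr pp y 0 \<and> place.vge Rr pp (wP x y) 0) \<or>
      (\<exists>n\<ge>1. place.val Rr pp x (- 2 * n) \<and> place.val Rr pp y (- 3 * n) \<and> place.vge Rr pp (rho x y) 0)"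
  shows "place.vge Rr pp (delta x y) (- b)"
proof -
  interpret place Rr pp by fact
  from loc show ?thesis
  proof (elim disjE exE conjE)
    assume *: "vge x 0" "vge y 0" "vge (wP x y) 0"
    show ?thesis unfolding delta_def
    proof (intro vge_diff)
      show "vge (wP x y ^ p) (- b)" using vge_mono[OF vge_power[OF *(3), of p]] b by simp
      show "vge (A * wP x y) (- b)" using vge_mult[OF A *(3)] by simp
      show "vge (y * Mx x) (- b)" using vge_mult[OF *(2) M[OF *(1)]] by simp
    qed
  next
    fix n :: int assume *: "n \<ge> 1" "val x (- 2 * n)" "val y (- 3 * n)" "vge (rho x y) 0"
    have x: "x \<noteq> 0" using val_nz[OF *(2)] .
    have "vge (y * Lx x) (- 3 * n - 2 * n * int (p - 2) - b)"
      using vge_mult[OF val_imp_vge[OF *(3)] L[of "2 * n"]] val_imp_vge[OF *(2)] * by (simp add: algebra_simps)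
    moreover have "val (x ^ p) (int p * (- 2 * n))" using val_power[OF *(2)] .
    ultimately have "vge (y * Lx x / x ^ p) (- b)"
    proof (rule vge_divide')
      have "int (p - 2) = int p - 2" using p0 by simp
      thus "- b \<le> - 3 * n - 2 * n * int (p - 2) - b - int p * (- 2 * n)" using * by (simp add: algebra_simps)
    qed
    moreover have "vge (rho x y ^ p) (- b)" using vge_mono[OF vge_power[OF *(4), of p]] b by simp
    moreover have "vge (A * rho x y) (- b)" using vge_mult[OF A *(4)] by simp
    ultimately show ?thesis unfolding delta_pole[OF on x] using vge_add vge_diff by blast
  qed
qed

lemma fin_delta:
  assumes "on x y" shows "fvge \<alpha> (delta x y) (- int (p - 1))"
proof (cases "poly s \<alpha> = 0")
  case True
  show ?thesis
    by (rule delta_local[OF place_fin assms]) (use A_add[OF True] M_add[OF True] L_add[OF True] fin_local(1)[OF assms] in auto)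
next
  case False
  interpret place "finR \<alpha>" "finpi \<alpha>" by (rule place_fin)
  have "vge (delta x y) (- 0)"
    by (rule delta_local[OF place_fin assms]) (use A_reg(1)[OF False] M_reg(1)[OF False] L_reg(1)[OF False] fin_local(1)[OF assms] in auto)
  thus ?thesis by (rule vge_mono) simp
qed

lemma inf_delta:
  assumes "on x y" shows "ivge (delta x y) (- 0)"
  by (rule delta_local[OF place_inf assms]) (use A_reg M_reg L_reg(2) inf_local(1)[OF assms] in auto)

text \<open>At the cusp $u=0$ the derivation vanishes on the residue field, so that there the reduction of
  $w$ is a solution of the Artin-Schreier equation.\<close>

lemma prime_field_int: "(of_int i :: 'c) ^ p = of_int i"
proof -
  have n: "(of_nat k :: 'c) ^ p = of_nat k" for k
    by (induction k) (use p in \<open>auto simp: freshmans_dream prime_gt_0_nat p0\<close>)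
  show ?thesis using n p(2) by (cases i rule: int_cases2) auto
qed

lemma frob_c: "(x + y :: 'c) ^ p = x ^ p + y ^ p"
  using p by (intro freshmans_dream) auto

lemma delta_0:
  assumes on: "on x y"
  shows "fvge 0 (delta x y) 1"
proof -
  interpret ode_lplace "finR 0" "finpi 0" D A2 a4 a6 nu g0 "const_fract kk" by (rule ode_0)
  have c: "vge a4 0" "vge a6 0" "vge nu 0" "vge g0 0" using reg[OF s(2)] by auto
  have A0: "vge A 0" using A_reg(1)[OF s(2)] .
  let ?c = const_fract
  have cR: "vge (?c k) 0" for k using const_finR by (simp add: vge_0_iff)
  have dvd: "vge (z * w) 1" if "vge z 1" "vge w 0" for z w using vge_mult[OF that] by simp
  from fin_local(1)[OF on, of 0] show ?thesis
  proof (elim disjE exE conjE)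
    fix n :: int assume *: "n \<ge> 1" "val x (- 2 * n)" "val y (- 3 * n)" "vge (rho x y) 0"
    have x: "x \<noteq> 0" using val_nz[OF *(2)] .
    have r: "vge (rho x y) 1" using pole_rho_log[OF on *(1-3) c] .
    have "vge (y * Lx x) (- 3 * n - 2 * n * int (p - 2))"
      using vge_mult[OF val_imp_vge[OF *(3)] L_reg(1)[OF s(2), of "2 * n"]] val_imp_vge[OF *(2)] *
      by (simp add: algebra_simps)
    moreover have "val (x ^ p) (int p * (- 2 * n))" using val_power[OF *(2)] .
    ultimately have "vge (y * Lx x / x ^ p) 1"
    proof (rule vge_divide')
      have "int (p - 2) = int p - 2" using p0 by simp
      thus "1 \<le> - 3 * n - 2 * n * int (p - 2) - int p * (- 2 * n)" using * by (simp add: algebra_simps)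
    qed
    moreover have "vge (rho x y ^ p) 1" using vge_mono[OF vge_power[OF r, of p], of 1] p0 by simp
    moreover have "vge (A * rho x y) 1" using vge_mult[OF A0 r] by simp
    ultimately show ?thesis unfolding delta_pole[OF on x] using vge_add vge_diff by blast
  next
    assume x: "vge x 0" and y: "vge y 0" and w: "vge (wP x y) 0"
    define W where "W = wP x y"
    obtain xc where xc: "vge (x - ?c xc) 1" using fin_residue x by blast
    obtain yc where yc: "vge (y - ?c yc) 1" using fin_residue y by blast
    obtain wc where wc: "vge (W - ?c wc) 1" using fin_residue w W_def by blast
    \<comment> \<open>These closure rules carry the equations of the point over to equations between
      the residues \<open>xc\<close>, \<open>yc\<close>, \<open>wc\<close>; by \<open>Dc\<close>
      every derivative has residue 0.\<close>
    have prodc: "vge (z * t - ?c (zc * tc)) 1" if "vge (z - ?c zc) 1" "vge (t - ?c tc) 1" "vge t 0" for z t zc tc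
    proof -
      have "z * t - ?c (zc * tc) = (z - ?c zc) * t + (t - ?c tc) * ?c zc"
        by (simp add: const_fract_mult algebra_simps)
      thus ?thesis using vge_add[OF dvd[OF that(1,3)] dvd[OF that(2) cR]] by simp
    qed
    have sumc: "vge (z + t - ?c (zc + tc)) 1" if "vge (z - ?c zc) 1" "vge (t - ?c tc) 1" for z t zc tc
    proof -
      have "z + t - ?c (zc + tc) = (z - ?c zc) + (t - ?c tc)" by (simp add: const_fract_add)
      thus ?thesis using vge_add[OF that] by metis
    qed
    have difc: "vge (z - t - ?c (zc - tc)) 1" if "vge (z - ?c zc) 1" "vge (t - ?c tc) 1" for z t zc tc
    proof -
      have "z - t - ?c (zc - tc) = (z - ?c zc) - (t - ?c tc)" by (simp add: const_fract_diff)
      thus ?thesis using vge_diff[OF that] by metis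
    qed
    have cc: "vge (?c k - ?c k) 1" for k by simp
    have numc: "vge (numeral k - ?c (numeral k)) 1" for k by simp
    have Dc: "vge (D z - ?c 0) 1" if "vge z 0" for z using D_R1 that by (simp add: vge_0_iff)
    have eqc: "k = l" if "vge (z - ?c k) 1" "vge (z - ?c l) 1" for z k l
    proof -
      have "vge (?c (l - k)) 1" using vge_diff[OF that] by (simp add: const_fract_diff)
      thus ?thesis using fvge_const_1 by fastforce
    qed
    have nuc: "vge (nu - ?c (- x0)) 1" using node_0(3) by (simp add: const_fract_uminus)
    have R1: "vge (D x + 2 * (x * x) - (2 * nu - 2 * A2) * x - g0
        - ?c (0 + 2 * (xc * xc) - (2 * (- x0) - 2 * a2) * xc - 2 * x0 * (a2 + 2 * x0))) 1"
      by (intro difc sumc prodc Dc x xc numc nuc cc node_0(4) cR vge_mult'[OF x x] vge_diff vge_coeff_mult c) (auto)?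
    moreover have "D x + 2 * (x * x) - (2 * nu - 2 * A2) * x - g0 = 2 * (y * W)"
      using Dx_eq[OF on nz[OF on]] by (simp add: G_def W_def power2_eq_square)
    moreover have "vge (2 * (y * W) - ?c (2 * (yc * wc))) 1"
      by (intro prodc numc yc wc vge_mult'[OF y w[folded W_def]] w[folded W_def]) (auto)?
    ultimately have E1: "2 * (xc * xc) - (2 * (- x0) - 2 * a2) * xc - 2 * x0 * (a2 + 2 * x0) = 2 * (yc * wc)"
      using eqc by fastforce
    have F0: "vge (F x - ?c (3 * (xc * xc) + 2 * a2 * xc + (- 3 * x0 ^ 2 - 2 * a2 * x0))) 1"
      unfolding F_def power2_eq_square[of x]
      by (intro sumc prodc numc xc cc x node_0(1) vge_mult'[OF x x] cR) (auto)?
    have "vge (D y + 3 * x * y - (3 * nu - 2 * A2) * y - ?c (0 + 3 * xc * yc - (3 * (- x0) - 2 * a2) * yc)) 1"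
      by (intro difc sumc prodc numc xc yc cc x y nuc Dc cR c vge_diff vge_coeff_mult) (auto)?
    moreover have "vge (F x * W - ?c ((3 * (xc * xc) + 2 * a2 * xc + (- 3 * x0 ^ 2 - 2 * a2 * x0)) * wc)) 1"
      by (intro prodc F0 wc w[folded W_def])
    moreover have "D y + 3 * x * y - (3 * nu - 2 * A2) * y = F x * W"
      using Dy_eq[OF on nz[OF on]] by (simp add: W_def)
    ultimately have E2: "3 * xc * yc - (3 * (- x0) - 2 * a2) * yc
        = (3 * (xc * xc) + 2 * a2 * xc + (- 3 * x0 ^ 2 - 2 * a2 * x0)) * wc"
      using eqc by fastforce
    have "vge (x * x * x + A2 * (x * x) + a4 * x + a6 - ?c (xc * xc * xc + a2 * (xc * xc)
        + (- 3 * x0 ^ 2 - 2 * a2 * x0) * xc + x0 ^ 2 * (a2 + 2 * x0))) 1"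
      by (intro sumc prodc xc cc x node_0(1,2) vge_mult'[OF x x] cR) (auto)?
    moreover have "vge (y * y - ?c (yc * yc)) 1" by (intro prodc yc y)
    moreover have "x * x * x + A2 * (x * x) + a4 * x + a6 = y * y"
      using on by (simp add: on_def power2_eq_square power3_eq_cube)
    ultimately have E3: "xc * xc * xc + a2 * (xc * xc) + (- 3 * x0 ^ 2 - 2 * a2 * x0) * xc + x0 ^ 2 * (a2 + 2 * x0) = yc * yc"
      using eqc by fastforce
    \<comment> \<open>In the coordinate centred at the node the reduced curve is
      \<open>yc^2 = xi^2 (xi + e0)\<close>.\<close>
    define xi e0 where "xi = xc - x0" and "e0 = a2 + 3 * x0"
    have e0: "e0 \<noteq> 0" using x0 by (simp add: e0_def)
    have "2 * (yc * wc) = 2 * (xi * (xi + e0))" unfolding E1[symmetric] xi_def e0_def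
      by (simp add: algebra_simps power2_eq_square)
    hence E1': "yc * wc = xi * (xi + e0)" using two by simp
    have E2': "(3 * xi + 2 * e0) * yc = (3 * xi + 2 * e0) * (xi * wc)"
    proof -
      have "(3 * xi + 2 * e0) * yc = 3 * xc * yc - (3 * (- x0) - 2 * a2) * yc"
        by (simp add: xi_def e0_def algebra_simps)
      also have "\<dots> = (3 * xi + 2 * e0) * (xi * wc)" unfolding E2
        by (simp add: xi_def e0_def algebra_simps power2_eq_square)
      finally show ?thesis .
    qed
    have E3': "yc * yc = xi * xi * (xi + e0)" unfolding E3[symmetric]
      by (simp add: xi_def e0_def algebra_simps power2_eq_square)
    \<comment> \<open>So \<open>wc\<close> is the slope of the line from the node to the point. The
      factor \<open>3 xi + 2 e0\<close> in \<open>E2'\<close> cannot spoil this: if it vanished and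
      the claim failed, then \<open>yc = 0\<close> and \<open>xi + e0 = 0\<close>, whence
      \<open>e0 = 0\<close>.\<close>
    have key: "xi * wc = yc"
    proof (rule ccontr)
      assume ne: "xi * wc \<noteq> yc"
      hence "3 * xi + 2 * e0 = 0" using E2' by auto
      have "yc * (xi * wc) = xi * (yc * wc)" by (simp only: mult_ac)
      also have "\<dots> = yc * yc" unfolding E1' E3' by (simp only: mult_ac)
      finally have "yc * (xi * wc) = yc * yc" .
      hence y0: "yc = 0" using ne by auto
      hence "xi \<noteq> 0" using ne by auto
      hence z: "xi + e0 = 0" using E3' y0 by simp
      have "e0 = 3 * (xi + e0) - (3 * xi + 2 * e0)" by (simp add: algebra_simps)
      also have "\<dots> = 0" unfolding z \<open>3 * xi + 2 * e0 = 0\<close> by simp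
      finally show False using e0 by simp
    qed
    have wp: "vge (W ^ p - ?c (wc ^ p)) 1"
    proof -
      have "W ^ p = (?c wc + (W - ?c wc)) ^ p" by simp
      also have "\<dots> = ?c wc ^ p + (W - ?c wc) ^ p" by (rule frob)
      finally have "W ^ p - ?c (wc ^ p) = (W - ?c wc) ^ p" by (simp add: const_fract_power)
      thus ?thesis using vge_mono[OF vge_power[OF wc, of p], of 1] p0 by simp
    qed
    have dc: "vge (delta x y - ?c (wc ^ p - Ac * wc - yc * Mc xc)) 1"
      unfolding delta_def W_def[symmetric]
      by (intro difc wp prodc Ac(1) wc w[folded W_def] yc Mc xc M_reg(1)[OF s(2)] x)
    have "wc ^ p - Ac * wc - yc * Mc xc = 0"
    proof (cases "xi = 0")
      case False
      \<comment> \<open>Away from the node \<open>wc^2 = xi + e0\<close>, which says that the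
        reduced point has parameter \<open>wc\<close>; there \<open>node_AS\<close> is exactly the
        equation wanted.\<close>
      have "xi * (wc * wc) = yc * wc" unfolding key[symmetric] by (simp only: mult_ac)
      hence "xi * (wc * wc) = xi * (xi + e0)" using E1' by simp
      hence w2: "wc ^ 2 = xi + e0" using False by (simp add: power2_eq_square)
      have "wc ^ p = Ac * wc + wc * (wc ^ 2 - e0) * Mc (wc ^ 2 - (a2 + 2 * x0))"
        using node_AS[of wc] by (simp add: e0_def)
      moreover have "wc ^ 2 - e0 = xi" "wc ^ 2 - (a2 + 2 * x0) = xc"
        unfolding w2 by (simp_all add: xi_def e0_def)
      ultimately show ?thesis using key by (simp add: mult.commute)
    next
      case True
      hence yc0: "yc = 0" using key by simp
      have y1: "vge y 1" using yc yc0 by simp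
      have xc0: "xc = x0" using True by (simp add: xi_def)
      have F1: "vge (F x) 1" using F0 unfolding xc0 by (simp add: power2_eq_square)
      have u: "val (A2 + 3 * x) 0" using unit_at_node(1)[OF x y1 on F1] .
      \<comment> \<open>At the node itself the reduced point says nothing about \<open>wc\<close>,
        and its residue has to be found from the orders of \<open>y\<close> and
        \<open>F x\<close>.\<close>
      have "vge (wP x y) 1 \<or> (\<exists>i. val y i \<and> val (F x) i \<and>
          vge (wP x y - (of_int i * ?c kk + (2 * A2 - 4 * nu + 2 * x)) / (4 * (A2 + 3 * x)) * (F x / y)) 1 \<and>
          vge (wP x y - (of_int i * ?c kk + 3 * x - (3 * nu - 2 * A2)) * (y / F x)) 1)"
        by (rule singular_w[OF on x _ A2_R(1) c(3) u y1]) (rule nz[OF on])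
      thus ?thesis
      proof (elim disjE exE conjE)
        assume "vge (wP x y) 1"
        hence "wc = 0" using eqc[OF wc, of 0] by (simp add: W_def)
        thus ?thesis using yc0 p0 by simp
      next
        fix i
        assume i: "val y i" "val (F x) i"
          "vge (wP x y - (of_int i * ?c kk + (2 * A2 - 4 * nu + 2 * x)) / (4 * (A2 + 3 * x)) * (F x / y)) 1"
          "vge (wP x y - (of_int i * ?c kk + 3 * x - (3 * nu - 2 * A2)) * (y / F x)) 1"
        have rv: "val (F x / y) 0" using val_divide[OF i(2,1)] by simp
        obtain r where r: "vge (F x / y - ?c r) 1" using fin_residue val_imp_vge[OF rv] by blast
        \<comment> \<open>With the residues \<open>x0\<close> of \<open>x\<close> and
          \<open>- x0\<close> of \<open>nu\<close>, the two numerators in \<open>singular_w\<close>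
          have the same residue \<open>q\<close>. With the residue \<open>r\<close> of
          \<open>F x / y\<close>, the two formulas become \<open>4 e0 wc = q r\<close> and
          \<open>wc r = q\<close>.\<close>
        define q where "q = of_int i * kk + 2 * e0"
        have q1: "vge (of_int i * ?c kk + (2 * A2 - 4 * nu + 2 * x) - ?c q) 1"
        proof -
          have "vge (of_int i * ?c kk + (2 * A2 - 4 * nu + 2 * x)
              - ?c (of_int i * kk + (2 * a2 - 4 * (- x0) + 2 * x0))) 1"
            by (intro sumc difc prodc numc nuc cc xc[unfolded xc0] x cR c) (auto simp: cc)?
          moreover have "of_int i * kk + (2 * a2 - 4 * (- x0) + 2 * x0) = q"
            by (simp add: q_def e0_def)
          ultimately show ?thesis by simp
        qed
        have q2: "vge (of_int i * ?c kk + 3 * x - (3 * nu - 2 * A2) - ?c q) 1"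
        proof -
          have "vge (of_int i * ?c kk + 3 * x - (3 * nu - 2 * A2)
              - ?c (of_int i * kk + 3 * x0 - (3 * (- x0) - 2 * a2))) 1"
            by (intro sumc difc prodc numc nuc cc xc[unfolded xc0] x cR c) (auto simp: cc)?
          moreover have "of_int i * kk + 3 * x0 - (3 * (- x0) - 2 * a2) = q"
            by (simp add: q_def e0_def)
          ultimately show ?thesis by simp
        qed
        have ynz: "y \<noteq> 0" "F x \<noteq> 0" using val_nz i by auto
        have rr: "vge (F x / y) 0" using val_imp_vge[OF rv] .
        have "vge (4 * (A2 + 3 * x) * W - ?c (4 * (a2 + 3 * x0) * wc)) 1"
          by (intro prodc sumc numc cc xc[unfolded xc0] wc w[folded W_def] x vge_add A2_R(1) vge_coeff_mult)
        moreover have "vge (4 * (A2 + 3 * x) * W - ?c (q * r)) 1"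
        proof -
          define U where "U = 4 * (A2 + 3 * x)"
          have U0: "vge U 0" unfolding U_def by (intro vge_coeff_mult vge_add A2_R(1) x)
          have Unz: "U \<noteq> 0"
          proof -
            have "val U 0" unfolding U_def using val_mult[OF two_unit val_2y[OF u]] by (simp add: mult.assoc[symmetric])
            thus ?thesis using val_nz by blast
          qed
          let ?Q = "of_int i * ?c kk + (2 * A2 - 4 * nu + 2 * x)"
          have "(W - q' / U * r') * U = U * W - q' * r'" for q' r'
            using Unz by (simp add: right_diff_distrib mult.commute)
          hence "U * W - ?Q * (F x / y) = (W - ?Q / U * (F x / y)) * U" by metis
          moreover have "vge ((W - ?Q / U * (F x / y)) * U) 1"
            using dvd[OF i(3)[folded W_def U_def] U0] .
          ultimately have "vge (U * W - ?Q * (F x / y)) 1" by simp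
          moreover have "vge (?Q * (F x / y) - ?c (q * r)) 1" by (intro prodc q1 r rr)
          ultimately have "vge ((U * W - ?Q * (F x / y)) + (?Q * (F x / y) - ?c (q * r))) 1" by (rule vge_add)
          thus ?thesis by (simp add: U_def)
        qed
        ultimately have e1: "4 * e0 * wc = q * r" using eqc by (simp add: e0_def)
        have e2: "wc * r = q"
        proof -
          let ?Q = "of_int i * ?c kk + 3 * x - (3 * nu - 2 * A2)"
          have "(W - q' * (y / f')) * (f' / y) = W * (f' / y) - q'" if "f' \<noteq> 0" for q' f'
            using ynz(1) that by (simp add: left_diff_distrib diff_divide_distrib)
          hence "W * (F x / y) - ?Q = (W - ?Q * (y / F x)) * (F x / y)" using ynz(2) by metis
          hence "vge (W * (F x / y) - ?Q) 1" using dvd[OF i(4)[folded W_def] rr] by simp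
          from vge_add[OF this q2] have "vge (W * (F x / y) - ?c q) 1" by simp
          moreover have "vge (W * (F x / y) - ?c (wc * r)) 1" by (intro prodc wc r rr)
          ultimately show ?thesis using eqc by blast
        qed
        \<comment> \<open>All ingredients of \<open>q\<close> lie in the prime field.\<close>
        have qp: "q ^ p = q"
        proof -
          have n: "(of_nat k :: 'c) ^ p = of_nat k" for k using prime_field_int[of "int k"] by simp
          have "e0 ^ p = e0" unfolding e0_def frob_c power_mult_distrib using x0 n[of 3] by simp
          thus ?thesis unfolding q_def frob_c power_mult_distrib prime_field_int using kk n[of 2] by simp
        qed
        show ?thesis
        proof (cases "q = 0")
          case True
          have "2 * (2 * (e0 * wc)) = 0" using e1 True by (simp add: mult.assoc)
          hence "wc = 0" using e0 two by (metis mult_eq_0_iff)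
          thus ?thesis using yc0 p0 by simp
        next
          case False
          hence rnz: "r \<noteq> 0" "wc \<noteq> 0" using e2 by auto
          \<comment> \<open>Eliminating \<open>q\<close> gives \<open>r^2 = 4 e0\<close>, so
            \<open>r^(p-1)\<close> is the inverse of \<open>Ac\<close>. Comparing
            \<open>wc r = q\<close> with its \<open>p\<close>-th power then yields
            \<open>wc^p = Ac wc\<close>.\<close>
          have "4 * e0 * wc = wc * r * r" using e1 e2 by simp
          hence r2: "r ^ 2 = 4 * e0" using rnz by (simp add: power2_eq_square)
          have pp: "p = 1 + 2 * ((p - 1) div 2)" using p(2) by presburger
          have "r ^ p = r * (r ^ 2) ^ ((p - 1) div 2)"
            by (subst pp) (simp only: power_add power_mult power_one_right)
          hence rp: "Ac * r ^ p = r" unfolding r2 using Ac(2) by (simp add: e0_def mult.commute mult.left_commute)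
          have "wc ^ p * r ^ p = wc * r" using e2 qp by (metis power_mult_distrib)
          also have "\<dots> = (Ac * wc) * r ^ p" using rp by (simp add: mult_ac)
          finally have "wc ^ p = Ac * wc" using rnz by simp
          thus ?thesis using yc0 by simp
        qed
      qed
    qed
    thus ?thesis using dc by simp
  qed
qed

lemma delta_zero:
  assumes "on x y" shows "delta x y = 0"
proof -
  have "D (delta x y) = 0" using D_delta[OF assms] M_zero[OF assms] by simp
  hence "tder (delta x y) = 0" using kk(1) by (simp add: const_fract_eq_0)
  then obtain e where e: "delta x y = e ^ p" using tder_eq_0[OF p(1,3)] by blast
  have "e \<in> finR \<alpha>" for \<alpha>
  proof -
    interpret place "finR \<alpha>" "finpi \<alpha>" by (rule place_fin)
    \<comment> \<open>A pole of \<open>e\<close> would give \<open>e^p\<close> a pole of order at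
      least \<open>p\<close>, but only \<open>p - 1\<close> is possible.\<close>
    have "vge e 0" using vge_powerD[of e p "- int (p - 1)"] fin_delta[OF assms, of \<alpha>] p0 unfolding e by simp
    thus ?thesis by (simp add: vge_0_iff)
  qed
  moreover have "e \<in> infR"
  proof -
    interpret place "infR :: 'c poly fract set" infpi by (rule place_inf)
    have "vge e 0" using vge_powerD[of e p 0] inf_delta[OF assms] p0 unfolding e by simp
    thus ?thesis by (simp add: vge_0_iff)
  qed
  ultimately obtain k where k: "e = const_fract k" using regular_const by blast
  have "fvge 0 (e ^ p) 1" using delta_0[OF assms] e by simp
  hence "fvge 0 (const_fract k) 1" using place.vge_power_pos[OF place_fin] p0 k by blast
  hence "k = 0" using fvge_const_1 by blast
  thus ?thesis using e k p0 by simp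
qed

theorem lift_point:
  assumes "on x y"
  shows "wP x y ^ p = A * wP x y + y * Mx x"
    and "D x = 2 * y * wP x y - 2 * x ^ 2 + (2 * nu - 2 * A2) * x + g0"
    and "D y = F x * wP x y - 3 * x * y + (3 * nu - 2 * A2) * y"
    and "D (wP x y) = x * wP x y - y + nu * wP x y"
proof -
  show "wP x y ^ p = A * wP x y + y * Mx x" using delta_zero[OF assms] by (simp add: delta_def algebra_simps)
  show "D x = 2 * y * wP x y - 2 * x ^ 2 + (2 * nu - 2 * A2) * x + g0"
    using Dx_eq[OF assms nz[OF assms]] by (simp add: G_def algebra_simps)
  show "D y = F x * wP x y - 3 * x * y + (3 * nu - 2 * A2) * y"
    using Dy_eq[OF assms nz[OF assms]] by (simp add: algebra_simps)
  show "D (wP x y) = x * wP x y - y + nu * wP x y"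
    using M_zero[OF assms] by (simp add: MP_def)
qed

end

section \<open>Polynomial identities by computation with nested lists\<close>

text \<open>Lists hold coefficients from the constant term upwards. The operations on coefficients
  are parameters, so that one set of functions serves at every level of nesting.\<close>

fun ladd :: "('a \<Rightarrow> 'a \<Rightarrow> 'a) \<Rightarrow> 'a list \<Rightarrow> 'a list \<Rightarrow> 'a list" where
  "ladd f [] q = q"
| "ladd f (x # p) [] = x # p"
| "ladd f (x # p) (y # q) = f x y # ladd f p q"

text \<open>The test \<open>n\<close> only speeds up sparse products: it has to imply that the
  coefficient is zero but may miss some zeros. \<open>z\<close> represents the zero coefficient that
  shifts a list.\<close>

fun lmul :: "('a \<Rightarrow> 'a \<Rightarrow> 'a) \<Rightarrow> ('a \<Rightarrow> 'a \<Rightarrow> 'a) \<Rightarrow> 'a \<Rightarrow> ('a \<Rightarrow> bool) \<Rightarrow> 'a list \<Rightarrow> 'a list \<Rightarrow> 'a list" where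
  "lmul f g z n [] q = []"
| "lmul f g z n (x # p) q = (if q = [] then [] else if n x then z # lmul f g z n p q
     else ladd f (map (g x) q) (z # lmul f g z n p q))"

text \<open>The product rule for \<open>x + v * l\<close>, so that no multiplication of coefficients
  by exponents is needed.\<close>

fun lder :: "('a \<Rightarrow> 'a \<Rightarrow> 'a) \<Rightarrow> 'a \<Rightarrow> 'a list \<Rightarrow> 'a list" where
  "lder f z [] = []"
| "lder f z (x # l) = ladd f l (z # lder f z l)"

fun lall :: "(nat \<Rightarrow> 'a \<Rightarrow> bool) \<Rightarrow> nat \<Rightarrow> 'a list \<Rightarrow> bool" where
  "lall Q i [] \<longleftrightarrow> True"
| "lall Q i (c # l) \<longleftrightarrow> Q i c \<and> lall Q (Suc i) l"

fun lev :: "('b \<Rightarrow> 'f::comm_ring_1) \<Rightarrow> 'f \<Rightarrow> 'b list \<Rightarrow> 'f" where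
  "lev e v [] = 0"
| "lev e v (c # l) = e c + v * lev e v l"

lemma lev_ladd: "(\<And>x y. e (f x y) = e x + e y) \<Longrightarrow> lev e v (ladd f p q) = lev e v p + lev e v q"
  by (induction f p q rule: ladd.induct) (auto simp: algebra_simps)

lemma lev_map_mult: "(\<And>y. e (g y) = k * e y) \<Longrightarrow> lev e v (map g q) = k * lev e v q"
  by (induction q) (auto simp: algebra_simps)

lemma lev_lmul:
  assumes "\<And>x y. e (f x y) = e x + e y" "\<And>x y. e (g x y) = e x * e y" "e z = 0" "\<And>x. n x \<Longrightarrow> e x = 0"
  shows "lev e v (lmul f g z n p q) = lev e v p * lev e v q"
proof (induction p)
  case (Cons x p)
  have "lev e v (map (g x) q) = e x * lev e v q" using lev_map_mult[of e "g x" "e x"] assms(2) by blast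
  thus ?case using Cons assms by (auto simp: lev_ladd algebra_simps)
qed simp

lemma lev_append: "lev e v (p @ q) = lev e v p + v ^ length p * lev e v q"
  by (induction p) (auto simp: algebra_simps)

lemma lev_zero: "list_all Z l \<Longrightarrow> (\<And>c. Z c \<Longrightarrow> e c = 0) \<Longrightarrow> lev e v l = 0"
  by (induction l) auto

lemma (in derivation) D_lev:
  assumes add: "\<And>x y. e (f x y) = e x + e y" and z: "e z = 0"
  shows "D (lev e v l) = lev (\<lambda>c. D (e c)) v l + lev e v (lder f z l) * D v"
proof (induction l)
  case (Cons c l)
  have s: "lev e v (ladd f l (z # lder f z l)) = lev e v l + v * lev e v (lder f z l)"
    using lev_ladd[of e f v] add z by simp
  show ?case unfolding lev.simps D_add D_mult Cons lder.simps s by (simp add: algebra_simps)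
qed simp

lemma lev_cong_add: "(\<And>c. e c = g c + k * h c) \<Longrightarrow> lev e v l = lev g v l + k * lev h v l"
  by (induction l) (auto simp: algebra_simps)

lemma lev_map: "lev e v (map g l) = lev (e \<circ> g) v l"
  by (induction l) auto

lemma (in place) vge_lev:
  assumes "lall Q i l" "\<And>j c. Q j c \<Longrightarrow> vge (z * v ^ j * e c) k"
  shows "vge (z * v ^ i * lev e v l) k"
  using assms(1)
proof (induction l arbitrary: i)
  case (Cons c l)
  have "z * v ^ i * lev e v (c # l) = z * v ^ i * e c + z * v ^ Suc i * lev e v l"
    by (simp add: algebra_simps)
  moreover have "vge (z * v ^ i * e c) k" "vge (z * v ^ Suc i * lev e v l) k"
    using Cons.IH[of "Suc i"] Cons.prems assms(2) by (auto simp del: power_Suc)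
  ultimately show ?case using vge_add by metis
qed simp

definition add1 :: "int list \<Rightarrow> int list \<Rightarrow> int list" where "add1 = ladd (+)"
definition mul1 :: "int list \<Rightarrow> int list \<Rightarrow> int list" where "mul1 = lmul (+) (*) 0 (\<lambda>x. x = 0)"
definition add2 where "add2 = ladd add1"
definition mul2 where "mul2 = lmul add1 mul1 [] (\<lambda>x. x = [])"
definition add3 where "add3 = ladd add2"
definition mul3 where "mul3 = lmul add2 mul2 [] (\<lambda>x. x = [])"
definition neg3 :: "int list list list \<Rightarrow> int list list list" where "neg3 = map (map (map uminus))"

text \<open>A \<open>polyw\<close> is the list of coefficients of the powers of $w$; the coefficient \<open>(p, q)\<close> stands for
  $p + q y$, and \<open>p\<close>, \<open>q\<close> are polynomials in $x$ whose coefficients are polynomials in $a_6$ with coefficients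
  in the integral polynomials in $a_4$.  Squares of $y$ are eliminated by the equation of the curve, and $p$-th powers
  of $w$ by the Artin-Schreier equation; coefficients are only compared modulo $p$.\<close>

type_synonym poly3 = "int list list list"
type_synonym polyw = "(poly3 \<times> poly3) list"

definition addy :: "poly3 \<times> poly3 \<Rightarrow> poly3 \<times> poly3 \<Rightarrow> poly3 \<times> poly3" where
  "addy p q = (add3 (fst p) (fst q), add3 (snd p) (snd q))"
definition muly :: "poly3 \<Rightarrow> poly3 \<times> poly3 \<Rightarrow> poly3 \<times> poly3 \<Rightarrow> poly3 \<times> poly3" where
  "muly f p q = (add3 (mul3 (fst p) (fst q)) (mul3 f (mul3 (snd p) (snd q))),
     add3 (mul3 (fst p) (snd q)) (mul3 (snd p) (fst q)))"
definition addw :: "polyw \<Rightarrow> polyw \<Rightarrow> polyw" where "addw = ladd addy"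
definition mulw :: "poly3 \<Rightarrow> polyw \<Rightarrow> polyw \<Rightarrow> polyw" where
  "mulw f = lmul addy (muly f) ([], []) (\<lambda>x. x = ([], []))"
definition negw :: "polyw \<Rightarrow> polyw" where "negw = map (map_prod neg3 neg3)"
text \<open>One substitution of \<open>R\<close> for \<open>w^p\<close>. As \<open>R\<close> is
  linear in \<open>w\<close>, one round brings any list of degree at most \<open>2 p - 2\<close> in
  \<open>w\<close>, such as a product of two reduced ones, below degree \<open>p\<close>.\<close>

definition redw :: "poly3 \<Rightarrow> nat \<Rightarrow> polyw \<Rightarrow> polyw \<Rightarrow> polyw" where
  "redw f p R l = addw (take p l) (mulw f (drop p l) R)"

definition z1 :: "int \<Rightarrow> int list \<Rightarrow> bool" where "z1 m = list_all (\<lambda>c. c mod m = 0)"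
definition z3 :: "int \<Rightarrow> poly3 \<Rightarrow> bool" where "z3 m = list_all (list_all (z1 m))"
definition zw :: "int \<Rightarrow> polyw \<Rightarrow> bool" where "zw m = list_all (\<lambda>pq. z3 m (fst pq) \<and> z3 m (snd pq))"

definition da3 :: "poly3 \<Rightarrow> poly3" where "da3 = map (map (lder (+) 0))"
definition db3 :: "poly3 \<Rightarrow> poly3" where "db3 = map (lder add1 [])"
definition dx3 :: "poly3 \<Rightarrow> poly3" where "dx3 = lder add2 []"

text \<open>The chain rule, where \<open>ia\<close>, \<open>ib\<close>, \<open>ix\<close>,
  \<open>iy\<close>, \<open>iw\<close> represent the derivatives of \<open>a4\<close>,
  \<open>a6\<close>, \<open>x\<close>, \<open>y\<close> and \<open>w\<close>. A coefficient stands
  for \<open>p + q y\<close>, so its partial derivative in \<open>y\<close> is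
  \<open>(snd pq, [])\<close>.\<close>

definition derw :: "poly3 \<Rightarrow> polyw \<Rightarrow> polyw \<Rightarrow> polyw \<Rightarrow> polyw \<Rightarrow> polyw \<Rightarrow> polyw \<Rightarrow> polyw" where
  "derw f ia ib ix iy iw l =
     addw (mulw f (map (map_prod da3 da3) l) ia)
    (addw (mulw f (map (map_prod db3 db3) l) ib)
    (addw (mulw f (map (map_prod dx3 dx3) l) ix)
    (addw (mulw f (map (\<lambda>pq. (snd pq, [])) l) iy)
          (mulw f (lder addy ([], []) l) iw))))"

text \<open>A condition on the exponents of the monomials that occur; zero entries are exempt, since
  lists are full of them.\<close>

definition all3 :: "(nat \<Rightarrow> nat \<Rightarrow> nat \<Rightarrow> bool) \<Rightarrow> poly3 \<Rightarrow> bool" where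
  "all3 P = lall (\<lambda>m. lall (\<lambda>j. lall (\<lambda>i c. c = 0 \<or> P i j m) 0) 0) 0"
definition allw :: "(nat \<Rightarrow> nat \<Rightarrow> nat \<Rightarrow> nat \<Rightarrow> nat \<Rightarrow> bool) \<Rightarrow> polyw \<Rightarrow> bool" where
  "allw P = lall (\<lambda>k pq. all3 (\<lambda>i j m. P i j m 0 k) (fst pq) \<and> all3 (\<lambda>i j m. P i j m 1 k) (snd pq)) 0"

definition ev1 :: "'f::comm_ring_1 \<Rightarrow> int list \<Rightarrow> 'f" where "ev1 a = lev of_int a"
definition ev2 :: "'f::comm_ring_1 \<Rightarrow> 'f \<Rightarrow> int list list \<Rightarrow> 'f" where "ev2 a b = lev (ev1 a) b"
definition ev3 :: "'f::comm_ring_1 \<Rightarrow> 'f \<Rightarrow> 'f \<Rightarrow> poly3 \<Rightarrow> 'f" where "ev3 a b x = lev (ev2 a b) x"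
definition evy :: "'f::comm_ring_1 \<Rightarrow> 'f \<Rightarrow> 'f \<Rightarrow> 'f \<Rightarrow> poly3 \<times> poly3 \<Rightarrow> 'f" where
  "evy a b x y pq = ev3 a b x (fst pq) + y * ev3 a b x (snd pq)"
definition evw :: "'f::comm_ring_1 \<Rightarrow> 'f \<Rightarrow> 'f \<Rightarrow> 'f \<Rightarrow> 'f \<Rightarrow> polyw \<Rightarrow> 'f" where
  "evw a b x y w = lev (evy a b x y) w"

lemma ev1_add: "ev1 a (add1 p q) = ev1 a p + ev1 a q"
  unfolding ev1_def add1_def by (rule lev_ladd) simp
lemma ev1_mul: "ev1 a (mul1 p q) = ev1 a p * ev1 a q"
  unfolding ev1_def mul1_def by (rule lev_lmul) auto
lemma ev2_add: "ev2 a b (add2 p q) = ev2 a b p + ev2 a b q"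
  unfolding ev2_def add2_def by (rule lev_ladd) (rule ev1_add)
lemma ev2_mul: "ev2 a b (mul2 p q) = ev2 a b p * ev2 a b q"
  unfolding ev2_def mul2_def by (rule lev_lmul) (simp_all add: ev1_add ev1_mul, simp_all add: ev1_def)
lemma ev3_add: "ev3 a b x (add3 p q) = ev3 a b x p + ev3 a b x q"
  unfolding ev3_def add3_def by (rule lev_ladd) (rule ev2_add)
lemma ev3_mul: "ev3 a b x (mul3 p q) = ev3 a b x p * ev3 a b x q"
  unfolding ev3_def mul3_def by (rule lev_lmul) (simp_all add: ev2_add ev2_mul, simp_all add: ev2_def)
lemma ev3_neg: "ev3 a b x (neg3 p) = - ev3 a b x p"
proof -
  have "lev of_int a (map uminus l) = - lev of_int a l" for l using lev_map_mult[of of_int uminus "-1"] by simp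
  hence "lev (ev1 a) b (map (map uminus) l) = - lev (ev1 a) b l" for l
    using lev_map_mult[of "ev1 a" "map uminus" "-1"] by (simp add: ev1_def)
  thus ?thesis
    using lev_map_mult[of "ev2 a b" "map (map uminus)" "-1"] by (simp add: ev3_def neg3_def ev2_def)
qed
lemma evy_add: "evy a b x y (addy p q) = evy a b x y p + evy a b x y q"
  unfolding evy_def addy_def by (simp add: ev3_add algebra_simps)
lemma evw_add: "evw a b x y w (addw p q) = evw a b x y w p + evw a b x y w q"
  unfolding evw_def addw_def by (rule lev_ladd) (rule evy_add)
lemma evw_neg: "evw a b x y w (negw p) = - evw a b x y w p"
  using lev_map_mult[of "evy a b x y" "map_prod neg3 neg3" "-1"]
  by (simp add: evw_def negw_def evy_def ev3_neg)
lemma evw_mul: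
  assumes "y ^ 2 = ev3 a b x f"
  shows "evw a b x y w (mulw f p q) = evw a b x y w p * evw a b x y w q"
  unfolding evw_def mulw_def
proof (rule lev_lmul)
  fix p q
  have "evy a b x y (muly f p q) = ev3 a b x (fst p) * ev3 a b x (fst q) + ev3 a b x f * (ev3 a b x (snd p) * ev3 a b x (snd q))
     + y * (ev3 a b x (fst p) * ev3 a b x (snd q) + ev3 a b x (snd p) * ev3 a b x (fst q))"
    by (simp add: evy_def muly_def ev3_add ev3_mul)
  thus "evy a b x y (muly f p q) = evy a b x y p * evy a b x y q"
    unfolding assms[symmetric] by (simp add: evy_def algebra_simps power2_eq_square)
qed (simp_all add: evy_add, simp_all add: evy_def ev3_def)

lemma evw_red:
  assumes "y ^ 2 = ev3 a b x f" "w ^ p = evw a b x y w R"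
  shows "evw a b x y w (redw f p R l) = evw a b x y w l"
proof (cases "length l \<ge> p")
  case True
  have "evw a b x y w l = evw a b x y w (take p l @ drop p l)" by simp
  also have "\<dots> = evw a b x y w (take p l) + w ^ p * evw a b x y w (drop p l)"
    using True unfolding evw_def lev_append by simp
  finally show ?thesis unfolding redw_def evw_add evw_mul[OF assms(1)] assms(2) by simp
next
  case False
  thus ?thesis by (simp add: redw_def evw_add evw_mul[OF assms(1)]) (simp add: evw_def)
qed

lemma z1_ev:
  assumes "of_nat p = (0::'f::comm_ring_1)" "z1 (int p) l"
  shows "ev1 (a::'f) l = 0"
  unfolding ev1_def
proof (rule lev_zero)
  show "list_all (\<lambda>c. c mod int p = 0) l" using assms(2) by (simp add: z1_def)
  fix c assume "c mod int p = 0"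
  then obtain k where "c = int p * k" by auto
  thus "of_int c = (0::'f)" using assms(1) by simp
qed
lemma z3_ev:
  assumes "of_nat p = (0::'f::comm_ring_1)" "z3 (int p) l"
  shows "ev3 (a::'f) b x l = 0"
  unfolding ev3_def ev2_def
  by (rule lev_zero[of "list_all (z1 (int p))"]) (use assms z1_ev[OF assms(1)] in \<open>auto simp: z3_def intro: lev_zero[of "z1 (int p)"]\<close>)
lemma zw_ev:
  assumes "of_nat p = (0::'f::comm_ring_1)" "zw (int p) l"
  shows "evw (a::'f) b x y w l = 0"
  unfolding evw_def
  by (rule lev_zero[of "\<lambda>pq. z3 (int p) (fst pq) \<and> z3 (int p) (snd pq)"])
     (use assms z3_ev[OF assms(1)] in \<open>auto simp: zw_def evy_def\<close>)

context derivation
begin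

lemma D_of_int [simp]: "D (of_int k) = 0"
  by (cases k rule: int_cases2) (simp_all add: D_uminus)

lemma D_ev1: "D (ev1 a l) = ev1 a (lder (+) 0 l) * D a"
proof -
  have "D (ev1 a l) = lev (\<lambda>c. D (of_int c)) a l + lev of_int a (lder (+) 0 l) * D a"
    unfolding ev1_def by (rule D_lev) simp_all
  moreover have "lev (\<lambda>c. D (of_int c)) a l = 0" by (rule lev_zero[of "\<lambda>_. True"]) (simp_all add: list_all_iff)
  ultimately show ?thesis by (simp add: ev1_def)
qed

lemma D_ev2: "D (ev2 a b l) = ev2 a b (map (lder (+) 0) l) * D a + ev2 a b (lder add1 [] l) * D b"
proof -
  have "D (ev2 a b l) = lev (\<lambda>c. D (ev1 a c)) b l + ev2 a b (lder add1 [] l) * D b"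
    unfolding ev2_def by (rule D_lev) (simp_all add: ev1_add, simp add: ev1_def)
  moreover have "lev (\<lambda>c. D (ev1 a c)) b l = lev (\<lambda>_. 0) b l + D a * lev (ev1 a \<circ> lder (+) 0) b l"
    by (rule lev_cong_add) (simp add: D_ev1)
  moreover have "lev (\<lambda>_. 0) b l = 0" by (rule lev_zero[of "\<lambda>_. True"]) (simp_all add: list_all_iff)
  ultimately show ?thesis by (simp add: ev2_def lev_map)
qed

lemma D_ev3: "D (ev3 a b x l) = ev3 a b x (da3 l) * D a + ev3 a b x (db3 l) * D b + ev3 a b x (dx3 l) * D x"
proof -
  have "D (ev3 a b x l) = lev (\<lambda>c. D (ev2 a b c)) x l + ev3 a b x (dx3 l) * D x"
    unfolding ev3_def dx3_def by (rule D_lev) (simp_all add: ev2_add, simp add: ev2_def)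
  moreover have "lev (\<lambda>c. D (ev2 a b c)) x l
      = lev (\<lambda>c. ev2 a b (map (lder (+) 0) c) * D a) x l + D b * lev (ev2 a b \<circ> lder add1 []) x l"
    by (rule lev_cong_add) (simp add: D_ev2)
  moreover have "lev (\<lambda>c. ev2 a b (map (lder (+) 0) c) * D a) x l
      = lev (\<lambda>_. 0) x l + D a * lev (ev2 a b \<circ> map (lder (+) 0)) x l"
    by (rule lev_cong_add) simp
  moreover have "lev (\<lambda>_. 0) x l = 0" by (rule lev_zero[of "\<lambda>_. True"]) (simp_all add: list_all_iff)
  ultimately show ?thesis by (simp add: ev3_def lev_map da3_def db3_def)
qed

lemma D_evy: "D (evy a b x y l) = evy a b x y (map_prod da3 da3 l) * D a + evy a b x y (map_prod db3 db3 l) * D b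
    + evy a b x y (map_prod dx3 dx3 l) * D x + evy a b x y (snd l, []) * D y"
proof -
  have "ev3 a b x [] = 0" by (simp add: ev3_def)
  thus ?thesis unfolding evy_def D_add D_mult D_ev3 by (cases l) (simp add: algebra_simps)
qed

text \<open>The quantity \<open>nu\<close> is not one of the variables of the lists. The derivatives
  are linear in it, so the derivation splits into a part without it and a multiple of it, here
  \<open>m\<close>, each given by its own lists.\<close>

lemma D_evw:
  assumes "y ^ 2 = ev3 a b x f"
    and "D a = evw a b x y w ia + m * evw a b x y w ja" "D b = evw a b x y w ib + m * evw a b x y w jb"
    and "D x = evw a b x y w ix + m * evw a b x y w jx" "D y = evw a b x y w iy + m * evw a b x y w jy"
    and "D w = evw a b x y w iw + m * evw a b x y w jw"
  shows "D (evw a b x y w l) = evw a b x y w (derw f ia ib ix iy iw l) + m * evw a b x y w (derw f ja jb jx jy jw l)"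
proof -
  have z: "lev (\<lambda>_. 0) w l = 0" by (rule lev_zero[of "\<lambda>_. True"]) (simp_all add: list_all_iff)
  let ?e = "evy a b x y"
  have "D (evw a b x y w l) = lev (\<lambda>c. D (?e c)) w l + evw a b x y w (lder addy ([], []) l) * D w"
    unfolding evw_def by (rule D_lev) (simp_all add: evy_add, simp add: evy_def ev3_def)
  moreover have "lev (\<lambda>c. D (?e c)) w l
      = lev (\<lambda>c. ?e (map_prod da3 da3 c) * D a + ?e (map_prod db3 db3 c) * D b + ?e (map_prod dx3 dx3 c) * D x) w l
        + D y * lev (?e \<circ> (\<lambda>l. (snd l, []))) w l"
    by (rule lev_cong_add) (simp add: D_evy)
  moreover have "lev (\<lambda>c. ?e (map_prod da3 da3 c) * D a + ?e (map_prod db3 db3 c) * D b + ?e (map_prod dx3 dx3 c) * D x) w l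
      = lev (\<lambda>c. ?e (map_prod da3 da3 c) * D a + ?e (map_prod db3 db3 c) * D b) w l + D x * lev (?e \<circ> map_prod dx3 dx3) w l"
    by (rule lev_cong_add) simp
  moreover have "lev (\<lambda>c. ?e (map_prod da3 da3 c) * D a + ?e (map_prod db3 db3 c) * D b) w l
      = lev (\<lambda>c. ?e (map_prod da3 da3 c) * D a) w l + D b * lev (?e \<circ> map_prod db3 db3) w l"
    by (rule lev_cong_add) simp
  moreover have "lev (\<lambda>c. ?e (map_prod da3 da3 c) * D a) w l = lev (\<lambda>_. 0) w l + D a * lev (?e \<circ> map_prod da3 da3) w l"
    by (rule lev_cong_add) simp
  ultimately have "D (evw a b x y w l) = evw a b x y w (map (map_prod da3 da3) l) * D a
      + evw a b x y w (map (map_prod db3 db3) l) * D b + evw a b x y w (map (map_prod dx3 dx3) l) * D x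
      + evw a b x y w (map (\<lambda>pq. (snd pq, [])) l) * D y + evw a b x y w (lder addy ([], []) l) * D w"
    by (simp add: evw_def lev_map z)
  thus ?thesis unfolding assms(2-6) derw_def evw_add evw_mul[OF assms(1)] by (simp add: algebra_simps)
qed

end

context place
begin

lemma vge_ev3:
  assumes "all3 P l" "\<And>i j m. P i j m \<Longrightarrow> vge (z * (x ^ m * (b ^ j * a ^ i))) k"
  shows "vge (z * ev3 a b x l) k"
proof -
  have i: "vge (c * of_int n) k" if "vge c k" for c n using vge_mult[OF that vge_of_int] by simp
  have "vge (z * x ^ 0 * lev (ev2 a b) x l) k" using assms(1) unfolding all3_def
  proof (rule vge_lev)
    fix m l assume "lall (\<lambda>j. lall (\<lambda>i c. c = (0::int) \<or> P i j m) 0) 0 l"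
    hence "vge (z * x ^ m * b ^ 0 * lev (ev1 a) b l) k"
    proof (rule vge_lev)
      fix j l assume "lall (\<lambda>i c. c = (0::int) \<or> P i j m) 0 l"
      hence "vge (z * x ^ m * b ^ j * a ^ 0 * lev of_int a l) k"
      proof (rule vge_lev)
        fix i' and c :: int assume "c = 0 \<or> P i' j m"
        thus "vge (z * x ^ m * b ^ j * a ^ i' * of_int c) k"
          using i[OF assms(2)[of i' j m], of c] by (auto simp: mult.assoc)
      qed
      thus "vge (z * x ^ m * b ^ j * ev1 a l) k" by (simp add: ev1_def)
    qed
    thus "vge (z * x ^ m * ev2 a b l) k" by (simp add: ev2_def)
  qed
  thus ?thesis by (simp add: ev3_def)
qed

lemma vge_evw:
  assumes "allw P l" "\<And>i j m e n. P i j m e n \<Longrightarrow> vge (w ^ n * y ^ e * (x ^ m * (b ^ j * a ^ i))) k"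
  shows "vge (evw a b x y w l) k"
proof -
  have "vge (1 * w ^ 0 * lev (evy a b x y) w l) k" using assms(1) unfolding allw_def
  proof (rule vge_lev)
    fix n pq
    assume *: "all3 (\<lambda>i j m. P i j m 0 n) (fst pq) \<and> all3 (\<lambda>i j m. P i j m 1 n) (snd pq)"
    have "vge (w ^ n * y ^ 0 * ev3 a b x (fst pq)) k" using conjunct1[OF *] assms(2) by (rule vge_ev3)
    moreover have "vge (w ^ n * y ^ 1 * ev3 a b x (snd pq)) k" using conjunct2[OF *] assms(2) by (rule vge_ev3)
    moreover have "1 * w ^ n * evy a b x y pq = w ^ n * y ^ 0 * ev3 a b x (fst pq) + w ^ n * y ^ 1 * ev3 a b x (snd pq)"
      by (simp add: evy_def algebra_simps)
    ultimately show "vge (1 * w ^ n * evy a b x y pq) k" using vge_add by metis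
  qed
  thus ?thesis by (simp add: evw_def)
qed

end

section \<open>Descent along the Frobenius twist\<close>

fun pow3 :: "poly3 \<Rightarrow> nat \<Rightarrow> poly3" where
  "pow3 f 0 = [[[1]]]"
| "pow3 f (Suc n) = mul3 f (pow3 f n)"

lemma ev3_pow: "ev3 a b x (pow3 f n) = ev3 a b x f ^ n"
  by (induction n) (auto simp: ev3_mul, simp add: ev3_def ev2_def ev1_def)

lemma ev3_shift: "ev3 a b x (replicate n [] @ l) = x ^ n * ev3 a b x l"
proof -
  have "lev (ev2 a b) x (replicate n []) = 0"
    by (rule lev_zero[of "\<lambda>c. c = []"]) (auto simp: list_all_iff ev2_def)
  thus ?thesis by (simp add: ev3_def lev_append)
qed

text \<open>The right-hand side \<open>X^3 + c X^2 + a4^p X + c6 a6^p\<close> of the Frobenius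
  twist. The square \<open>Xl2\<close> is passed in already reduced, so that a single further
  reduction suffices for the cube.\<close>

definition cube_check :: "nat \<Rightarrow> int \<Rightarrow> int \<Rightarrow> poly3 \<Rightarrow> polyw \<Rightarrow> polyw \<Rightarrow> polyw \<Rightarrow> polyw" where
  "cube_check p c c6 f R Xl Xl2 = addw (redw f p R (mulw f Xl Xl2)) (addw (mulw f [([[[c]]], [])] Xl2)
     (addw (mulw f [([[replicate p 0 @ [1]]], [])] Xl) [([replicate p [] @ [[c6]]], [])]))"

text \<open>Everything here depends on \<open>p\<close> and on the shape of the equation, but
  neither on \<open>d\<close> nor on the values of the coefficients, so it can be settled by
  evaluation. \<open>D_check1\<close> and \<open>D_check2\<close> say that \<open>X\<close> is a
  constant of the derivation, \<open>curve_check\<close> that \<open>(X, Y)\<close> lies on the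
  twist. \<open>X_check\<close> is what makes the descent terminate: in units of half the pole order
  of \<open>x\<close>, the variables \<open>x\<close>, \<open>y\<close>, \<open>w\<close> have poles
  of order 2, 3, 1, and 1 suffices for \<open>a4\<close> and \<open>a6\<close>.\<close>

locale descent_certificate =
  fixes p :: nat and c c6 :: int and f M L :: poly3 and A :: "int list list" and Xl Yl :: polyw
    and ia ib ix iy iw ja jb jx jy jw :: polyw
  assumes frob_check: "z3 (int p) (add3 (pow3 f ((p - 1) div 2))
      (neg3 (add3 (replicate p [] @ M) (add3 (replicate (p - 1) [] @ [A]) L))))"
    and AS_check1: "zw (int p) (addw (mulw f (derw f ia ib ix iy iw [([A], [])]) [([], []), ([[[1]]], [])])
       (addw (derw f ia ib ix iy iw [([], M)]) (mulw f [([A], [])] iw)))"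
    and AS_check2: "zw (int p) (addw (mulw f (derw f ja jb jx jy jw [([A], [])]) [([], []), ([[[1]]], [])])
       (addw (derw f ja jb jx jy jw [([], M)]) (mulw f [([A], [])] jw)))"
    and D_check1: "zw (int p) (redw f p [([], M), ([A], [])] (derw f ia ib ix iy iw Xl))"
    and D_check2: "zw (int p) (redw f p [([], M), ([A], [])] (derw f ja jb jx jy jw Xl))"
    and curve_check: "zw (int p) (addw (redw f p [([], M), ([A], [])] (mulw f Yl Yl))
       (negw (cube_check p c c6 f [([], M), ([A], [])] Xl (redw f p [([], M), ([A], [])] (mulw f Xl Xl)))))"
    and A_check: "all3 (\<lambda>i j m. i + j \<le> p - 1 \<and> m = 0) [A]"
    and M_check: "all3 (\<lambda>i j m. i + j \<le> p - 1 \<and> m \<le> p) M"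
    and L_check: "all3 (\<lambda>i j m. i + j \<le> p - 1 \<and> m \<le> p - 2) L"
    and X_check: "allw (\<lambda>i j m e n. i + j \<le> p - 1 \<and> i + j + 2 * m + 3 * e + n \<le> 2 * p - 1) Xl"

text \<open>Matches a concrete family with the lists of a certificate. \<open>b4\<close> and
  \<open>b6\<close> are the values of \<open>a4\<close> and \<open>a6\<close> at
  \<open>u = 0\<close>, so that the conditions on the node become statements about
  constants.\<close>

locale certified_family = odd_family p kk a2 x0 a4 a6 nu g0 s +
   descent_certificate p c c6 f M L A Xl Yl ia ib ix iy iw ja jb jx jy jw
  for p :: nat and kk a2 x0 :: "'c::alg_closed_field" and a4 a6 nu g0 :: "'c poly fract" and s :: "'c poly"
    and c c6 :: int and f M L A Xl Yl ia ib ix iy iw ja jb jx jy jw +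
  fixes Am :: "'c poly" and b4 b6 :: 'c
  assumes a2: "a2 = of_int c" and c6: "of_int c6 * a6 ^ p = a6 ^ p"
    and fl: "\<And>x. x ^ 3 + const_fract a2 * x ^ 2 + a4 * x + a6 = ev3 a4 a6 x f"
    and Da: "\<And>x y w. const_fract kk * tder a4 = evw a4 a6 x y w ia + nu * evw a4 a6 x y w ja"
    and Db: "\<And>x y w. const_fract kk * tder a6 = evw a4 a6 x y w ib + nu * evw a4 a6 x y w jb"
    and Dx: "\<And>x y w. 2 * y * w - 2 * x ^ 2 + (2 * nu - 2 * const_fract a2) * x + g0 = evw a4 a6 x y w ix + nu * evw a4 a6 x y w jx"
    and Dy: "\<And>x y w. (3 * x ^ 2 + 2 * const_fract a2 * x + a4) * w - 3 * x * y + (3 * nu - 2 * const_fract a2) * y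
      = evw a4 a6 x y w iy + nu * evw a4 a6 x y w jy"
    and Dw: "\<And>x y w. x * w - y + nu * w = evw a4 a6 x y w iw + nu * evw a4 a6 x y w jw"
    and Am': "Fract Am 1 = Fract s 1 ^ (p - 1) * ev2 a4 a6 A"
    and inj': "\<And>M. degree M \<le> degree s \<Longrightarrow> (\<And>i. coeff (Am * M) (p * i) = 0) \<Longrightarrow> M = 0"
    and b46: "b4 = - 3 * x0 ^ 2 - 2 * a2 * x0" "b6 = x0 ^ 2 * (a2 + 2 * x0)"
    and Ac': "ev2 b4 b6 A * (4 * (a2 + 3 * x0)) ^ ((p - 1) div 2) = 1"
    and node_AS': "\<And>l. l ^ p = ev2 b4 b6 A * l + l * (l ^ 2 - (a2 + 3 * x0)) * ev3 b4 b6 (l ^ 2 - (a2 + 2 * x0)) M"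
begin

lemma char: "of_nat p = (0 :: 'c poly fract)"
  using p(3) CHAR_poly_fract[where 'a = 'c] of_nat_CHAR by metis

lemma curve_list: "on x y \<Longrightarrow> y ^ 2 = ev3 a4 a6 x f"
  using fl[of x] by (simp add: on_def)

lemma ev_const: "evw a b x y w [(q, [])] = ev3 a b x q" "evw a b x y w [([], q)] = y * ev3 a b x q"
  "ev3 a b x [q'] = ev2 a b q'"
  by (simp_all add: evw_def evy_def) (simp_all add: ev3_def)

lemma Nil3: "da3 [] = []" "db3 [] = []" "dx3 [] = []"
  by (simp_all add: da3_def db3_def dx3_def)

lemma frob_list:
  "(x ^ 3 + A2 * x ^ 2 + a4 * x + a6) ^ ((p - 1) div 2)
     = x ^ p * ev3 a4 a6 x M + ev2 a4 a6 A * x ^ (p - 1) + ev3 a4 a6 x L"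
  using z3_ev[OF char frob_check, of a4 a6 x]
  unfolding fl ev3_add ev3_neg ev3_pow ev3_shift ev_const add_eq_0_iff2 minus_minus
  by (simp only: mult.commute add.assoc)

lemma AS_list:
  assumes on: "on x y"
  shows "D (ev2 a4 a6 A) * wP x y + D (y * ev3 a4 a6 x M)
    = - ev2 a4 a6 A * (x * wP x y - y + nu * wP x y)"
proof -
  let ?w = "wP x y"
  have Dx': "D x = evw a4 a6 x y ?w ix + nu * evw a4 a6 x y ?w jx"
    using Dx_eq[OF on nz[OF on]] Dx[of y ?w x] by (simp add: G_def algebra_simps)
  have Dy': "D y = evw a4 a6 x y ?w iy + nu * evw a4 a6 x y ?w jy"
    using Dy_eq[OF on nz[OF on]] Dy[of x ?w y] by (simp add: F_def algebra_simps)
  note cl = curve_list[OF on]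
  have wl: "evw a4 a6 x y ?w [([], []), ([[[1]]], [])] = ?w"
    by (simp add: evw_def evy_def ev3_def ev2_def ev1_def)
  have D1: "D (ev3 a4 a6 x q) = evw a4 a6 x y ?w (derw f ia ib ix iy iw [(q, [])]) + nu * evw a4 a6 x y ?w (derw f ja jb jx jy jw [(q, [])])"
    for q
  proof -
    have z: "evw a b x y w (map (\<lambda>pq. (snd pq, [])) [(q, [])]) = 0" "evw a b x y w (lder addy ([], []) [(q, [])]) = 0" for a b x y w :: "'c poly fract"
      by (simp_all add: evw_def evy_def ev3_def)
    show ?thesis
      unfolding D_ev3 Da[of x y ?w] Db[of x y ?w] Dx' derw_def evw_add evw_mul[OF cl] z
      by (simp add: ev_const Nil3) (simp only: algebra_simps)
  qed
  have D2: "D (y * ev3 a4 a6 x M) = evw a4 a6 x y ?w (derw f ia ib ix iy iw [([], M)]) + nu * evw a4 a6 x y ?w (derw f ja jb jx jy jw [([], M)])"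
  proof -
    have z: "evw a b x y w (lder addy ([], []) [([], M)]) = 0" for a b x y w :: "'c poly fract"
      by (simp_all add: evw_def evy_def ev3_def)
    show ?thesis
      unfolding D_mult D_ev3 Da[of x y ?w] Db[of x y ?w] Dx' Dy' derw_def evw_add evw_mul[OF cl] z
      by (simp add: ev_const Nil3) (simp only: algebra_simps)
  qed
  have "D (ev2 a4 a6 A) * ?w + D (y * ev3 a4 a6 x M) + ev2 a4 a6 A * (x * ?w - y + nu * ?w) = 0"
  proof -
    have *: "(E1 + nu * N1) * ?w + (E2 + nu * N2) + B * (Ew + nu * Nw) = 0"
      if "E1 * ?w + (E2 + B * Ew) = 0" "N1 * ?w + (N2 + B * Nw) = 0" for E1 N1 E2 N2 B Ew Nw
    proof -
      have "(E1 + nu * N1) * ?w + (E2 + nu * N2) + B * (Ew + nu * Nw)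
          = (E1 * ?w + (E2 + B * Ew)) + nu * (N1 * ?w + (N2 + B * Nw))" by (simp add: algebra_simps)
      thus ?thesis unfolding that by simp
    qed
    show ?thesis
      using zw_ev[OF char AS_check1, of a4 a6 x y ?w] zw_ev[OF char AS_check2, of a4 a6 x y ?w]
      unfolding D2 ev_const(3)[of a4 a6 x A, symmetric] D1 Dw[of x ?w y] evw_add evw_mul[OF cl] wl ev_const(1)
      by (rule *)
  qed
  thus ?thesis by (metis add_eq_0_iff2 mult_minus_left)
qed

lemma vge_mono3:
  assumes "place Rr pp" "place.vge Rr pp a4 (- e)" "place.vge Rr pp a6 (- e)" "e \<ge> 0"
    "all3 P l" "\<And>i j m. P i j m \<Longrightarrow> i + j \<le> k \<and> m \<le> k'" "place.vge Rr pp x (- n)" "n \<ge> 0"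
  shows "place.vge Rr pp (ev3 a4 a6 x l) (- n * int k' - e * int k)"
proof -
  interpret place Rr pp by fact
  have "vge (1 * ev3 a4 a6 x l) (- n * int k' - e * int k)"
  proof (rule vge_ev3[OF assms(5)])
    fix i j m assume "P i j m"
    hence b: "i + j \<le> k" "m \<le> k'" using assms(6) by auto
    have "vge (x ^ m * (a6 ^ j * a4 ^ i)) (int m * - n + (int j * - e + int i * - e))"
      by (intro vge_mult vge_power assms)
    moreover have "- n * int k' - e * int k \<le> int m * - n + (int j * - e + int i * - e)"
    proof -
      have "n * int m \<le> n * int k'" "e * int (i + j) \<le> e * int k"
        using b assms by (auto intro: mult_left_mono)
      thus ?thesis by (simp add: algebra_simps)
    qed
    ultimately show "vge (1 * (x ^ m * (a6 ^ j * a4 ^ i))) (- n * int k' - e * int k)"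
      using vge_mono by simp
  qed
  thus ?thesis by simp
qed

lemma residue_ev3:
  assumes "fvge 0 (x - const_fract d) 1"
  shows "fvge 0 (ev3 a4 a6 x l - const_fract (ev3 b4 b6 d l)) 1"
proof -
  interpret place "finR 0" "finpi 0" by (rule place_fin)
  have cR: "vge (const_fract k) 0" for k :: 'c using const_finR by (simp add: vge_0_iff)
  have lv: "vge (lev e v l - const_fract (lev e' v' l)) 1"
    if v: "vge (v - const_fract v') 1" and e: "\<And>c. vge (e c - const_fract (e' c)) 1"
    for e v e' and v' :: 'c and l :: "'z list"
  proof (induction l)
    case (Cons c l)
    have "lev e v (c # l) - const_fract (lev e' v' (c # l)) = (e c - const_fract (e' c))
        + (v - const_fract v') * (lev e v l - const_fract (lev e' v' l)) + (v - const_fract v') * const_fract (lev e' v' l)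
        + (lev e v l - const_fract (lev e' v' l)) * const_fract v'"
      by (simp add: const_fract_add const_fract_mult algebra_simps)
    moreover have "vge ((v - const_fract v') * (lev e v l - const_fract (lev e' v' l))) 1"
      by (rule vge_mult'[OF v Cons]) simp
    moreover have "vge ((v - const_fract v') * const_fract (lev e' v' l)) 1"
      by (rule vge_mult'[OF v cR]) simp
    moreover have "vge ((lev e v l - const_fract (lev e' v' l)) * const_fract v') 1"
      by (rule vge_mult'[OF Cons cR]) simp
    ultimately show ?case using e[of c] vge_add by metis
  qed simp
  show ?thesis unfolding ev3_def ev2_def ev1_def
    by (intro lv assms) (use node_0(1,2) b46 in simp_all)
qed

sublocale hasse_family p kk a2 x0 a4 a6 nu g0 s "ev2 a4 a6 A" "\<lambda>x. ev3 a4 a6 x M" "\<lambda>x. ev3 a4 a6 x L" Am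
  "ev2 b4 b6 A" "\<lambda>x. ev3 b4 b6 x M"
proof (unfold_locales)
  fix x y assume "on x y" thus "D (ev2 a4 a6 A) * wP x y + D (y * ev3 a4 a6 x M) = - ev2 a4 a6 A * (x * wP x y - y + nu * wP x y)"
    by (rule AS_list)
next
  show "(x ^ 3 + A2 * x ^ 2 + a4 * x + a6) ^ ((p - 1) div 2)
     = x ^ p * ev3 a4 a6 x M + ev2 a4 a6 A * x ^ (p - 1) + ev3 a4 a6 x L" for x by (rule frob_list)
next
  show "Fract Am 1 = Fract s 1 ^ (p - 1) * ev2 a4 a6 A" by (rule Am')
next
  fix M assume "degree M \<le> degree s" "\<And>i. coeff (Am * M) (p * i) = 0" thus "M = 0" by (rule inj')
next
  have z: "place.vge Rr pp 0 n" if "place Rr pp" for Rr :: "'c poly fract set" and pp n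
    using place.vge_zero[OF that] .
  fix \<alpha> :: 'c
  show "fvge \<alpha> (ev2 a4 a6 A) 0" if "poly s \<alpha> \<noteq> 0"
    using vge_mono3[OF place_fin _ _ _ A_check, of \<alpha> 0 "p - 1" 0 0 0] reg[OF that] z[OF place_fin] by (simp add: ev_const)
  show "fvge \<alpha> (ev2 a4 a6 A) (- int (p - 1))" if "poly s \<alpha> = 0"
    using vge_mono3[OF place_fin _ _ _ A_check, of \<alpha> 1 "p - 1" 0 0 0] addv[OF that] z[OF place_fin] by (simp add: ev_const)
  show "ivge (ev2 a4 a6 A) 0"
    using vge_mono3[OF place_inf _ _ _ A_check, of 0 "p - 1" 0 0 0] reg_inf z[OF place_inf] by (simp add: ev_const)
next
  show "fvge \<alpha> (ev3 a4 a6 x M) 0" if "poly s \<alpha> \<noteq> 0" "fvge \<alpha> x 0" for \<alpha> x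
    using vge_mono3[OF place_fin _ _ _ M_check, of \<alpha> 0 "p - 1" p x 0] reg[OF that(1)] that by simp
  show "ivge (ev3 a4 a6 x M) 0" if "ivge x 0" for x
    using vge_mono3[OF place_inf _ _ _ M_check, of 0 "p - 1" p x 0] reg_inf that by simp
  show "fvge \<alpha> (ev3 a4 a6 x M) (- int (p - 1))" if "poly s \<alpha> = 0" "fvge \<alpha> x 0" for \<alpha> x
    using vge_mono3[OF place_fin _ _ _ M_check, of \<alpha> 1 "p - 1" p x 0] addv[OF that(1)] that by simp
next
  show "fvge \<alpha> (ev3 a4 a6 x L) (- m * int (p - 2))" if "poly s \<alpha> \<noteq> 0" "m \<ge> 0" "fvge \<alpha> x (- m)" for \<alpha> x m
    using vge_mono3[OF place_fin _ _ _ L_check, of \<alpha> 0 "p - 1" "p - 2" x m] reg[OF that(1)] that by simp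
  show "ivge (ev3 a4 a6 x L) (- m * int (p - 2))" if "m \<ge> 0" "ivge x (- m)" for x m
    using vge_mono3[OF place_inf _ _ _ L_check, of 0 "p - 1" "p - 2" x m] reg_inf that by simp
  show "fvge \<alpha> (ev3 a4 a6 x L) (- m * int (p - 2) - int (p - 1))" if "poly s \<alpha> = 0" "m \<ge> 0" "fvge \<alpha> x (- m)" for \<alpha> x m
    using vge_mono3[OF place_fin _ _ _ L_check, of \<alpha> 1 "p - 1" "p - 2" x m] addv[OF that(1)] that by simp
next
  show "ev2 b4 b6 A * (4 * (a2 + 3 * x0)) ^ ((p - 1) div 2) = 1" by (rule Ac')
  show "fvge 0 (ev2 a4 a6 A - const_fract (ev2 b4 b6 A)) 1"
    using residue_ev3[of 0 0 "[A]"] place.vge_zero[OF place_fin[of "0::'c"], of 1] by (simp add: ev_const)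
  show "fvge 0 (ev3 a4 a6 x M - const_fract (ev3 b4 b6 c M)) 1" if "fvge 0 (x - const_fract c) 1" for x c
    by (rule residue_ev3[OF that])
  show "l ^ p = ev2 b4 b6 A * l + l * (l ^ 2 - (a2 + 3 * x0)) * ev3 b4 b6 (l ^ 2 - (a2 + 2 * x0)) M" for l
    by (rule node_AS')
qed

abbreviation XP where "XP x y \<equiv> evw a4 a6 x y (wP x y) Xl"
abbreviation YP where "YP x y \<equiv> evw a4 a6 x y (wP x y) Yl"

lemma wP_list:
  assumes on: "on x y"
  shows "wP x y ^ p = evw a4 a6 x y (wP x y) [([], M), ([A], [])]"
  using lift_point(1)[OF on] by (simp add: evw_def evy_def ev3_def algebra_simps)

lemma D_XP:
  assumes on: "on x y"
  shows "D (XP x y) = 0"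
proof -
  let ?w = "wP x y" and ?R = "[([], M), ([A], [])]"
  note cl = curve_list[OF on] and red = evw_red[OF curve_list[OF on] wP_list[OF on], symmetric]
  have Dx': "D x = evw a4 a6 x y ?w ix + nu * evw a4 a6 x y ?w jx"
    unfolding lift_point(2)[OF on] by (rule Dx)
  have Dy': "D y = evw a4 a6 x y ?w iy + nu * evw a4 a6 x y ?w jy"
    unfolding lift_point(3)[OF on] F_def by (rule Dy)
  have Dw': "D ?w = evw a4 a6 x y ?w iw + nu * evw a4 a6 x y ?w jw"
    unfolding lift_point(4)[OF on] by (rule Dw)
  have "D (XP x y) = evw a4 a6 x y ?w (derw f ia ib ix iy iw Xl) + nu * evw a4 a6 x y ?w (derw f ja jb jx jy jw Xl)"
    by (rule D_evw[OF cl Da Db Dx' Dy' Dw'])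
  thus ?thesis
    using zw_ev[OF char D_check1, of a4 a6 x y ?w] zw_ev[OF char D_check2, of a4 a6 x y ?w]
    by (simp add: red[of "derw f ia ib ix iy iw Xl"] red[of "derw f ja jb jx jy jw Xl"])
qed

lemma curve_P:
  assumes on: "on x y"
  shows "YP x y ^ 2 = XP x y ^ 3 + A2 * XP x y ^ 2 + a4 ^ p * XP x y + a6 ^ p"
proof -
  let ?w = "wP x y"
  note cl = curve_list[OF on] and red = evw_red[OF curve_list[OF on] wP_list[OF on]]
  have k: "evw a4 a6 x y ?w [([[[c]]], [])] = A2"
    by (simp add: a2 ev_const(1)) (simp add: ev3_def ev2_def ev1_def)
  have l0: "lev of_int v (replicate n 0 @ [1]) = v ^ n" for v :: "'c poly fract" and n
    by (induction n) auto
  have a: "evw a4 a6 x y ?w [([[replicate p 0 @ [1]]], [])] = a4 ^ p"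
    by (simp add: ev_const(1)) (simp add: ev3_def ev2_def ev1_def l0)
  have l1: "lev (ev1 a4) v (replicate n [] @ [[c6]]) = of_int c6 * v ^ n" for v :: "'c poly fract" and n
    by (induction n) (auto simp: ev1_def)
  have b: "evw a4 a6 x y ?w [([replicate p [] @ [[c6]]], [])] = a6 ^ p"
    by (simp add: ev_const(1)) (simp add: ev3_def ev2_def l1 c6)
  show ?thesis using zw_ev[OF char curve_check, of a4 a6 x y ?w]
    unfolding cube_check_def evw_add evw_neg red evw_mul[OF cl] k a b add_eq_0_iff2 minus_minus
    by (simp only: power2_eq_square power3_eq_cube add.assoc mult.assoc)
qed

lemma frob_inj: "u ^ p = v ^ p \<Longrightarrow> u = v" for u v :: "'c poly fract"
proof -
  assume *: "u ^ p = v ^ p"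
  have "u ^ p = (v + (u - v)) ^ p" by simp
  also have "\<dots> = v ^ p + (u - v) ^ p" by (rule frob)
  finally show ?thesis using * p0 by simp
qed

text \<open>Where \<open>x\<close> is regular, \<open>X\<close> has a pole of order at most
  \<open>p - 1\<close>, too small for a pole of its \<open>p\<close>-th root \<open>z\<close>. At a
  pole of \<open>x\<close> of order \<open>2 q\<close>, \<open>X\<close> has a pole of order at most
  \<open>q (2 p - 1) < 2 q p\<close>, so that of \<open>z\<close> is smaller than
  \<open>2 q\<close>.\<close>

lemma local_decrease:
  fixes Rr :: "'c poly fract set" and pp :: "'c poly fract"
  assumes P: "place Rr pp" and on: "on x y"
    and a: "place.vge Rr pp a4 (-1)" "place.vge Rr pp a6 (-1)"
    and loc: "(place.vge Rr pp x 0 \<and> place.vge Rr pp y 0 \<and> place.vge Rr pp (wP x y) 0) \<or>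
      (\<exists>n\<ge>1. place.val Rr pp x (- 2 * n) \<and> place.val Rr pp y (- 3 * n) \<and> place.vge Rr pp (rho x y) 0)"
    and z: "z ^ p = XP x y" "z \<notin> Rr"
  shows "\<exists>m n. 0 < m \<and> m < n \<and> place.val Rr pp z (- int m) \<and> place.val Rr pp x (- int n)"
proof -
  interpret place Rr pp by fact
  have "\<not> vge z 0" using z by (simp add: vge_0_iff)
  then obtain m' where m': "m' < 0" "val z m'" using not_vge_val by blast
  have zp: "val (XP x y) (int p * m')" using val_power[OF m'(2)] z(1) by metis
  have pi: "int (p - 1) = int p - 1" "int (2 * p - 1) = 2 * int p - 1" using p0 by auto
  from loc show ?thesis
  proof (elim disjE exE conjE)
    assume *: "vge x 0" "vge y 0" "vge (wP x y) 0"
    have "vge (XP x y) (- int (p - 1))"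
    proof (rule vge_evw[OF X_check])
      fix i j m e n :: nat
      assume b: "i + j \<le> p - 1 \<and> i + j + 2 * m + 3 * e + n \<le> 2 * p - 1"
      have "vge (wP x y ^ n * y ^ e * (x ^ m * (a6 ^ j * a4 ^ i)))
          (int n * 0 + int e * 0 + (int m * 0 + (int j * - 1 + int i * - 1)))"
        by (intro vge_mult vge_power * a)
      thus "vge (wP x y ^ n * y ^ e * (x ^ m * (a6 ^ j * a4 ^ i))) (- int (p - 1))"
        by (rule vge_mono) (use b in linarith)
    qed
    hence "- int (p - 1) \<le> int p * m'" using val_vge_le[OF zp] by blast
    moreover have "int p * m' \<le> int p * - 1" using m'(1) by (intro mult_left_mono) auto
    ultimately show ?thesis using pi by simp
  next
    fix q :: int assume *: "q \<ge> 1" "val x (- 2 * q)" "val y (- 3 * q)" "vge (rho x y) 0"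
    have w: "vge (wP x y) (- q)"
    proof -
      have "vge (y / x) (- q)" using vge_divide'[OF val_imp_vge[OF *(3)] *(2)] by simp
      moreover have "vge (rho x y) (- q)" using vge_mono[OF *(4)] * by simp
      ultimately have "vge (y / x + rho x y) (- q)" by (rule vge_add)
      thus ?thesis by (simp add: rho_def)
    qed
    have a': "vge a4 (- q)" "vge a6 (- q)" using vge_mono[OF a(1)] vge_mono[OF a(2)] * by auto
    have "vge (XP x y) (- q * int (2 * p - 1))"
    proof (rule vge_evw[OF X_check])
      fix i j m e n :: nat
      assume b: "i + j \<le> p - 1 \<and> i + j + 2 * m + 3 * e + n \<le> 2 * p - 1"
      have "vge (wP x y ^ n * y ^ e * (x ^ m * (a6 ^ j * a4 ^ i)))
          (int n * - q + int e * (- 3 * q) + (int m * (- 2 * q) + (int j * - q + int i * - q)))"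
        by (intro vge_mult vge_power w a' val_imp_vge *)
      moreover have "- q * int (2 * p - 1) \<le> int n * - q + int e * (- 3 * q) + (int m * (- 2 * q) + (int j * - q + int i * - q))"
      proof -
        have "q * int (i + j + 2 * m + 3 * e + n) \<le> q * int (2 * p - 1)"
          using b * by (intro mult_left_mono) auto
        thus ?thesis by (simp add: algebra_simps)
      qed
      ultimately show "vge (wP x y ^ n * y ^ e * (x ^ m * (a6 ^ j * a4 ^ i))) (- q * int (2 * p - 1))"
        using vge_mono by blast
    qed
    hence "- q * int (2 * p - 1) \<le> int p * m'" using val_vge_le[OF zp] by blast
    hence "int p * (- m') \<le> int p * (2 * q) - q" unfolding pi by (simp add: algebra_simps)
    hence "int p * (- m') < int p * (2 * q)" using * by linarith
    hence "- m' < 2 * q" using p0 mult_less_cancel_left_pos[of "int p" "- m'" "2 * q"] by simp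
    moreover have "val z (- int (nat (- m')))" "val x (- int (nat (2 * q)))" using m' * by simp_all
    ultimately show ?thesis using m' by (intro exI[of _ "nat (- m')"] exI[of _ "nat (2 * q)"]) auto
  qed
qed

lemma descend:
  assumes on: "on x y"
  obtains z t where "on z t" "z ^ p = XP x y" "(\<exists>\<alpha>. x \<notin> finR \<alpha>) \<or> x \<notin> infR \<Longrightarrow> npoles z < npoles x"
proof -
  have "tder (XP x y) = 0" using D_XP[OF on] kk(1) by (simp add: const_fract_eq_0)
  then obtain z where z: "XP x y = z ^ p" using tder_eq_0[OF p(1,3)] by blast
  \<comment> \<open>That \<open>Y\<close> is a constant of the derivation needs no certificate of
    its own: the equation of the twist gives \<open>2 Y D Y = 0\<close>.\<close>
  have "D (YP x y ^ 2) = D (XP x y ^ 3 + A2 * XP x y ^ 2 + a4 ^ p * XP x y + a6 ^ p)"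
    unfolding curve_P[OF on] ..
  also have "\<dots> = 0"
    unfolding D_add D_mult D_pth D_power[of "XP x y"] D_XP[OF on] Da2 by simp
  finally have "2 * YP x y * D (YP x y) = 0" by (simp add: D_power)
  hence "YP x y = 0 \<or> D (YP x y) = 0" using two_nz by simp
  hence "D (YP x y) = 0" using D_0 by metis
  hence "tder (YP x y) = 0" using kk(1) by (simp add: const_fract_eq_0)
  then obtain t where t: "YP x y = t ^ p" using tder_eq_0[OF p(1,3)] by blast
  have A2p: "A2 ^ p = A2" using x0(2) by (simp add: const_fract_power[symmetric])
  have pc: "(u ^ n) ^ p = (u ^ p) ^ n" for u :: "'c poly fract" and n by (simp add: power_mult[symmetric] mult.commute)
  have "(t ^ 2) ^ p = (z ^ 3 + A2 * z ^ 2 + a4 * z + a6) ^ p"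
    unfolding frob power_mult_distrib A2p pc using curve_P[OF on] unfolding z t .
  hence "on z t" unfolding on_def by (rule frob_inj)
  moreover have "z ^ p = XP x y" using z by simp
  moreover have "npoles z < npoles x" if "(\<exists>\<alpha>. x \<notin> finR \<alpha>) \<or> x \<notin> infR"
  proof (rule npoles_less[OF _ _ that])
    fix \<alpha> assume zz: "z \<notin> finR \<alpha>"
    interpret place "finR \<alpha>" "finpi \<alpha>" by (rule place_fin)
    have "vge a4 (-1)" "vge a6 (-1)"
      using reg[of \<alpha>] addv[of \<alpha>] vge_mono[of a4 0 "-1"] vge_mono[of a6 _ "-1"] by fastforce+
    thus "\<exists>m n. 0 < m \<and> m < n \<and> val z (- int m) \<and> val x (- int n)"
      using local_decrease[OF place_fin on _ _ fin_local(1)[OF on] _ zz] z by auto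
  next
    assume zz: "z \<notin> infR"
    interpret place "infR :: 'c poly fract set" infpi by (rule place_inf)
    have "vge a4 (-1)" "vge a6 (-1)"
      using reg_inf vge_mono[of a4 0 "-1"] vge_mono[of a6 0 "-1"] by fastforce+
    thus "\<exists>m n. 0 < m \<and> m < n \<and> val z (- int m) \<and> val x (- int n)"
      using local_decrease[OF place_inf on _ _ inf_local(1)[OF on] _ zz] z by auto
  qed
  ultimately show ?thesis using that by blast
qed

lemma no_poles:
  assumes on: "on x y" and "\<And>\<alpha>. x \<in> finR \<alpha>" "x \<in> infR"
  obtains k d where "x = const_fract k" "y = const_fract d"
proof -
  have "y \<in> finR \<alpha>" for \<alpha>
  proof -
    interpret place "finR \<alpha>" "finpi \<alpha>" by (rule place_fin)
    show ?thesis using fin_local(1)[OF on, of \<alpha>] assms(2)[of \<alpha>] val_vge_le[of x _ 0] by (force simp: vge_0_iff)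
  qed
  moreover have "y \<in> infR"
  proof -
    interpret place "infR :: 'c poly fract set" infpi by (rule place_inf)
    show ?thesis using inf_local(1)[OF on] assms(3) val_vge_le[of x _ 0] by (force simp: vge_0_iff)
  qed
  ultimately show ?thesis using that regular_const[of x] regular_const[of y] assms(2,3) by metis
qed

text \<open>\<open>Q\<close> is the property of \<open>x\<close> to be shown. It is
  \<open>False\<close> when there is no affine point at all; when torsion survives it is the value
  of \<open>x\<close> there, and \<open>step\<close> then has to bring it back from the root
  \<open>z\<close> to \<open>x\<close>.\<close>

theorem descent:
  assumes on: "on x y"
    and const: "\<And>k d. on (const_fract k) (const_fract d) \<Longrightarrow> Q (const_fract k)"
    and step: "\<And>x y z. on x y \<Longrightarrow> z ^ p = XP x y \<Longrightarrow> Q z \<Longrightarrow> Q x"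
  shows "Q x"
  using on
proof (induction "npoles x" arbitrary: x y rule: less_induct)
  case less
  obtain z t where z: "on z t" "z ^ p = XP x y" "(\<exists>\<alpha>. x \<notin> finR \<alpha>) \<or> x \<notin> infR \<Longrightarrow> npoles z < npoles x"
    using descend[OF less.prems] by blast
  show ?case
  proof (cases "(\<exists>\<alpha>. x \<notin> finR \<alpha>) \<or> x \<notin> infR")
    case True
    thus ?thesis using less.hyps[OF z(3) z(1)] step[OF less.prems z(2)] by blast
  next
    case False
    then obtain k d where "x = const_fract k" "y = const_fract d" using no_poles[OF less.prems] by blast
    thus ?thesis using const less.prems by blast
  qed
qed

end

text \<open>The coordinates $X$, $Y$ on the Frobenius twist were found by linear algebra, as polynomials of weight
  $2p$ and $3p$ that are annihilated by the derivation.  In the short form every term of an image under the derivation is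
  either of weight two higher or a multiple of $\nu$; the lists \<open>short_i*\<close> and \<open>short_j*\<close> are these two parts.\<close>

definition A_3 :: "int list list" where
  "A_3 =
    [[1]]"
definition M_3 :: "poly3" where
  "M_3 =
    [[[1]]]"
definition L_3 :: "poly3" where
  "L_3 =
    [[], [[0, 1]]]"
definition X_3 :: "polyw" where
  "X_3 =
    [([[], [[0, -1]], [[-1]]], []), ([], [[[-1]]]), ([[[0, 1]], [[-1]]], [])]"
definition Y_3 :: "polyw" where
  "Y_3 =
    [([], [[[0, 1]], [[-1]]]), ([[[0, 1, -1]], [[-1, -1]], [[-1]]], []), ([], [[[-1]]])]"

definition A_5 :: "int list list" where
  "A_5 =
    [[0, 2]]"
definition M_5 :: "poly3" where
  "M_5 =
    [[], [[1]]]"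
definition L_5 :: "poly3" where
  "L_5 =
    [[[], [], [1]], [[], [0, 2]], [[0, 0, 1]], [[], [2]]]"
definition X_5 :: "polyw" where
  "X_5 =
    [([[[], [0, -1]], [[0, 0, -1]], [[], [-1]], [[0, -2]]], []), ([], [[[], [1]], [[0, -2]]]), ([[[0, 0, 2]],
    [[], [-2]], [[0, -2]]], []), ([], [[[0, -2]]]), ([[[], [2]], [[0, -2]]], [])]"
definition Y_5 :: "polyw" where
  "Y_5 =
    [([], [[[0, 0, 0, 2], [], [1]], [[], [0, 1]], [[0, 0, -1]]]), ([[[], [0, 0, 2]], [[0, 0, 0, 2], [], [1]],
    [[], [0, 2]], [[0, 0, -1]]], []), ([], [[[], [0, -2]], [[0, 0, -1]]]), ([[[0, 0, 0, 2], [], [-2]], [[], [0,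
    -1]], [[0, 0, -1]]], []), ([], [[[0, 0, -1]]])]"

definition A_7 :: "int list list" where
  "A_7 =
    [[], [3]]"
definition M_7 :: "poly3" where
  "M_7 =
    [[[0, 3]], [], [[1]]]"
definition L_7 :: "poly3" where
  "L_7 =
    [[[], [], [], [1]], [[], [], [0, 3]], [[], [0, 0, 3]], [[0, 0, 0, 1], [], [3]], [[], [0, -1]], [[0, 0, 3]]]"
definition X_7 :: "polyw" where
  "X_7 =
    [([[[], [0, 0, -2]], [[0, 0, 0, -2], [], [-2]], [[], [0, -1]], [[0, 0, -1]], [[], [-3]]], []), ([], [[[], [0,
    -3]], [[0, 0, 2]], [[], [-3]]]), ([[[0, 0, 0, -3], [], [-2]], [], [[0, 0, -2]], [[], [-3]]], []), ([], [[[0,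
    0, 1]], [[], [-3]]]), ([[[], [0, -2]], [[0, 0, -3]], [[], [-3]]], []), ([], [[[], [-3]]]), ([[[0, 0, 3]],
    [[], [-3]]], [])]"
definition Y_7 :: "polyw" where
  "Y_7 =
    [([], [[[], [0, 0, 0, -2], [], [-1]], [[0, 0, 0, 0, 3]], [[], [0, 0, -2]], [[], [], [2]]]), ([[[0, 0, 0, 0,
    0, -2], [], [0, 0, 3]], [[], [], [], [3]], [[0, 0, 0, 0, 1], [], [0, 1]], [[], [0, 0, 3]], [[], [], [2]]],
    []), ([], [[[0, 0, 0, 0, 1]], [[], [0, 0, 1]], [[], [], [2]]]), ([[[], [0, 0, 0, -3], [], [2]], [[0, 0, 0, 0,
    3], [], [0, 1]], [[], [0, 0, -1]], [[], [], [2]]], []), ([], [[[], [0, 0, -3]], [[], [], [2]]]), ([[[0, 0, 0,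
    0, -1], [], [0, 1]], [[], [0, 0, 2]], [[], [], [2]]], []), ([], [[[], [], [2]]])]"

definition A_11 :: "int list list" where
  "A_11 =
    [[], [0, -2]]"
definition M_11 :: "poly3" where
  "M_11 =
    [[[0, 0, -1]], [[], [5]], [[0, 5]], [], [[1]]]"
definition L_11 :: "poly3" where
  "L_11 =
    [[[], [], [], [], [], [1]], [[], [], [], [], [0, 5]], [[], [], [], [0, 0, -1]], [[], [], [0, 0, 0, -1], [],
    [5]], [[], [0, 0, 0, 0, 5], [], [0, -2]], [[0, 0, 0, 0, 0, 1], [], [0, 0, -3]], [[], [0, 0, 0, -2], [],
    [-1]], [[0, 0, 0, 0, 5], [], [0, -3]], [[], [0, 0, -3]], [[0, 0, 0, -1], [], [-1]]]"
definition X_11 :: "polyw" where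
  "X_11 =
    [([[[], [0, 0, 0, 0, 5], [], [0, 4]], [[0, 0, 0, 0, 0, 5], [], [0, 0, -4]], [[], [0, 0, 0, 2], [], [-3]],
    [[0, 0, 0, 0, 4], [], [0, 1]], [[], [0, 0, 2]], [[0, 0, 0, -2], [], [-2]], [[], [0, 2]]], []), ([], [[[], [],
    [], [-2]], [[0, 0, 0, 0, -5], [], [0, 1]], [[], [0, 0, -5]], [[0, 0, 0, -3], [], [-3]], [[], [0, 2]]]),
    ([[[0, 0, 0, 0, 0, 1], [], [0, 0, 2]], [[], [0, 0, 0, -5], [], [4]], [[0, 0, 0, 0, -1], [], [0, 4]], [[], [0,
    0, 4]], [[0, 0, 0, -4], [], [-4]], [[], [0, 2]]], []), ([], [[[0, 0, 0, 0, -2]], [[], [0, 0, 3]], [[0, 0, 0,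
    -5], [], [-5]], [[], [0, 2]]]), ([[[], [0, 0, 0, 3], [], [2]], [[0, 0, 0, 0, -4], [], [0, 2]], [[], [0, 0,
    -4]], [[0, 0, 0, 5], [], [5]], [[], [0, 2]]], []), ([], [[[], [0, 0, 1]], [[0, 0, 0, 4], [], [4]], [[], [0,
    2]]]), ([[[0, 0, 0, 0, -2], [], [0, -1]], [], [[0, 0, 0, 3], [], [3]], [[], [0, 2]]], []), ([], [[[0, 0, 0,
    2], [], [2]], [[], [0, 2]]]), ([[[], [0, 0, 5]], [[0, 0, 0, 1], [], [1]], [[], [0, 2]]], []), ([], [[[], [0,
    2]]]), ([[[0, 0, 0, -1], [], [-1]], [[], [0, 2]]], [])]"
definition Y_11 :: "polyw" where
  "Y_11 =
    [([], [[[], [0, 0, 0, 0, 0, 0, -1], [], [0, 0, 0, 4], [], [1]], [[0, 0, 0, 0, 0, 0, 0, -3], [], [0, 0, 0, 0,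
    -1], [], [0, 2]], [[], [0, 0, 0, 0, 0, 5], [], [0, 0, 4]], [[0, 0, 0, 0, 0, 0, -4], [], [0, 0, 0, 3], [],
    [-4]], [[], [0, 0, 0, 0, -2], [], [0, -2]], [[], [], [0, 0, 4]]]), ([[[0, 0, 0, 0, 0, 0, 0, 0, -1], [], [0,
    0, 0, 0, 0, -2], [], [0, 0, -2]], [[], [0, 0, 0, 0, 0, 0, 3], [], [0, 0, 0, -1], [], [-4]], [[0, 0, 0, 0, 0,
    0, 0, 1], [], [0, 0, 0, 0, -1], [], [0, 2]], [[], [0, 0, 0, 0, 0, 3], [], [0, 0, 4]], [[0, 0, 0, 0, 0, 0, 4],
    [], [0, 0, 0, -1], [], [4]], [[], [0, 0, 0, 0, -4], [], [0, -4]], [[], [], [0, 0, 4]]], []), ([], [[[0, 0, 0,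
    0, 0, 0, 0, 3], [], [0, 0, 0, 0, 4], [], [0, -3]], [[], [0, 0, 0, 0, 0, 2], [], [0, 0, -5]], [[0, 0, 0, 0, 0,
    0, 2], [], [0, 0, 0, 4], [], [2]], [[], [0, 0, 0, 0, 5], [], [0, 5]], [[], [], [0, 0, 4]]]), ([[[], [0, 0, 0,
    0, 0, 0, 3], [], [0, 0, 0, -4], [], [-4]], [[0, 0, 0, 0, 0, 0, 0, -3], [], [0, 0, 0, 0, 5], [], [0, -5]],
    [[], [0, 0, 0, 0, 0, 5], [], [0, 0, 3]], [[0, 0, 0, 0, 0, 0, 1], [], [0, 0, 0, 4], [], [1]], [[], [0, 0, 0,
    0, 3], [], [0, 3]], [[], [], [0, 0, 4]]], []), ([], [[[], [0, 0, 0, 0, 0, -5], [], [0, 0, -4]], [[0, 0, 0, 0,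
    0, 0, 1], [], [0, 0, 0, 2], [], [1]], [[], [0, 0, 0, 0, 1], [], [0, 1]], [[], [], [0, 0, 4]]]), ([[[0, 0, 0,
    0, 0, 0, 0, -5], [], [0, 0, 0, 0, -4]], [[], [], [], [0, 0, 3]], [[0, 0, 0, 0, 0, 0, 2], [], [0, 0, 0, -5],
    [], [2]], [[], [0, 0, 0, 0, -1], [], [0, -1]], [[], [], [0, 0, 4]]], []), ([], [[[0, 0, 0, 0, 0, 0, 4], [],
    [0, 0, 0, -3], [], [4]], [[], [0, 0, 0, 0, -3], [], [0, -3]], [[], [], [0, 0, 4]]]), ([[[], [0, 0, 0, 0, 0,
    4], [], [0, 0, -3]], [[0, 0, 0, 0, 0, 0, -4], [], [0, 0, 0, 5], [], [-4]], [[], [0, 0, 0, 0, -5], [], [0,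
    -5]], [[], [], [0, 0, 4]]], []), ([], [[[], [0, 0, 0, 0, 4], [], [0, 4]], [[], [], [0, 0, 4]]]), ([[[0, 0, 0,
    0, 0, 0, 5], [], [0, 0, 0, 1], [], [5]], [[], [0, 0, 0, 0, 2], [], [0, 2]], [[], [], [0, 0, 4]]], []), ([],
    [[[], [], [0, 0, 4]]])]"

definition short_f :: poly3 where "short_f = [[[], [1]], [[0, 1]], [], [[1]]]"
definition short_ia :: polyw where "short_ia = [([[[], [-6]]], [])]"
definition short_ib :: "int \<Rightarrow> polyw" where "short_ib k = [([[[0, 0, - k]]], [])]"
definition short_ix :: "int \<Rightarrow> polyw" where "short_ix k = [([[[0, k]], [], [[-2]]], []), ([], [[[2]]])]"
definition short_iy :: polyw where "short_iy = [([], [[], [[-3]]]), ([[[0, 1]], [], [[3]]], [])]"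
definition short_iw :: polyw where "short_iw = [([], [[[-1]]]), ([[], [[1]]], [])]"
definition short_ja :: polyw where "short_ja = [([[[0, 4]]], [])]"
definition short_jb :: polyw where "short_jb = [([[[], [6]]], [])]"
definition short_jx :: polyw where "short_jx = [([[], [[2]]], [])]"
definition short_jy :: polyw where "short_jy = [([], [[[3]]])]"
definition short_jw :: polyw where "short_jw = [([], []), ([[[1]]], [])]"

text \<open>The argument of \<open>short_ib\<close> and \<open>short_ix\<close> is
  \<open>-4/3\<close> modulo \<open>p\<close>, thus 2, 1, 6 for 5, 7, 11: for \<open>a2 = 0\<close>
  the relation \<open>rel\<close> reads \<open>g0 = - 4/3 a4\<close>.\<close>

lemma certificate_5: "descent_certificate 5 0 1 short_f M_5 L_5 A_5 X_5 Y_5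
    short_ia (short_ib 2) (short_ix 2) short_iy short_iw short_ja short_jb short_jx short_jy short_jw"
  by (intro descent_certificate.intro) code_simp+

lemma certificate_7: "descent_certificate 7 0 1 short_f M_7 L_7 A_7 X_7 Y_7
    short_ia (short_ib 1) (short_ix 1) short_iy short_iw short_ja short_jb short_jx short_jy short_jw"
  by (intro descent_certificate.intro) code_simp+

lemma certificate_11: "descent_certificate 11 0 1 short_f M_11 L_11 A_11 X_11 Y_11
    short_ia (short_ib 6) (short_ix 6) short_iy short_iw short_ja short_jb short_jx short_jy short_jw"
  by (intro descent_certificate.intro) code_simp+

text \<open>In characteristic 3 the family has \<open>a2 = 1\<close>, \<open>a6 = 0\<close>,
  \<open>nu = - a4\<close> and \<open>g0 = 0\<close>. All derivatives are thus polynomials in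
  \<open>a4\<close>, \<open>x\<close>, \<open>y\<close>, \<open>w\<close>, and the lists for the
  multiples of \<open>nu\<close> are empty.\<close>

lemma certificate_3: "descent_certificate 3 1 0 [[], [[0, 1]], [[1]], [[1]]] M_3 L_3 A_3 X_3 Y_3
    [([[[0, 1, -1]]], [])] [] [([[], [[-2, -2]], [[-2]]], []), ([], [[[2]]])]
    [([], [[[-2, -3]], [[-3]]]), ([[[0, 1]], [[2]], [[3]]], [])] [([], [[[-1]]]), ([[[0, -1]], [[1]]], [])]
    [] [] [] [] []"
  by (intro descent_certificate.intro) code_simp+

section \<open>The families in odd characteristic\<close>

definition spoly :: "nat \<Rightarrow> 'a::field \<Rightarrow> 'a poly" where "spoly d c = monom 1 d - [:c:]"

definition tt :: "nat \<Rightarrow> 'a::field poly fract" where "tt d = Fract (monom 1 d) 1"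

definition sg :: "nat \<Rightarrow> 'a::field \<Rightarrow> 'a poly fract" where "sg d c = inverse (tt d - const_fract c)"

lemma poly_spoly: "poly (spoly d c) \<alpha> = \<alpha> ^ d - c"
  by (simp add: spoly_def poly_monom)

lemma degree_spoly: "d > 0 \<Longrightarrow> degree (spoly d c) = d"
proof -
  assume d: "d > 0"
  have "degree (- [:c:] + monom 1 d) = degree (monom (1::'a) d)"
    by (rule degree_add_eq_right) (use d in \<open>simp add: degree_monom_eq\<close>)
  moreover have "- [:c:] + monom 1 d = spoly d c" by (simp add: spoly_def)
  ultimately show ?thesis by (simp add: degree_monom_eq)
qed

lemma spoly_nz: "d > 0 \<Longrightarrow> spoly d c \<noteq> 0"
  using degree_spoly[of d c] by auto

lemma Fract_spoly: "Fract (spoly d c) 1 = tt d - const_fract c"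
  by (simp add: spoly_def tt_def const_fract_def)

lemma sg_Fract: "sg d c = Fract 1 (spoly d c)"
  unfolding sg_def Fract_spoly[symmetric] by simp

lemma sg_mult: "d > 0 \<Longrightarrow> sg d c * (tt d - const_fract c) = 1"
proof -
  assume "d > 0"
  hence "tt d - const_fract c \<noteq> 0"
    unfolding Fract_spoly[symmetric] using spoly_nz[of d c] by (simp add: Zero_fract_def eq_fract)
  thus ?thesis by (simp add: sg_def)
qed

lemma fval_poly: "poly f \<alpha> \<noteq> 0 \<Longrightarrow> fval \<alpha> (Fract f 1) 0"
proof -
  assume f: "poly f \<alpha> \<noteq> 0"
  have "fvge \<alpha> (Fract (f - [:poly f \<alpha>:]) 1) 1" by (rule fvge_poly_root) simp
  hence "fval \<alpha> (const_fract (poly f \<alpha>) + Fract (f - [:poly f \<alpha>:]) 1) 0"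
    using place.val_add[OF place_fin fval_const[OF f]] by simp
  thus ?thesis by (simp add: const_fract_def)
qed

lemma tt_unit: "\<alpha> \<noteq> 0 \<Longrightarrow> fval \<alpha> (tt d) 0"
  unfolding tt_def by (rule fval_poly) (simp add: poly_monom)

lemma sg_unit: "\<alpha> ^ d \<noteq> c \<Longrightarrow> fval \<alpha> (sg d c) 0"
  using place.val_inverse[OF place_fin fval_poly[of "spoly d c" \<alpha>]]
  by (simp add: sg_def Fract_spoly poly_spoly)

text \<open>The pole is simple because \<open>u^d - c\<close> is separable: its derivative at the
  root is \<open>d\<close> times a power of the root, and \<open>d\<close> is non-zero in the
  field.\<close>

lemma sg_pole:
  assumes "\<alpha> ^ d = c" "c \<noteq> 0" "of_nat d \<noteq> (0::'a::field)"
  shows "fval (\<alpha>::'a) (sg d c) (- 1)"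
proof -
  interpret place "finR \<alpha>" "finpi \<alpha>" by (rule place_fin)
  have "poly (spoly d c) \<alpha> = 0" using assms by (simp add: poly_spoly)
  then obtain q where q: "spoly d c = [:-\<alpha>, 1:] * q" using poly_eq_0_iff_dvd by blast
  have "d \<noteq> 0" using assms(3) by (metis of_nat_0)
  hence \<alpha>: "\<alpha> \<noteq> 0" using assms(1,2) by (auto simp: power_0_left)
  have "poly q \<alpha> = poly (pderiv ([:-\<alpha>, 1:] * q)) \<alpha>"
    unfolding pderiv_mult by (simp add: pderiv_pCons)
  also have "\<dots> = of_nat d * \<alpha> ^ (d - 1)" unfolding q[symmetric] spoly_def
    by (simp add: pderiv_diff pderiv_monom poly_monom pderiv_pCons)
  finally have "poly q \<alpha> \<noteq> 0" using assms(3) \<alpha> by simp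
  hence "val (finpi \<alpha> * Fract q 1) (1 + 0)" by (intro val_mult val_pi fval_poly)
  moreover have "finpi \<alpha> * Fract q 1 = tt d - const_fract c"
    unfolding Fract_spoly[symmetric] q finpi_def by simp
  ultimately show ?thesis using val_inverse by (fastforce simp: sg_def)
qed

lemma sg_inf:
  fixes c :: "'a::field"
  assumes "d > 0" shows "ivge (sg d c) 1"
proof -
  interpret place "infR :: 'a poly fract set" infpi by (rule place_inf)
  have "vge (Fract [:0, 1:] (spoly d c)) 0"
    unfolding vge_0_iff by (rule infR_I) (use assms degree_spoly[of d c] spoly_nz[of d c] in auto)
  hence "vge (infpi * Fract [:0, 1:] (spoly d c)) (1 + 0)"
    by (rule vge_mult[OF val_imp_vge[OF val_pi]])
  moreover have "infpi * Fract [:0, 1:] (spoly d c) = sg d c"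
    unfolding infpi_def sg_Fract mult_fract using spoly_nz[OF assms, of c] by (subst eq_fract) auto
  ultimately show ?thesis by simp
qed

lemma sg_0:
  fixes c :: "'a::field"
  assumes "d > 0" "c \<noteq> 0" shows "fvge 0 (sg d c + const_fract (1 / c)) 1"
proof -
  interpret place "finR (0::'a)" "finpi 0" by (rule place_fin)
  have "const_fract c \<noteq> 0" using assms by (simp add: const_fract_eq_0)
  hence "sg d c + const_fract (1 / c) = sg d c * (tt d * const_fract (1 / c)) + const_fract (1 / c) * (1 - sg d c * (tt d - const_fract c))"
    using assms(2) by (simp add: const_fract_divide algebra_simps)
  hence e: "sg d c + const_fract (1 / c) = sg d c * (tt d * const_fract (1 / c))"
    using sg_mult[OF assms(1), of c] by simp
  have "vge (tt d) 1" unfolding tt_def by (rule fvge_poly_root) (use assms in \<open>simp add: poly_monom power_0_left\<close>)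
  moreover have "vge (sg d c) 0" by (rule val_imp_vge[OF sg_unit]) (use assms in \<open>simp add: power_0_left\<close>)
  moreover have "vge (const_fract (1 / c)) 0" using const_finR by (simp add: vge_0_iff)
  ultimately have "vge (sg d c * (tt d * const_fract (1 / c))) (0 + (1 + 0))" by (intro vge_mult)
  thus ?thesis unfolding e by simp
qed

lemma tder_tt: "tder (tt d) = of_nat d * tt d"
proof -
  have "tpoly (monom 1 d) = smult (of_nat d) (monom (1::'a) d)"
    by (rule poly_eqI) (auto simp: coeff_tpoly)
  moreover have "Fract (smult (of_nat d) (monom 1 d)) 1 = const_fract (of_nat d) * tt d"
    by (simp add: const_fract_def tt_def del: const_fract_of_nat)
  ultimately show ?thesis by (simp add: tt_def tder_poly)
qed

text \<open>A Riccati equation, which turns the differential system into an identity between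
  polynomials in such functions. With \<open>kk = kap / d\<close> the factor
  \<open>kk * of_nat d\<close> is \<open>kap\<close>, and \<open>d\<close> disappears.\<close>

lemma D_sg:
  assumes "d > 0"
  shows "const_fract kk * tder (sg d c) = - const_fract (kk * of_nat d) * (sg d c + const_fract c * sg d c ^ 2)"
proof -
  interpret derivation "\<lambda>x. const_fract kk * tder x" by (rule derivation_tder)
  have n: "tt d - const_fract c \<noteq> 0" using sg_mult[OF assms, of c] by auto
  have "const_fract kk * tder (tt d - const_fract c) = const_fract (kk * of_nat d) * tt d"
    using D_diff[of "tt d" "const_fract c"] by (simp add: tder_tt const_fract_mult)
  hence "const_fract kk * tder (sg d c) = - (const_fract (kk * of_nat d) * tt d) * sg d c ^ 2"
    using D_inverse[OF n] by (simp add: sg_def power_inverse[symmetric] field_simps)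
  moreover have "tt d * sg d c ^ 2 = sg d c * (sg d c * (tt d - const_fract c)) + const_fract c * sg d c ^ 2"
    by (simp add: algebra_simps power2_eq_square)
  hence "tt d * sg d c ^ 2 = sg d c + const_fract c * sg d c ^ 2" using sg_mult[OF assms, of c] by simp
  ultimately show ?thesis by (metis mult.assoc mult_minus_left)
qed

text \<open>All coefficients have the form \<open>l0 + l1 / (t - 1) + l2 / (t - c2)\<close>, written
  \<open>lin l0 l1 l2\<close>. The flag \<open>two\<close> tells whether there are additive fibres
  over \<open>t = c2\<close> besides those over \<open>t = 1\<close>; without it \<open>c2\<close>
  is any value other than 0 and 1. The scale \<open>kap\<close> is fixed by each family through its
  differential system.\<close>

locale rational_pencil =
  fixes d :: nat and c2 :: "'c::alg_closed_field" and two :: bool and p :: nat and kap kk :: 'c and s :: "'c poly"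
  assumes d: "d > 0" "coprime d p" and p: "prime p" "odd p" "CHAR('c) = p"
    and c2: "c2 \<noteq> 0" "c2 \<noteq> 1"
    and kap: "kap \<noteq> 0" "kap ^ p = kap" "kk = kap / of_nat d"
    and s: "s = spoly d 1 * (if two then spoly d c2 else 1)"
begin

abbreviation c where "c \<equiv> const_fract :: 'c \<Rightarrow> _"
definition lin where "lin l0 l1 l2 = c l0 + c l1 * sg d 1 + c l2 * sg d c2"

lemma dnz: "of_nat d \<noteq> (0::'c)"
proof
  assume "of_nat d = (0::'c)"
  hence "p dvd d" using p(3) of_nat_eq_0_iff_char_dvd by blast
  thus False using d p by (metis coprime_absorb_left coprime_commute not_prime_unit)
qed

lemma kk: "kk \<noteq> 0" "kk ^ p = kk" "kk * of_nat d = kap"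
proof -
  show "kk \<noteq> 0" "kk * of_nat d = kap" using kap dnz by auto
  have "(of_nat k :: 'c) ^ p = of_nat k" for k
    by (induction k) (use p in \<open>auto simp: freshmans_dream prime_gt_0_nat\<close>)
  thus "kk ^ p = kk" using kap by (simp add: power_divide)
qed

lemma s_nz: "s \<noteq> 0" "poly s 0 \<noteq> 0"
  using spoly_nz[OF d(1)] d(1) c2 by (auto simp: s poly_spoly power_0_left)

lemma s_root: "poly s \<alpha> = 0 \<longleftrightarrow> \<alpha> ^ d = 1 \<or> (two \<and> \<alpha> ^ d = c2)"
  by (auto simp: s poly_spoly)

lemma degree_s: "degree s = (if two then 2 * d else d)"
  using degree_spoly[OF d(1)] degree_mult_eq[OF spoly_nz[OF d(1), of "1::'c"] spoly_nz[OF d(1), of c2]]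
  by (auto simp: s)

lemma D_lin: "c kk * tder (lin l0 l1 l2) = - c kap * (c l1 * (sg d 1 + sg d 1 ^ 2) + c l2 * (sg d c2 + c c2 * sg d c2 ^ 2))"
proof -
  interpret derivation "\<lambda>x. c kk * tder x" by (rule derivation_tder)
  show ?thesis unfolding lin_def D_add D_mult D_sg[OF d(1)] kk(3) by (simp add: algebra_simps)
qed

lemma cR: "fvge \<alpha> (c k) 0" "ivge (c k) 0"
  by (simp_all add: place.vge_0_iff[OF place_fin] place.vge_0_iff[OF place_inf] const_finR const_infR)

lemma lin_reg:
  assumes "poly s \<alpha> \<noteq> 0" "\<not> two \<Longrightarrow> l2 = 0" shows "fvge \<alpha> (lin l0 l1 l2) 0"
proof -
  interpret place "finR \<alpha>" "finpi \<alpha>" by (rule place_fin)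
  have n: "\<alpha> ^ d \<noteq> 1" "two \<Longrightarrow> \<alpha> ^ d \<noteq> c2" using assms(1) s_root by auto
  have "vge (c l1 * sg d 1) 0" by (rule vge_mult'[OF cR(1) val_imp_vge[OF sg_unit[OF n(1)]]]) simp
  moreover have "vge (c l2 * sg d c2) 0"
  proof (cases two)
    case True thus ?thesis by (intro vge_mult'[OF cR(1) val_imp_vge[OF sg_unit[OF n(2)]]]) auto
  qed (use assms in simp)
  ultimately show ?thesis unfolding lin_def by (intro vge_add cR)
qed

lemma lin_pole1:
  assumes "\<alpha> ^ d = 1"
  shows "fvge \<alpha> (lin l0 l1 l2) (-1)" "l1 \<noteq> 0 \<Longrightarrow> fval \<alpha> (lin l0 l1 l2) (-1)" "l1 = 0 \<Longrightarrow> fvge \<alpha> (lin l0 l1 l2) 0"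
proof -
  interpret place "finR \<alpha>" "finpi \<alpha>" by (rule place_fin)
  have r: "vge (c l0 + c l2 * sg d c2) 0"
    by (intro vge_add cR vge_mult'[OF cR(1) val_imp_vge[OF sg_unit]]) (use assms c2 in auto)
  have v: "val (sg d 1) (-1)" using sg_pole[OF assms _ dnz] by simp
  have e: "lin l0 l1 l2 = c l1 * sg d 1 + (c l0 + c l2 * sg d c2)" by (simp add: lin_def)
  have "val (c l1 * sg d 1) (0 + - 1)" if "l1 \<noteq> 0" using val_mult[OF fval_const[OF that] v] .
  thus a: "val (lin l0 l1 l2) (-1)" if "l1 \<noteq> 0" using that val_add[of "c l1 * sg d 1" "-1"] r by (simp add: e)
  show b: "vge (lin l0 l1 l2) 0" if "l1 = 0" using r that by (simp add: lin_def)
  show "vge (lin l0 l1 l2) (-1)" using a b val_imp_vge vge_mono[of "lin l0 l1 l2" 0 "-1"] by (cases "l1 = 0") auto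
qed

lemma lin_pole2:
  assumes "\<alpha> ^ d = c2"
  shows "fvge \<alpha> (lin l0 l1 l2) (-1)" "l2 \<noteq> 0 \<Longrightarrow> fval \<alpha> (lin l0 l1 l2) (-1)"
proof -
  interpret place "finR \<alpha>" "finpi \<alpha>" by (rule place_fin)
  have r: "vge (c l0 + c l1 * sg d 1) 0"
    by (intro vge_add cR vge_mult'[OF cR(1) val_imp_vge[OF sg_unit]]) (use assms c2 in auto)
  have v: "val (sg d c2) (-1)" using sg_pole[OF assms c2(1) dnz] .
  have e: "lin l0 l1 l2 = c l2 * sg d c2 + (c l0 + c l1 * sg d 1)" by (simp add: lin_def)
  have "val (c l2 * sg d c2) (0 + - 1)" if "l2 \<noteq> 0" using val_mult[OF fval_const[OF that] v] .
  thus a: "val (lin l0 l1 l2) (-1)" if "l2 \<noteq> 0" using that val_add[of "c l2 * sg d c2" "-1"] r by (simp add: e)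
  have b: "vge (lin l0 l1 l2) 0" if "l2 = 0" using r that by (simp add: lin_def)
  show "vge (lin l0 l1 l2) (-1)" using a b val_imp_vge vge_mono[of "lin l0 l1 l2" 0 "-1"] by (cases "l2 = 0") auto
qed

lemma lin_inf: "ivge (lin l0 l1 l2 - c l0) 1" "ivge (lin l0 l1 l2) 0"
proof -
  interpret place "infR :: 'c poly fract set" infpi by (rule place_inf)
  have *: "vge (c l1 * sg d 1 + c l2 * sg d c2) 1"
    by (intro vge_add vge_mult'[OF cR(2) sg_inf[OF d(1)]]) auto
  moreover have "lin l0 l1 l2 - c l0 = c l1 * sg d 1 + c l2 * sg d c2" by (simp add: lin_def)
  ultimately show "vge (lin l0 l1 l2 - c l0) 1" by simp
  show "vge (lin l0 l1 l2) 0" unfolding lin_def add.assoc by (intro vge_add cR vge_mono[OF *]) simp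
qed

lemma lin_0: "b = l0 - l1 - l2 / c2 \<Longrightarrow> fvge 0 (lin l0 l1 l2 - c b) 1"
proof -
  interpret place "finR (0::'c)" "finpi 0" by (rule place_fin)
  assume b: "b = l0 - l1 - l2 / c2"
  have "vge (c l1 * (sg d 1 + c (1 / 1)) + c l2 * (sg d c2 + c (1 / c2))) 1"
    by (intro vge_add vge_mult'[OF cR(1) sg_0[OF d(1)]]) (use c2 in auto)
  moreover have "c l1 * (sg d 1 + c (1 / 1)) + c l2 * (sg d c2 + c (1 / c2)) = lin l0 l1 l2 - c b"
    using const_fract_mult[of l2 "1 / c2"]
    by (simp add: lin_def b const_fract_diff const_fract_add algebra_simps)
  ultimately show ?thesis by simp
qed

text \<open>\<open>disc\<close> is a Bezout identity between the cubic and its derivative. Where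
  \<open>Del\<close> is a unit, \<open>y\<close> and \<open>F x\<close> cannot vanish together, and
  \<open>Del \<noteq> 0\<close> excludes a double root over the function field.\<close>

lemma odd_family:
  assumes ode: "ode (\<lambda>x. c kk * tder x) (c a2) (lin l0 l1 l2) (lin m0 m1 m2) (lin n0 n1 n2) (lin h0 h1 h2)"
    and two: "\<not> two \<Longrightarrow> l2 = 0 \<and> m2 = 0 \<and> n2 = 0 \<and> h2 = 0"
    and disc: "\<And>x. P x * (x ^ 3 + c a2 * x ^ 2 + lin l0 l1 l2 * x + lin m0 m1 m2)
        + Q x * (3 * x ^ 2 + 2 * c a2 * x + lin l0 l1 l2) = Del"
    and PQ: "\<And>\<alpha> x. poly s \<alpha> \<noteq> 0 \<Longrightarrow> fvge \<alpha> x 0 \<Longrightarrow> fvge \<alpha> (P x) 0 \<and> fvge \<alpha> (Q x) 0"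
    and Del: "\<And>\<alpha>. \<alpha> \<noteq> 0 \<Longrightarrow> poly s \<alpha> \<noteq> 0 \<Longrightarrow> fval \<alpha> Del 0" "Del \<noteq> 0"
    and lm: "l1 \<noteq> 0 \<or> m1 \<noteq> 0" "two \<Longrightarrow> l2 \<noteq> 0"
    and inf: "a2 ^ 2 - 3 * l0 \<noteq> 0"
    and x0: "x0 ^ p = x0" "a2 ^ p = a2" "a2 + 3 * x0 \<noteq> 0"
    and node: "- 3 * x0 ^ 2 - 2 * a2 * x0 = l0 - l1 - l2 / c2" "x0 ^ 2 * (a2 + 2 * x0) = m0 - m1 - m2 / c2"
       "- x0 = n0 - n1 - n2 / c2" "2 * x0 * (a2 + 2 * x0) = h0 - h1 - h2 / c2"
  shows "odd_family p kk a2 x0 (lin l0 l1 l2) (lin m0 m1 m2) (lin n0 n1 n2) (lin h0 h1 h2) s"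
proof -
  interpret ode "\<lambda>x. c kk * tder x" "c a2" "lin l0 l1 l2" "lin m0 m1 m2" "lin n0 n1 n2" "lin h0 h1 h2" by (rule ode)
  have disc': "P x * y ^ 2 + Q x * F x = Del" if "on x y" for x y
    using disc[of x] that by (simp add: on_def F_def)
  show ?thesis
  proof (unfold_locales)
    show "prime p" "odd p" "CHAR('c) = p" using p by auto
    show "kk \<noteq> 0" "kk ^ p = kk" using kk by auto
    show "s \<noteq> 0" "poly s 0 \<noteq> 0" using s_nz by auto
    show "F x \<noteq> 0" if "on x y" "y = 0" for x y using disc'[OF that(1)] that(2) Del(2) by auto
    show "fvge \<alpha> (lin l0 l1 l2) 0 \<and> fvge \<alpha> (lin m0 m1 m2) 0 \<and> fvge \<alpha> (lin n0 n1 n2) 0 \<and> fvge \<alpha> (lin h0 h1 h2) 0"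
      if "poly s \<alpha> \<noteq> 0" for \<alpha> using lin_reg[OF that] two by blast
    show "ivge (lin l0 l1 l2) 0" "ivge (lin m0 m1 m2) 0" "ivge (lin n0 n1 n2) 0" "ivge (lin h0 h1 h2) 0"
      by (rule lin_inf)+
    show "fval \<alpha> y 0 \<or> fval \<alpha> (F x) 0"
      if a: "\<alpha> \<noteq> 0" "poly s \<alpha> \<noteq> 0" and on: "on x y" and x: "fvge \<alpha> x 0" for \<alpha> x y
    proof (rule ccontr)
      assume n: "\<not> (fval \<alpha> y 0 \<or> fval \<alpha> (F x) 0)"
      interpret place "finR \<alpha>" "finpi \<alpha>" by (rule place_fin)
      have l: "vge (lin l0 l1 l2) 0" "vge (lin m0 m1 m2) 0" using lin_reg[OF a(2)] two by blast+
      have x2: "vge (x ^ 2) 0" "vge (x ^ 3) 0" using vge_power[OF x, of 2] vge_power[OF x, of 3] by auto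
      have "vge (y ^ 2) 0" using on unfolding on_def
        by (simp, intro vge_add x2 l vge_mult'[OF cR(1) x2(1)] vge_mult'[OF l(1) x]) auto
      hence y: "vge y 0" using vge_powerD[of y 2 0] by simp
      have "vge (2 * c a2 * x) 0" by (intro vge_mult'[OF vge_mult'[OF vge_numeral cR(1)] x, of 0]) auto
      hence Fx: "vge (F x) 0" unfolding F_def by (intro vge_add l vge_mult'[OF vge_numeral x2(1)]) auto
      have y1: "vge y 1" "vge (F x) 1" using unit_or_vge[OF y] unit_or_vge[OF Fx] n by auto
      have "vge (y ^ 2) 1" using vge_power[OF y1(1), of 2] vge_mono by fastforce
      hence "vge Del 1" unfolding disc'[OF on, symmetric] using PQ[OF a(2) x] y1
        by (intro vge_add) (auto intro: vge_mult')
      thus False using val_vge_le[OF Del(1)[OF a]] by fastforce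
    qed
    show "fvge \<alpha> (lin l0 l1 l2) (-1) \<and> fvge \<alpha> (lin m0 m1 m2) (-1) \<and> fvge \<alpha> (lin n0 n1 n2) (-1) \<and>
       fvge \<alpha> (lin h0 h1 h2) (-1) \<and> (fval \<alpha> (lin l0 l1 l2) (-1) \<or> fvge \<alpha> (lin l0 l1 l2) 0 \<and> fval \<alpha> (lin m0 m1 m2) (-1))"
      if "poly s \<alpha> = 0" for \<alpha>
    proof (cases "\<alpha> ^ d = 1")
      case True
      show ?thesis using lin_pole1[OF True] lm(1) by blast
    next
      case False
      hence "\<alpha> ^ d = c2" "two" using that s_root by auto
      thus ?thesis using lin_pole2[of \<alpha>] lm(2) by blast
    qed
    show "ival (c a2 ^ 2 - 3 * lin l0 l1 l2) 0"
    proof -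
      interpret place "infR :: 'c poly fract set" infpi by (rule place_inf)
      have "c a2 ^ 2 - 3 * lin l0 l1 l2 = c (a2 ^ 2 - 3 * l0) + c (- 3) * (lin l0 l1 l2 - c l0)"
        by (simp add: const_fract_diff const_fract_power const_fract_mult const_fract_uminus algebra_simps)
      moreover have "vge (c (- 3) * (lin l0 l1 l2 - c l0)) (0 + 1)"
        by (intro vge_mult cR lin_inf)
      ultimately show ?thesis using val_add[OF ival_const[OF inf]] by simp
    qed
    show "x0 ^ p = x0" "a2 ^ p = a2" "a2 + 3 * x0 \<noteq> 0" using x0 by auto
    show "fvge 0 (lin l0 l1 l2 - c (- 3 * x0 ^ 2 - 2 * a2 * x0)) 1" by (rule lin_0[OF node(1)])
    show "fvge 0 (lin m0 m1 m2 - c (x0 ^ 2 * (a2 + 2 * x0))) 1" by (rule lin_0[OF node(2)])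
    show "fvge 0 (lin n0 n1 n2 + c x0) 1" using lin_0[OF node(3)] by (simp add: const_fract_uminus)
    show "fvge 0 (lin h0 h1 h2 - c (2 * x0 * (a2 + 2 * x0))) 1" by (rule lin_0[OF node(4)])
  qed
qed

lemma tsg_unit:
  assumes "\<alpha> \<noteq> 0" "poly s \<alpha> \<noteq> 0"
  shows "fval \<alpha> (tt d ^ i * sg d 1 ^ j) 0" "two \<Longrightarrow> fval \<alpha> (tt d ^ i * sg d 1 ^ j * sg d c2 ^ k) 0"
proof -
  interpret place "finR \<alpha>" "finpi \<alpha>" by (rule place_fin)
  have n: "\<alpha> ^ d \<noteq> 1" "two \<Longrightarrow> \<alpha> ^ d \<noteq> c2" using assms(2) s_root by auto
  show a: "val (tt d ^ i * sg d 1 ^ j) 0"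
    using val_mult[OF val_power[OF tt_unit[OF assms(1), of d], of i] val_power[OF sg_unit[OF n(1)], of j]] by simp
  show "val (tt d ^ i * sg d 1 ^ j * sg d c2 ^ k) 0" if two
    using val_mult[OF a val_power[OF sg_unit[OF n(2)[OF that]], of k]] by simp
qed

lemma Fract_s: "Fract s 1 = (tt d - 1) * (if two then tt d - c c2 else 1)"
  using Fract_spoly[of d "1::'c"] Fract_spoly[of d c2] mult_fract[of "spoly d 1" 1 "spoly d c2" 1] by (auto simp: s)

end

lemma certified_shortI:
  assumes fam: "odd_family p kk 0 x0 a4 a6 nu g0 s"
    and cert: "descent_certificate p 0 1 short_f M L A Xl Yl short_ia (short_ib k) (short_ix k) short_iy short_iw
      short_ja short_jb short_jx short_jy short_jw"
    and g0: "g0 = of_int k * a4"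
    and Am: "Fract Am 1 = Fract s 1 ^ (p - 1) * ev2 a4 a6 A"
    and inj: "\<And>M. degree M \<le> degree s \<Longrightarrow> (\<And>i. coeff (Am * M) (p * i) = 0) \<Longrightarrow> M = 0"
    and b46: "b4 = - 3 * x0 ^ 2" "b6 = 2 * x0 ^ 3"
    and Ac: "ev2 b4 b6 A * (4 * (3 * x0)) ^ ((p - 1) div 2) = 1"
    and node_AS: "\<And>l. l ^ p = ev2 b4 b6 A * l + l * (l ^ 2 - 3 * x0) * ev3 b4 b6 (l ^ 2 - 2 * x0) M"
  shows "certified_family p kk 0 x0 a4 a6 nu g0 s 0 1 short_f M L A Xl Yl short_ia (short_ib k) (short_ix k)
    short_iy short_iw short_ja short_jb short_jx short_jy short_jw Am b4 b6"
proof -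
  interpret odd_family p kk 0 x0 a4 a6 nu g0 s by (rule fam)
  note ev = evw_def evy_def ev3_def ev2_def ev1_def
  show ?thesis
  proof (intro certified_family.intro fam cert certified_family_axioms.intro Am inj)
    show "x ^ 3 + const_fract 0 * x ^ 2 + a4 * x + a6 = ev3 a4 a6 x short_f" for x
      by (simp add: ev short_f_def algebra_simps power3_eq_cube)
    show "D a4 = evw a4 a6 x y w short_ia + nu * evw a4 a6 x y w short_ja" for x y w
      unfolding Da4 by (simp add: ev short_ia_def short_ja_def algebra_simps)
    show "D a6 = evw a4 a6 x y w (short_ib k) + nu * evw a4 a6 x y w short_jb" for x y w
      unfolding Da6 g0 by (simp add: ev short_ib_def short_jb_def algebra_simps)
    show "2 * y * w - 2 * x ^ 2 + (2 * nu - 2 * const_fract 0) * x + g0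
       = evw a4 a6 x y w (short_ix k) + nu * evw a4 a6 x y w short_jx" for x y w
      unfolding g0 by (simp add: ev short_ix_def short_jx_def algebra_simps power2_eq_square)
    show "(3 * x ^ 2 + 2 * const_fract 0 * x + a4) * w - 3 * x * y + (3 * nu - 2 * const_fract 0) * y
       = evw a4 a6 x y w short_iy + nu * evw a4 a6 x y w short_jy" for x y w
      by (simp add: ev short_iy_def short_jy_def algebra_simps power2_eq_square)
    show "x * w - y + nu * w = evw a4 a6 x y w short_iw + nu * evw a4 a6 x y w short_jw" for x y w
      by (simp add: ev short_iw_def short_jw_def algebra_simps)
    show "b4 = - 3 * x0 ^ 2 - 2 * 0 * x0" "b6 = x0 ^ 2 * (0 + 2 * x0)"
      using b46 by (simp_all add: power2_eq_square power3_eq_cube)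
    show "ev2 b4 b6 A * (4 * (0 + 3 * x0)) ^ ((p - 1) div 2) = 1" using Ac by simp
    show "l ^ p = ev2 b4 b6 A * l + l * (l ^ 2 - (0 + 3 * x0)) * ev3 b4 b6 (l ^ 2 - (0 + 2 * x0)) M" for l
      using node_AS[of l] by simp
  qed simp_all
qed

lemma Fract_list:
  "Fract (pcompose (Poly (map of_int l)) (monom 1 d)) 1 = ev1 (tt d :: 'a::field poly fract) l"
proof (induction l)
  case Nil thus ?case by (simp add: ev1_def fract_collapse)
next
  case (Cons k l)
  have "Fract (pcompose (Poly (map of_int (k # l))) (monom 1 d)) 1
     = Fract [:of_int k:] 1 + Fract (monom 1 d) 1 * Fract (pcompose (Poly (map of_int l)) (monom 1 d)) 1"
    by (simp add: pcompose_pCons)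
  also have "Fract [:of_int k :: 'a:] 1 = of_int k"
    using const_fract_of_int[of k, where 'a = 'a] unfolding const_fract_def .
  finally show ?case unfolding Cons by (simp add: ev1_def tt_def)
qed

lemma of_int_nz: "CHAR('a::comm_ring_1) = p \<Longrightarrow> \<not> int p dvd k \<Longrightarrow> of_int k \<noteq> (0::'a)"
  using of_int_eq_0_iff_char_dvd[of k, where 'a = 'a] by auto

lemma coeff_Poly_of_int: "coeff (Poly (map of_int l)) j = of_int (nth_default 0 l j)"
  by (simp add: nth_default_def)

lemma degree_Poly_of_int: "degree (Poly (map of_int l)) \<le> length l - 1"
  by (rule degree_le) (auto simp: nth_default_def)

lemma (in rational_pencil) inj_1:
  assumes "length l = p" "list_all (\<lambda>k. \<not> int p dvd k) l" "\<not> two"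
    and "degree M \<le> degree s" "\<And>i. coeff (pcompose (Poly (map of_int l)) (monom 1 d) * M) (p * i) = 0"
  shows "M = (0 :: 'c poly)"
proof (rule hasse_witt_1[of p d "Poly (map of_int l)"])
  show "p > 0" using p(1) prime_gt_0_nat by blast
  show "degree (Poly (map of_int l)) \<le> p - 1" using degree_Poly_of_int[of l] assms(1) by auto
  fix j assume j: "j < p"
  hence "\<not> int p dvd l ! j" using assms(1,2) by (auto simp: list_all_length)
  thus "coeff (Poly (map of_int l)) j \<noteq> (0::'c)"
    using j assms(1) of_int_nz[OF p(3)] unfolding coeff_Poly_of_int by (simp add: nth_default_def)
qed (use assms d degree_s in auto)

lemma (in rational_pencil) not_const1: "l1 \<noteq> 0 \<Longrightarrow> lin l0 l1 l2 \<noteq> c k"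
proof
  assume "l1 \<noteq> 0" "lin l0 l1 l2 = c k"
  hence "fval 1 (c k) (-1)" using lin_pole1(2)[of 1 l1 l0 l2] by simp
  thus False using place.val_vge_le[OF place_fin _ cR(1)] by fastforce
qed

lemma const_fract_neg_numeral [simp]: "const_fract (- numeral n) = - numeral n" "const_fract (- 1) = - 1"
  by (simp_all add: const_fract_uminus)

lemma short_discriminant:
  fixes a4 a6 x :: "'a::comm_ring_1"
  shows "(27 * a6 - 18 * a4 * x) * (x ^ 3 + 0 * x ^ 2 + a4 * x + a6)
     + (6 * a4 * x ^ 2 - 9 * a6 * x + 4 * a4 ^ 2) * (3 * x ^ 2 + 2 * 0 * x + a4) = 4 * a4 ^ 3 + 27 * a6 ^ 2"
  by (simp add: algebra_simps power2_eq_square power3_eq_cube)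

lemma (in place) short_discriminant_vge:
  assumes "vge a4 0" "vge a6 0" "vge x 0"
  shows "vge (27 * a6 - 18 * a4 * x) 0 \<and> vge (6 * a4 * x ^ 2 - 9 * a6 * x + 4 * a4 ^ 2) 0"
proof -
  have m: "vge (u * v) 0" if "vge u 0" "vge v 0" for u v using vge_mult[OF that] by simp
  show ?thesis by (intro conjI vge_add vge_diff m vge_numeral assms) (simp_all add: power2_eq_square m assms)
qed

lemma char_field:
  assumes "prime p" "CHAR('c::field) = p"
  shows "(of_nat p :: 'c) = 0" "(of_nat p :: 'c poly fract) = 0"
  using assms CHAR_poly_fract[where 'a = 'c] of_nat_CHAR by metis+

lemma of_int_pow:
  assumes "prime p" "CHAR('c::field) = p"
  shows "(of_int k :: 'c) ^ p = of_int k"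
proof -
  have n: "(of_nat k :: 'c) ^ p = of_nat k" for k
    by (induction k) (use assms in \<open>auto simp: freshmans_dream prime_gt_0_nat\<close>)
  obtain m where m: "(of_int k :: 'c) = of_nat m"
  proof
    have "(of_int k :: 'c) = of_int (k mod int p + int p * (k div int p))" by simp
    also have "\<dots> = of_int (k mod int p)" unfolding of_int_add of_int_mult using char_field(1)[OF assms] by simp
    also have "\<dots> = of_nat (nat (k mod int p))" using assms(1) prime_gt_0_nat[of p] by simp
    finally show "(of_int k :: 'c) = of_nat (nat (k mod int p))" .
  qed
  show ?thesis unfolding m by (rule n)
qed

lemma of_int_cong:
  assumes "CHAR('a::comm_ring_1) = p" "(k - l) mod int p = 0" shows "of_int k = (of_int l :: 'a)"
proof -
  have "of_int (k - l) = (0::'a)" unfolding of_int_eq_0_iff_char_dvd assms(1) using assms(2) by presburger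
  thus ?thesis by simp
qed

fun pow1 :: "int list \<Rightarrow> nat \<Rightarrow> int list" where
  "pow1 f 0 = [1]"
| "pow1 f (Suc n) = mul1 f (pow1 f n)"

lemma ev1_c: "ev1 a [k] = of_int k" by (simp add: ev1_def)

lemma ev1_pow: "ev1 a (pow1 f n) = ev1 a f ^ n"
  by (induction n) (auto simp: ev1_mul, simp add: ev1_def)

context rational_pencil
begin

lemma ts: "tt d * sg d 1 = 1 + (sg d 1 :: 'c poly fract)"
  using sg_mult[OF d(1), of "1::'c"] by (simp add: algebra_simps)

lemma sg_nz: "sg d k \<noteq> (0 :: 'c poly fract)"
  using sg_mult[OF d(1), of k] by auto

lemma tt_nz: "tt d \<noteq> (0 :: 'c poly fract)"
  using place.val_nz[OF place_fin tt_unit[of "1::'c" d]] by simp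

lemma two_nz: "(2::'c poly fract) \<noteq> 0"
proof
  assume "(2::'c poly fract) = 0"
  hence "of_nat 2 = (0::'c poly fract)" by simp
  hence "p dvd 2" using p(3) CHAR_poly_fract[where 'a = 'c] of_nat_eq_0_iff_char_dvd by metis
  hence "p = 2" using p(1) primes_dvd_imp_eq two_is_prime_nat by blast
  thus False using p(2) by simp
qed

text \<open>A discriminant that is a constant times powers of \<open>t\<close>,
  \<open>1/(t - 1)\<close> and \<open>1/(t - c2)\<close> is a unit outside 0 and the zeros of
  \<open>s\<close>, which is the smoothness required there.\<close>

lemma short_odd_family:
  assumes Da4: "c kk * tder (lin l0 l1 l2) = - 6 * lin m0 m1 m2 + 4 * lin n0 n1 n2 * lin l0 l1 l2"
    and Da6: "c kk * tder (lin m0 m1 m2) = 6 * lin n0 n1 n2 * lin m0 m1 m2 - lin l0 l1 l2 * lin h0 h1 h2"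
    and rel: "4 * lin l0 l1 l2 = - 3 * lin h0 h1 h2"
    and two: "\<not> two \<Longrightarrow> l2 = 0 \<and> m2 = 0 \<and> n2 = 0 \<and> h2 = 0 \<and> k = 0"
    and Del: "4 * lin l0 l1 l2 ^ 3 + 27 * lin m0 m1 m2 ^ 2 = c e * (tt d ^ i * sg d 1 ^ j * sg d c2 ^ k)" "e \<noteq> 0"
    and lm: "l1 \<noteq> 0 \<or> m1 \<noteq> 0" "two \<Longrightarrow> l2 \<noteq> 0"
    and inf: "3 * l0 \<noteq> 0" and x0: "x0 ^ p = x0" "3 * x0 \<noteq> 0"
    and node: "- 3 * x0 ^ 2 = l0 - l1 - l2 / c2" "2 * x0 ^ 3 = m0 - m1 - m2 / c2"
       "- x0 = n0 - n1 - n2 / c2" "4 * x0 ^ 2 = h0 - h1 - h2 / c2"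
  shows "odd_family p kk 0 x0 (lin l0 l1 l2) (lin m0 m1 m2) (lin n0 n1 n2) (lin h0 h1 h2) s"
proof (rule odd_family)
  show "ode (\<lambda>x. c kk * tder x) (c 0) (lin l0 l1 l2) (lin m0 m1 m2) (lin n0 n1 n2) (lin h0 h1 h2)"
    by (intro ode.intro derivation_tder ode_axioms.intro two_nz) (use Da4 Da6 rel tder_const[of "0::'c"] in simp_all)
  show "(27 * lin m0 m1 m2 - 18 * lin l0 l1 l2 * x) * (x ^ 3 + c 0 * x ^ 2 + lin l0 l1 l2 * x + lin m0 m1 m2)
     + (6 * lin l0 l1 l2 * x ^ 2 - 9 * lin m0 m1 m2 * x + 4 * lin l0 l1 l2 ^ 2) * (3 * x ^ 2 + 2 * c 0 * x + lin l0 l1 l2)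
     = 4 * (lin l0 l1 l2) ^ 3 + 27 * (lin m0 m1 m2) ^ 2" for x
    using short_discriminant[of "lin m0 m1 m2" "lin l0 l1 l2" x] by simp
  show "fvge \<alpha> (27 * lin m0 m1 m2 - 18 * lin l0 l1 l2 * x) 0 \<and>
     fvge \<alpha> (6 * lin l0 l1 l2 * x ^ 2 - 9 * lin m0 m1 m2 * x + 4 * lin l0 l1 l2 ^ 2) 0"
    if "poly s \<alpha> \<noteq> 0" "fvge \<alpha> x 0" for \<alpha> x
    by (rule place.short_discriminant_vge[OF place_fin]) (use that lin_reg two in auto)
  show "fval \<alpha> (4 * (lin l0 l1 l2) ^ 3 + 27 * (lin m0 m1 m2) ^ 2) 0" if "\<alpha> \<noteq> 0" "poly s \<alpha> \<noteq> 0" for \<alpha>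
  proof -
    have "fval \<alpha> (tt d ^ i * sg d 1 ^ j * sg d c2 ^ k) 0"
      using tsg_unit[OF that] two by (cases two) auto
    thus ?thesis unfolding Del(1) using place.val_mult[OF place_fin fval_const[OF Del(2)]] by fastforce
  qed
  show "4 * (lin l0 l1 l2) ^ 3 + 27 * (lin m0 m1 m2) ^ 2 \<noteq> 0"
    unfolding Del(1) using Del(2) sg_nz tt_nz by (simp add: const_fract_eq_0)
  show "x0 ^ 2 * (0 + 2 * x0) = m0 - m1 - m2 / c2" using node(2) by (simp add: power2_eq_square power3_eq_cube mult_ac)
  show "2 * x0 * (0 + 2 * x0) = h0 - h1 - h2 / c2" using node(4) by (simp add: power2_eq_square mult_ac)
  show "(0::'c) ^ p = 0" using p(1) prime_gt_0_nat by simp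
  show "l1 \<noteq> 0 \<or> m1 \<noteq> 0" by (rule lm)
qed (use assms in auto)

end

text \<open>The Hasse invariant \<open>2 a4 = -6\<close> is the constant -1 here. Multiplied by
  \<open>(t - 1)^4 = 1 + t + t^2 + t^3 + t^4\<close> it has all five digits equal to 4, so
  \<open>hasse_witt_1\<close> applies.\<close>

theorem no_points_5:
  fixes x y :: "'c::alg_closed_field poly fract"
  assumes ch: "CHAR('c) = 5" and d: "d > 0" "coprime d 5"
  shows "y ^ 2 \<noteq> x ^ 3 - 3 * x + (2 + 4 * sg d 1)"
proof
  assume on: "y ^ 2 = x ^ 3 - 3 * x + (2 + 4 * sg d 1)"
  have pr: "prime (5::nat)" by simp
  have z: "(5::'c) = 0" "(5::'c poly fract) = 0" using char_field[OF pr ch] by simp_all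
  have nz: "\<not> 5 dvd k \<Longrightarrow> of_int k \<noteq> (0::'c)" for k using of_int_nz[OF ch, of k] by simp
  note eq = of_int_cong[OF ch]
  have n: "(2::'c) \<noteq> 0" "(3::'c) \<noteq> 0" "(9::'c) \<noteq> 0" "(12::'c) \<noteq> 0" "(432::'c) \<noteq> 0" "(4::'c) \<noteq> 0"
    using nz[of 2] nz[of 3] nz[of 9] nz[of 12] nz[of 432] nz[of 4] by auto
  \<comment> \<open>\<open>kap = 12\<close> makes \<open>D a6 = 6 nu a6 - a4 g0\<close> hold: both
    sides are \<open>-48 (s + s^2)\<close> with \<open>s = 1/(t - 1)\<close>. At
    \<open>t = 0\<close> the cubic is \<open>(x + 1)^2 (x - 2)\<close>, which gives the node
    \<open>x0 = -1\<close>.\<close>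
  interpret r: rational_pencil d "-1" False 5 12 "12 / of_nat d :: 'c" "spoly d 1"
    by unfold_locales (use d ch pr n of_int_pow[OF pr ch, of 12] in \<open>auto simp: eq_neg_iff_add_eq_0\<close>)
  let ?s = "sg d 1 :: 'c poly fract" and ?t = "tt d :: 'c poly fract"
  have l: "r.lin (-3) 0 0 = -3" "r.lin 2 4 0 = 2 + 4 * ?s" "r.lin (-1) (-2) 0 = -1 - 2 * ?s" "r.lin 4 0 0 = 4"
    by (simp_all add: r.lin_def)
  have Del: "4 * (r.lin (-3) 0 0) ^ 3 + 27 * (r.lin 2 4 0) ^ 2 = r.c 432 * (?t ^ 1 * ?s ^ 2 * sg d (-1) ^ 0)"
  proof -
    have "?t ^ 1 * ?s ^ 2 = ?s + ?s ^ 2" using r.ts by (simp add: power2_eq_square mult.assoc[symmetric] algebra_simps)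
    thus ?thesis unfolding l by (simp add: power2_eq_square power3_eq_cube algebra_simps)
  qed
  have fam: "odd_family 5 (12 / of_nat d) 0 (-1) (r.lin (-3) 0 0) (r.lin 2 4 0) (r.lin (-1) (-2) 0) (r.lin 4 0 0) (spoly d 1)"
    by (rule r.short_odd_family[OF _ _ _ _ Del])
      (simp_all add: r.D_lin n, simp_all add: l algebra_simps power2_eq_square power3_eq_cube)
  interpret f: certified_family 5 "12 / of_nat d" 0 "-1" "r.lin (-3) 0 0" "r.lin 2 4 0" "r.lin (-1) (-2) 0" "r.lin 4 0 0"
    "spoly d 1" 0 1 short_f M_5 L_5 A_5 X_5 Y_5 short_ia "short_ib 2" "short_ix 2"
    short_iy short_iw short_ja short_jb short_jx short_jy short_jw
    "pcompose (Poly (map of_int [4, 4, 4, 4, 4])) (monom 1 d)" "-3" "-2"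
  proof (rule certified_shortI[OF fam certificate_5])
    have "(4 + 6 :: 'c poly fract) = 5 * 2" by simp
    thus "r.lin 4 0 0 = of_int 2 * r.lin (-3) 0 0" unfolding l z by (simp add: add_eq_0_iff2)
    have "ev1 ?t (add1 [4, 4, 4, 4, 4] (mul1 [6] (pow1 [-1, 1] 4))) = 0"
      by (rule z1_ev[OF char_field(2)[OF pr ch]]) code_simp
    thus "Fract (pcompose (Poly (map of_int [4, 4, 4, 4, 4])) (monom 1 d)) 1
       = Fract (spoly d 1) 1 ^ (5 - 1) * ev2 (r.lin (-3) 0 0) (r.lin 2 4 0) A_5"
      unfolding Fract_list Fract_spoly ev1_add ev1_mul ev1_pow l
      by (simp add: ev2_def ev1_def A_5_def add_eq_0_iff2 mult.commute)
    show "M = 0" if "degree M \<le> degree (spoly d (1::'c))"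
      "\<And>i. coeff (pcompose (Poly (map of_int [4, 4, 4, 4, 4])) (monom 1 d) * M) (5 * i) = 0" for M :: "'c poly"
      by (rule r.inj_1[OF _ _ _ that]) simp_all
    show "ev2 (-3) (-2) A_5 * (4 * (3 * (- 1))) ^ ((5 - 1) div 2) = (1::'c)"
      using eq[of "-864" 1] by (simp add: ev2_def ev1_def A_5_def)
    fix l :: 'c
    have "ev2 (-3) (-2) A_5 * l + l * (l ^ 2 - 3 * - 1) * ev3 (-3) (-2) (l ^ 2 - 2 * - 1) M_5 = l ^ 5 + 5 * l ^ 3"
      by (simp add: ev3_def ev2_def ev1_def A_5_def M_5_def algebra_simps eval_nat_numeral)
    thus "l ^ 5 = ev2 (-3) (-2) A_5 * l + l * (l ^ 2 - 3 * - 1) * ev3 (-3) (-2) (l ^ 2 - 2 * - 1) M_5"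
      unfolding z by simp
  qed simp_all
  have "f.on x y" unfolding f.on_def unfolding l using on by simp
  thus False
  proof (rule f.descent[of x y "\<lambda>_. False"])
    fix k e :: 'c assume "f.on (r.c k) (r.c e)"
    \<comment> \<open>A constant point would make \<open>2 + 4/(t - 1)\<close> constant.\<close>
    hence "r.lin 2 4 0 = r.c (e ^ 2 - k ^ 3 + 3 * k)"
      unfolding f.on_def unfolding l by (simp add: const_fract_add const_fract_diff const_fract_mult const_fract_power algebra_simps)
    thus False using r.not_const1[OF n(6)] by blast
  qed
qed

text \<open>Over the common denominator the numerators of \<open>a4\<close> and \<open>a6\<close>
  are \<open>1 + t\<close> and \<open>5 t^2 - 11 t - 6\<close>. The claim becomes a congruence of
  polynomials modulo 7.\<close>

lemma discriminant_7:
  assumes d: "d > 0" and ch: "CHAR('k::field) = 7"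
  shows "4 * (1 + 4 * sg d 3) ^ 3 + 27 * (5 + 6 * sg d 1 + 3 * sg d 3) ^ 2
    = tt d ^ 2 * sg d 1 ^ 2 * sg d (3 :: 'k) ^ 3"
proof -
  let ?s = "sg d 1 :: 'k poly fract" and ?r = "sg d 3 :: 'k poly fract" and ?t = "tt d :: 'k poly fract"
  have z: "(7 :: 'k poly fract) = 0" using char_field(2)[OF _ ch] by simp
  have s: "?s * (?t - 1) = 1" "?r * (?t - 3) = 1" using sg_mult[OF d, of "1::'k"] sg_mult[OF d, of "3::'k"] by simp_all
  have a4: "1 + 4 * ?r = (1 + ?t) * ?r" using s(2) by (simp add: algebra_simps)
  have a6: "5 + 6 * ?s + 3 * ?r = (5 * ?t ^ 2 - 11 * ?t - 6) * (?s * ?r)"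
  proof -
    have "(5 * ?t ^ 2 - 11 * ?t - 6) * (?s * ?r)
       = 5 * ((?s * (?t - 1)) * (?r * (?t - 3))) + 6 * (?s * (?r * (?t - 3))) + 3 * (?r * (?s * (?t - 1)))"
      by (simp add: algebra_simps power2_eq_square)
    thus ?thesis by (simp add: s)
  qed
  have gen: "r' ^ 3 * P * (s' * u) ^ 2 + s' ^ 2 * r' ^ 2 * Q * (r' * v) = s' ^ 2 * r' ^ 3 * (P * u ^ 2 + Q * v)"
    for r' s' P Q u v :: "'k poly fract"
    by (simp add: power3_eq_cube power2_eq_square algebra_simps)
  have "4 * (1 + 4 * ?r) ^ 3 + 27 * (5 + 6 * ?s + 3 * ?r) ^ 2
     = ?r ^ 3 * (4 * (1 + ?t) ^ 3) + ?s ^ 2 * ?r ^ 2 * (27 * (5 * ?t ^ 2 - 11 * ?t - 6) ^ 2)"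
    unfolding a4 a6 by (simp add: power_mult_distrib mult_ac)
  also have "\<dots> = ?r ^ 3 * (4 * (1 + ?t) ^ 3) * (?s * (?t - 1)) ^ 2
      + ?s ^ 2 * ?r ^ 2 * (27 * (5 * ?t ^ 2 - 11 * ?t - 6) ^ 2) * (?r * (?t - 3))" by (simp add: s)
  also have "\<dots> = ?s ^ 2 * ?r ^ 3 * (4 * (1 + ?t) ^ 3 * (?t - 1) ^ 2 + 27 * (5 * ?t ^ 2 - 11 * ?t - 6) ^ 2 * (?t - 3))"
    by (rule gen)
  \<comment> \<open>An identity over the integers; the bracket is the difference of both sides
    divided by 7.\<close>
  also have "4 * (1 + ?t) ^ 3 * (?t - 1) ^ 2 + 27 * (5 * ?t ^ 2 - 11 * ?t - 6) ^ 2 * (?t - 3)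
    = ?t ^ 2 + 7 * (97 * ?t ^ 5 - 713 * ?t ^ 4 + 1507 * ?t ^ 3 - 198 * ?t ^ 2 - 1388 * ?t - 416)"
    by (simp add: algebra_simps eval_nat_numeral)
  finally show ?thesis unfolding z by (simp add: mult_ac)
qed

text \<open>Of the odd characteristics treated this is the one with two sets of additive fibres, so
  that the defect may have degree \<open>2 * d\<close> and the determinant criterion of
  \<open>hasse_witt_2\<close> is required.\<close>

theorem no_points_7:
  fixes x y :: "'c::alg_closed_field poly fract"
  assumes ch: "CHAR('c) = 7" and d: "d > 0" "coprime d 7"
  shows "y ^ 2 \<noteq> x ^ 3 + (1 + 4 * sg d 3) * x + (5 + 6 * sg d 1 + 3 * sg d 3)"
proof
  assume on: "y ^ 2 = x ^ 3 + (1 + 4 * sg d 3) * x + (5 + 6 * sg d 1 + 3 * sg d 3)"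
  have pr: "prime (7::nat)" by simp
  have z: "(7::'c) = 0" "(7::'c poly fract) = 0" using char_field[OF pr ch] by simp_all
  have nz: "\<not> 7 dvd k \<Longrightarrow> of_int k \<noteq> (0::'c)" for k using of_int_nz[OF ch, of k] by simp
  note eq = of_int_cong[OF ch]
  have nz31: "(3::'c) \<noteq> 1"
  proof -
    have "(3::'c) - 1 = of_int 2" by simp
    moreover have "of_int 2 \<noteq> (0::'c)" by (rule nz) simp
    ultimately show ?thesis by (metis right_minus_eq)
  qed
  have n: "(2::'c) \<noteq> 0" "(3::'c) \<noteq> 0" "(5::'c) \<noteq> 0" "(6::'c) \<noteq> 0" "(4::'c) \<noteq> 0" "(3::'c) \<noteq> 1"
    using nz[of 2] nz[of 3] nz[of 5] nz[of 6] nz[of 4] nz31 by simp_all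
  interpret r: rational_pencil d 3 True 7 5 "5 / of_nat d :: 'c" "spoly d 1 * spoly d 3"
    by unfold_locales (use d ch pr n of_int_pow[OF pr ch, of 5] in auto)
  let ?s = "sg d 1 :: 'c poly fract" and ?r = "sg d 3 :: 'c poly fract" and ?t = "tt d :: 'c poly fract"
  have l: "r.lin 1 0 4 = 1 + 4 * ?r" "r.lin 5 6 3 = 5 + 6 * ?s + 3 * ?r" "r.lin 4 5 5 = 4 + 5 * ?s + 5 * ?r"
    by (simp_all add: r.lin_def)
  have tr: "?t * ?r = 1 + 3 * ?r" using sg_mult[OF d(1), of "3::'c"] by (simp add: algebra_simps)
  \<comment> \<open>The partial fraction relation for \<open>1/((t - 1)(t - 3))\<close>. It removes
    the mixed products, so each equation of the system is a multiple of 7 plus a multiple of this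
    relation.\<close>
  have sr: "?r - ?s - 2 * ?s * ?r = 0"
  proof -
    have "?r - ?s - 2 * ?s * ?r = ?r * (?t * ?s - ?s) - ?s * (?t * ?r - 3 * ?r) - 2 * ?s * ?r"
      unfolding r.ts tr by simp
    thus ?thesis by (simp add: algebra_simps)
  qed
  have a6: "r.lin 5 6 3 = (5 * ?t ^ 2 - 11 * ?t - 6) * (?s * ?r)"
  proof -
    have "(5 * ?t ^ 2 - 11 * ?t - 6) * (?s * ?r)
       = 5 * ((?s * (?t - 1)) * (?r * (?t - 3))) + 6 * (?s * (?r * (?t - 3))) + 3 * (?r * (?s * (?t - 1)))"
      by (simp add: algebra_simps power2_eq_square)
    thus ?thesis using sg_mult[OF d(1), of "1::'c"] sg_mult[OF d(1), of "3::'c"] by (simp add: l)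
  qed
  have Del: "4 * (r.lin 1 0 4) ^ 3 + 27 * (r.lin 5 6 3) ^ 2 = r.c 1 * (?t ^ 2 * ?s ^ 2 * ?r ^ 3)"
    unfolding l discriminant_7[OF d(1) ch] by simp
  have q1: "(4::'c) / 3 = 6" unfolding nonzero_divide_eq_eq[OF n(2)] using eq[of 4 18] by simp
  have q2: "(5::'c) / 3 = 4" unfolding nonzero_divide_eq_eq[OF n(2)] using eq[of 5 12] by simp
  note q = q1 q2
  have fam: "odd_family 7 (5 / of_nat d) 0 (-2) (r.lin 1 0 4) (r.lin 5 6 3) (r.lin 4 5 5) (r.lin 1 0 4) (spoly d 1 * spoly d 3)"
  proof (rule r.short_odd_family[OF _ _ _ _ Del])
    let ?e = "?r - ?s - 2 * ?s * ?r"
    have "r.c (5 / of_nat d) * tder (r.lin 1 0 4) - (- 6 * r.lin 5 6 3 + 4 * r.lin 4 5 5 * r.lin 1 0 4)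
        = 7 * (2 + 8 * ?s - 18 * ?r - 20 * ?r ^ 2) + 40 * ?e"
      unfolding r.D_lin unfolding l by (simp add: algebra_simps power2_eq_square)
    thus "r.c (5 / of_nat d) * tder (r.lin 1 0 4) = - 6 * r.lin 5 6 3 + 4 * r.lin 4 5 5 * r.lin 1 0 4"
      unfolding sr z by simp
    have "r.c (5 / of_nat d) * tder (r.lin 5 6 3) - (6 * r.lin 4 5 5 * r.lin 5 6 3 - r.lin 1 0 4 * r.lin 1 0 4)
        = 7 * (- 17 - 27 * ?s - 52 * ?r - 30 * ?s ^ 2 - 17 * ?r ^ 2) + 135 * ?e"
      unfolding r.D_lin unfolding l by (simp add: algebra_simps power2_eq_square)
    thus "r.c (5 / of_nat d) * tder (r.lin 5 6 3) = 6 * r.lin 4 5 5 * r.lin 5 6 3 - r.lin 1 0 4 * r.lin 1 0 4"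
      unfolding sr z by simp
    have "4 * r.lin 1 0 4 - - 3 * r.lin 1 0 4 = 7 * r.lin 1 0 4" by (simp add: algebra_simps)
    thus "4 * r.lin 1 0 4 = - 3 * r.lin 1 0 4" unfolding z by simp
    show "(- 2 :: 'c) ^ 7 = - 2" using of_int_pow[OF pr ch, of "-2"] by simp
    show "3 * (- 2) \<noteq> (0::'c)" using n(4) by simp
    show "- 3 * (- 2) ^ 2 = 1 - 0 - 4 / (3::'c)" unfolding q using eq[of "-12" "-5"] by simp
    show "2 * (- 2) ^ 3 = 5 - 6 - 3 / (3::'c)" using eq[of "-16" "-2"] n(2) by simp
    show "- (- 2) = 4 - 5 - 5 / (3::'c)" unfolding q using eq[of "2" "-5"] by simp
    show "4 * (- 2) ^ 2 = 1 - 0 - 4 / (3::'c)" unfolding q using eq[of "16" "-5"] by simp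
  qed (use n in auto)
  \<comment> \<open>The digits modulo 7 of \<open>((t - 1)(t - 3))^6\<close> times the Hasse
    invariant \<open>3 a6\<close>, that is of
    \<open>3 ((t - 1)(t - 3))^5 (5 t^2 - 11 t - 6)\<close>, a polynomial of degree
    \<open>12 = 2 p - 2\<close>.\<close>
  let ?l = "[1, 1, 6, 2, 0, 5, 2, 4, 0, 5, 5, 3, 1] :: int list"
  interpret f: certified_family 7 "5 / of_nat d" 0 "-2" "r.lin 1 0 4" "r.lin 5 6 3" "r.lin 4 5 5" "r.lin 1 0 4"
    "spoly d 1 * spoly d 3" 0 1 short_f M_7 L_7 A_7 X_7 Y_7 short_ia "short_ib 1" "short_ix 1"
    short_iy short_iw short_ja short_jb short_jx short_jy short_jw
    "pcompose (Poly (map of_int ?l)) (monom 1 d)" "-12" "-16"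
  proof (rule certified_shortI[OF fam certificate_7])
    have "ev1 ?t (add1 ?l (mul1 [-3] (mul1 (pow1 [3, -4, 1] 5) [-6, -11, 5]))) = 0"
      by (rule z1_ev[OF char_field(2)[OF pr ch]]) code_simp
    hence e: "ev1 ?t ?l = 3 * (ev1 ?t [3, -4, 1] ^ 5 * ev1 ?t [-6, -11, 5])"
      unfolding ev1_add ev1_mul ev1_pow ev1_c by (simp add: add_eq_0_iff2)
    have S: "Fract (spoly d 1 * spoly d 3) 1 = (?t - 1) * (?t - 3)" using r.Fract_s by simp
    have S': "(?t - 1) * (?t - 3) = ev1 ?t [3, -4, 1]" by (simp add: ev1_def algebra_simps)
    have "Fract (spoly d 1 * spoly d 3) 1 ^ (7 - 1) * ev2 (r.lin 1 0 4) (r.lin 5 6 3) A_7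
        = ((?t - 1) * (?t - 3)) ^ 5 * (((?s * (?t - 1)) * (?r * (?t - 3))) * (3 * (5 * ?t ^ 2 - 11 * ?t - 6)))"
      unfolding S a6 by (simp add: ev2_def ev1_def A_7_def eval_nat_numeral mult_ac)
    also have "\<dots> = ((?t - 1) * (?t - 3)) ^ 5 * (3 * (5 * ?t ^ 2 - 11 * ?t - 6))"
      using sg_mult[OF d(1), of "1::'c"] sg_mult[OF d(1), of "3::'c"] by simp
    also have "5 * ?t ^ 2 - 11 * ?t - 6 = ev1 ?t [-6, -11, 5]" by (simp add: ev1_def algebra_simps power2_eq_square)
    finally show "Fract (pcompose (Poly (map of_int ?l)) (monom 1 d)) 1
       = Fract (spoly d 1 * spoly d 3) 1 ^ (7 - 1) * ev2 (r.lin 1 0 4) (r.lin 5 6 3) A_7"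
      unfolding Fract_list e S' by (simp only: mult_ac)
    show "M = 0" if M: "degree M \<le> degree (spoly d (1::'c) * spoly d 3)"
      "\<And>i. coeff (pcompose (Poly (map of_int ?l)) (monom 1 d) * M) (7 * i) = 0" for M :: "'c poly"
    proof (rule hasse_witt_2[of 7 d "Poly (map of_int ?l)"])
      show "degree (Poly (map of_int ?l) :: 'c poly) \<le> 2 * 7 - 2" using degree_Poly_of_int[of ?l, where 'a = 'c] by simp
      show "degree M \<le> 2 * d" using M(1) r.degree_s by simp
      have nz': "of_int k \<noteq> (0::'c)" if "k mod 7 \<noteq> 0" for k using nz[of k] that by presburger
      show "coeff (Poly (map of_int ?l)) 0 \<noteq> (0::'c)" "coeff (Poly (map of_int ?l)) (7 - 1) \<noteq> (0::'c)"
        "coeff (Poly (map of_int ?l)) (2 * 7 - 2) \<noteq> (0::'c)"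
        unfolding coeff_Poly_of_int by (rule nz', code_simp)+
      fix j :: nat assume j: "0 < j" "j < 7"
      let ?n = "nth_default 0 ?l"
      have "list_all (\<lambda>j. (?n j * ?n (j + 7 - 1) - ?n (j - 1) * ?n (j + 7)) mod 7 \<noteq> 0) [1, 2, 3, 4, 5, 6]"
        by code_simp
      moreover have "j \<in> set [1, 2, 3, 4, 5, 6]" using j by auto
      ultimately have "(?n j * ?n (j + 7 - 1) - ?n (j - 1) * ?n (j + 7)) mod 7 \<noteq> 0" unfolding list_all_iff by (rule bspec)
      hence "of_int (?n j * ?n (j + 7 - 1) - ?n (j - 1) * ?n (j + 7)) \<noteq> (0::'c)" by (rule nz')
      thus "coeff (Poly (map of_int ?l)) j * coeff (Poly (map of_int ?l)) (j + 7 - 1)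
         \<noteq> coeff (Poly (map of_int ?l)) (j - 1) * (coeff (Poly (map of_int ?l)) (j + 7) :: 'c)"
        unfolding coeff_Poly_of_int of_int_diff of_int_mult by (simp only: right_minus_eq not_False_eq_True)
    qed (use d M in auto)
    show "ev2 (-12) (-16) A_7 * (4 * (3 * (- 2))) ^ ((7 - 1) div 2) = (1::'c)"
      using eq[of "663552" 1] by (simp add: ev2_def ev1_def A_7_def)
    fix l :: 'c
    have "ev2 (-12) (-16) A_7 * l + l * (l ^ 2 - 3 * - 2) * ev3 (-12) (-16) (l ^ 2 - 2 * - 2) M_7
       = l ^ 7 + 7 * (2 * l ^ 5 + 4 * l ^ 3 - 24 * l)"
      by (simp add: ev3_def ev2_def ev1_def A_7_def M_7_def algebra_simps eval_nat_numeral)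
    thus "l ^ 7 = ev2 (-12) (-16) A_7 * l + l * (l ^ 2 - 3 * - 2) * ev3 (-12) (-16) (l ^ 2 - 2 * - 2) M_7"
      unfolding z by simp
  qed simp_all
  have "f.on x y" unfolding f.on_def unfolding l using on by simp
  thus False
  proof (rule f.descent[of x y "\<lambda>_. False"])
    fix k e :: 'c assume "f.on (r.c k) (r.c e)"
    hence "r.lin (5 + k) 6 (3 + 4 * k) = r.c (e ^ 2 - k ^ 3)"
      unfolding f.on_def unfolding l r.lin_def by (simp add: const_fract_add const_fract_diff const_fract_mult const_fract_power algebra_simps)
    thus False using r.not_const1[OF n(4)] by blast
  qed
qed

text \<open>Horner evaluation that replaces the second variable \<open>a6\<close> by a polynomial in
  \<open>a4\<close>. In the family for 11 these two are linearly related, and the torsion identity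
  holds only modulo that relation.\<close>

fun sub2 :: "int list \<Rightarrow> int list list \<Rightarrow> int list" where
  "sub2 b [] = []"
| "sub2 b (c # l) = add1 c (mul1 b (sub2 b l))"

definition subw :: "int list \<Rightarrow> polyw \<Rightarrow> polyw" where
  "subw b = map (map_prod (map (\<lambda>l. [sub2 b l])) (map (\<lambda>l. [sub2 b l])))"

lemma evw_sub:
  assumes "b = ev1 a q" shows "evw a b x y w (subw q l) = evw a b x y w l"
proof -
  have 1: "ev1 a (sub2 q l) = ev2 a b l" for l
    by (induction l) (simp_all add: ev1_add ev1_mul assms, simp_all add: ev1_def ev2_def)
  have "ev2 a b [m] = ev1 a m" for m by (simp add: ev2_def)
  hence 2: "ev3 a b x (map (\<lambda>l. [sub2 q l]) l) = ev3 a b x l" for l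
    by (induction l) (simp_all add: ev3_def 1)
  show ?thesis unfolding evw_def subw_def by (induction l) (simp_all add: evy_def 2)
qed

text \<open>With $a_6 = 2 - 4 a_4$ one has $(X - 4) H = (x - 4) (a_4 + 4)^{10}$, so that the descent can reach the
  point $(4, 0)$ only from a point with $x = 4$.\<close>

definition H_11 :: polyw where
  "H_11 =
    [([[[1, 5, -5, -4, -1]], [[2, 2, 4, 1, 5]], [[5, -4, -1, -5, -2]], [[2, -1, -4, -3]], [[2, 3, -1, -4]], [[1,
    -4, -2]], [[-1, 0, -1]]], []), ([], [[[-4, 4, -5, 4]], [[5, -5, -4]], [[-4, -2, 5, -3]], [[2, -2, -5]], [[-1,
    0, -1]]]), ([[[-1, -2, -3, 2, 3]], [[3, 4, -2, 4, 2]], [[4, 3, -3, 2]], [[-2, 2, 0, 3]], [[-4, -1, -2]],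
    [[-1, 0, -1]]], []), ([], [[[4, -2, 5, 4]], [[-5, -1, -5, -1]], [[5, -1, -4]], [[-1, 0, -1]]]), ([[[5, 2, -3,
    -3]], [[3, -1, -3, -1]], [[0, 4, -3, -3]], [[-4, -2]], [[-1, 0, -1]]], []), ([], [[[-3, 5, -2]], [[2, -4,
    -1]], [[-1, 0, -1]]]), ([[[-2, -5, 1, 2]], [[-4, -1, -3, 5]], [[1, 4, 4]], [[-1, 0, -1]]], []), ([], [[[4, 0,
    4]], [[-1, 0, -1]]]), ([[[5, -2, -2]], [[0, -5, -1]], [[-1, 0, -1]]], []), ([], [[[-1, 0, -1]]]), ([[[4, 4,
    -4]], [[-1, 0, -1]]], [])]"

lemma torsion_check_11:
  "zw (int 11) (subw [2, -4] (redw short_f 11 [([], M_11), ([A_11], [])] (addw (mulw short_f (addw X_11 [([[[-4]]], [])]) H_11)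
     (negw (mulw short_f [([[[-4]], [[1]]], [])] [([[pow1 [4, 1] 10]], [])])))))"
  by code_simp

text \<open>The curve has the 2-torsion point \<open>(4, 0)\<close>, so points cannot be excluded
  altogether; the property \<open>x = 4\<close> is carried through the descent instead.\<close>

theorem points_11:
  fixes x y :: "'c::alg_closed_field poly fract"
  assumes ch: "CHAR('c) = 11" and d: "d > 0" "coprime d 11"
    and on: "y ^ 2 = x ^ 3 + (- 1 + 3 * sg d 1) * x + (6 - sg d 1)"
  shows "x = 4"
proof -
  have pr: "prime (11::nat)" by simp
  have z: "(11::'c) = 0" "(11::'c poly fract) = 0" using char_field[OF pr ch] by simp_all
  have nz: "\<not> 11 dvd k \<Longrightarrow> of_int k \<noteq> (0::'c)" for k using of_int_nz[OF ch, of k] by simp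
  note eq = of_int_cong[OF ch]
  have n: "(2::'c) \<noteq> 0" "(3::'c) \<noteq> 0" "(9::'c) \<noteq> 0" "(12::'c) \<noteq> 0"
    using nz[of 2] nz[of 3] nz[of 9] nz[of 12] by auto
  interpret r: rational_pencil d "-1" False 11 "-2" "-2 / of_nat d :: 'c" "spoly d 1"
    by unfold_locales (use d ch pr n of_int_pow[OF pr ch, of "-2"] in \<open>auto simp: eq_neg_iff_add_eq_0\<close>)
  let ?s = "sg d 1 :: 'c poly fract" and ?t = "tt d :: 'c poly fract"
  have l: "r.lin (-1) 3 0 = -1 + 3 * ?s" "r.lin 6 (-1) 0 = 6 - ?s" "r.lin 2 6 0 = 2 + 6 * ?s" "r.lin (-6) 18 0 = -6 + 18 * ?s"
    by (simp_all add: r.lin_def)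
  have Del: "4 * (r.lin (-1) 3 0) ^ 3 + 27 * (r.lin 6 (-1) 0) ^ 2 = r.c 9 * (?t ^ 2 * ?s ^ 3 * sg d (-1) ^ 0)"
  proof -
    have "?t ^ 2 * ?s ^ 3 = (?t * ?s) ^ 2 * ?s" by (simp add: power2_eq_square power3_eq_cube mult_ac)
    also have "\<dots> = ?s ^ 3 + 2 * ?s ^ 2 + ?s" unfolding r.ts by (simp add: power2_eq_square power3_eq_cube algebra_simps)
    finally have t: "?t ^ 2 * ?s ^ 3 = ?s ^ 3 + 2 * ?s ^ 2 + ?s" .
    have "4 * (r.lin (-1) 3 0) ^ 3 + 27 * (r.lin 6 (-1) 0) ^ 2 = 9 * (?t ^ 2 * ?s ^ 3)
       + 11 * (88 - 27 * ?s - 9 * ?s ^ 2 + 9 * ?s ^ 3)"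
      unfolding l t by (simp add: power2_eq_square power3_eq_cube algebra_simps)
    thus ?thesis unfolding z by simp
  qed
  have fam: "odd_family 11 (-2 / of_nat d) 0 4 (r.lin (-1) 3 0) (r.lin 6 (-1) 0) (r.lin 2 6 0) (r.lin (-6) 18 0) (spoly d 1)"
  proof (rule r.short_odd_family[OF _ _ _ _ Del])
    have "r.c (-2 / of_nat d) * tder (r.lin (-1) 3 0) - (- 6 * r.lin 6 (-1) 0 + 4 * r.lin 2 6 0 * r.lin (-1) 3 0)
        = 11 * (4 - 6 * ?s ^ 2)"
      unfolding r.D_lin unfolding l by (simp add: algebra_simps power2_eq_square)
    thus "r.c (-2 / of_nat d) * tder (r.lin (-1) 3 0) = - 6 * r.lin 6 (-1) 0 + 4 * r.lin 2 6 0 * r.lin (-1) 3 0"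
      unfolding z by simp
    have "r.c (-2 / of_nat d) * tder (r.lin 6 (-1) 0) - (6 * r.lin 2 6 0 * r.lin 6 (-1) 0 - r.lin (-1) 3 0 * r.lin (-6) 18 0)
        = 11 * (- 6 - 22 * ?s + 8 * ?s ^ 2)"
      unfolding r.D_lin unfolding l by (simp add: algebra_simps power2_eq_square)
    thus "r.c (-2 / of_nat d) * tder (r.lin 6 (-1) 0) = 6 * r.lin 2 6 0 * r.lin 6 (-1) 0 - r.lin (-1) 3 0 * r.lin (-6) 18 0"
      unfolding z by simp
    have "4 * r.lin (-1) 3 0 - - 3 * r.lin (-6) 18 0 = 11 * (2 * r.lin (-1) 3 0)" unfolding l by (simp add: algebra_simps)
    thus "4 * r.lin (-1) 3 0 = - 3 * r.lin (-6) 18 0" unfolding z by (simp add: eq_neg_iff_add_eq_0)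
    show "(4 :: 'c) ^ 11 = 4" using of_int_pow[OF pr ch, of 4] by simp
    show "3 * 4 \<noteq> (0::'c)" using n(4) by simp
    show "- 3 * 4 ^ 2 = - 1 - 3 - 0 / (- 1 :: 'c)" using eq[of "-48" "-4"] by simp
    show "2 * 4 ^ 3 = 6 - - 1 - 0 / (- 1 :: 'c)" using eq[of "128" "7"] by simp
    show "4 * 4 ^ 2 = - 6 - 18 - 0 / (- 1 :: 'c)" using eq[of "64" "-24"] by simp
  qed (use n in auto)
  \<comment> \<open>The digits modulo 11 of \<open>(t - 1)^10\<close> times the Hasse invariant
    \<open>- 2 a4 a6\<close>; two of the ten factors turn \<open>a4\<close> and \<open>a6\<close>
    into \<open>4 - t\<close> and \<open>6 t - 7\<close>.\<close>
  let ?l = "[1, 7, 8, 4, 6, 3, 6, 4, 8, 7, 1] :: int list"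
  interpret f: certified_family 11 "-2 / of_nat d" 0 4 "r.lin (-1) 3 0" "r.lin 6 (-1) 0" "r.lin 2 6 0" "r.lin (-6) 18 0"
    "spoly d 1" 0 1 short_f M_11 L_11 A_11 X_11 Y_11 short_ia "short_ib 6" "short_ix 6"
    short_iy short_iw short_ja short_jb short_jx short_jy short_jw
    "pcompose (Poly (map of_int ?l)) (monom 1 d)" "-48" 128
  proof (rule certified_shortI[OF fam certificate_11])
    show "r.lin (-6) 18 0 = of_int 6 * r.lin (-1) 3 0" unfolding l by simp
    have "ev1 ?t (add1 ?l (mul1 [2] (mul1 (pow1 [-1, 1] 8) (mul1 [4, -1] [-7, 6])))) = 0"
      by (rule z1_ev[OF char_field(2)[OF pr ch]]) code_simp
    hence e: "ev1 ?t ?l = - 2 * (ev1 ?t [-1, 1] ^ 8 * (ev1 ?t [4, -1] * ev1 ?t [-7, 6]))"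
      unfolding ev1_add ev1_mul ev1_pow ev1_c by (simp add: add_eq_0_iff2)
    have a: "ev1 ?t [-1, 1] = ?t - 1" "(?t - 1) * (-1 + 3 * ?s) = ev1 ?t [4, -1]" "(?t - 1) * (6 - ?s) = ev1 ?t [-7, 6]"
      using r.ts by (simp_all add: ev1_def algebra_simps)
    have "(?t - 1) ^ 10 * ((-1 + 3 * ?s) * ((6 - ?s) * - 2))
       = - 2 * ((?t - 1) ^ 8 * (((?t - 1) * (-1 + 3 * ?s)) * ((?t - 1) * (6 - ?s))))"
    proof -
      have "u ^ 10 = u ^ 8 * u ^ 2" for u :: "'c poly fract" by (simp flip: power_add)
      hence "u ^ 10 * (P * (Q * k)) = k * (u ^ 8 * ((u * P) * (u * Q)))" for u P Q k :: "'c poly fract"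
        by (simp add: power2_eq_square mult_ac)
      thus ?thesis .
    qed
    moreover have "Fract (spoly d 1) 1 ^ (11 - 1) * ev2 (r.lin (-1) 3 0) (r.lin 6 (-1) 0) A_11
       = (?t - 1) ^ 10 * ((-1 + 3 * ?s) * ((6 - ?s) * - 2))"
    proof -
      have e: "ev2 a b A_11 = a * (b * - 2)" for a b :: "'c poly fract" by (simp add: ev2_def ev1_def A_11_def)
      show ?thesis unfolding Fract_spoly e l by simp
    qed
    ultimately show "Fract (pcompose (Poly (map of_int ?l)) (monom 1 d)) 1
       = Fract (spoly d 1) 1 ^ (11 - 1) * ev2 (r.lin (-1) 3 0) (r.lin 6 (-1) 0) A_11"
      unfolding Fract_list e a by metis
    show "M = 0" if "degree M \<le> degree (spoly d (1::'c))"
      "\<And>i. coeff (pcompose (Poly (map of_int ?l)) (monom 1 d) * M) (11 * i) = 0" for M :: "'c poly"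
      by (rule r.inj_1[OF _ _ _ that]) simp_all
    show "ev2 (-48) 128 A_11 * (4 * (3 * 4)) ^ ((11 - 1) div 2) = (1::'c)"
      using eq[of "12288 * 48 ^ 5" 1] by (simp add: ev2_def ev1_def A_11_def)
    fix l :: 'c
    \<comment> \<open>The equation is \<open>l\<close> times an identity in \<open>l^2\<close>,
      which keeps the degrees small.\<close>
    define u where "u = l ^ 2"
    have "ev2 (-48) 128 A_11 + (u - 3 * 4) * ev3 (-48) 128 (u - 2 * 4) M_11
      = u ^ 5 + 11 * (21504 - 4352 * u + 64 * u ^ 2 + 48 * u ^ 3 - 4 * u ^ 4)"
      by (simp add: ev3_def ev2_def ev1_def A_11_def M_11_def algebra_simps eval_nat_numeral)
    hence v: "ev2 (-48) 128 A_11 + (u - 3 * 4) * ev3 (-48) 128 (u - 2 * 4) M_11 = u ^ 5" unfolding z by simp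
    have "l ^ 11 = l * (ev2 (-48) 128 A_11 + (u - 3 * 4) * ev3 (-48) 128 (u - 2 * 4) M_11)"
      unfolding v unfolding u_def by (simp add: eval_nat_numeral)
    thus "l ^ 11 = ev2 (-48) 128 A_11 * l + l * (l ^ 2 - 3 * 4) * ev3 (-48) 128 (l ^ 2 - 2 * 4) M_11"
      unfolding u_def by (simp only: distrib_left mult_ac)
  qed simp_all
  have "f.on x y" unfolding f.on_def unfolding l using on by simp
  thus ?thesis
  proof (rule f.descent[of x y "\<lambda>x. x = 4"])
    fix k e :: 'c assume "f.on (r.c k) (r.c e)"
    hence "r.lin (6 - k) (3 * k - 1) 0 = r.c (e ^ 2 - k ^ 3)"
      unfolding f.on_def unfolding l r.lin_def by (simp add: const_fract_add const_fract_diff const_fract_mult const_fract_power algebra_simps)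
    hence "3 * k = 1" using r.not_const1[of "3 * k - 1"] by fastforce
    \<comment> \<open>4 is the inverse of 3 modulo 11. A constant \<open>x = k\<close> is possible
      only if the pole part \<open>(3 k - 1)/(t - 1)\<close> vanishes.\<close>
    moreover have "k = 4 * (3 * k) - 11 * k" by simp
    ultimately have "k = 4" unfolding z by simp
    thus "r.c k = 4" by simp
  next
    fix x y z' :: "'c poly fract" assume on: "f.on x y" and X: "z' ^ 11 = f.XP x y" and "z' = 4"
    have b: "r.lin 6 (-1) 0 = ev1 (r.lin (-1) 3 0) [2, -4]"
    proof -
      have "r.lin 6 (-1) 0 = ev1 (r.lin (-1) 3 0) [2, -4] + 11 * ?s" unfolding l ev1_def by (simp add: algebra_simps)
      thus ?thesis unfolding z by simp
    qed
    have ev4: "evw a b x y w [([[[-4]]], [])] = - 4" "evw a b x y w [([[[-4]], [[1]]], [])] = x - 4"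
      "evw a b x y w [([[q]], [])] = ev1 a q" for a b y w q
      by (simp_all add: evw_def evy_def ev3_def ev2_def ev1_def)
    have "(f.XP x y - 4) * evw (r.lin (-1) 3 0) (r.lin 6 (-1) 0) x y (f.wP x y) H_11
       = (x - 4) * ev1 (r.lin (-1) 3 0) [4, 1] ^ 10"
      using zw_ev[OF char_field(2)[OF pr ch] torsion_check_11, of "r.lin (-1) 3 0" "r.lin 6 (-1) 0" x y "f.wP x y"]
      unfolding evw_sub[OF b] evw_red[OF f.curve_list[OF on] f.wP_list[OF on]] evw_add evw_neg
        evw_mul[OF f.curve_list[OF on]] ev4 ev1_pow by (simp add: ev1_c)
    moreover have "f.XP x y = 4"
      using X \<open>z' = 4\<close> of_int_pow[of 11 4, where 'c = "'c poly fract"] pr ch CHAR_poly_fract[where 'a = 'c] by simp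
    \<comment> \<open>\<open>a4 + 4 = 3 t/(t - 1)\<close>, so the factor \<open>(a4 + 4)^10\<close>
      can be cancelled and \<open>X = 4\<close> forces \<open>x = 4\<close>.\<close>
    moreover have "ev1 (r.lin (-1) 3 0) [4, 1] \<noteq> 0"
    proof -
      have "ev1 (r.lin (-1) 3 0) [4, 1] = 3 * (?t * ?s)" unfolding r.ts l by (simp add: ev1_def)
      thus ?thesis using n(2) const_fract_eq_0[of "3::'c"] r.sg_nz[of 1] r.tt_nz by simp
    qed
    ultimately show "x = 4" by simp
  qed
qed

text \<open>The cofactor with \<open>X_3 * H_3 = x * a4^2\<close> on the curve: if the root has
  \<open>x\<close>-coordinate 0, so has the point it came from.\<close>

definition H_3 :: polyw where "H_3 = [([[[1]], [[-1]], [[1]]], []), ([], [[[1]]]), ([[[-1]], [[1]]], [])]"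

lemma torsion_check_3:
  "zw (int 3) (redw [[], [[0, 1]], [[1]], [[1]]] 3 [([], M_3), ([A_3], [])] (addw (mulw [[], [[0, 1]], [[1]], [[1]]] X_3 H_3)
     (negw [([[], [[0, 0, 1]]], [])])))"
  by code_simp

text \<open>Here the Hasse invariant is 1, and \<open>(t - 1)^2 = 1 + t + t^2\<close> modulo 3
  supplies the digits. The 2-torsion point \<open>(0, 0)\<close> survives; for a constant
  \<open>x = k\<close> the term \<open>k * a4\<close> has to be constant, hence
  \<open>k = 0\<close>.\<close>

theorem points_3:
  fixes x y :: "'c::alg_closed_field poly fract"
  assumes ch: "CHAR('c) = 3" and d: "d > 0" "coprime d 3"
    and on: "y ^ 2 = x ^ 3 + x ^ 2 + (1 + sg d 1) * x"
  shows "x = 0"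
proof -
  have pr: "prime (3::nat)" by simp
  have z: "(3::'c) = 0" "(3::'c poly fract) = 0" using char_field[OF pr ch] by simp_all
  have nz: "\<not> 3 dvd k \<Longrightarrow> of_int k \<noteq> (0::'c)" for k using of_int_nz[OF ch, of k] by simp
  have n: "(2::'c) \<noteq> 0" using nz[of 2] by auto
  interpret r: rational_pencil d "-1" False 3 1 "1 / of_nat d :: 'c" "spoly d 1"
    by unfold_locales (use d ch pr n in \<open>auto simp: eq_neg_iff_add_eq_0\<close>)
  let ?s = "sg d 1 :: 'c poly fract" and ?t = "tt d :: 'c poly fract"
  define a where "a = 1 + ?s"
  have l: "r.lin 1 1 0 = a" "r.lin 0 0 0 = 0" "r.lin (-1) (-1) 0 = - a" by (simp_all add: r.lin_def a_def)
  have ss: "?s = a - 1" by (simp add: a_def)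
  have Del: "a ^ 3 - a ^ 2 = ?t ^ 2 * ?s ^ 3"
  proof -
    have "?t ^ 2 * ?s ^ 3 = (?t * ?s) ^ 2 * ?s" by (simp add: power2_eq_square power3_eq_cube mult_ac)
    also have "\<dots> = a ^ 3 - a ^ 2" unfolding r.ts a_def by (simp add: power2_eq_square power3_eq_cube algebra_simps)
    finally show ?thesis by simp
  qed
  have z': "3 * u = (0 :: 'c poly fract)" for u using z by simp
  have Da: "r.c (1 / of_nat d) * tder (r.lin 1 1 0) = a - a ^ 2"
    unfolding r.D_lin unfolding ss by (simp add: algebra_simps power2_eq_square)
  have fam: "odd_family 3 (1 / of_nat d) 1 0 (r.lin 1 1 0) (r.lin 0 0 0) (r.lin (-1) (-1) 0) (r.lin 0 0 0) (spoly d 1)"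
  proof (rule r.odd_family)
    show "ode (\<lambda>x. r.c (1 / of_nat d) * tder x) (r.c 1) (r.lin 1 1 0) (r.lin 0 0 0) (r.lin (-1) (-1) 0) (r.lin 0 0 0)"
    proof (intro ode.intro derivation_tder ode_axioms.intro r.two_nz)
      have "a - a ^ 2 - (- 4 * a ^ 2 - 2 * a) = 3 * (a + a ^ 2)" by (simp add: algebra_simps)
      hence "a - a ^ 2 = - 4 * a ^ 2 - 2 * a" unfolding z by simp
      thus "r.c (1 / of_nat d) * tder (r.lin 1 1 0) = - 6 * r.lin 0 0 0 + (4 * r.lin (- 1) (- 1) 0 - 2 * r.c 1) * r.lin 1 1 0
          - 2 * r.c 1 * r.lin 0 0 0"
        unfolding Da unfolding l by (simp add: algebra_simps power2_eq_square)
      have "4 * a - (- 2 * a) = 3 * (2 * a)" by simp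
      hence "4 * a = - 2 * a" unfolding z by simp
      thus "4 * r.lin 1 1 0 = 2 * r.lin (- 1) (- 1) 0 * r.c 1 - 3 * r.lin 0 0 0" unfolding l by simp
    qed (use tder_const[of "0::'c"] tder_const[of "1::'c"] in \<open>simp_all add: l\<close>)
    show "1 * (x ^ 3 + r.c 1 * x ^ 2 + r.lin 1 1 0 * x + r.lin 0 0 0)
       + (x ^ 2 + x * a + a ^ 2 + x + 2 * a) * (3 * x ^ 2 + 2 * r.c 1 * x + r.lin 1 1 0) = a ^ 3 - a ^ 2" for x
    proof -
      \<comment> \<open>Bezout multipliers for the discriminant modulo 3, with the error over the
        integers written out as a multiple of 3.\<close>
      have "1 * (x ^ 3 + r.c 1 * x ^ 2 + a * x + 0) + (x ^ 2 + x * a + a ^ 2 + x + 2 * a) * (3 * x ^ 2 + 2 * r.c 1 * x + a)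
        = a ^ 3 - a ^ 2 + 3 * (x ^ 3 + x ^ 2 * a + x * a ^ 2 + x ^ 2 + 2 * a * x + a ^ 2 + x ^ 2 * (x ^ 2 + x * a + a ^ 2 + x + 2 * a))"
        by (simp add: algebra_simps power2_eq_square power3_eq_cube)
      thus ?thesis unfolding l z by simp
    qed
    show "fvge \<alpha> 1 0 \<and> fvge \<alpha> (x ^ 2 + x * a + a ^ 2 + x + 2 * a) 0"
      if "poly (spoly d 1) \<alpha> \<noteq> 0" "fvge \<alpha> x 0" for \<alpha> x
    proof -
      interpret place "finR \<alpha>" "finpi \<alpha>" by (rule place_fin)
      have a: "vge a 0" using r.lin_reg[OF that(1), of 0 1 1] by (simp add: l)
      have m: "vge (u * v) 0" if "vge u 0" "vge v 0" for u v using vge_mult[OF that] by simp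
      show ?thesis unfolding power2_eq_square by (intro conjI vge_1 vge_add m a that vge_numeral)
    qed
    show "fval \<alpha> (a ^ 3 - a ^ 2) 0" if "\<alpha> \<noteq> 0" "poly (spoly d 1) \<alpha> \<noteq> 0" for \<alpha>
      unfolding Del by (rule r.tsg_unit(1)[OF that])
    show "a ^ 3 - a ^ 2 \<noteq> 0" unfolding Del using r.sg_nz r.tt_nz by simp
  qed (use z in auto)
  interpret f: certified_family 3 "1 / of_nat d" 1 0 "r.lin 1 1 0" "r.lin 0 0 0" "r.lin (-1) (-1) 0" "r.lin 0 0 0"
    "spoly d 1" 1 0 "[[], [[0, 1]], [[1]], [[1]]]" M_3 L_3 A_3 X_3 Y_3
    "[([[[0, 1, -1]]], [])]" "[]" "[([[], [[-2, -2]], [[-2]]], []), ([], [[[2]]])]"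
    "[([], [[[-2, -3]], [[-3]]]), ([[[0, 1]], [[2]], [[3]]], [])]" "[([], [[[-1]]]), ([[[0, -1]], [[1]]], [])]"
    "[]" "[]" "[]" "[]" "[]" "pcompose (Poly (map of_int [1, 1, 1])) (monom 1 d)" 0 0
  proof (intro certified_family.intro fam certificate_3 certified_family_axioms.intro)
    note ev = evw_def evy_def ev3_def ev2_def ev1_def
    show "x ^ 3 + r.c 1 * x ^ 2 + r.lin 1 1 0 * x + r.lin 0 0 0 = ev3 (r.lin 1 1 0) (r.lin 0 0 0) x [[], [[0, 1]], [[1]], [[1]]]" for x
      by (simp add: ev l algebra_simps power2_eq_square power3_eq_cube)
    show "r.c (1 / of_nat d) * tder (r.lin 1 1 0) = evw (r.lin 1 1 0) (r.lin 0 0 0) x y w [([[[0, 1, -1]]], [])]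
       + r.lin (-1) (-1) 0 * evw (r.lin 1 1 0) (r.lin 0 0 0) x y w []" for x y w
      unfolding Da unfolding l by (simp add: ev algebra_simps power2_eq_square)
    show "r.c (1 / of_nat d) * tder (r.lin 0 0 0) = evw (r.lin 1 1 0) (r.lin 0 0 0) x y w []
       + r.lin (-1) (-1) 0 * evw (r.lin 1 1 0) (r.lin 0 0 0) x y w []" for x y w
      using tder_const[of "0::'c"] by (simp add: ev l)
    show "2 * y * w - 2 * x ^ 2 + (2 * r.lin (-1) (-1) 0 - 2 * r.c 1) * x + r.lin 0 0 0
       = evw (r.lin 1 1 0) (r.lin 0 0 0) x y w [([[], [[-2, -2]], [[-2]]], []), ([], [[[2]]])]
       + r.lin (-1) (-1) 0 * evw (r.lin 1 1 0) (r.lin 0 0 0) x y w []" for x y w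
      by (simp add: ev l algebra_simps power2_eq_square)
    show "(3 * x ^ 2 + 2 * r.c 1 * x + r.lin 1 1 0) * w - 3 * x * y + (3 * r.lin (-1) (-1) 0 - 2 * r.c 1) * y
       = evw (r.lin 1 1 0) (r.lin 0 0 0) x y w [([], [[[-2, -3]], [[-3]]]), ([[[0, 1]], [[2]], [[3]]], [])]
       + r.lin (-1) (-1) 0 * evw (r.lin 1 1 0) (r.lin 0 0 0) x y w []" for x y w
      by (simp add: ev l algebra_simps power2_eq_square)
    show "x * w - y + r.lin (-1) (-1) 0 * w
       = evw (r.lin 1 1 0) (r.lin 0 0 0) x y w [([], [[[-1]]]), ([[[0, -1]], [[1]]], [])]
       + r.lin (-1) (-1) 0 * evw (r.lin 1 1 0) (r.lin 0 0 0) x y w []" for x y w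
      by (simp add: ev l algebra_simps)
    have "ev1 ?t (add1 [1, 1, 1] (mul1 [-1] (pow1 [-1, 1] 2))) = 0"
      by (rule z1_ev[OF char_field(2)[OF pr ch]]) code_simp
    thus "Fract (pcompose (Poly (map of_int [1, 1, 1])) (monom 1 d)) 1
       = Fract (spoly d 1) 1 ^ (3 - 1) * ev2 (r.lin 1 1 0) (r.lin 0 0 0) A_3"
      unfolding Fract_list Fract_spoly ev1_add ev1_mul ev1_pow
      by (simp add: ev2_def ev1_def A_3_def add_eq_0_iff2)
    show "M = 0" if "degree M \<le> degree (spoly d (1::'c))"
      "\<And>i. coeff (pcompose (Poly (map of_int [1, 1, 1])) (monom 1 d) * M) (3 * i) = 0" for M :: "'c poly"
      by (rule r.inj_1[OF _ _ _ that]) simp_all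
    have "(4::'c) = 1" using of_int_cong[OF ch, of 4 1] by simp
    thus "ev2 0 0 A_3 * (4 * (1 + 3 * 0)) ^ ((3 - 1) div 2) = (1::'c)"
      by (simp add: ev2_def ev1_def A_3_def)
    show "k ^ 3 = ev2 0 0 A_3 * k + k * (k ^ 2 - (1 + 3 * 0)) * ev3 0 0 (k ^ 2 - (1 + 2 * 0)) M_3" for k :: 'c
      by (simp add: ev3_def ev2_def ev1_def A_3_def M_3_def algebra_simps power2_eq_square power3_eq_cube)
  qed (simp_all add: l)
  have "f.on x y" unfolding f.on_def unfolding l a_def using on by simp
  thus ?thesis
  proof (rule f.descent[of x y "\<lambda>x. x = 0"])
    fix k e :: 'c assume "f.on (r.c k) (r.c e)"
    hence "r.lin k k 0 = r.c (e ^ 2 - k ^ 3 - k ^ 2)"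
      unfolding f.on_def unfolding l a_def r.lin_def by (simp add: const_fract_add const_fract_diff const_fract_mult const_fract_power algebra_simps)
    thus "r.c k = 0" using r.not_const1[of k] by fastforce
  next
    fix x y z :: "'c poly fract" assume on: "f.on x y" and X: "z ^ 3 = f.XP x y" and "z = 0"
    have e: "evw a b x y w [([[], [[0, 0, 1]]], [])] = x * a ^ 2" for a b y w
      by (simp add: evw_def evy_def ev3_def ev2_def ev1_def power2_eq_square)
    have "f.XP x y * evw (r.lin 1 1 0) (r.lin 0 0 0) x y (f.wP x y) H_3 = x * r.lin 1 1 0 ^ 2"
      using zw_ev[OF char_field(2)[OF pr ch] torsion_check_3, of "r.lin 1 1 0" "r.lin 0 0 0" x y "f.wP x y"]
      unfolding evw_red[OF f.curve_list[OF on] f.wP_list[OF on]] evw_add evw_neg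
        evw_mul[OF f.curve_list[OF on]] e by simp
    moreover have "f.XP x y = 0" using X \<open>z = 0\<close> by simp
    moreover have "a \<noteq> 0" using r.ts r.sg_nz[of 1] r.tt_nz by (metis a_def mult_eq_0_iff)
    ultimately show "x = 0" by (simp add: l)
  qed
qed

section \<open>Characteristic two\<close>

text \<open>The analogue for \<open>y^2 + x y + a y = x^3\<close>, whose Hasse invariant is
  \<open>a1 = 1\<close>. The Artin-Schreier equation is now \<open>W^2 + W = x\<close>, and
  \<open>x + a\<close> and \<open>x^2 + y\<close>, the partial derivatives of the equation, replace
  \<open>2 y\<close> and \<open>F x\<close>. The defect \<open>N\<close> is
  \<open>D (x + W)\<close>; it is also the derivative of \<open>del\<close>, because squares are
  killed.\<close>

locale ode2 = derivation D for D :: "'f::field \<Rightarrow> 'f" +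
  fixes a :: 'f
  assumes two0: "(2::'f) = 0" and Da: "D a = a ^ 2 + a"
begin

lemma self_add: "z + z = (0::'f)" "z + (z + v) = v"
proof -
  show z: "z + z = 0" for z :: 'f using two0 by (metis mult_2 mult_zero_left)
  show "z + (z + v) = v" using z[of z] by (simp add: add.assoc[symmetric])
qed

lemma neg: "- z = (z::'f)" "z - v = z + (v::'f)"
  using self_add(1) by (metis minus_unique, metis add_uminus_conv_diff minus_unique)

lemma shift: "p + q = (r::'f) \<longleftrightarrow> p = r + q"
  using neg(2)[of r q] by (metis eq_diff_eq)

lemmas char2 = self_add neg two0 power2_eq_square power3_eq_cube

definition on where "on x y \<longleftrightarrow> y ^ 2 + x * y + a * y = x ^ 3"
definition W where "W x y = (D x + y + a) / (x + a)"
definition N where "N x y = D (x + W x y)"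
definition del where "del x y = W x y ^ 2 + W x y + x"
definition rh where "rh x y = W x y + y / x"

lemma on_y2: "on x y \<Longrightarrow> y ^ 2 = x ^ 3 + x * y + a * y"
  unfolding on_def add.assoc by (simp add: shift add.commute)

lemma on_0: "on x y \<Longrightarrow> y ^ 2 + x * y + a * y + x ^ 3 = 0"
  unfolding on_def by (simp add: self_add)

lemma D_square: "D (z ^ 2) = 0"
  by (simp add: D_power two0)

lemma D_cube: "D (z ^ 3) = z ^ 2 * D z"
proof -
  have "(3::'f) = 2 + 1" by simp
  thus ?thesis by (simp add: D_power two0)
qed

lemma Dx_W: "x + a \<noteq> 0 \<Longrightarrow> D x = W x y * (x + a) + y + a"
proof -
  assume "x + a \<noteq> 0"
  hence "D x + y + a = W x y * (x + a)" by (simp add: W_def)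
  moreover have "D x = (D x + y + a) + y + a" by (simp add: algebra_simps self_add)
  ultimately show ?thesis by metis
qed

lemma Dy_W:
  assumes on: "on x y" and xa: "x + a \<noteq> 0"
  shows "D y = (x ^ 2 + y) * W x y + x ^ 2 + y * (x + a + 1)"
proof -
  let ?w = "W x y"
  have "D (y ^ 2 + x * y + a * y) = D (x ^ 3)" using on by (simp add: on_def)
  hence "(x + a) * D y + (y * D x + y * D a) = x ^ 2 * D x"
    by (simp add: D_add D_square D_mult D_cube algebra_simps)
  hence "(x + a) * D y = (x ^ 2 + y) * D x + y * D a"
    unfolding shift[of "(x + a) * D y"] by (simp add: algebra_simps)
  also have "\<dots> = (x + a) * ((x ^ 2 + y) * ?w) + (x ^ 2 * (y + a) + y * a ^ 2) + y ^ 2"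
    unfolding Dx_W[OF xa, of y] Da by (simp add: algebra_simps char2)
  also have "y ^ 2 = x ^ 3 + x * y + a * y" by (rule on_y2[OF on])
  also have "(x + a) * ((x ^ 2 + y) * ?w) + (x ^ 2 * (y + a) + y * a ^ 2) + (x ^ 3 + x * y + a * y)
     = (x + a) * ((x ^ 2 + y) * ?w + x ^ 2 + y * (x + a + 1))"
    by (simp add: algebra_simps char2)
  finally show ?thesis using xa by simp
qed

lemma D_del: "D (del x y) = N x y"
  unfolding del_def N_def D_add D_square by simp

lemma del_rh:
  assumes "on x y" "x \<noteq> 0"
  shows "del x y = a * y / x ^ 2 + rh x y ^ 2 + rh x y"
proof -
  have w: "W x y = y / x + rh x y" unfolding rh_def by (simp add: self_add add.left_commute add.commute)
  have "del x y = (y ^ 2 + x * y + x ^ 3) / x ^ 2 + rh x y ^ 2 + rh x y"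
    unfolding del_def w using assms(2) by (simp add: add_divide_distrib char2 algebra_simps)
  also have "y ^ 2 + x * y + x ^ 3 = a * y" unfolding on_y2[OF assms(1)] by (simp add: algebra_simps char2)
  finally show ?thesis .
qed

lemma N_rh:
  assumes on: "on x y" and "x \<noteq> 0" and xa: "x + a \<noteq> 0"
  shows "N x y = a * rh x y + rh x y * (a * y) / x ^ 2 + a * y / x ^ 2 + a ^ 2 * y / x ^ 3 + D (rh x y)"
proof -
  let ?r = "rh x y" and ?w = "W x y"
  have w: "?w = y / x + ?r" unfolding rh_def by (simp add: self_add add.left_commute add.commute)
  have xw: "x * ?w = y + x * ?r" unfolding w using assms(2) by (simp add: distrib_left)
  have "N x y = D x + D (y / x) + D ?r" unfolding N_def D_add by (subst w) (simp add: D_add)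
  also have "D (y / x) = (x * D y + y * D x) / x ^ 2" using D_divide[OF assms(2)] by (simp add: neg mult.commute)
  also have "x * D y + y * D x = x ^ 2 * D x + a * ((x ^ 2 + y) * ?w + x ^ 2 + x * y) + (y ^ 2 + x * y + a * y + x ^ 3)"
    unfolding Dx_W[OF xa, of y] Dy_W[OF on xa] by (simp add: algebra_simps char2)
  also have "\<dots> = x ^ 2 * D x + a * ((x ^ 2 + y) * ?w + x ^ 2 + x * y)" unfolding on_0[OF on] by simp
  also have "D x + (x ^ 2 * D x + a * ((x ^ 2 + y) * ?w + x ^ 2 + x * y)) / x ^ 2
     = a * ((x ^ 2 + y) * ?w + x ^ 2 + x * y) / x ^ 2"
    using assms(2) by (simp add: add_divide_distrib self_add)
  also have "(x ^ 2 + y) * ?w + x ^ 2 + x * y = ?r * (x ^ 2 + y) + (y ^ 2 + x ^ 3) / x"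
    unfolding w using assms(2) by (simp add: field_simps char2)
  also have "(y ^ 2 + x ^ 3) / x = y + a * y / x"
    unfolding on_y2[OF on] using assms(2) by (simp add: field_simps char2)
  also have "a * (?r * (x ^ 2 + y) + (y + a * y / x)) / x ^ 2
     = a * ?r + ?r * (a * y) / x ^ 2 + a * y / x ^ 2 + a ^ 2 * y / x ^ 3"
    using assms(2) by (simp add: field_simps power2_eq_square power3_eq_cube)
  finally show ?thesis .
qed

lemma rh_eq:
  assumes "x \<noteq> 0" "x + a \<noteq> 0"
  shows "rh x y = (D x + a + a * y / x) / (x + a)"
proof -
  have "rh x y * (x + a) = D x + y + a + (x + a) * (y / x)"
  proof -
    have "W x y * (x + a) = D x + y + a" using assms(2) by (simp add: W_def)
    thus ?thesis unfolding rh_def distrib_right[of "W x y"] by (simp only: mult.commute)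
  qed
  also have "(x + a) * (y / x) = y + a * y / x" using assms(1) by (simp add: distrib_right add_divide_distrib)
  also have "D x + y + a + (y + z) = D x + a + z" for z by (simp add: algebra_simps self_add)
  finally show ?thesis unfolding nonzero_eq_divide_eq[OF assms(2)] .
qed

end

locale ode2_place = ode2 D a + dplace R pi D for R :: "'f::field set" and pi :: 'f and D :: "'f \<Rightarrow> 'f" and a
begin

text \<open>An even power of the uniformiser is a square and passes through \<open>D\<close>, so no
  order is lost. This applies to \<open>x\<close>, whose poles have even order.\<close>

lemma vge_D_even:
  assumes "vge x (2 * k)" shows "vge (D x) (2 * k)"
proof -
  obtain v where v: "v \<in> R" "x = pi powi (2 * k) * v" using assms by (auto simp: vge_def)
  have "pi powi (2 * k) = (pi powi k) ^ 2"
    unfolding power2_eq_square mult_2 using pi_nz by (intro power_int_add) simp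
  hence "D x = pi powi (2 * k) * D v" unfolding v(2) D_mult by (simp add: D_square)
  thus ?thesis using D_R[OF v(1)] unfolding vge_def by blast
qed

lemma pole_val2:
  assumes on: "on x y" and a: "vge a (-1)" and nx: "\<not> vge x 0"
  obtains n where "n \<ge> 1" "val x (- 2 * n)" "val y (- 3 * n)"
proof -
  obtain m where m: "m < 0" "val x m" using not_vge_val[OF nx] by blast
  have x3: "val (x ^ 3) (3 * m)" using val_power[OF m(2), of 3] by simp
  have xa: "vge (x + a) m" using vge_add[OF val_imp_vge[OF m(2)] vge_mono[OF a]] m by simp
  have e: "y ^ 2 + (x + a) * y = x ^ 3" using on by (simp add: on_def algebra_simps)
  have "y \<noteq> 0" using e val_nz[OF x3] by auto
  then obtain k where k: "val y k" using val_ex by blast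
  have y2: "val (y ^ 2) (2 * k)" using val_power[OF k, of 2] by simp
  have xy: "vge ((x + a) * y) (m + k)" using vge_mult[OF xa val_imp_vge[OF k]] .
  have "2 * k = 3 * m"
  proof (rule linorder_cases[of "2 * k" "3 * m"])
    assume "2 * k < 3 * m"
    hence "val (y ^ 2 + (x + a) * y) (2 * k)" using m by (intro val_add[OF y2] vge_mono[OF xy]) simp
    thus ?thesis using val_unique[OF x3] unfolding e by simp
  next
    assume "2 * k > 3 * m"
    hence "vge (y ^ 2 + (x + a) * y) (3 * m + 1)" using m
      by (intro vge_add vge_mono[OF val_imp_vge[OF y2]] vge_mono[OF xy]) auto
    thus ?thesis using val_vge_le[OF x3] unfolding e by fastforce
  qed simp
  moreover from this have "even m" by presburger
  then obtain n where n: "m = 2 * n" by blast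
  ultimately show ?thesis using m k by (intro that[of "- n"]) auto
qed

lemma pole_local2:
  assumes on: "on x y" and n: "n \<ge> 1" "val x (- 2 * n)" "val y (- 3 * n)"
    and e: "0 \<le> e" "e \<le> 1" "vge a (- e)"
  shows "vge (rh x y) 0" "vge (N x y) (- e)" "vge (del x y) 0" "x + a \<noteq> 0"
    and "vge (a * y / x ^ 2) (- e + n)" "vge (D x) (- 2 * n + 1) \<Longrightarrow> e = 0 \<Longrightarrow> vge (rh x y) 1"
proof -
  have x0: "x \<noteq> 0" using val_nz[OF n(2)] .
  have xav: "val (x + a) (- 2 * n)" by (rule val_add[OF n(2) vge_mono[OF e(3)]]) (use n e in simp)
  thus xa: "x + a \<noteq> 0" using val_nz by blast
  have x2: "val (x ^ 2) (- 4 * n)" "val (x ^ 3) (- 6 * n)" using val_power[OF n(2), of 2] val_power[OF n(2), of 3] by simp_all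
  have ay: "vge (a * y) (- e - 3 * n)" using vge_mult[OF e(3) val_imp_vge[OF n(3)]] by simp
  have Dx: "vge (D x) (- 2 * n)" using vge_D_even[of x "- n"] val_imp_vge[OF n(2)] by simp
  have ayx: "vge (a * y / x) (- e - n)" by (rule vge_divide'[OF ay n(2)]) simp
  have "vge (D x + a + a * y / x) (- 2 * n)"
    by (intro vge_add Dx vge_mono[OF e(3)] vge_mono[OF ayx]) (use n e in auto)
  thus r: "vge (rh x y) 0" unfolding rh_eq[OF x0 xa] by (rule vge_divide'[OF _ xav]) simp
  show "vge (rh x y) 1" if "vge (D x) (- 2 * n + 1)" "e = 0"
  proof -
    have "vge (D x + a + a * y / x) (- 2 * n + 1)"
      by (intro vge_add that vge_mono[OF e(3)] vge_mono[OF ayx]) (use n that in auto)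
    thus ?thesis unfolding rh_eq[OF x0 xa] by (rule vge_divide'[OF _ xav]) simp
  qed
  show ayx2: "vge (a * y / x ^ 2) (- e + n)" by (rule vge_divide'[OF ay x2(1)]) simp
  have a2: "vge (a ^ 2 * y / x ^ 3) 0"
    using vge_divide'[OF vge_mult[OF vge_power[OF e(3), of 2] val_imp_vge[OF n(3)]] x2(2), of 0] n e by simp
  have ra: "vge (rh x y * (a * y) / x ^ 2) 0"
    using vge_mult'[OF r ayx2, of 0] n e by simp
  have l: "vge z (- e)" if "vge z 0" for z using vge_mono[OF that] e by simp
  have ayx0: "vge (a * y / x ^ 2) 0" using vge_mono[OF ayx2, of 0] n e by simp
  have r2: "vge (rh x y ^ 2) 0" using vge_power[OF r, of 2] by simp
  show "vge (del x y) 0" unfolding del_rh[OF on x0] using vge_add[OF vge_add[OF ayx0 r2] r] .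
  have ar: "vge (a * rh x y) (- e)" using vge_mult[OF e(3) r] by simp
  show "vge (N x y) (- e)" unfolding N_rh[OF on x0 xa]
    using vge_add[OF vge_add[OF vge_add[OF vge_add[OF ar l[OF ra]] l[OF ayx0]] l[OF a2]] l[OF vge_D0[OF r]]] .
qed

text \<open>Over an additive fibre \<open>y\<close> may share the simple pole of \<open>a\<close>.
  \<open>W\<close> is regular nevertheless, since its denominator \<open>x + a\<close> has a pole of
  order exactly 1.\<close>

lemma additive2:
  assumes on: "on x y" and x: "vge x 0" and a: "val a (-1)"
  shows "vge y (-1)" "vge (W x y) 0" "x + a \<noteq> 0"
proof -
  have "val (a + x) (-1)" by (rule val_add[OF a]) (use x in simp)
  hence xa: "val (x + a) (-1)" by (simp add: add.commute)
  thus "x + a \<noteq> 0" using val_nz by blast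
  show y: "vge y (-1)"
  proof (rule ccontr)
    assume "\<not> vge y (-1)"
    then obtain k where k: "k < -1" "val y k" using not_vge_val by blast
    have e: "y ^ 2 + (x + a) * y = x ^ 3" using on by (simp add: on_def algebra_simps)
    have y2: "val (y ^ 2) (2 * k)" using val_power[OF k(2), of 2] by simp
    have "vge ((x + a) * y) (2 * k + 1)"
      by (rule vge_mult'[OF val_imp_vge[OF xa] val_imp_vge[OF k(2)]]) (use k in simp)
    from val_add[OF y2 this] have "val (x ^ 3) (2 * k)" unfolding e .
    moreover have "vge (x ^ 3) 0" using vge_power[OF x, of 3] by simp
    ultimately have "0 \<le> 2 * k" by (rule val_vge_le)
    thus False using k by simp
  qed
  have "vge (D x + y + a) (-1)"
    by (intro vge_add y val_imp_vge[OF a] vge_mono[OF vge_D0[OF x]]) simp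
  thus "vge (W x y) 0" unfolding W_def by (rule vge_divide'[OF _ xa]) simp
qed

lemma y_regular2:
  assumes on: "on x y" and x: "vge x 0" and a: "vge a 0" shows "vge y 0"
proof (rule ccontr)
  assume "\<not> vge y 0"
  then obtain k where k: "k < 0" "val y k" using not_vge_val by blast
  have e: "y ^ 2 + (x + a) * y = x ^ 3" using on by (simp add: on_def algebra_simps)
  have y2: "val (y ^ 2) (2 * k)" using val_power[OF k(2), of 2] by simp
  have "vge ((x + a) * y) (2 * k + 1)"
    by (rule vge_mult'[OF vge_add[OF x a] val_imp_vge[OF k(2)]]) (use k in simp)
  from val_add[OF y2 this] have "val (x ^ 3) (2 * k)" unfolding e .
  moreover have "vge (x ^ 3) 0" using vge_power[OF x, of 3] by simp
  ultimately have "0 \<le> 2 * k" by (rule val_vge_le)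
  thus False using k by simp
qed

text \<open>\<open>W\<close> can be computed with either partial derivative as denominator. The two
  formulas have the same shape \<open>F W = D F + ...\<close>, which is what the local analysis at a
  node exploits.\<close>

lemma F12:
  assumes on: "on x y" and xa: "x + a \<noteq> 0"
  shows "(x + a) * W x y = D (x + a) + (x ^ 2 + y) + (x + a) ^ 2"
    and "(x ^ 2 + y) * W x y = D (x ^ 2 + y) + y * (x + a) + (x ^ 2 + y)"
proof -
  show "(x + a) * W x y = D (x + a) + (x ^ 2 + y) + (x + a) ^ 2"
    unfolding D_add Dx_W[OF xa, of y] Da by (simp add: algebra_simps char2)
  show "(x ^ 2 + y) * W x y = D (x ^ 2 + y) + y * (x + a) + (x ^ 2 + y)"
    unfolding D_add D_square Dy_W[OF on xa] by (simp add: algebra_simps char2)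
qed

lemma nonsingular2:
  assumes on: "on x y" and x: "vge x 0" and a: "vge a 0" and xa: "x + a \<noteq> 0"
    and u: "val (x + a) 0 \<or> val (x ^ 2 + y) 0"
  shows "vge (W x y) 0"
proof -
  have y: "vge y 0" by (rule y_regular2[OF on x a])
  have m: "vge (p * q) 0" if "vge p 0" "vge q 0" for p q using vge_mult[OF that] by simp
  have F: "vge (x + a) 0" "vge (x ^ 2 + y) 0" "vge ((x + a) ^ 2) 0"
    unfolding power2_eq_square by (intro vge_add x a y m)+
  from u show ?thesis
  proof
    assume v: "val (x + a) 0"
    have "vge ((x + a) * W x y) 0" unfolding F12(1)[OF on xa] by (intro vge_add F vge_D0)
    from vge_divide'[OF this v, of 0] xa show ?thesis by simp
  next
    assume v: "val (x ^ 2 + y) 0"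
    have "vge ((x ^ 2 + y) * W x y) 0" unfolding F12(2)[OF on xa] by (intro vge_add F vge_D0 m y)
    from vge_divide'[OF this v, of 0] val_nz[OF v] show ?thesis by simp
  qed
qed

text \<open>Substituting \<open>x = p + a\<close> and \<open>y = q + (p + a)^2\<close>, with
  \<open>p\<close>, \<open>q\<close> the two partial derivatives, turns the equation into
  \<open>a^4 + a^3\<close>, the discriminant, plus terms divisible by \<open>p\<close> or
  \<open>q\<close>.\<close>

lemma singular_disc:
  assumes on: "on x y" and x: "vge x 0" and a: "vge a 0" and F: "vge (x + a) 1" "vge (x ^ 2 + y) 1"
  shows "vge (a ^ 4 + a ^ 3) 1"
proof -
  have y: "vge y 0" by (rule y_regular2[OF on x a])
  have m: "vge (p * q) 0" if "vge p 0" "vge q 0" for p q using vge_mult[OF that] by simp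
  have m1: "vge (p * q) 1" if "vge p 1" "vge q 0" for p q using vge_mult[OF that] by simp
  define p q where "p = x + a" and "q = x ^ 2 + y"
  have e: "x = p + a" "y = q + (p + a) ^ 2" by (simp_all add: p_def q_def add.assoc add.left_commute self_add)
  have "0 = y ^ 2 + x * y + a * y + x ^ 3" using on_0[OF on] by simp
  also have "\<dots> = (a ^ 4 + a ^ 3) + (p * (p ^ 3 + (x ^ 2 + x * a + a ^ 2) + y) + q * q)"
    unfolding e by (simp add: algebra_simps eval_nat_numeral self_add two0)
  finally have "a ^ 4 + a ^ 3 = 0 + (p * (p ^ 3 + (x ^ 2 + x * a + a ^ 2) + y) + q * q)"
    by (intro shift[THEN iffD1]) (rule sym)
  moreover have "vge (p * (p ^ 3 + (x ^ 2 + x * a + a ^ 2) + y) + q * q) 1"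
    unfolding power2_eq_square power3_eq_cube using F[folded p_def q_def]
    by (intro vge_add m1 m x a y) (auto intro: vge_mono)
  ultimately show ?thesis by simp
qed

end

locale ode2_lplace = ode2_place R pi D a + lplace R pi D k0
  for R :: "'f::field set" and pi :: 'f and D :: "'f \<Rightarrow> 'f" and a k0
begin

text \<open>As in odd characteristic, the logarithmic derivation multiplies the leading coefficient
  of a partial derivative by its order. With \<open>k0 = 1\<close> the residue of \<open>W\<close>
  is therefore an integer: the order of \<open>x + a\<close> if that is smaller than the order of
  \<open>x^2 + y\<close>, and otherwise one more than the latter.\<close>

lemma singular_log2:
  assumes on: "on x y" and x: "vge x 0" and a: "vge a 0" and xa: "x + a \<noteq> 0"
    and F: "vge (x + a) 1" "vge (x ^ 2 + y) 1"
  shows "vge (W x y) 0"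
    and "vge y 1 \<Longrightarrow> k0 = 1 \<Longrightarrow> \<exists>i. vge (W x y + of_int i) 1"
proof -
  have y: "vge y 0" by (rule y_regular2[OF on x a])
  let ?F = "x + a" and ?G = "x ^ 2 + y"
  obtain n where n: "val ?F n" using val_ex[OF xa] by blast
  have n1: "n \<ge> 1" using val_vge_le[OF n F(1)] .
  have "vge (W x y) 0 \<and> (vge y 1 \<longrightarrow> k0 = 1 \<longrightarrow> (\<exists>i. vge (W x y + of_int i) 1))"
  proof (cases "vge ?G (n + 1)")
    case True
    have F2: "vge (?F ^ 2) (n + 1)" using vge_mono[OF vge_power[OF val_imp_vge[OF n], of 2]] n1 by simp
    have "vge (D ?F + ?G + ?F ^ 2) n"
      by (intro vge_add vge_Dl[OF val_imp_vge[OF n]] vge_mono[OF True] vge_mono[OF F2]) auto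
    hence 1: "vge (W x y) 0" using vge_divide'[of "?F * W x y" n ?F n 0] n xa unfolding F12(1)[OF on xa, symmetric] by simp
    have "vge (W x y + of_int n) 1" if "k0 = 1"
    proof -
      have "(W x y + of_int n) * ?F = (D ?F - of_int n * k0 * ?F) + ?G + ?F ^ 2"
      proof -
        have "(W x y + of_int n) * ?F = ?F * W x y + of_int n * ?F" by (simp add: algebra_simps)
        thus ?thesis unfolding F12(1)[OF on xa] that neg(2) by (simp only: add.assoc add.left_commute add.commute mult_1_right)
      qed
      moreover have "vge ((D ?F - of_int n * k0 * ?F) + ?G + ?F ^ 2) (n + 1)"
        by (intro vge_add val_D[OF val_imp_vge[OF n]] True F2)
      ultimately have "vge ((W x y + of_int n) * ?F) (n + 1)" by simp
      from vge_divide'[OF this n, of 1] show ?thesis using xa by simp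
    qed
    thus ?thesis using 1 by blast
  next
    case False
    then obtain m where m: "m < n + 1" "val ?G m" using not_vge_val by blast
    have g: "?G \<noteq> 0" using val_nz[OF m(2)] .
    have "vge (y * ?F) m" by (rule vge_mult'[OF y val_imp_vge[OF n]]) (use m in simp)
    hence "vge (?G * W x y) m" unfolding F12(2)[OF on xa]
      by (intro vge_add vge_Dl val_imp_vge[OF m(2)])
    from vge_divide'[OF this m(2), of 0] g have 1: "vge (W x y) 0" by simp
    have "vge (W x y + of_int (m + 1)) 1" if "vge y 1" "k0 = 1"
    proof -
      have "(W x y + of_int (m + 1)) * ?G = (D ?G - of_int m * k0 * ?G) + y * ?F"
      proof -
        have "(W x y + of_int (m + 1)) * ?G = ?G * W x y + (of_int m * ?G + ?G)" by (simp add: algebra_simps)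
        also have "\<dots> = D ?G + y * ?F + ?G + (of_int m * ?G + ?G)" unfolding F12(2)[OF on xa] ..
        also have "p + q + g + (h + g) = p + h + q" for p q g h :: 'f
        proof -
          have "p + q + g + (h + g) = p + h + q + (g + g)" by (simp only: add.assoc add.left_commute add.commute)
          thus ?thesis unfolding self_add by simp
        qed
        finally show ?thesis unfolding that(2) neg(2) mult_1_right .
      qed
      moreover have "vge (y * ?F) (m + 1)" by (rule vge_mult'[OF that(1) val_imp_vge[OF n]]) (use m in simp)
      ultimately have "vge ((W x y + of_int (m + 1)) * ?G) (m + 1)"
        using vge_add[OF val_D[OF val_imp_vge[OF m(2)]]] by simp
      from vge_divide'[OF this m(2), of 1] show ?thesis using g by simp
    qed
    thus ?thesis using 1 by blast
  qed
  thus "vge (W x y) 0" "vge y 1 \<Longrightarrow> k0 = 1 \<Longrightarrow> \<exists>i. vge (W x y + of_int i) 1" by auto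
qed

end

locale pencil2 =
  fixes d :: nat and a :: "'c::alg_closed_field poly fract"
  assumes ch: "CHAR('c) = 2" and d: "d > 0" "odd d" and a: "a = 1 + sg d 1"
begin

lemma char0: "(2::'c poly fract) = 0" "(2::'c) = 0"
  using char_field[OF two_is_prime_nat ch] by simp_all

lemma tder_eta: "(\<lambda>x. const_fract (1::'c) * tder x) = tder"
  by simp

lemma of_nat_d: "of_nat d = (1::'c)"
proof -
  obtain k where "d = 2 * k + 1" using d(2) oddE by blast
  thus ?thesis using char0 by simp
qed

sublocale ode2 tder a
proof (intro ode2.intro ode2_axioms.intro)
  show "derivation (tder :: 'c poly fract \<Rightarrow> _)" using derivation_tder[of "1::'c"] unfolding tder_eta .
  then interpret derivation "tder :: 'c poly fract \<Rightarrow> _" .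
  show "(2::'c poly fract) = 0" by (rule char0)
  have "tder a = - (sg d 1 + sg d 1 ^ 2)" using D_sg[OF d(1), of 1 "1::'c"] of_nat_d by (simp add: a D_add)
  also have "\<dots> = (a ^ 2 + a) - 2 * (a ^ 2)" unfolding a by (simp add: algebra_simps power2_eq_square)
  finally show "tder a = a ^ 2 + a" using char0 by simp
qed

lemma place2: "ode2_place (finR \<alpha>) (finpi \<alpha>) tder a"
  using dplace_fin[of \<alpha> "1::'c"] unfolding tder_eta by (intro ode2_place.intro ode2_axioms)

lemma lplace2: "ode2_lplace (finR 0) (finpi 0) tder a 1" "ode2_lplace infR infpi tder a (const_fract (- 1))"
proof -
  show "ode2_lplace (finR 0) (finpi 0) tder a 1"
    using lplace_0[of "1::'c"] unfolding tder_eta by (intro ode2_lplace.intro place2) simp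
  have l: "lplace infR infpi (tder :: 'c poly fract \<Rightarrow> _) (const_fract (- 1))" using lplace_inf[of "1::'c"] unfolding tder_eta .
  thus "ode2_lplace infR infpi tder a (const_fract (- 1))"
    by (intro ode2_lplace.intro ode2_place.intro ode2_axioms) (auto simp: lplace_def)
qed

lemma sg1: "a + 1 = sg d 1" "a = tt d * sg d 1"
  using sg_mult[OF d(1), of "1::'c"] by (simp_all add: a algebra_simps self_add)

lemma a_pole: "\<alpha> ^ d = 1 \<Longrightarrow> fval \<alpha> a (-1)"
proof -
  assume al: "\<alpha> ^ d = 1"
  have "fval \<alpha> (sg d 1 + 1) (-1)"
    by (rule place.val_add[OF place_fin sg_pole[OF al]]) (use of_nat_d place.vge_1[OF place_fin] in auto)
  thus ?thesis by (simp add: a add.commute)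
qed

lemma a_reg: "\<alpha> ^ d \<noteq> 1 \<Longrightarrow> fvge \<alpha> a 0"
  unfolding a by (intro place.vge_add[OF place_fin] place.vge_1[OF place_fin] place.val_imp_vge[OF place_fin sg_unit])

lemma a_unit: "\<alpha> ^ d \<noteq> 1 \<Longrightarrow> \<alpha> \<noteq> 0 \<Longrightarrow> fval \<alpha> (a ^ 4 + a ^ 3) 0"
proof -
  assume *: "\<alpha> ^ d \<noteq> 1" "\<alpha> \<noteq> 0"
  interpret place "finR \<alpha>" "finpi \<alpha>" by (rule place_fin)
  have "val a 0" unfolding sg1(2) using val_mult[OF tt_unit[OF *(2)] sg_unit[OF *(1)]] by simp
  hence "val (a ^ 3 * (a + 1)) 0" unfolding sg1(1) using val_mult[OF val_power[of a 0 3] sg_unit[OF *(1)]] by simp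
  thus ?thesis by (simp add: algebra_simps eval_nat_numeral)
qed

lemma a_0: "fvge 0 a 1"
  using sg_0[OF d(1), of "1::'c"] by (simp add: a add.commute)

lemma a_inf: "ivge a 0"
  unfolding a by (intro place.vge_add[OF place_inf] place.vge_1[OF place_inf] place.vge_mono[OF place_inf sg_inf[OF d(1)]]) simp

lemma a_nz: "a \<noteq> 0" "a + 1 \<noteq> 0"
  using place.val_nz[OF place_fin a_pole[of 1]] place.val_nz[OF place_fin sg_pole[of 1 d "1::'c"]] of_nat_d
  unfolding sg1(1) by auto

text \<open>\<open>x = a\<close> would give \<open>y^2 = a^3\<close>, whose pole at
  \<open>u = 1\<close> has the odd order 3.\<close>

lemma xa: "on x y \<Longrightarrow> x + a \<noteq> 0"
proof
  assume on: "on x y" and "x + a = 0"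
  hence x: "x = a" using neg(1) by (metis add_eq_0_iff2)
  interpret place "finR (1::'c)" "finpi 1" by (rule place_fin)
  have "y ^ 2 = a ^ 3" using on unfolding on_def x by (simp add: self_add add.assoc)
  moreover have a3: "val (a ^ 3) (-3)" using val_power[OF a_pole[of 1], of 3] by simp
  ultimately have y2: "val (y ^ 2) (-3)" by simp
  hence "y \<noteq> 0" using val_nz by fastforce
  then obtain k where "val y k" using val_ex by blast
  hence "-3 = 2 * k" using val_unique[OF y2 val_power[of y k 2]] by simp
  thus False by presburger
qed

abbreviation locally_fine where
  "locally_fine Rr pp e x y \<equiv> ((place.vge Rr pp x 0 \<and> place.vge Rr pp y (- e) \<and> place.vge Rr pp (W x y) 0) \<or>
     (\<exists>n\<ge>1. place.val Rr pp x (- 2 * n) \<and> place.val Rr pp y (- 3 * n) \<and> place.vge Rr pp (rh x y) 0)) \<and>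
     place.vge Rr pp (N x y) (- e) \<and> place.vge Rr pp (del x y) 0"

lemma regularI:
  assumes "ode2_place Rr pp tder a" "place.vge Rr pp x 0" "place.vge Rr pp y (- e)" "place.vge Rr pp (W x y) 0" "e \<ge> 0"
  shows "locally_fine Rr pp e x y"
proof -
  interpret ode2_place Rr pp tder a by fact
  have "vge (W x y ^ 2) 0" using vge_power[OF assms(4), of 2] by simp
  hence "vge (del x y) 0" unfolding del_def by (intro vge_add assms)
  moreover have "vge (N x y) 0" unfolding N_def by (intro vge_D0 vge_add assms)
  hence "vge (N x y) (- e)" by (rule vge_mono) (use assms in simp)
  ultimately show ?thesis using assms by blast
qed

lemma poleI:
  assumes "ode2_place Rr pp tder a" "on x y" "\<not> place.vge Rr pp x 0" "0 \<le> e" "e \<le> 1" "place.vge Rr pp a (- e)"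
  shows "locally_fine Rr pp e x y"
proof -
  interpret ode2_place Rr pp tder a by fact
  have "vge a (-1)" using vge_mono[OF assms(6), of "-1"] assms by simp
  then obtain n where n: "n \<ge> 1" "val x (- 2 * n)" "val y (- 3 * n)" using pole_val2[OF assms(2) _ assms(3)] by blast
  show ?thesis using pole_local2[OF assms(2) n assms(4-6)] n by blast
qed

lemma fin_local2:
  assumes on: "on x y"
  shows "locally_fine (finR \<alpha>) (finpi \<alpha>) (if \<alpha> ^ d = 1 then 1 else 0) x y"
proof (cases "fvge \<alpha> x 0")
  case x: True
  interpret ode2_place "finR \<alpha>" "finpi \<alpha>" tder a by (rule place2)
  show ?thesis
  proof (cases "\<alpha> ^ d = 1")
    case True
    show ?thesis using regularI[OF place2 x, of y 1] additive2[OF on x a_pole[OF True]] True by simp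
  next
    case False
    have av: "vge a 0" by (rule a_reg[OF False])
    have y: "vge y 0" by (rule y_regular2[OF on x av])
    have "vge (W x y) 0"
    proof (cases "val (x + a) 0 \<or> val (x ^ 2 + y) 0")
      case True thus ?thesis by (rule nonsingular2[OF on x av xa[OF on]])
    next
      case nu: False
      have "vge (x ^ 2) 0" using vge_power[OF x, of 2] by simp
      hence F: "vge (x + a) 1" "vge (x ^ 2 + y) 1"
        using unit_or_vge[OF vge_add[OF x av]] unit_or_vge[OF vge_add[of "x ^ 2" 0 y]] y nu by auto
      have "\<alpha> = 0"
        using singular_disc[OF on x av F] a_unit[OF False] val_vge_le[of "a ^ 4 + a ^ 3" 0 1] by fastforce
      thus ?thesis using ode2_lplace.singular_log2(1)[OF lplace2(1) on _ _ xa[OF on]] x av F by simp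
    qed
    thus ?thesis using regularI[OF place2 x, of y 0] y False by simp
  qed
next
  case False
  have "fvge \<alpha> a (- (if \<alpha> ^ d = 1 then 1 else 0))"
    using place.val_imp_vge[OF place_fin a_pole[of \<alpha>]] a_reg[of \<alpha>] by simp
  thus ?thesis by (intro poleI[OF place2 on False]) auto
qed

lemma inf_local2:
  assumes on: "on x y" shows "locally_fine infR infpi 0 x y"
proof -
  interpret ode2_lplace infR infpi tder a "const_fract (- 1)" by (rule lplace2)
  have P: "ode2_place infR infpi tder a" by unfold_locales
  show ?thesis
  proof (cases "vge x 0")
    case x: True
    have y: "vge y 0" by (rule y_regular2[OF on x a_inf])
    have "vge (W x y) 0"
    proof (cases "val (x + a) 0 \<or> val (x ^ 2 + y) 0")
      case True thus ?thesis by (rule nonsingular2[OF on x a_inf xa[OF on]])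
    next
      case nu: False
      have "vge (x ^ 2) 0" using vge_power[OF x, of 2] by simp
      hence F: "vge (x + a) 1" "vge (x ^ 2 + y) 1"
        using unit_or_vge[OF vge_add[OF x a_inf]] unit_or_vge[OF vge_add[of "x ^ 2" 0 y]] y nu by auto
      show ?thesis by (rule singular_log2(1)[OF on x a_inf xa[OF on] F])
    qed
    thus ?thesis using regularI[OF P x, of y 0] y by simp
  next
    case False
    show ?thesis by (rule poleI[OF P on False]) (use a_inf in auto)
  qed
qed

lemma N_zero:
  assumes on: "on x y" shows "N x y = 0"
proof -
  define S where "S = Fract (spoly d (1::'c)) 1"
  have "S * N x y \<in> finR \<alpha>" for \<alpha>
  proof -
    interpret place "finR \<alpha>" "finpi \<alpha>" by (rule place_fin)
    have "vge (S * N x y) 0"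
    proof (cases "\<alpha> ^ d = 1")
      case True
      have "vge S 1" unfolding S_def by (rule fvge_poly_root) (use True in \<open>simp add: poly_spoly\<close>)
      thus ?thesis using vge_mult[of S 1 "N x y" "-1"] fin_local2[OF on, of \<alpha>] True by simp
    next
      case False
      have "vge S 0" unfolding S_def by (rule fvge_poly)
      thus ?thesis using vge_mult[of S 0 "N x y" 0] fin_local2[OF on, of \<alpha>] False by simp
    qed
    thus ?thesis by (simp add: vge_0_iff)
  qed
  then obtain Mm where Mm: "S * N x y = Fract Mm 1" using regular_poly by blast
  have "N x y \<in> infR" using inf_local2[OF on] place.vge_0_iff[OF place_inf, of "N x y"] by simp
  hence deg: "degree Mm \<le> d" using degree_le_of_inf[of Mm "spoly d 1" "N x y"] Mm degree_spoly[OF d(1), of "1::'c"] unfolding S_def by simp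
  \<comment> \<open>The Hasse invariant being 1, the polynomial to be used in
    \<open>hasse_witt_1\<close> is \<open>t - 1 = 1 + t\<close>, with both digits non-zero.\<close>
  have T: "pcompose [:1, 1:] (monom 1 d) = spoly d (1::'c)"
  proof -
    have "pcompose [:1, 1:] (monom 1 d) = spoly d 1 + [:2::'c:]" by (simp add: pcompose_pCons spoly_def numeral_poly one_pCons)
    thus ?thesis using char0 by simp
  qed
  have "Fract (pcompose [:1, 1:] (monom 1 d) * Mm) 1 = S * Fract Mm 1" unfolding T S_def by simp
  also have "\<dots> = S ^ 2 * N x y" unfolding Mm[symmetric] by (simp only: power2_eq_square mult.assoc)
  also have "\<dots> = tder (S ^ 2 * del x y)" unfolding D_mult D_square D_del by simp
  finally have "coeff (pcompose [:1, 1:] (monom 1 d) * Mm) (2 * i) = 0" for i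
    using exact_coeff[OF two_is_prime_nat ch] by blast
  hence "Mm = 0"
  proof (intro hasse_witt_1[of 2 d "[:1, 1:]"])
    fix j :: nat assume "j < 2" thus "coeff [:1, 1 :: 'c:] j \<noteq> 0" by (cases j) auto
  qed (use d deg in auto)
  hence "S * N x y = 0" using Mm by (simp add: fract_collapse)
  moreover have "S \<noteq> 0" unfolding S_def using spoly_nz[OF d(1), of "1::'c"] by (simp add: Zero_fract_def eq_fract)
  ultimately show ?thesis by simp
qed

lemma del_0:
  assumes on: "on x y" shows "fvge 0 (del x y) 1"
proof -
  interpret ode2_lplace "finR 0" "finpi 0" tder a 1 by (rule lplace2)
  have av: "vge a 0" by (rule vge_mono[OF a_0]) simp
  have m1: "vge (p * q) 1" if "vge p 1" "vge q 0" for p q using vge_mult[OF that] by simp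
  show ?thesis
  proof (cases "vge x 0")
    case False
    have "vge a (-1)" by (rule vge_mono[OF a_0]) simp
    then obtain n where n: "n \<ge> 1" "val x (- 2 * n)" "val y (- 3 * n)" using pole_val2[OF on _ False] by blast
    note loc = pole_local2[OF on n, of 0]
    \<comment> \<open>The logarithmic derivation multiplies the leading coefficient of
      \<open>x\<close> by its order, which is even; so \<open>D x\<close> gains an order and
      \<open>rh\<close> vanishes at \<open>u = 0\<close>.\<close>
    have "of_int (- 2 * n) = (0 :: 'c poly fract)" using two0 by simp
    hence "vge (tder x) (- 2 * n + 1)" using val_D[OF val_imp_vge[OF n(2)]] by (simp add: two0)
    hence r: "vge (rh x y) 1" using loc(6) av by simp
    have "vge (rh x y ^ 2) 1" using vge_mono[OF vge_power[OF r, of 2], of 1] by simp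
    moreover have "vge (a * y / x ^ 2) 1" using vge_mono[OF loc(5), of 1] av n by simp
    ultimately show ?thesis unfolding del_rh[OF on val_nz[OF n(2)]] using r by (intro vge_add)
  next
    case x: True
    have y: "vge y 0" by (rule y_regular2[OF on x av])
    have w: "vge (W x y) 0" using fin_local2[OF on, of 0] x val_vge_le[of x _ 0] d(1) by (fastforce simp: power_0_left)
    have Dx: "vge (tder x) 1" using D_R1 x by (simp add: vge_0_iff)
    have e: "(x + a) * W x y = tder x + y + a" using xa[OF on] by (simp add: W_def)
    show ?thesis
    proof (cases "val x 0")
      case True
      have "x * W x y + y = tder x + a + a * W x y"
        using e by (simp add: algebra_simps shift[of "x * W x y"] self_add) (simp add: shift algebra_simps self_add)
      moreover have "vge (tder x + a + a * W x y) 1" by (intro vge_add Dx a_0 m1[OF a_0 w])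
      ultimately have h: "vge (x * W x y + y) 1" by simp
      \<comment> \<open>Away from the node of \<open>y^2 + x y = x^3\<close> the slope relation
        \<open>x W + y = 0\<close> holds in the residue field, and \<open>del\<close> times
        \<open>x^2\<close> is expressed by it, by \<open>a\<close>, and by the equation of the
        curve.\<close>
      have "x ^ 2 * del x y = (x * W x y + y) * (x * W x y + y) + x * (x * W x y + y) + (y ^ 2 + x * y + a * y + x ^ 3) + a * y"
        unfolding del_def by (simp add: algebra_simps char2)
      hence "x ^ 2 * del x y = (x * W x y + y) * (x * W x y + y) + x * (x * W x y + y) + a * y"
        unfolding on_0[OF on] by simp
      moreover have "vge (x * (x * W x y + y)) 1" using m1[OF h x] by (simp add: mult.commute)
      ultimately have "vge (x ^ 2 * del x y) 1"
        using vge_add[OF vge_add[OF m1[OF h vge_mono[OF h]]] m1[OF a_0 y]] by simp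
      moreover have "val (x ^ 2) 0" using val_power[OF True, of 2] by simp
      ultimately show ?thesis using vge_divide'[of "x ^ 2 * del x y" 1 "x ^ 2" 0 1] val_nz[OF True] by simp
    next
      case False
      hence x1: "vge x 1" using unit_or_vge[OF x] by simp
      have xx: "vge (x ^ 2) 1" "vge (x ^ 3) 1"
        using vge_mono[OF vge_power[OF x1, of 2], of 1] vge_mono[OF vge_power[OF x1, of 3], of 1] by auto
      have "vge (x ^ 3 + x * y + a * y) 1" by (intro vge_add xx m1 x1 y a_0)
      hence "vge (y ^ 2) 1" unfolding on_y2[OF on, symmetric] .
      hence y1: "vge y 1" using vge_power_pos[of y 2] by simp
      \<comment> \<open>At the node the residue of \<open>W\<close> lies in the field with two
        elements, hence is a root of \<open>W^2 + W\<close>.\<close>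
      obtain i where i: "vge (W x y + of_int i) 1"
        using singular_log2(2)[OF on x av xa[OF on] vge_add[OF x1 a_0] vge_add[OF xx(1) y1] y1] by blast
      have "(of_int i :: 'c poly fract) * of_int i = of_int i"
        using of_int_pow[OF two_is_prime_nat, of i, where 'c = "'c poly fract"] ch CHAR_poly_fract[where 'a = 'c]
        by (simp add: power2_eq_square)
      hence "of_int i * of_int i + of_int i = (of_int i + of_int i :: 'c poly fract)" by (simp only:)
      hence "of_int i * of_int i + of_int i = (0 :: 'c poly fract)" unfolding self_add .
      moreover have "(v + k) * (v + k + 1) = v ^ 2 + v + (k * k + k)" for v k :: "'c poly fract"
        by (simp add: algebra_simps char2)
      ultimately have "W x y ^ 2 + W x y = (W x y + of_int i) * (W x y + of_int i + 1)" by simp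
      moreover have "vge (W x y + of_int i + 1) 0" by (intro vge_add vge_mono[OF i] vge_1) simp
      ultimately have "vge (W x y ^ 2 + W x y) 1" using m1[OF i] by simp
      thus ?thesis unfolding del_def using x1 by (rule vge_add)
    qed
  qed
qed

lemma del_zero:
  assumes on: "on x y" shows "x = W x y ^ 2 + W x y"
proof -
  have "tder (del x y) = 0" using D_del N_zero[OF on] by simp
  then obtain e where e: "del x y = e ^ 2" using tder_eq_0[OF two_is_prime_nat ch] by blast
  have "e \<in> finR \<alpha>" for \<alpha>
  proof -
    interpret place "finR \<alpha>" "finpi \<alpha>" by (rule place_fin)
    have "vge (e ^ 2) 0" using fin_local2[OF on, of \<alpha>] e by simp
    thus ?thesis using vge_powerD[of e 2 0] by (simp add: vge_0_iff)
  qed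
  moreover have "e \<in> infR"
  proof -
    interpret place "infR :: 'c poly fract set" infpi by (rule place_inf)
    have "vge (e ^ 2) 0" using inf_local2[OF on] e by simp
    thus ?thesis using vge_powerD[of e 2 0] by (simp add: vge_0_iff)
  qed
  ultimately obtain k where k: "e = const_fract k" using regular_const by blast
  have "fvge 0 (e ^ 2) 1" using del_0[OF on] e by simp
  hence "fvge 0 (const_fract k) 1" using place.vge_power_pos[OF place_fin, of 0 e 2] k by simp
  hence "k = 0" using fvge_const_1 by blast
  hence "W x y ^ 2 + W x y + x = 0" using e k by (simp add: del_def)
  from iffD1[OF shift this] show ?thesis unfolding add_0 by (rule sym)
qed

definition X2 where "X2 x y = (x + a) * (W x y + 1) + y"
definition Y2 where "Y2 x y = (X2 x y + a ^ 2) * W x y + a * X2 x y"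

text \<open>The duplication formula: with \<open>X2 = z^2\<close> it reads
  \<open>x = (z^4 + a z^2)/(z^2 + a^2)\<close>, the \<open>x\<close>-coordinate of twice a point
  with \<open>x\<close>-coordinate \<open>z\<close>.\<close>

lemma X2_rel:
  assumes on: "on x y" shows "X2 x y ^ 2 + (x + a) * X2 x y + a ^ 2 * x = 0"
proof -
  let ?w = "W x y"
  have "X2 x y ^ 2 + (x + a) * X2 x y + a ^ 2 * x
     = (x + a) ^ 2 * (?w ^ 2 + ?w) + a ^ 2 * x + (y ^ 2 + x * y + a * y)"
    unfolding X2_def by (simp add: algebra_simps char2)
  also have "\<dots> = (x + a) ^ 2 * x + a ^ 2 * x + x ^ 3" unfolding del_zero[OF on, symmetric] using on by (simp add: on_def)
  also have "\<dots> = 0" by (simp add: algebra_simps char2)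
  finally show ?thesis .
qed

lemma D_W: "on x y \<Longrightarrow> tder (W x y) = tder x"
  using N_zero[of x y] unfolding N_def D_add shift[of "tder x"] by simp

lemma D_X2:
  assumes on: "on x y" shows "tder (X2 x y) = 0"
proof -
  let ?w = "W x y"
  have "tder (X2 x y) = (tder x + tder a) * (?w + 1) + (x + a) * tder x + tder y"
    unfolding X2_def D_add D_mult D_W[OF on] by (simp add: algebra_simps)
  also have "\<dots> = (x + a) * (?w ^ 2 + ?w) + a * x + x ^ 2"
    unfolding Dx_W[OF xa[OF on], of y] Dy_W[OF on xa[OF on]] Da by (simp add: algebra_simps char2)
  also have "\<dots> = 0" unfolding del_zero[OF on, symmetric] by (simp add: algebra_simps char2)
  finally show ?thesis .
qed

lemma D_Y2:
  assumes on: "on x y" shows "tder (Y2 x y) = 0"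
proof -
  have "tder (X2 x y ^ 2 + (x + a) * X2 x y + a ^ 2 * x) = 0" unfolding X2_rel[OF on] by simp
  hence "(tder x + tder a) * X2 x y + a ^ 2 * tder x = 0"
    unfolding D_add D_square D_mult D_X2[OF on] by simp
  moreover have "tder (Y2 x y) = (tder x + tder a) * X2 x y + a ^ 2 * tder x"
    unfolding Y2_def D_add D_mult D_square D_X2[OF on] D_W[OF on] by (simp add: algebra_simps)
  ultimately show ?thesis by simp
qed

lemma curve2:
  assumes on: "on x y" shows "Y2 x y ^ 2 + X2 x y * Y2 x y + a ^ 2 * Y2 x y = X2 x y ^ 3"
proof -
  let ?w = "W x y" and ?X = "X2 x y"
  have "(?X + a ^ 2) * x + (?X ^ 2 + a * ?X) = 0" using X2_rel[OF on] by (simp add: algebra_simps)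
  hence e: "(?X + a ^ 2) * x = ?X ^ 2 + a * ?X" unfolding shift by simp
  have "Y2 x y ^ 2 + ?X * Y2 x y + a ^ 2 * Y2 x y = (?X + a ^ 2) * ((?X + a ^ 2) * (?w ^ 2 + ?w)) + a ^ 2 * ?X ^ 2 + a * ?X * (?X + a ^ 2)"
    unfolding Y2_def by (simp add: algebra_simps char2)
  also have "\<dots> = (?X + a ^ 2) * (?X ^ 2 + a * ?X) + a ^ 2 * ?X ^ 2 + a * ?X * (?X + a ^ 2)"
    unfolding del_zero[OF on, symmetric] e ..
  also have "\<dots> = ?X ^ 3" by (simp add: algebra_simps char2)
  finally show ?thesis .
qed

lemma frob2: "(u + v) ^ 2 = u ^ 2 + v ^ 2" for u v :: "'c poly fract"
  by (simp add: algebra_simps char2)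

lemma square_inj: "u ^ 2 = v ^ 2 \<Longrightarrow> u = v" for u v :: "'c poly fract"
proof -
  assume "u ^ 2 = v ^ 2"
  hence "(u + v) ^ 2 = 0" unfolding frob2 by (simp add: self_add)
  thus ?thesis by (simp add: shift)
qed

lemma local_decrease2:
  fixes Rr :: "'c poly fract set" and pp :: "'c poly fract"
  assumes P: "place Rr pp" and e: "e \<le> 1" "place.vge Rr pp a (- e)" "e \<ge> 0" and loc: "locally_fine Rr pp e x y"
    and z: "z ^ 2 = X2 x y" "z \<notin> Rr"
  shows "\<exists>m n. 0 < m \<and> m < n \<and> place.val Rr pp z (- int m) \<and> place.val Rr pp x (- int n)"
proof -
  interpret place Rr pp by fact
  have "\<not> vge z 0" using z by (simp add: vge_0_iff)
  then obtain m where m: "m < 0" "val z m" using not_vge_val by blast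
  have zp: "val (X2 x y) (2 * m)" using val_power[OF m(2), of 2] z(1) by simp
  from conjunct1[OF loc] show ?thesis
  proof (elim disjE exE conjE)
    assume *: "vge x 0" "vge y (- e)" "vge (W x y) 0"
    have "vge (X2 x y) (- e)" unfolding X2_def
      by (intro vge_add *(2) vge_mult'[of _ "- e" _ 0] vge_add[OF vge_mono[OF *(1)] e(2)] vge_add[OF *(3) vge_1])
        (use e in auto)
    hence "- e \<le> 2 * m" using val_vge_le[OF zp] by blast
    thus ?thesis using m e by simp
  next
    fix q :: int assume *: "q \<ge> 1" "val x (- 2 * q)" "val y (- 3 * q)" "vge (rh x y) 0"
    have w: "vge (W x y) (- q)"
    proof -
      have "vge (y / x) (- q)" using vge_divide'[OF val_imp_vge[OF *(3)] *(2)] by simp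
      moreover have "vge (rh x y) (- q)" using vge_mono[OF *(4)] * by simp
      ultimately have "vge (rh x y + y / x) (- q)" by (intro vge_add)
      thus ?thesis by (simp add: rh_def add.assoc self_add)
    qed
    have "vge (X2 x y) (- 3 * q)" unfolding X2_def
      by (intro vge_add val_imp_vge[OF *(3)] vge_mult'[of _ "- 2 * q" _ "- q"] val_imp_vge[OF *(2)] vge_mono[OF e(2)] w
          vge_mono[OF vge_1]) (use * e in auto)
    hence "- 3 * q \<le> 2 * m" using val_vge_le[OF zp] by blast
    hence "- m < 2 * q" using * by simp
    moreover have "val z (- int (nat (- m)))" "val x (- int (nat (2 * q)))" using m * by simp_all
    ultimately show ?thesis using m by (intro exI[of _ "nat (- m)"] exI[of _ "nat (2 * q)"]) auto
  qed
qed

lemma descend2: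
  assumes on: "on x y"
  obtains z t where "on z t" "z ^ 2 = X2 x y" "(\<exists>\<alpha>. x \<notin> finR \<alpha>) \<or> x \<notin> infR \<Longrightarrow> npoles z < npoles x"
proof -
  obtain z where z: "X2 x y = z ^ 2" using tder_eq_0[OF two_is_prime_nat ch D_X2[OF on]] by blast
  obtain t where t: "Y2 x y = t ^ 2" using tder_eq_0[OF two_is_prime_nat ch D_Y2[OF on]] by blast
  have "(t ^ 2 + z * t + a * t) ^ 2 = (z ^ 3) ^ 2"
    using curve2[OF on] unfolding z t frob2 power_mult_distrib by (simp add: power_mult[symmetric] mult.commute)
  hence "on z t" unfolding on_def by (rule square_inj)
  moreover have "npoles z < npoles x" if "(\<exists>\<alpha>. x \<notin> finR \<alpha>) \<or> x \<notin> infR"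
  proof (rule npoles_less[OF _ _ that])
    fix \<alpha> assume zz: "z \<notin> finR \<alpha>"
    have "fvge \<alpha> a (- (if \<alpha> ^ d = 1 then 1 else 0))"
      using place.val_imp_vge[OF place_fin a_pole[of \<alpha>]] a_reg[of \<alpha>] by simp
    thus "\<exists>m n. 0 < m \<and> m < n \<and> fval \<alpha> z (- int m) \<and> fval \<alpha> x (- int n)"
      using local_decrease2[OF place_fin _ _ _ fin_local2[OF on] _ zz] z by auto
  next
    assume zz: "z \<notin> infR"
    show "\<exists>m n. 0 < m \<and> m < n \<and> ival z (- int m) \<and> ival x (- int n)"
      using local_decrease2[OF place_inf _ _ _ inf_local2[OF on] _ zz] z a_inf by auto
  qed
  ultimately show ?thesis using that z by simp
qed

text \<open>If \<open>x\<close> has no poles, neither has \<open>W\<close>, so \<open>W\<close> and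
  \<open>x\<close> are constants. Then \<open>D x = 0\<close> expresses \<open>y\<close> linearly
  through \<open>a\<close>, and the equation of the curve collapses to
  \<open>a (a + 1) x = 0\<close>.\<close>

lemma const2:
  assumes on: "on x y" and x: "\<And>\<alpha>. x \<in> finR \<alpha>" "x \<in> infR"
  shows "x = 0"
proof -
  let ?w = "W x y"
  have wl: "place.vge Rr pp ?w 0" if P: "place Rr pp" and xr: "x \<in> Rr" for Rr and pp :: "'c poly fract"
  proof (rule ccontr)
    interpret place Rr pp by (rule P)
    assume "\<not> vge ?w 0"
    then obtain k where k: "k < 0" "val ?w k" using not_vge_val by blast
    have "val (?w ^ 2 + ?w) (2 * k)"
      using val_add[OF val_power[OF k(2), of 2], of ?w] vge_mono[OF val_imp_vge[OF k(2)], of "2 * k + 1"] k by simp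
    hence "val x (2 * k)" unfolding del_zero[OF on, symmetric] .
    moreover have "vge x 0" using xr by (simp add: vge_0_iff)
    ultimately have "0 \<le> 2 * k" by (rule val_vge_le)
    thus False using k by simp
  qed
  have "?w \<in> finR \<alpha>" for \<alpha> using wl[OF place_fin x(1), of \<alpha>] place.vge_0_iff[OF place_fin] by blast
  moreover have "?w \<in> infR" using wl[OF place_inf x(2)] place.vge_0_iff[OF place_inf] by blast
  ultimately obtain v where v: "?w = const_fract v" using regular_const by blast
  have "x = const_fract (v ^ 2 + v)" by (subst del_zero[OF on]) (simp add: v const_fract_add const_fract_power)
  hence "tder x = 0" by simp
  hence "?w * (x + a) + y + a = 0" using Dx_W[OF xa[OF on], of y] by simp
  hence "y + (?w * (x + a) + a) = 0" by (simp only: add.assoc add.left_commute add.commute)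
  from iffD1[OF shift this] have y: "y = ?w * (x + a) + a" unfolding add_0 .
  have "a * (a + 1) * x = 0" if y: "y = w * (x + a) + a" and x: "x = w ^ 2 + w" for w
  proof -
    have "0 = y ^ 2 + x * y + a * y + x ^ 3" using on_0[OF on] by simp
    also have "\<dots> = a ^ 2 * (w ^ 2 + w) + a * x + x ^ 2 * (w ^ 2 + w) + x ^ 3"
      unfolding y by (simp add: algebra_simps char2)
    also have "\<dots> = a * (a + 1) * x" unfolding x[symmetric] by (simp add: algebra_simps char2)
    finally show ?thesis by simp
  qed
  from this[OF y del_zero[OF on]] show ?thesis using a_nz by simp
qed

text \<open>The affine points with \<open>x = 0\<close> are 3-torsion and cannot be excluded. If the
  root has \<open>z = 0\<close>, then \<open>X2_rel\<close> leaves \<open>a^2 x = 0\<close>, so the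
  property passes back to \<open>x\<close>.\<close>

theorem points_2:
  assumes "on x y" shows "x = 0"
  using assms
proof (induction "npoles x" arbitrary: x y rule: less_induct)
  case less
  obtain z t where z: "on z t" "z ^ 2 = X2 x y" "(\<exists>\<alpha>. x \<notin> finR \<alpha>) \<or> x \<notin> infR \<Longrightarrow> npoles z < npoles x"
    using descend2[OF less.prems] by blast
  show ?case
  proof (cases "(\<exists>\<alpha>. x \<notin> finR \<alpha>) \<or> x \<notin> infR")
    case True
    hence "z = 0" using less.hyps[OF z(3) z(1)] by blast
    hence "X2 x y = 0" using z(2) by simp
    thus ?thesis using X2_rel[OF less.prems] a_nz by simp
  next
    case False
    thus ?thesis using const2[OF less.prems] by blast
  qed
qed

end

section \<open>Torsion points and rank\<close>

text \<open>Translation by 1 permutes the field, so the sum of all elements is unchanged although it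
  grows by the number of elements; this number is therefore 0 in the field.\<close>

lemma CHAR_prime_card:
  assumes "prime p" "card (UNIV :: ('k::{field,finite}) set) = p"
  shows "CHAR('k) = p"
proof -
  have "(\<Sum>x\<in>UNIV. x :: 'k) = (\<Sum>x\<in>UNIV. x + 1)"
    by (rule sum.reindex_bij_witness[of _ "\<lambda>x. x + 1" "\<lambda>x. x - 1"]) auto
  also have "\<dots> = (\<Sum>x\<in>UNIV. x) + of_nat p" using assms(2) by (simp add: sum.distrib)
  finally have "of_nat p = (0::'k)" by simp
  hence "CHAR('k) dvd p" by (simp add: of_nat_eq_0_iff_char_dvd)
  thus ?thesis using assms(1) by (metis CHAR_not_1 One_nat_def prime_nat_iff)
qed

section \<open>The embedding into the extension by a root of \<open>t\<close> as a field
  homomorphism\<close>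

lemma poly_emb_add: "poly_emb d (a + b) = poly_emb d a + poly_emb d b"
proof -
  have "map_poly to_ac (a + b) = map_poly to_ac a + map_poly to_ac b"
    by (rule poly_eqI) (simp add: coeff_map_poly)
  thus ?thesis by (simp add: poly_emb_def pcompose_add)
qed

lemma poly_emb_mult: "poly_emb d (a * b) = poly_emb d a * poly_emb d b"
proof -
  have "map_poly to_ac (a * b) = map_poly to_ac a * map_poly to_ac b"
    by (rule poly_eqI) (simp add: coeff_map_poly coeff_mult to_ac_sum)
  thus ?thesis by (simp add: poly_emb_def pcompose_mult)
qed

lemma poly_emb_eq_0: "d > 0 \<Longrightarrow> poly_emb d b = 0 \<longleftrightarrow> b = 0"
proof -
  assume d: "d > 0"
  have "map_poly to_ac b = 0 \<longleftrightarrow> b = 0" by (simp add: map_poly_eq_0_iff)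
  moreover have "pcompose q (monom 1 d) = 0 \<longleftrightarrow> q = 0" for q :: "'a alg_closure poly"
    using pcompose_eq_0[of q "monom 1 d"] d by (auto simp: degree_monom_eq)
  ultimately show ?thesis by (simp add: poly_emb_def)
qed

lemma fract_emb_Fract:
  assumes "d > 0" "b \<noteq> 0"
  shows "fract_emb d (Fract a b) = Fract (poly_emb d a) (poly_emb d b)"
proof -
  obtain c e where s: "(SOME ab. snd ab \<noteq> 0 \<and> Fract a b = Fract (fst ab) (snd ab)) = (c, e)"
    and e: "e \<noteq> 0" "a * e = c * b" using Fract_some[OF assms(2)] by blast
  have "poly_emb d a * poly_emb d e = poly_emb d c * poly_emb d b"
    using e(2) by (metis poly_emb_mult)
  thus ?thesis unfolding fract_emb_def s using e(1) assms poly_emb_eq_0[OF assms(1), of e] poly_emb_eq_0[OF assms(1), of b]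
    by (simp add: eq_fract)
qed

lemma fract_emb_add: "d > 0 \<Longrightarrow> fract_emb d (x + y) = fract_emb d x + fract_emb d y"
  by (cases x; cases y) (simp add: fract_emb_Fract poly_emb_add poly_emb_mult poly_emb_eq_0)

lemma fract_emb_mult: "d > 0 \<Longrightarrow> fract_emb d (x * y) = fract_emb d x * fract_emb d y"
  by (cases x; cases y) (simp add: fract_emb_Fract poly_emb_mult)

lemma poly_emb_const: "poly_emb d [:k:] = [:to_ac k:]"
  by (simp add: poly_emb_def map_poly_pCons pcompose_pCons)

lemma poly_emb_1: "poly_emb d (1 :: 'k::field poly) = 1"
  using poly_emb_const[of d "1::'k"] by (simp add: one_pCons)

lemma fract_emb_const: "d > 0 \<Longrightarrow> fract_emb d (const_fract k) = const_fract (to_ac (k::'k::field))"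
  using fract_emb_Fract[of d "1 :: 'k poly" "[:k:]"] poly_emb_1[of d, where 'k = 'k] poly_emb_const[of d k]
  by (simp add: const_fract_def)

lemma fract_emb_of_int: "d > 0 \<Longrightarrow> fract_emb d (of_int k :: 'k::field poly fract) = of_int k"
  using fract_emb_const[of d "of_int k :: 'k"] by simp

lemma fract_emb_simps:
  fixes x y :: "'k::field poly fract"
  assumes "d > 0"
  shows "fract_emb d (0 :: 'k poly fract) = 0" "fract_emb d (1 :: 'k poly fract) = 1"
    "fract_emb d (numeral n :: 'k poly fract) = numeral n"
    "fract_emb d (- x) = - fract_emb d x" "fract_emb d (x - y) = fract_emb d x - fract_emb d y"
proof -
  show z: "fract_emb d (0 :: 'k poly fract) = 0" "fract_emb d (1 :: 'k poly fract) = 1"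
    "fract_emb d (numeral n :: 'k poly fract) = numeral n"
    using fract_emb_of_int[OF assms, of 0, where 'k = 'k] fract_emb_of_int[OF assms, of 1, where 'k = 'k]
      fract_emb_of_int[OF assms, of "numeral n", where 'k = 'k] by simp_all
  have u: "fract_emb d (- x) = - fract_emb d x" for x :: "'k poly fract"
    using fract_emb_add[OF assms, of x "- x"] z(1) by (simp add: eq_neg_iff_add_eq_0 add.commute)
  show "fract_emb d (- x) = - fract_emb d x" by (rule u)
  show "fract_emb d (x - y) = fract_emb d x - fract_emb d y"
    using fract_emb_add[OF assms, of x "- y"] u by simp
qed

lemma fract_emb_sg:
  assumes "d > 0" shows "fract_emb d (sg 1 k) = sg d (to_ac k)"
proof -
  have "poly_emb d (spoly 1 k) = spoly d (to_ac k)"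
  proof -
    have "spoly 1 k = [:- k, 1:]" by (simp add: spoly_def monom_altdef)
    thus ?thesis by (simp add: poly_emb_def map_poly_pCons pcompose_pCons spoly_def)
  qed
  thus ?thesis unfolding sg_Fract using fract_emb_Fract[OF assms spoly_nz[of 1 k], of 1] poly_emb_1[of d, where 'k = 'a] by simp
qed

lemmas fract_emb_hom = fract_emb_add fract_emb_mult fract_emb_simps fract_emb_sg[unfolded One_nat_def]

section \<open>Rank zero from torsion, and the five curves\<close>

lemma ec_zmul_0: "ec_zmul E 0 P = Inf"
  by (simp add: ec_zmul_def)

text \<open>A torsion point in an independent set would give a relation with a single non-zero
  coefficient. Only the empty set is independent, and the supremum is taken over
  \<open>{0}\<close>.\<close>

lemma mw_rank_torsion:
  assumes "\<And>P. on_curve E P \<Longrightarrow> \<exists>n. n \<noteq> 0 \<and> ec_zmul E n P = Inf"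
  shows "mw_rank E = 0"
proof -
  have empty: "S = {}" if S: "z_independent E S" for S
  proof (rule ccontr)
    assume "S \<noteq> {}"
    then obtain P where P: "P \<in> S" by blast
    hence "on_curve E P" using S by (simp add: z_independent_def)
    then obtain n where n: "n \<noteq> 0" "ec_zmul E n P = Inf" using assms by blast
    define c where "c Q = (if Q = P then n else 0)" for Q
    have "finite S" using S by (simp add: z_independent_def)
    then obtain xs where xs: "set xs = S" "distinct xs" using finite_distinct_list by blast
    have "ec_zmul E (c Q) Q = Inf" for Q using n by (simp add: c_def ec_zmul_0)
    hence "ec_sum_list E (map (\<lambda>P. ec_zmul E (c P) P) xs) = Inf"
      unfolding ec_sum_list_def by (induction xs) simp_all
    hence "c P = 0" using S xs P unfolding z_independent_def by blast
    thus False using n by (simp add: c_def)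
  qed
  have "z_independent E {}" by (simp add: z_independent_def)
  hence "z_independent E S \<longleftrightarrow> S = {}" for S using empty by blast
  hence "{enat (card S) | S. z_independent E S} = {0}" by (simp add: zero_enat_def)
  thus ?thesis unfolding mw_rank_def by simp
qed

lemma ec_zmul_Inf: "ec_zmul E 1 Inf = Inf"
  by (simp add: ec_zmul_def)

lemma ec_zmul_2: "y + y + wa1 E * x + wa3 E = 0 \<Longrightarrow> ec_zmul E 2 (Pt x y) = Inf"
  by (simp add: ec_zmul_def numeral_2_eq_2)

lemma not_const_fract: "fval 0 x n \<Longrightarrow> n \<noteq> 0 \<Longrightarrow> x \<notin> range const_fract"
proof
  assume x: "fval 0 x n" "n \<noteq> 0" "x \<in> range const_fract"
  then obtain k where k: "x = const_fract k" by blast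
  interpret place "finR (0::'a)" "finpi 0" by (rule place_fin)
  have "k \<noteq> 0" using val_nz[OF x(1)] k by auto
  hence "val x 0" using fval_const k by blast
  thus False using val_unique x by blast
qed

text \<open>Over \<open>t = 0\<close> the reduction is multiplicative: \<open>c4\<close> is a unit
  and the discriminant vanishes to order \<open>i\<close>. Thus \<open>j\<close> has a pole of order
  \<open>i\<close> there and is not constant.\<close>

lemma j_nonconst:
  assumes "fval 0 (wc4 E) 0" "discr E = const_fract e * (tt 1 ^ i * u)" "e \<noteq> 0" "i > 0" "fval 0 u 0"
  shows "elliptic E" "j_inv E \<notin> range const_fract"
proof -
  interpret place "finR (0::'a)" "finpi 0" by (rule place_fin)
  have "finpi 0 = (tt 1 :: 'a poly fract)" by (simp add: finpi_def tt_def monom_altdef)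
  hence "val (tt 1 ^ i :: 'a poly fract) (int i)" using val_power[OF val_pi, of i] by simp
  hence "val (discr E) (0 + (int i + 0))" unfolding assms(2) by (intro val_mult fval_const assms)
  hence d: "val (discr E) (int i)" by simp
  thus "elliptic E" using val_nz by (auto simp: elliptic_def)
  have "val (j_inv E) (- int i)" unfolding j_inv_def using val_divide[OF val_power[OF assms(1), of 3] d] by simp
  thus "j_inv E \<notin> range const_fract" using not_const_fract assms(4) by fastforce
qed

lemma sg_unit_0: "k \<noteq> 0 \<Longrightarrow> fval 0 (sg 1 k ^ j) 0"
  using place.val_power[OF place_fin sg_unit[of 0 1 k], of j] by simp

lemma short_discr: "discr (W 0 0 0 a4 a6) = - 16 * (4 * a4 ^ 3 + 27 * a6 ^ 2)"
  unfolding discr_def wb2_def wb4_def wb6_def wb8_def by (simp add: power2_eq_square power3_eq_cube algebra_simps)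

lemma short_c4: "wc4 (W 0 0 0 a4 a6) = - 48 * a4"
  unfolding wc4_def wb2_def wb4_def by simp

lemma ts1: "tt 1 * sg 1 1 = 1 + sg 1 (1 :: 'a::field)"
  using sg_mult[of 1 "1::'a"] by (simp add: algebra_simps)

lemma rank_zero_3:
  assumes "CHAR('k::field) = 3"
  defines "E \<equiv> W 0 1 0 (1 + sg 1 1) 0 :: 'k poly fract weier"
  shows "elliptic E" "j_inv E \<notin> range const_fract" "d > 0 \<Longrightarrow> coprime d 3 \<Longrightarrow> mw_rank (base_change d E) = 0"
proof -
  have z: "(3 :: 'k poly fract) = 0" using char_field(2)[OF _ assms(1)] by simp
  have n: "of_int k \<noteq> (0::'k)" if "\<not> 3 dvd k" for k using of_int_nz[OF assms(1), of k] that by simp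
  define a where "a = 1 + sg 1 (1::'k)"
  have "discr E = (- (a ^ 2 * (a - 1))) + 3 * (5 * a ^ 2 - 21 * a ^ 3)"
    unfolding E_def a_def[symmetric] discr_def wb2_def wb4_def wb6_def wb8_def
    by (simp add: power2_eq_square power3_eq_cube algebra_simps)
  also have "a ^ 2 * (a - 1) = tt 1 ^ 2 * sg 1 1 ^ 3"
  proof -
    have "tt 1 ^ 2 * sg 1 1 ^ 3 = (tt 1 * sg 1 (1::'k)) ^ 2 * sg 1 1" by (simp add: power2_eq_square power3_eq_cube mult_ac)
    thus ?thesis unfolding ts1 a_def by simp
  qed
  finally have d: "discr E = const_fract (- 1) * (tt 1 ^ 2 * sg 1 1 ^ 3)" unfolding z by simp
  have "wc4 E = const_fract 16 - 3 * (16 * a)"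
    unfolding E_def a_def[symmetric] wc4_def wb2_def wb4_def by (simp add: power2_eq_square)
  hence c: "fval 0 (wc4 E) 0" unfolding z using fval_const[of "16 :: 'k" 0] n[of 16] by simp
  show "elliptic E" "j_inv E \<notin> range const_fract"
    using j_nonconst[OF c d _ _ sg_unit_0] by simp_all
  assume dd: "d > 0" "coprime d 3"
  have b: "base_change d E = W 0 1 0 (1 + sg d 1) 0"
    unfolding base_change_def map_weier_def E_def by (simp add: fract_emb_hom[OF dd(1)])
  show "mw_rank (base_change d E) = 0"
  proof (rule mw_rank_torsion)
    fix P assume P: "on_curve (base_change d E) P"
    show "\<exists>n. n \<noteq> 0 \<and> ec_zmul (base_change d E) n P = Inf"
    proof (cases P)
      case (Pt x y)
      have e: "y ^ 2 = x ^ 3 + x ^ 2 + (1 + sg d 1) * x" using P unfolding Pt b by simp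
      have "x = 0" by (rule points_3[OF _ dd e]) (simp add: assms)
      hence "y = 0" using e by simp
      thus ?thesis using ec_zmul_2[of y "base_change d E" x] unfolding Pt b by (intro exI[of _ 2]) simp
    qed (use ec_zmul_Inf in \<open>auto intro!: exI[of _ 1]\<close>)
  qed
qed

lemma rank_zero_5:
  assumes "CHAR('k::field) = 5"
  defines "E \<equiv> W 0 0 0 (- 3) (2 + 4 * sg 1 1) :: 'k poly fract weier"
  shows "elliptic E" "j_inv E \<notin> range const_fract" "d > 0 \<Longrightarrow> coprime d 5 \<Longrightarrow> mw_rank (base_change d E) = 0"
proof -
  have n: "of_int k \<noteq> (0::'k)" if "\<not> 5 dvd k" for k using of_int_nz[OF assms(1), of k] that by simp
  let ?s = "sg 1 1 :: 'k poly fract"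
  have t: "tt 1 ^ 1 * ?s ^ 2 = ?s + ?s ^ 2" using ts1[where 'a = 'k] by (simp add: power2_eq_square mult.assoc[symmetric] algebra_simps)
  have d: "discr E = const_fract (- 6912) * (tt 1 ^ 1 * ?s ^ 2)"
    unfolding E_def short_discr t by (simp add: power2_eq_square power3_eq_cube algebra_simps)
  have "wc4 E = const_fract 144" unfolding E_def short_c4 by simp
  hence c: "fval 0 (wc4 E) 0" using fval_const[of "144 :: 'k" 0] n[of 144] by simp
  show "elliptic E" "j_inv E \<notin> range const_fract"
    using j_nonconst[OF c d _ _ sg_unit_0] n[of 6912] by simp_all
  assume dd: "d > 0" "coprime d 5"
  have b: "base_change d E = W 0 0 0 (- 3) (2 + 4 * sg d 1)"
    unfolding base_change_def map_weier_def E_def by (simp add: fract_emb_hom[OF dd(1)])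
  show "mw_rank (base_change d E) = 0"
  proof (rule mw_rank_torsion)
    fix P assume P: "on_curve (base_change d E) P"
    show "\<exists>n. n \<noteq> 0 \<and> ec_zmul (base_change d E) n P = Inf"
    proof (cases P)
      case (Pt x y)
      have "y ^ 2 = x ^ 3 - 3 * x + (2 + 4 * sg d 1)" using P unfolding Pt b by simp
      thus ?thesis using no_points_5[OF _ dd, of y x] assms(1) by simp
    qed (use ec_zmul_Inf in \<open>auto intro!: exI[of _ 1]\<close>)
  qed
qed

lemma rank_zero_7:
  assumes "CHAR('k::field) = 7"
  defines "E \<equiv> W 0 0 0 (1 + 4 * sg 1 3) (5 + 6 * sg 1 1 + 3 * sg 1 3) :: 'k poly fract weier"
  shows "elliptic E" "j_inv E \<notin> range const_fract" "d > 0 \<Longrightarrow> coprime d 7 \<Longrightarrow> mw_rank (base_change d E) = 0"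
proof -
  have z: "(7 :: 'k poly fract) = 0" using char_field(2)[OF _ assms(1)] by simp
  have n: "of_int k \<noteq> (0::'k)" if "\<not> 7 dvd k" for k using of_int_nz[OF assms(1), of k] that by simp
  have n3: "(3::'k) \<noteq> 0" using n[of 3] by simp
  let ?s = "sg 1 1 :: 'k poly fract" and ?r = "sg 1 3 :: 'k poly fract" and ?t = "tt 1 :: 'k poly fract"
  interpret place "finR (0::'k)" "finpi 0" by (rule place_fin)
  have d: "discr E = const_fract (- 16) * (?t ^ 2 * (?s ^ 2 * ?r ^ 3))"
    unfolding E_def short_discr discriminant_7[OF zero_less_one assms(1)] by simp
  have a4: "1 + 4 * ?r = (1 + ?t) * ?r" using sg_mult[of 1 "3::'k"] by (simp add: algebra_simps)
  have "?t + 1 = Fract [:1, 1:] 1" by (simp add: tt_def monom_altdef One_fract_def one_pCons)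
  hence "val (1 + ?t) 0" using fval_poly[of "[:1, 1:]" "0::'k"] by (simp add: add.commute)
  moreover have "val ?r 0" using sg_unit_0[OF n3, of 1] by simp
  ultimately have "val (1 + 4 * ?r) 0" unfolding a4 using val_mult[of _ 0 _ 0] by simp
  hence "val (const_fract (- 48) * (1 + 4 * ?r)) (0 + 0)" using n[of 48] by (intro val_mult fval_const) auto
  hence c: "val (wc4 E) 0" unfolding E_def short_c4 by simp
  have "val (?s ^ 2 * ?r ^ 3) (0 + 0)" by (intro val_mult sg_unit_0 n3) simp
  thus "elliptic E" "j_inv E \<notin> range const_fract" using j_nonconst[OF c d] n[of 16] by simp_all
  assume dd: "d > 0" "coprime d 7"
  have b: "base_change d E = W 0 0 0 (1 + 4 * sg d 3) (5 + 6 * sg d 1 + 3 * sg d 3)"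
    unfolding base_change_def map_weier_def E_def by (simp add: fract_emb_hom[OF dd(1)])
  show "mw_rank (base_change d E) = 0"
  proof (rule mw_rank_torsion)
    fix P assume P: "on_curve (base_change d E) P"
    show "\<exists>n. n \<noteq> 0 \<and> ec_zmul (base_change d E) n P = Inf"
    proof (cases P)
      case (Pt x y)
      have "y ^ 2 = x ^ 3 + (1 + 4 * sg d 3) * x + (5 + 6 * sg d 1 + 3 * sg d 3)" using P unfolding Pt b by simp
      thus ?thesis using no_points_7[OF _ dd, of y x] assms(1) by simp
    qed (use ec_zmul_Inf in \<open>auto intro!: exI[of _ 1]\<close>)
  qed
qed

lemma rank_zero_11:
  assumes "CHAR('k::field) = 11"
  defines "E \<equiv> W 0 0 0 (- 1 + 3 * sg 1 1) (6 - sg 1 1) :: 'k poly fract weier"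
  shows "elliptic E" "j_inv E \<notin> range const_fract" "d > 0 \<Longrightarrow> coprime d 11 \<Longrightarrow> mw_rank (base_change d E) = 0"
proof -
  have z: "(11 :: 'k poly fract) = 0" using char_field(2)[OF _ assms(1)] by simp
  have n: "of_int k \<noteq> (0::'k)" if "\<not> 11 dvd k" for k using of_int_nz[OF assms(1), of k] that by simp
  let ?s = "sg 1 1 :: 'k poly fract" and ?t = "tt 1 :: 'k poly fract"
  interpret place "finR (0::'k)" "finpi 0" by (rule place_fin)
  have t: "?t ^ 2 * ?s ^ 3 = ?s ^ 3 + 2 * ?s ^ 2 + ?s"
  proof -
    have "?t ^ 2 * ?s ^ 3 = (?t * ?s) ^ 2 * ?s" by (simp add: power2_eq_square power3_eq_cube mult_ac)
    thus ?thesis unfolding ts1 by (simp add: power2_eq_square power3_eq_cube algebra_simps)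
  qed
  have "discr E = - 144 * (?t ^ 2 * ?s ^ 3) + 11 * (- 16 * (88 - 27 * ?s - 9 * ?s ^ 2 + 9 * ?s ^ 3))"
    unfolding E_def short_discr t by (simp add: power2_eq_square power3_eq_cube algebra_simps)
  hence d: "discr E = const_fract (- 144) * (?t ^ 2 * ?s ^ 3)" unfolding z by simp
  have "vge (?s + 1) 1" using sg_0[of 1 "1::'k"] by simp
  hence "vge (const_fract 3 * (?s + 1)) (0 + 1)"
    by (intro vge_mult) (simp_all add: vge_numeral)
  hence "val (const_fract (- 4) + const_fract 3 * (?s + 1)) 0"
    using n[of 4] by (intro val_add fval_const) auto
  hence "val (const_fract (- 48) * (- 1 + 3 * ?s)) (0 + 0)" using n[of 48]
    by (intro val_mult fval_const) (auto simp: algebra_simps)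
  hence c: "val (wc4 E) 0" unfolding E_def short_c4 by simp
  show "elliptic E" "j_inv E \<notin> range const_fract"
    using j_nonconst[OF c d _ _ sg_unit_0] n[of 144] by simp_all
  assume dd: "d > 0" "coprime d 11"
  have b: "base_change d E = W 0 0 0 (- 1 + 3 * sg d 1) (6 - sg d 1)"
    unfolding base_change_def map_weier_def E_def by (simp add: fract_emb_hom[OF dd(1)])
  show "mw_rank (base_change d E) = 0"
  proof (rule mw_rank_torsion)
    fix P assume P: "on_curve (base_change d E) P"
    show "\<exists>n. n \<noteq> 0 \<and> ec_zmul (base_change d E) n P = Inf"
    proof (cases P)
      case (Pt x y)
      have e: "y ^ 2 = x ^ 3 + (- 1 + 3 * sg d 1) * x + (6 - sg d 1)" using P unfolding Pt b by simp
      have x: "x = 4" by (rule points_11[OF _ dd e]) (simp add: assms)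
      have z': "(11 :: 'k alg_closure poly fract) = 0"
        using char_field(2)[of 11, where 'c = "'k alg_closure"] assms(1) by simp
      have "y ^ 2 = 11 * (6 + sg d 1)" unfolding e x by (simp add: algebra_simps)
      hence "y = 0" unfolding z' by simp
      thus ?thesis using ec_zmul_2[of y "base_change d E" x] unfolding Pt b by (intro exI[of _ 2]) simp
    qed (use ec_zmul_Inf in \<open>auto intro!: exI[of _ 1]\<close>)
  qed
qed

lemma rank_zero_2:
  assumes "CHAR('k::field) = 2"
  defines "E \<equiv> W 1 0 (1 + sg 1 1) 0 0 :: 'k poly fract weier"
  shows "elliptic E" "j_inv E \<notin> range const_fract" "d > 0 \<Longrightarrow> coprime d 2 \<Longrightarrow> mw_rank (base_change d E) = 0"
proof -
  have z: "(2 :: 'k poly fract) = 0" using char_field(2)[OF _ assms(1)] by simp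
  let ?s = "sg 1 1 :: 'k poly fract"
  define a where "a = 1 + ?s"
  have "discr E = a ^ 3 * (a - 1) + 2 * (- 14 * a ^ 4 + a ^ 3)"
    unfolding E_def a_def[symmetric] discr_def wb2_def wb4_def wb6_def wb8_def
    by (simp add: eval_nat_numeral algebra_simps)
  also have "a ^ 3 * (a - 1) = tt 1 ^ 3 * ?s ^ 4"
  proof -
    have "tt 1 ^ 3 * ?s ^ 4 = (tt 1 * ?s) ^ 3 * ?s" by (simp add: eval_nat_numeral mult_ac)
    thus ?thesis unfolding ts1 a_def by simp
  qed
  finally have d: "discr E = const_fract 1 * (tt 1 ^ 3 * ?s ^ 4)" unfolding z by simp
  have "wc4 E = const_fract 1 - 2 * (12 * a)"
    unfolding E_def a_def[symmetric] wc4_def wb2_def wb4_def by simp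
  hence c: "fval 0 (wc4 E) 0" unfolding z using fval_const[of "1 :: 'k" 0] by simp
  show "elliptic E" "j_inv E \<notin> range const_fract"
    using j_nonconst[OF c d _ _ sg_unit_0] by simp_all
  assume dd: "d > 0" "coprime d 2"
  define a' where "a' = 1 + sg d (1 :: 'k alg_closure)"
  have b: "base_change d E = W 1 0 a' 0 0"
    unfolding base_change_def map_weier_def E_def a'_def by (simp add: fract_emb_hom[OF dd(1)])
  interpret pencil2 d a'
    by unfold_locales (use assms(1) dd in \<open>auto simp: a'_def\<close>)
  show "mw_rank (base_change d E) = 0"
  proof (rule mw_rank_torsion)
    fix P assume P: "on_curve (base_change d E) P"
    show "\<exists>n. n \<noteq> 0 \<and> ec_zmul (base_change d E) n P = Inf"
    proof (cases P)
      case (Pt x y)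
      have e: "on x y" using P unfolding Pt b on_def by simp
      have x: "x = 0" by (rule points_2[OF e])
      have "y * (y + a') = 0" using e unfolding on_def x by (simp add: power2_eq_square algebra_simps)
      \<comment> \<open>In characteristic 2 the tangent slope at \<open>(0, y)\<close> is
        \<open>y / a'\<close>; this relation makes the \<open>x\<close>-coordinate of the double
        vanish.\<close>
      hence l: "(y / a') * (y / a') + y / a' = 0" using a_nz(1) by (simp add: field_simps)
      \<comment> \<open>Doubling exchanges the two affine points with \<open>x = 0\<close>. They are
        negatives of each other, so both have order 3.\<close>
      have 2: "ec_add (weier.W 1 0 a' 0 0) (Pt 0 y) (Pt 0 y) = Pt 0 (y + a')"
        using a_nz(1) l by (simp add: Let_def neg self_add two0 power2_eq_square add.assoc)
      have 3: "ec_add (weier.W 1 0 a' 0 0) (Pt 0 y) (Pt 0 (y + a')) = Inf"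
        by (simp add: self_add add.assoc)
      have "ec_zmul (base_change d E) 3 P = Inf"
        unfolding ec_zmul_def Pt b x by (simp add: numeral_3_eq_3 2 3 del: ec_add.simps(3))
      thus ?thesis by (intro exI[of _ 3]) simp
    qed (use ec_zmul_Inf in \<open>auto intro!: exI[of _ 1]\<close>)
  qed
qed

theorem theorem6p2:
  fixes p :: nat
  assumes "p \<in> {2, 3, 5, 7, 11}"
    and "card (UNIV :: ('k::{field,finite}) set) = p"
  shows "\<exists>E :: 'k poly fract weier.
           elliptic E \<and> j_inv E \<notin> range const_fract \<and>
           (\<forall>d::nat. d > 0 \<longrightarrow> coprime d p \<longrightarrow> mw_rank (base_change d E) = 0)"
proof -
  have "prime p" using assms(1) by auto
  hence "CHAR('k) = p" using CHAR_prime_card assms(2) by blast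
  thus ?thesis using assms(1) rank_zero_2[where 'k = 'k] rank_zero_3[where 'k = 'k] rank_zero_5[where 'k = 'k]
      rank_zero_7[where 'k = 'k] rank_zero_11[where 'k = 'k] by auto
qed

end
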